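(* Work in the setting of the context. Let $z_0\in\mathfrak X$ and assume that, in addition to (A), (B), (C), the assumptions (V1), (V2'), ($\Phi'$), (B1-a), (B1-b), (B1-c), (C1), (D1) listed in the context hold for $z_0$ and some $r_0\in(0,R_0]$. Then for any $a\in(1/2,1)$ there exists $C_1=C_1(z_0,r_0,a)>1$ such that for any $r<r_0/(2n_0)$, any open set $D\subset B(z_0,r)$ and any non-negative function $u$ on $\mathfrak X$ which is regular harmonic with respect to $X$ in $D$ and vanishes on $B(z_0,r)\cap\left(\overline{D}^c\cup D^{\mathrm{reg}}\right)$, it holds that $$C_1^{-1}\,\mathbb E_x[\tau_{D}]\int_{\overline{B}(z_0,ar/2)^c} j(z_0,z)u(z)\, m(dz) \le u(x)\le C_1 \,\mathbb E_x[\tau_{D}]\int_{\overline{B}(z_0, ar/2)^c} j(z_0,z)u(z)\, m(dz)$$ for all $x\in D\cap B(z_0,r/8)$.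
   Context: **Space.** $(\mathfrak X,d)$ is a metric space in which all bounded closed sets are compact; $m$ is a $\sigma$-finite measure on $\mathfrak X$ with full support. The localization radius $R_0\in(0,\infty]$ is such that $\mathfrak X\setminus B(x,2r)\ne\emptyset$ for all $x\in\mathfrak X$ and $r<R_0$. $B(x,r)$ is the open ball and $\overline B(x,r)$ its closure; $A(x,r,R)=\{y: r<d(x,y)<R\}$ and $\overline A(x,r,R)$ is its closure; complements are in $\mathfrak X$. $C_0(\mathfrak X)$ is the space of bounded continuous functions vanishing at infinity. **Process.** $X=(X_t,\mathbb P_x)$ is a Markov process on $\mathfrak X$ (not assumed conservative) with semigroup $(P_t)$, cemetery $\partial$, lifetime $\zeta$; conventions $X_\zeta=\partial$ and $u(\partial)=0$ for every function $u$. For open $D$, $\tau_D=\inf\{t>0: X_t\notin D\}$. Objects for the dual process carry a hat. (A) $X$ is a Hunt process admitting a strong dual $\widehat X$ with respect to $m$, and $\widehat X$ is also a Hunt process. The semigroups $(P_t)$, $(\widehat P_t)$ are both Feller and strongly Feller. Every semi-polar set of $X$ is polar. Under (A), for open $D$ the process $X$ killed on exiting $D$ has a unique (possibly infinite) Green function $G_D(x,y)$ with $\mathbb E_x\int_0^{\tau_D}f(X_t)dt=\int_D f(y)G_D(x,y)m(dy)$ for non-negative Borel $f$, and $G_D(x,y)=\widehat G_D(y,x)$. $\mathcal A$, $\widehat{\mathcal A}$ are the generators of $(P_t)$, $(\widehat P_t)$ in $C_0(\mathfrak X)$. (B) There is a linear subspace $\mathcal D$ of $\mathcal D(\mathcal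 A)\cap\mathcal D(\widehat{\mathcal A})$ such that for any compact $K$ and open $D$ with $K\subset D\subset\mathfrak X$, the collection $\mathcal D(K,D)$ of all $f\in\mathcal D$ with $f=1$ on $K$, $f=0$ on $\mathfrak X\setminus D$, $0\le f\le1$ on $\mathfrak X$, and $m(\partial\{f>0\})=0$, is nonempty. Under (B) the jumps of $X$ are described by a Lévy kernel $J$ (with $J(x,\{x\})=0$) satisfying $\int f(y)J(x,dy)=\lim_{t\downarrow0}\mathbb E_xf(X_t)/t$ for bounded continuous $f$ and $x\notin\mathrm{supp} f$; $\widehat J$ is defined similarly. (C) The Lévy kernels of $X$ and $\widehat X$ are $j(x,y)m(dy)$ and $\widehat j(x,y)m(dy)$, with $j(x,y)=\widehat j(y,x)>0$ for all $x\ne y$. **Harmonicity.** A non-negative $u$ is regular harmonic in open $D$ with respect to $X$ if $u(x)=\mathbb E_x(u(X_{\tau_D}))$ for all $x\in D$. $D^{\mathrm{reg}}$ is the set of $x\in\partial D$ with $\mathbb P_x(\tau_D=0)=1$. **Assumptions at the point $z_0$** ($r_0\in(0,R_0]$; $r_0/(2n_0)$ means $\infty$ if $r_0=\infty$). Put $V(r)=m(B(z_0,r))$. (V1) There is $c>1$ with $V(2r)\le cV(r)$ for all $r>0$. (V2') There are $c>1$ and $n_0\in\mathbb N$, $n_0\ge2$, with $V(n_0r)\ge cV(r)$ for all $r\le r_0$. ($\Phi'$) There is an increasing function $\Phi:[0,\infty)\to[0,\infty)$ and $c>1$ with $\Phi(2r)\le c\,\Phi(r)$ for all $r>0$. (B1-a)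 For any $a\in(1/2,1)$ there is $c=c(z_0,a)$ such that for any $r<r_0$, $\inf_{f\in\mathcal D(\overline B(z_0,ar),B(z_0,r))}\sup_{x\in\mathfrak X}\max(\mathcal Af(x),\widehat{\mathcal A}f(x))\le c/\Phi(r)$. (B1-b) For any $a\in(1/2,1)$ there is $c=c(z_0,a)$ such that for any $r<r_0$ and any $f\in\mathcal D(\overline B(z_0,ar),B(z_0,r))$, $\max(\mathcal Af(x),\widehat{\mathcal A}f(x))\le cV(r)j(x,z_0)$ for $x\in\overline A(z_0,ar,(a+1)r)$. (B1-c) For any $1/2<b<a<1$ there is $c=c(z_0,a,b)$ such that for any $r<r_0$, $\inf_{f\in\mathcal D(\overline A(z_0,br,ar),A(z_0,r/2,r))}\sup_{x\in\mathfrak X}\max(\mathcal Af(x),\widehat{\mathcal A}f(x))\le c/\Phi(r)$. (C1) For any $a\in(1/2,1)$ there are $c\ge1$, $c'>0$ depending on $a,r_0,z_0$ such that for $r<r_0$, $x\in B(z_0,ar)$, $y\in\mathfrak X\setminus B(z_0,r)$: $c^{-1}j(z_0,y)\le j(x,y)\le c\,j(z_0,y)$, $c^{-1}\widehat j(z_0,y)\le\widehat j(x,y)\le c\,\widehat j(z_0,y)$, and $\inf_{y\in\overline A(z_0,ar,r)}\min(j(z_0,y),\widehat j(z_0,y))\ge\frac{c'}{V(r)\Phi(r)}$. (D1) For any $a\in(1/2,1)$ there is $c=c(z_0,r_0,a)$ such that for all $r<r_0$, $\sup_{x\in\overline A(z_0,ar,r)}\sup_{y\in B(z_0,r/2)}\max(G_{B(z_0,r)}(x,y),\widehat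 G_{B(z_0,r)}(x,y))\le c\,\Phi(r)/V(r)$. *)

theory Defs
  imports "HOL-Probability.Probability"
begin

section \<open>The state space\<close>

text \<open>
  The class \<^class>\<open>heine_borel\<close> consists of the metric spaces in which all bounded closed sets
  are compact (see \<open>compact_eq_bounded_closed\<close>). Such spaces are separable, hence second countable.
\<close>

lemma heine_borel_countable_base:
  "\<exists>B :: 'a::heine_borel set set. countable B \<and> open = generate_topology B"
proof -
  obtain x0 :: 'a where True by simp
  have "\<exists>F. finite F \<and> cball x0 (real n) \<subseteq> (\<Union>x\<in>F. ball x (inverse (real (Suc k))))" for n k
  proof -
    have "compact (cball x0 (real n))"
      by (simp add: compact_eq_bounded_closed)
    moreover have c: "cball x0 (real n) \<subseteq> (\<Union>x\<in>UNIV. ball x (inverse (real (Suc k))))"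
    proof
      fix y :: 'a
      show "y \<in> (\<Union>x\<in>UNIV. ball x (inverse (real (Suc k))))"
        by (rule UN_I[of y]) (simp_all del: of_nat_Suc)
    qed
    ultimately obtain F where "finite F" "cball x0 (real n) \<subseteq> (\<Union>x\<in>F. ball x (inverse (real (Suc k))))"
      using compactE_image[of _ UNIV "\<lambda>x. ball x (inverse (real (Suc k)))"] by (metis open_ball)
    then show ?thesis by blast
  qed
  then obtain F where fin: "\<And>n k. finite (F n k)"
    and cov: "\<And>n k. cball x0 (real n) \<subseteq> (\<Union>x\<in>F n k. ball x (inverse (real (Suc k))))"
    by metis
  define B where "B = (\<Union>n k. (\<lambda>x. ball x (inverse (real (Suc k)))) ` F n k)"
  have cB: "countable B"
    unfolding B_def by (intro countable_UN countableI_type countable_image countable_finite fin)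
  have "topological_basis B"
  proof (rule topological_basisI)
    show "open U" if "U \<in> B" for U
      using that by (auto simp: B_def)
  next
    fix U :: "'a set" and x
    assume U: "open U" "x \<in> U"
    then obtain e where e: "e > 0" "ball x e \<subseteq> U"
      using open_contains_ball by blast
    obtain k where k: "inverse (real (Suc k)) < e / 2"
      using reals_Archimedean[of "e / 2"] e by auto
    obtain n where n: "dist x0 x \<le> real n"
      using real_arch_simple by blast
    obtain y where y: "y \<in> F n k" "dist y x < inverse (real (Suc k))"
      using cov[of n k] n by (force simp: subset_iff)
    have "ball y (inverse (real (Suc k))) \<subseteq> U"
    proof
      fix z assume "z \<in> ball y (inverse (real (Suc k)))"
      then have "dist y z < inverse (real (Suc k))" by simp
      then have "dist x z < e"
        using y(2) k dist_triangle[of x z y] by (simp add: dist_commute del: of_nat_Suc)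
      then show "z \<in> U" using e by auto
    qed
    moreover have "ball y (inverse (real (Suc k))) \<in> B"
      using y by (auto simp: B_def)
    moreover have "x \<in> ball y (inverse (real (Suc k)))"
      using y(2) by (simp del: of_nat_Suc)
    ultimately show "\<exists>V\<in>B. x \<in> V \<and> V \<subseteq> U" by blast
  qed
  then have "open = generate_topology B"
    by (rule topological_basis_imp_subbasis)
  with cB show ?thesis by blast
qed

instance heine_borel \<subseteq> second_countable_topology
  by standard (rule heine_borel_countable_base)

text \<open>
  The cemetery is \<open>None\<close>. It is the point at infinity of the one-point compactification if the
  space is not compact, and an isolated point if it is compact.
\<close>

definition one_point :: "'a::t2_space option topology" where
  "one_point = topology (\<lambda>U. open (Some -` U) \<and> (None \<in> U \<longrightarrow> compact (- (Some -` U))))"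

lemma openin_one_point:
  "openin (one_point :: 'a::t2_space option topology) U \<longleftrightarrow>
     open (Some -` U) \<and> (None \<in> U \<longrightarrow> compact (- (Some -` U)))"
proof -
  have "istopology (\<lambda>U :: 'a option set. open (Some -` U) \<and> (None \<in> U \<longrightarrow> compact (- (Some -` U))))"
    unfolding istopology_def
  proof (intro conjI allI impI)
    fix S T :: "'a option set"
    assume "open (Some -` S) \<and> (None \<in> S \<longrightarrow> compact (- (Some -` S)))"
      "open (Some -` T) \<and> (None \<in> T \<longrightarrow> compact (- (Some -` T)))"
    then show "open (Some -` (S \<inter> T))" "None \<in> S \<inter> T \<Longrightarrow> compact (- (Some -` (S \<inter> T)))"
      by (auto simp: vimage_Int Compl_Int)
  next
    fix K :: "'a option set set"
    assume K: "\<forall>U\<in>K. open (Some -` U) \<and> (None \<in> U \<longrightarrow> compact (- (Some -` U)))"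
    then show op: "open (Some -` \<Union>K)"
      by (auto simp: vimage_Union)
    assume "None \<in> \<Union>K"
    then obtain U where U: "U \<in> K" "None \<in> U" by blast
    have "- (Some -` \<Union>K) = - (Some -` U) \<inter> - (Some -` \<Union>K)"
      using U by auto
    moreover have "compact \<dots>"
      using K U op by (intro compact_Int_closed) auto
    ultimately show "compact (- (Some -` \<Union>K))" by simp
  qed
  then show ?thesis
    unfolding one_point_def by (simp add: topology_inverse')
qed

definition state_alg :: "'a::t2_space option measure" where
  "state_alg = sigma UNIV {U. openin one_point U}"

text \<open>Extension of functions by the convention \<open>u(\<partial>) = 0\<close>.\<close>

definition ext0 :: "('a \<Rightarrow> 'b::zero) \<Rightarrow> 'a option \<Rightarrow> 'b" where
  "ext0 f = case_option 0 f"

definition C0 :: "('a::metric_space \<Rightarrow> real) set" where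
  "C0 = {f. continuous_on UNIV f \<and> bounded (range f) \<and>
            (\<forall>e>0. \<exists>K. compact K \<and> (\<forall>x. x \<notin> K \<longrightarrow> \<bar>f x\<bar> < e))}"

definition annulus :: "'a::metric_space \<Rightarrow> real \<Rightarrow> real \<Rightarrow> 'a set" where
  "annulus x r R = {y. r < dist x y \<and> dist x y < R}"

definition vol :: "'a::metric_space measure \<Rightarrow> 'a \<Rightarrow> real \<Rightarrow> ennreal" where
  "vol m z r = emeasure m (ball z r)"

text \<open>\<open>R0\<close> is the localization radius; it may be infinite.\<close>

definition state_space :: "'a::heine_borel measure \<Rightarrow> ereal \<Rightarrow> bool" where
  "state_space m R0 \<longleftrightarrow>
     sets m = sets borel \<and> sigma_finite_measure m \<and>
     (\<forall>U. open U \<and> U \<noteq> {} \<longrightarrow> 0 < emeasure m U) \<and>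
     0 < R0 \<and> (\<forall>(x :: 'a) r. 0 < r \<and> ereal r < R0 \<longrightarrow> - ball x (2 * r) \<noteq> {})"


section \<open>Hunt processes\<close>

text \<open>
  A process consists of a sample space, positions \<open>X\<^sub>t\<close>, shifts \<open>\<theta>\<^sub>t\<close> (both indexed by reals,
  with only \<open>t \<ge> 0\<close> relevant) and the laws \<open>P\<^sub>x\<close>, where \<open>x\<close> may also be the cemetery.
  The laws live on the \<open>\<sigma>\<close>-algebra generated by the positions; whenever an event or a function
  may fail to be measurable for it, the law is completed.
\<close>

record ('w, 'a) process =
  paths :: "'w set"
  pos :: "real \<Rightarrow> 'w \<Rightarrow> 'a option"
  shift :: "real \<Rightarrow> 'w \<Rightarrow> 'w"
  law :: "'a option \<Rightarrow> 'w measure"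

definition history :: "('w, 'a::t2_space) process \<Rightarrow> real set \<Rightarrow> 'w measure" where
  "history X I = sigma (paths X) {pos X s -` B \<inter> paths X | s B. s \<in> I \<and> B \<in> sets state_alg}"

definition init_laws :: "'a::t2_space option measure set" where
  "init_laws = space (prob_algebra state_alg)"

text \<open>The completed law \<open>P\<^sub>\<mu>\<close>, for an initial distribution \<open>\<mu>\<close>.\<close>

definition law_from :: "('w, 'a::t2_space) process \<Rightarrow> 'a option measure \<Rightarrow> 'w measure" where
  "law_from X \<mu> = completion (\<mu> \<bind> law X)"

text \<open>The minimal augmented filtration: \<open>events X\<close> is \<open>\<F>\<close>, \<open>events_upto X t\<close> is \<open>\<F>\<^sub>t\<close>,
  and \<open>events_before X T\<close> is \<open>\<F>\<^sub>T\<close>.\<close>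

definition events :: "('w, 'a::t2_space) process \<Rightarrow> 'w set set" where
  "events X = (\<Inter>\<mu>\<in>init_laws. sets (law_from X \<mu>))"

definition events_upto :: "('w, 'a::t2_space) process \<Rightarrow> real \<Rightarrow> 'w set set" where
  "events_upto X t =
     {A \<in> events X. \<forall>\<mu>\<in>init_laws. \<exists>B\<in>sets (history X {0..t}).
        (A - B) \<union> (B - A) \<in> null_sets (law_from X \<mu>)}"

definition optional_time :: "('w, 'a::t2_space) process \<Rightarrow> ('w \<Rightarrow> ennreal) \<Rightarrow> bool" where
  "optional_time X T \<longleftrightarrow> (\<forall>t\<ge>0. {\<omega> \<in> paths X. T \<omega> \<le> ennreal t} \<in> events_upto X t)"

definition events_before :: "('w, 'a::t2_space) process \<Rightarrow> ('w \<Rightarrow> ennreal) \<Rightarrow> 'w set set" where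
  "events_before X T =
     {A \<in> events X. \<forall>t\<ge>0. {\<omega> \<in> A. T \<omega> \<le> ennreal t} \<in> events_upto X t}"

text \<open>The position at a random time, with \<open>X\<^sub>\<infinity> = \<partial>\<close>.\<close>

definition pos_at :: "('w, 'a) process \<Rightarrow> ('w \<Rightarrow> ennreal) \<Rightarrow> 'w \<Rightarrow> 'a option" where
  "pos_at X T \<omega> = (if T \<omega> = \<infinity> then None else pos X (enn2real (T \<omega>)) \<omega>)"

definition markov_paths :: "('w, 'a::t2_space) process \<Rightarrow> bool" where
  "markov_paths X \<longleftrightarrow>
     law X \<in> state_alg \<rightarrow>\<^sub>M prob_algebra (history X {0..}) \<and>
     (\<forall>x. AE \<omega> in law X x. pos X 0 \<omega> = x) \<and>
     (\<forall>\<omega>\<in>paths X.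
        (\<forall>s t. 0 \<le> s \<and> s \<le> t \<and> pos X s \<omega> = None \<longrightarrow> pos X t \<omega> = None) \<and>
        (\<forall>t\<ge>0. shift X t \<omega> \<in> paths X \<and>
           (\<forall>s\<ge>0. pos X s (shift X t \<omega>) = pos X (s + t) \<omega>)) \<and>
        (\<forall>t\<ge>0. limitin one_point (\<lambda>s. pos X s \<omega>) (pos X t \<omega>) (at_right t)) \<and>
        (\<forall>t>0. \<exists>l. limitin one_point (\<lambda>s. pos X s \<omega>) l (at_left t)))"

definition right_continuous_filtration :: "('w, 'a::t2_space) process \<Rightarrow> bool" where
  "right_continuous_filtration X \<longleftrightarrow> (\<forall>t\<ge>0. (\<Inter>s\<in>{t<..}. events_upto X s) = events_upto X t)"

definition strong_markov :: "('w, 'a::t2_space) process \<Rightarrow> bool" where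
  "strong_markov X \<longleftrightarrow>
     (\<forall>\<mu>\<in>init_laws. \<forall>T. optional_time X T \<longrightarrow>
       (\<forall>t\<ge>0. \<forall>B\<in>sets state_alg. \<forall>A\<in>events_before X T.
         emeasure (law_from X \<mu>)
           {\<omega> \<in> A. T \<omega> < \<infinity> \<and> pos X (enn2real (T \<omega>) + t) \<omega> \<in> B} =
         (\<integral>\<^sup>+\<omega>\<in>{\<omega> \<in> A. T \<omega> < \<infinity>}.
            emeasure (law X (pos_at X T \<omega>)) {\<omega>' \<in> paths X. pos X t \<omega>' \<in> B} \<partial>law_from X \<mu>)))"

definition quasi_left_continuous :: "('w, 'a::t2_space) process \<Rightarrow> bool" where
  "quasi_left_continuous X \<longleftrightarrow>
     (\<forall>\<mu>\<in>init_laws. \<forall>T. (\<forall>n. optional_time X (T n)) \<and> (\<forall>n. \<forall>\<omega>\<in>paths X. T n \<omega> \<le> T (Suc n) \<omega>) \<longrightarrow>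
       (AE \<omega> in law_from X \<mu>. (SUP n. T n \<omega>) < \<infinity> \<longrightarrow>
          limitin one_point (\<lambda>n. pos_at X (T n) \<omega>) (pos_at X (\<lambda>\<omega>. SUP n. T n \<omega>) \<omega>) sequentially))"

definition hunt_process :: "('w, 'a::t2_space) process \<Rightarrow> bool" where
  "hunt_process X \<longleftrightarrow>
     markov_paths X \<and> right_continuous_filtration X \<and> strong_markov X \<and> quasi_left_continuous X"


section \<open>Semigroup, generator, duality\<close>

definition transition :: "('w, 'a) process \<Rightarrow> real \<Rightarrow> ('a \<Rightarrow> real) \<Rightarrow> 'a \<Rightarrow> real" where
  "transition X t f x = (\<integral>\<omega>. ext0 f (pos X t \<omega>) \<partial>law X (Some x))"

definition feller :: "('w, 'a::metric_space) process \<Rightarrow> bool" where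
  "feller X \<longleftrightarrow>
     (\<forall>t\<ge>0. \<forall>f\<in>C0. transition X t f \<in> C0) \<and>
     (\<forall>f\<in>C0. uniform_limit UNIV (\<lambda>t. transition X t f) f (at_right 0))"

definition strongly_feller :: "('w, 'a::metric_space) process \<Rightarrow> bool" where
  "strongly_feller X \<longleftrightarrow>
     (\<forall>t>0. \<forall>f\<in>borel_measurable borel. bounded (range f) \<longrightarrow>
        continuous_on UNIV (transition X t f) \<and> bounded (range (transition X t f)))"

definition has_generator :: "('w, 'a::metric_space) process \<Rightarrow> ('a \<Rightarrow> real) \<Rightarrow> ('a \<Rightarrow> real) \<Rightarrow> bool" where
  "has_generator X f g \<longleftrightarrow> f \<in> C0 \<and> g \<in> C0 \<and>
     uniform_limit UNIV (\<lambda>t x. (transition X t f x - f x) / t) g (at_right 0)"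

definition gen_dom :: "('w, 'a::metric_space) process \<Rightarrow> ('a \<Rightarrow> real) set" where
  "gen_dom X = {f. \<exists>g. has_generator X f g}"

definition gen :: "('w, 'a::metric_space) process \<Rightarrow> ('a \<Rightarrow> real) \<Rightarrow> 'a \<Rightarrow> real" where
  "gen X f = (THE g. has_generator X f g)"

text \<open>Expectations with respect to \<open>P\<^sub>x\<close> of functions with values in \<open>[0, \<infinity>]\<close>.\<close>

definition expect :: "('w, 'a) process \<Rightarrow> 'a \<Rightarrow> ('w \<Rightarrow> ennreal) \<Rightarrow> ennreal" where
  "expect X x F = (\<integral>\<^sup>+\<omega>. F \<omega> \<partial>completion (law X (Some x)))"

definition resolvent :: "('w, 'a) process \<Rightarrow> real \<Rightarrow> ('a \<Rightarrow> ennreal) \<Rightarrow> 'a \<Rightarrow> ennreal" where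
  "resolvent X \<alpha> f x =
     expect X x (\<lambda>\<omega>. \<integral>\<^sup>+t\<in>{0..}. ennreal (exp (- \<alpha> * t)) * ext0 f (pos X t \<omega>) \<partial>lborel)"

text \<open>
  Strong duality in the sense of Blumenthal and Getoor: the resolvents are dual and all resolvent
  measures are absolutely continuous.
\<close>

definition strong_dual ::
    "'a::topological_space measure \<Rightarrow> ('w, 'a) process \<Rightarrow> ('v, 'a) process \<Rightarrow> bool" where
  "strong_dual m X Xh \<longleftrightarrow>
     (\<forall>\<alpha>>0. \<forall>f\<in>borel_measurable borel. \<forall>g\<in>borel_measurable borel.
        (\<integral>\<^sup>+x. f x * resolvent X \<alpha> g x \<partial>m) = (\<integral>\<^sup>+x. resolvent Xh \<alpha> f x * g x \<partial>m)) \<and>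
     (\<forall>\<alpha>>0. \<forall>x. \<forall>N\<in>null_sets m.
        resolvent X \<alpha> (indicator N) x = 0 \<and> resolvent Xh \<alpha> (indicator N) x = 0)"


section \<open>Hitting times, polar and semi-polar sets\<close>

definition hitting_time :: "('w, 'a) process \<Rightarrow> 'a option set \<Rightarrow> 'w \<Rightarrow> ennreal" where
  "hitting_time X B \<omega> = Inf (ennreal ` {t. 0 < t \<and> pos X t \<omega> \<in> B})"

text \<open>The cemetery does not belong to \<open>D\<close>, so the exit time is at most the lifetime.\<close>

definition exit_time :: "('w, 'a) process \<Rightarrow> 'a set \<Rightarrow> 'w \<Rightarrow> ennreal" where
  "exit_time X D = hitting_time X (- (Some ` D))"

definition nearly_borel :: "('w, 'a::t2_space) process \<Rightarrow> 'a set \<Rightarrow> bool" where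
  "nearly_borel X A \<longleftrightarrow>
     (\<forall>\<mu>\<in>init_laws. \<exists>B\<in>sets borel. \<exists>B'\<in>sets borel. B \<subseteq> A \<and> A \<subseteq> B' \<and>
        (AE \<omega> in law_from X \<mu>. \<forall>t\<ge>0. pos X t \<omega> \<notin> Some ` (B' - B)))"

definition polar :: "('w, 'a::t2_space) process \<Rightarrow> 'a set \<Rightarrow> bool" where
  "polar X A \<longleftrightarrow>
     (\<exists>B. nearly_borel X B \<and> A \<subseteq> B \<and>
        (\<forall>x. AE \<omega> in law X (Some x). hitting_time X (Some ` B) \<omega> = \<infinity>))"

definition thin :: "('w, 'a::t2_space) process \<Rightarrow> 'a set \<Rightarrow> bool" where
  "thin X A \<longleftrightarrow>
     (\<exists>B. nearly_borel X B \<and> A \<subseteq> B \<and>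
        (\<forall>x. AE \<omega> in law X (Some x). hitting_time X (Some ` B) \<omega> > 0))"

definition semi_polar :: "('w, 'a::t2_space) process \<Rightarrow> 'a set \<Rightarrow> bool" where
  "semi_polar X A \<longleftrightarrow> (\<exists>S :: nat \<Rightarrow> 'a set. (\<forall>n. thin X (S n)) \<and> A \<subseteq> (\<Union>n. S n))"

definition assumption_A ::
    "'a::heine_borel measure \<Rightarrow> ('w, 'a) process \<Rightarrow> ('v, 'a) process \<Rightarrow> bool" where
  "assumption_A m X Xh \<longleftrightarrow>
     hunt_process X \<and> hunt_process Xh \<and> strong_dual m X Xh \<and>
     feller X \<and> feller Xh \<and> strongly_feller X \<and> strongly_feller Xh \<and>
     (\<forall>A. semi_polar X A \<longrightarrow> polar X A)"


section \<open>Green functions, Levy kernels, harmonic functions\<close>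

text \<open>
  \<open>G D\<close> is a density of the potential of the process killed on exiting \<open>D\<close>, extended by zero
  outside \<open>D \<times> D\<close>. This determines \<open>G D x\<close> up to \<open>m\<close>-null sets, and nothing else about the choice
  of the density is required.
\<close>

definition green_function ::
    "'a::topological_space measure \<Rightarrow> ('w, 'a) process \<Rightarrow> ('a set \<Rightarrow> 'a \<Rightarrow> 'a \<Rightarrow> ennreal) \<Rightarrow> bool" where
  "green_function m X G \<longleftrightarrow>
     (\<forall>D. open D \<longrightarrow>
        (\<forall>x\<in>D. G D x \<in> borel_measurable borel \<and>
           (\<forall>f\<in>borel_measurable borel.
              expect X x (\<lambda>\<omega>. \<integral>\<^sup>+t\<in>{t. 0 \<le> t \<and> ennreal t < exit_time X D \<omega>}.
                                ext0 f (pos X t \<omega>) \<partial>lborel) =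
              (\<integral>\<^sup>+y\<in>D. f y * G D x y \<partial>m))) \<and>
        (\<forall>x y. x \<notin> D \<or> y \<notin> D \<longrightarrow> G D x y = 0))"

definition dual_green_functions ::
    "'a::topological_space measure \<Rightarrow> ('w, 'a) process \<Rightarrow> ('v, 'a) process \<Rightarrow>
     ('a set \<Rightarrow> 'a \<Rightarrow> 'a \<Rightarrow> ennreal) \<Rightarrow> ('a set \<Rightarrow> 'a \<Rightarrow> 'a \<Rightarrow> ennreal) \<Rightarrow> bool" where
  "dual_green_functions m X Xh G Gh \<longleftrightarrow>
     green_function m X G \<and> green_function m Xh Gh \<and>
     (\<forall>D x y. open D \<longrightarrow> G D x y = Gh D y x)"

definition levy_kernel :: "('w, 'a::metric_space) process \<Rightarrow> ('a \<Rightarrow> 'a measure) \<Rightarrow> bool" where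
  "levy_kernel X J \<longleftrightarrow>
     (\<forall>x. sets (J x) = sets borel \<and> emeasure (J x) {x} = 0) \<and>
     (\<forall>A\<in>sets borel. (\<lambda>x. emeasure (J x) A) \<in> borel_measurable borel) \<and>
     (\<forall>(f :: 'a \<Rightarrow> real) x.
        continuous_on UNIV f \<and> bounded (range f) \<and> x \<notin> closure {y. f y \<noteq> 0} \<longrightarrow>
        integrable (J x) f \<and>
        ((\<lambda>t. transition X t f x / t) \<longlongrightarrow> (\<integral>y. f y \<partial>J x)) (at_right 0))"

definition regular_harmonic :: "('w, 'a) process \<Rightarrow> 'a set \<Rightarrow> ('a \<Rightarrow> real) \<Rightarrow> bool" where
  "regular_harmonic X D u \<longleftrightarrow>
     (\<forall>x\<in>D. ennreal (u x) = expect X x (\<lambda>\<omega>. ext0 (\<lambda>y. ennreal (u y)) (pos_at X (exit_time X D) \<omega>)))"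

definition regular_boundary :: "('w, 'a::topological_space) process \<Rightarrow> 'a set \<Rightarrow> 'a set" where
  "regular_boundary X D = {x \<in> frontier D. AE \<omega> in law X (Some x). exit_time X D \<omega> = 0}"

text \<open>\<open>bump m \<D> K D\<close> is the collection \<open>\<D>(K, D)\<close>.\<close>

definition bump ::
    "'a::topological_space measure \<Rightarrow> ('a \<Rightarrow> real) set \<Rightarrow> 'a set \<Rightarrow> 'a set \<Rightarrow> ('a \<Rightarrow> real) set" where
  "bump m \<D> K D =
     {f \<in> \<D>. (\<forall>x\<in>K. f x = 1) \<and> (\<forall>x. x \<notin> D \<longrightarrow> f x = 0) \<and> (\<forall>x. 0 \<le> f x \<and> f x \<le> 1) \<and>
            emeasure m (frontier {x. f x > 0}) = 0}"

definition assumption_B ::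
    "'a::heine_borel measure \<Rightarrow> ('w, 'a) process \<Rightarrow> ('v, 'a) process \<Rightarrow> ('a \<Rightarrow> real) set \<Rightarrow> bool" where
  "assumption_B m X Xh \<D> \<longleftrightarrow>
     (\<lambda>_. 0) \<in> \<D> \<and> (\<forall>f\<in>\<D>. \<forall>g\<in>\<D>. (\<lambda>x. f x + g x) \<in> \<D>) \<and> (\<forall>f\<in>\<D>. \<forall>b. (\<lambda>x. b * f x) \<in> \<D>) \<and>
     \<D> \<subseteq> gen_dom X \<inter> gen_dom Xh \<and>
     (\<forall>K D. compact K \<and> open D \<and> K \<subseteq> D \<longrightarrow> bump m \<D> K D \<noteq> {})"

text \<open>The values of \<open>j\<close> and \<open>jh\<close> on the diagonal only enter through \<open>J(x, {x}) = 0\<close>.\<close>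

definition assumption_C ::
    "'a::heine_borel measure \<Rightarrow> ('w, 'a) process \<Rightarrow> ('v, 'a) process \<Rightarrow>
     ('a \<Rightarrow> 'a \<Rightarrow> real) \<Rightarrow> ('a \<Rightarrow> 'a \<Rightarrow> real) \<Rightarrow> bool" where
  "assumption_C m X Xh j jh \<longleftrightarrow>
     (\<forall>x. j x \<in> borel_measurable borel \<and> jh x \<in> borel_measurable borel) \<and>
     levy_kernel X (\<lambda>x. density m (\<lambda>y. ennreal (j x y))) \<and>
     levy_kernel Xh (\<lambda>x. density m (\<lambda>y. ennreal (jh x y))) \<and>
     (\<forall>x y. x \<noteq> y \<longrightarrow> j x y = jh y x \<and> 0 < j x y)"


section \<open>Assumptions at a point\<close>

definition assumption_V1 :: "'a::heine_borel measure \<Rightarrow> 'a \<Rightarrow> bool" where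
  "assumption_V1 m z \<longleftrightarrow> (\<exists>c>1. \<forall>r>0. vol m z (2 * r) \<le> ennreal c * vol m z r)"

definition assumption_V2 :: "'a::heine_borel measure \<Rightarrow> 'a \<Rightarrow> ereal \<Rightarrow> nat \<Rightarrow> bool" where
  "assumption_V2 m z r0 n0 \<longleftrightarrow>
     2 \<le> n0 \<and>
     (\<exists>c>1. \<forall>r>0. ereal r \<le> r0 \<longrightarrow> ennreal c * vol m z r \<le> vol m z (real n0 * r))"

definition assumption_Phi :: "(real \<Rightarrow> real) \<Rightarrow> bool" where
  "assumption_Phi \<Phi> \<longleftrightarrow>
     mono_on {0..} \<Phi> \<and> (\<forall>r\<ge>0. 0 \<le> \<Phi> r) \<and> (\<exists>c>1. \<forall>r>0. \<Phi> (2 * r) \<le> c * \<Phi> r)"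

definition max_gen ::
    "('w, 'a::metric_space) process \<Rightarrow> ('v, 'a) process \<Rightarrow> ('a \<Rightarrow> real) \<Rightarrow> 'a \<Rightarrow> ereal" where
  "max_gen X Xh f x = ereal (max (gen X f x) (gen Xh f x))"

definition assumption_B1a ::
    "'a::heine_borel measure \<Rightarrow> ('w, 'a) process \<Rightarrow> ('v, 'a) process \<Rightarrow> ('a \<Rightarrow> real) set \<Rightarrow>
     (real \<Rightarrow> real) \<Rightarrow> 'a \<Rightarrow> ereal \<Rightarrow> bool" where
  "assumption_B1a m X Xh \<D> \<Phi> z r0 \<longleftrightarrow>
     (\<forall>a. 1/2 < a \<and> a < 1 \<longrightarrow> (\<exists>c>0. \<forall>r>0. ereal r < r0 \<longrightarrow>
        (INF f\<in>bump m \<D> (closure (ball z (a * r))) (ball z r). SUP x. max_gen X Xh f x)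
          \<le> ereal c / ereal (\<Phi> r)))"

definition assumption_B1b ::
    "'a::heine_borel measure \<Rightarrow> ('w, 'a) process \<Rightarrow> ('v, 'a) process \<Rightarrow> ('a \<Rightarrow> real) set \<Rightarrow>
     ('a \<Rightarrow> 'a \<Rightarrow> real) \<Rightarrow> 'a \<Rightarrow> ereal \<Rightarrow> bool" where
  "assumption_B1b m X Xh \<D> j z r0 \<longleftrightarrow>
     (\<forall>a. 1/2 < a \<and> a < 1 \<longrightarrow> (\<exists>c>0. \<forall>r>0. ereal r < r0 \<longrightarrow>
        (\<forall>f\<in>bump m \<D> (closure (ball z (a * r))) (ball z r).
         \<forall>x\<in>closure (annulus z (a * r) ((a + 1) * r)).
           max_gen X Xh f x \<le> ereal c * enn2ereal (vol m z r) * ereal (j x z))))"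

definition assumption_B1c ::
    "'a::heine_borel measure \<Rightarrow> ('w, 'a) process \<Rightarrow> ('v, 'a) process \<Rightarrow> ('a \<Rightarrow> real) set \<Rightarrow>
     (real \<Rightarrow> real) \<Rightarrow> 'a \<Rightarrow> ereal \<Rightarrow> bool" where
  "assumption_B1c m X Xh \<D> \<Phi> z r0 \<longleftrightarrow>
     (\<forall>a b. 1/2 < b \<and> b < a \<and> a < 1 \<longrightarrow> (\<exists>c>0. \<forall>r>0. ereal r < r0 \<longrightarrow>
        (INF f\<in>bump m \<D> (closure (annulus z (b * r) (a * r))) (annulus z (r / 2) r).
           SUP x. max_gen X Xh f x)
          \<le> ereal c / ereal (\<Phi> r)))"

definition assumption_C1 ::
    "'a::heine_borel measure \<Rightarrow> ('a \<Rightarrow> 'a \<Rightarrow> real) \<Rightarrow> ('a \<Rightarrow> 'a \<Rightarrow> real) \<Rightarrow>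
     (real \<Rightarrow> real) \<Rightarrow> 'a \<Rightarrow> ereal \<Rightarrow> bool" where
  "assumption_C1 m j jh \<Phi> z r0 \<longleftrightarrow>
     (\<forall>a. 1/2 < a \<and> a < 1 \<longrightarrow> (\<exists>c\<ge>1. \<exists>c'>0. \<forall>r>0. ereal r < r0 \<longrightarrow>
        (\<forall>x\<in>ball z (a * r). \<forall>y\<in>- ball z r.
           inverse c * j z y \<le> j x y \<and> j x y \<le> c * j z y \<and>
           inverse c * jh z y \<le> jh x y \<and> jh x y \<le> c * jh z y) \<and>
        ennreal c' / (vol m z r * ennreal (\<Phi> r))
          \<le> (INF y\<in>closure (annulus z (a * r) r). ennreal (min (j z y) (jh z y)))))"

definition assumption_D1 ::
    "'a::heine_borel measure \<Rightarrow> ('a set \<Rightarrow> 'a \<Rightarrow> 'a \<Rightarrow> ennreal) \<Rightarrow> ('a set \<Rightarrow> 'a \<Rightarrow> 'a \<Rightarrow> ennreal) \<Rightarrow>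
     (real \<Rightarrow> real) \<Rightarrow> 'a \<Rightarrow> ereal \<Rightarrow> bool" where
  "assumption_D1 m G Gh \<Phi> z r0 \<longleftrightarrow>
     (\<forall>a. 1/2 < a \<and> a < 1 \<longrightarrow> (\<exists>c>0. \<forall>r>0. ereal r < r0 \<longrightarrow>
        (SUP x\<in>closure (annulus z (a * r) r). SUP y\<in>ball z (r / 2).
           max (G (ball z r) x y) (Gh (ball z r) x y))
          \<le> ennreal c * ennreal (\<Phi> r) / vol m z r))"

end

theory Submission
	imports Defs
begin

text \<open>
  For \<open>U = D \<inter> B(z0, r / 5)\<close> the Levy system at the exit time of \<open>U\<close> bounds \<open>u\<close> from below by the mean exit
  time of \<open>U\<close> times \<open>\<integral> j u\<close>, and test functions in the domain of the generator show that the mean exit times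
  of \<open>U\<close> and \<open>D\<close> are comparable on \<open>B(z0, r / 8)\<close>, since leaving \<open>U\<close> into \<open>B(z0, r)\<close> has probability
  \<open>O(E T\<^sub>U / \<Phi>(r))\<close>. The same splitting gives the upper bound once \<open>u\<close> is known to be at most
  \<open>C \<Phi>(r) \<integral> j u\<close> on \<open>D \<inter> B(z0, r / 2)\<close>.

  For that supremum bound take a bump \<open>\<phi>\<close> from the domain of the generators and kill the processes at the rate
  \<open>\<psi> = ((\<A>\<phi>)\<^sup>+ + \<delta> (1 - \<phi>)) / (\<phi> + \<epsilon>)\<close>, for which \<open>\<phi> + \<epsilon>\<close> is a supersolution of the dual process.
  The rate blows up near the edge of \<open>{\<phi> > 0}\<close> as \<open>\<epsilon> \<rightarrow> 0\<close>, so the process is absorbed before leaving continuously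
  and \<open>u\<close> is the mean of \<open>u\<close> at the killing time plus a contribution of large jumps. By duality the former
  is the integral of \<open>u\<close> against \<open>\<psi>\<close> times a dual potential, which the Green function bound controls in the
  annulus and the supersolution controls elsewhere. Irregular boundary points, where \<open>u\<close> need not vanish, are
  semipolar, hence not hit.
\<close>

text \<open>The assumptions bound generators of bumps only from above, and the Levy system speaks
  only of landing sets away from the closure of the region left. Nothing controls directly a
  continuous exit near the edge of a ball, where \<open>u\<close> may be large; the penalty is there
  to rule out such exits. Killing is expressed by a multiplicative weight along the paths of
  \<open>X\<close>, not by a new process. A constant part \<open>\<alpha> > 0\<close> of the rates
  keeps potentials of bounded functions finite, so that subtractive identities can be stated as sums
  in \<open>ennreal\<close> and cancelled; it finally tends to 0. Duality and Green densities see
  functions only up to \<open>m\<close>-null sets, hence the supremum bound is proved for integrals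
  over sets \<open>E\<close> on which \<open>u\<close> is bounded and transferred to points
  afterwards. The chain \<open>r / 8 < r / 5 < r / 4 < a r / 2 < r / 2\<close> separates the
  starting points, the set \<open>U\<close> and the landing points counted in the integral, and
  \<open>r < r0 / (2 n0)\<close> keeps the annulus reached by jumps in the bound of the mean exit
  time within the range of (C1).\<close>

abbreviation (input) "inv1 n \<equiv> inverse (real (Suc n))"

abbreviation (input) "before s \<equiv> {t::real. 0 <= t & ennreal t < s}"

abbreviation (input) "fin_on T A \<equiv> {w \<in> A. T w < (\<infinity>::ennreal)}"

abbreviation (input) "Leb \<equiv> nn_integral (lborel :: real measure)"

abbreviation (input) "bmeas \<equiv> borel_measurable borel"

abbreviation (input) "smeas \<equiv> borel_measurable state_alg"

section \<open>The one-point extension of the state space\<close>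

lemma space_state_alg [simp]: "space state_alg = UNIV"
	by (simp add: state_alg_def)

lemma openin_sets_state_alg: "openin one_point U ==> U \<in> sets state_alg"
	by (auto simp: state_alg_def intro!: in_measure_of)

lemma openin_Some_image: "open D ==> openin one_point (Some ` D :: 'a::t2_space option set)"
	by (auto simp: openin_one_point inj_vimage_image_eq)

text \<open>An open set containing the cemetery is the complement of the image of a closed set, so
  images of open sets already generate. Measurability into the extended space then needs testing
  only on the images of open \<open>D\<close> under \<open>Some\<close>.\<close>

lemma sets_state_alg_generated:
	"sets (state_alg :: 'a::t2_space option measure) = sigma_sets UNIV {Some ` D | D. open D}"
	(is "_ = sigma_sets UNIV ?G")
proof -
	interpret S: sigma_algebra UNIV "sigma_sets UNIV ?G"
		by (rule sigma_algebra_sigma_sets) auto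
	have "sets (state_alg :: 'a option measure) = sigma_sets UNIV {U. openin one_point U}"
		by (simp add: state_alg_def)
	also have "... = sigma_sets UNIV ?G"
	proof (rule sigma_sets_eqI)
		fix U :: "'a option set" assume U: "U \<in> {U. openin one_point U}"
		have *: "Some ` D \<in> sigma_sets UNIV ?G" if "open D" for D
			using that by (intro sigma_sets.Basic) auto
		show "U \<in> sigma_sets UNIV ?G"
		proof (cases "None \<in> U")
			case False
			hence "U = Some ` (Some -` U)"
				by (auto simp: image_iff) (metis not_None_eq vimageI2)
			moreover have "Some ` (Some -` U) \<in> sigma_sets UNIV ?G"
				by (rule *) (use U in "simp add: openin_one_point")
			ultimately show ?thesis by metis
		next
			case True
			let ?K = "- (Some -` U)"
			have "compact ?K" using U True by (simp add: openin_one_point)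
			have "open (- ?K)" using U by (simp add: openin_one_point)
			moreover have "U = UNIV - (Some ` UNIV - Some ` (- ?K))"
				using True by (auto simp: image_iff) (metis not_None_eq vimageI2)
			moreover have "UNIV - (Some ` UNIV - Some ` (- ?K)) \<in> sigma_sets UNIV ?G"
				using *[OF \<open>open (- ?K)\<close>] *[OF open_UNIV] S.compl_sets S.Diff by auto
			ultimately show ?thesis by metis
		qed
	next
		fix U :: "'a option set" assume "U \<in> ?G"
		thus "U \<in> sigma_sets UNIV {U. openin one_point U}"
			by (intro sigma_sets.Basic) (auto simp: openin_Some_image)
	qed
	finally show ?thesis .
qed

lemma Some_image_sets_state_alg:
	fixes A :: "'a::t2_space set"
	assumes "A \<in> sets borel"
	shows "Some ` A \<in> sets state_alg"
proof -
	have "A \<in> sigma_sets UNIV {S. open S}"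
		using assms by (simp add: borel_def)
	thus ?thesis
	proof induction
		case (Basic a)
		thus ?case by (intro openin_sets_state_alg openin_Some_image) simp
	next
		case Empty
		thus ?case by simp
	next
		case (Compl a)
		have "(Some ` UNIV :: 'a option set) \<in> sets state_alg"
			by (intro openin_sets_state_alg openin_Some_image) simp
		moreover have "Some ` (UNIV - a) = Some ` UNIV - Some ` a" by auto
		ultimately show ?case using Compl by auto
	next
		case (Union a)
		thus ?case by (auto simp: image_UN)
	qed
qed

lemma None_sets_state_alg: "{None} \<in> sets (state_alg :: 'a::t2_space option measure)"
proof -
	have "space state_alg - Some ` UNIV \<in> sets (state_alg :: 'a option measure)"
		by (intro sets.compl_sets Some_image_sets_state_alg) simp
	moreover have "space state_alg - Some ` UNIV = {None :: 'a option}"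
		by auto (metis not_None_eq rangeI)
	ultimately show ?thesis by simp
qed

lemma measurable_Some [measurable]: "(Some :: 'a::t2_space => _) \<in> borel \<rightarrow>\<^sub>M state_alg"
proof (rule measurable_sigma_sets[OF sets_state_alg_generated])
	fix A :: "'a option set" assume "A \<in> {Some ` D | D. open D}"
	thus "Some -` A \<inter> space borel \<in> sets borel" by (auto simp: inj_vimage_image_eq)
qed auto

lemma measurable_case_option_state_alg:
	fixes f :: "'a::t2_space => 'b"
	assumes f: "f \<in> borel \<rightarrow>\<^sub>M N" and c: "c \<in> space N"
	shows "case_option c f \<in> state_alg \<rightarrow>\<^sub>M N"
proof (rule measurableI)
	fix A assume A: "A \<in> sets N"
	have *: "case_option c f -` A \<inter> space state_alg
		 = Some ` (f -` A \<inter> space borel) \<union> (if c \<in> A then {None} else {})"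
		by (auto split: option.splits if_splits)
	show "case_option c f -` A \<inter> space state_alg \<in> sets state_alg"
		unfolding * using Some_image_sets_state_alg[OF measurable_sets[OF f A]] None_sets_state_alg
		by (intro sets.Un) auto
next
	show "case_option c f x \<in> space N" for x
		using measurable_space[OF f] c by (cases x) auto
qed

lemma measurable_ext0 [measurable (raw)]:
	fixes f :: "'a::t2_space => 'b::{zero,topological_space}"
	shows "f \<in> bmeas ==> ext0 f \<in> smeas"
	unfolding ext0_def by (rule measurable_case_option_state_alg) auto

abbreviation (input) "enn0 f \<equiv> ext0 (%x. ennreal (f x))"

lemma ext0_simps [simp]: "ext0 f None = 0" "ext0 f (Some x) = f x"
	by (simp_all add: ext0_def)

text \<open>Vanishing at infinity gives continuity at the cemetery: the preimage of a neighbourhood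
  of 0 has compact complement.\<close>

lemma continuous_map_ext0:
	assumes f: "f \<in> C0"
	shows "continuous_map one_point euclideanreal (ext0 f)"
	unfolding continuous_map
proof (intro conjI allI impI ballI)
	show "ext0 f ` topspace one_point \<subseteq> topspace euclideanreal" by simp
	have "openin one_point (UNIV :: 'a option set)" by (simp add: openin_one_point)
	hence top: "topspace (one_point :: 'a option topology) = UNIV"
		by (metis openin_subset subset_antisym subset_UNIV)
	fix U :: "real set" assume "openin euclideanreal U"
	hence U: "open U" by simp
	have cont: "continuous_on UNIV f" using f by (simp add: C0_def)
	have 1: "Some -` {x. ext0 f x \<in> U} = f -` U" by auto
	have 2: "compact (- (f -` U))" if "0 \<in> U"
	proof -
		obtain e where e: "e > 0" "!!y. \<bar>y\<bar> < e ==> y \<in> U"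
			using U \<open>0 \<in> U\<close> by (auto simp: open_dist dist_real_def)
		obtain K where K: "compact K" "!!x. x \<notin> K ==> \<bar>f x\<bar> < e"
			using f e by (auto simp: C0_def)
		have "- (f -` U) = K \<inter> (- (f -` U))" using e K by auto
		moreover have "closed (- (f -` U))"
			using open_vimage[OF U cont] by (simp only: closed_def double_complement)
		ultimately show ?thesis using compact_Int_closed[OF K(1)] by metis
	qed
	show "openin one_point {x \<in> topspace one_point. ext0 f x \<in> U}"
		unfolding top using 1 2 open_vimage[OF U cont] by (auto simp: openin_one_point)
qed

lemma C0_measurable: "f \<in> C0 ==> f \<in> bmeas"
	by (auto simp: C0_def intro: borel_measurable_continuous_onI)

lemma C0_bounded: "f \<in> C0 ==> \<exists>B>0. \<forall>x. \<bar>f x\<bar> <= B"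
	by (auto simp: C0_def bounded_pos)

text \<open>The distance to the complement is cut off by \<open>p\<close>, which tends to 0 at
  infinity because closed balls are compact. Every open set thus becomes the positivity set of a
  function whose values along paths are right continuous.\<close>

lemma open_eq_C0_positive:
	fixes D :: "'a::heine_borel set"
	assumes "open D"
	shows "\<exists>g\<in>C0. (\<forall>x. 0 <= g x) & D = {x. 0 < g x}"
proof -
	obtain z :: 'a where True by simp
	define p where "p x = 1 / (1 + dist z x)" for x
	have p: "continuous_on UNIV p" "!!x. 0 < p x" "!!x. p x <= 1"
		unfolding p_def by (auto intro!: continuous_intros simp: add_pos_nonneg add_nonneg_eq_0_iff)
	have pv: "\<exists>K. compact K & (\<forall>x. x \<notin> K --> p x < e)" if "e > 0" for e
	proof (intro exI[of _ "cball z (1 / e)"] conjI allI impI)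
		show "compact (cball z (1 / e))" by (simp add: compact_eq_bounded_closed)
		fix x assume "x \<notin> cball z (1 / e)"
		hence "1 / e < 1 + dist z x" by simp
		thus "p x < e" using that unfolding p_def
			by (simp add: field_simps add_pos_nonneg)
	qed
	\<comment> \<open>\<open>infdist\<close> to the empty set is 0, so the whole space needs its own
	  case.\<close>
	define g where "g x = (if D = UNIV then p x else min (p x) (infdist x (- D)))" for x
	have g0: "0 <= g x" "g x <= p x" for x
		using p(2)[of x] by (auto simp: g_def infdist_nonneg)
	have "continuous_on UNIV g"
		unfolding g_def using p(1) by (cases "D = UNIV") (auto intro!: continuous_intros)
	moreover have "bounded (range g)"
		unfolding bounded_iff using g0 p(3) by (intro exI[of _ 1]) (auto intro: order_trans)
	moreover have "\<exists>K. compact K & (\<forall>x. x \<notin> K --> \<bar>g x\<bar> < e)" if "e > 0" for e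
		using pv[OF that] g0 by (metis abs_of_nonneg le_less_trans)
	ultimately have "g \<in> C0" by (simp add: C0_def)
	moreover have "D = {x. 0 < g x}"
	proof (cases "D = UNIV")
		case True
		thus ?thesis using p by (auto simp: g_def)
	next
		case False
		have "closed (- D)" "- D ~= {}" using assms False by auto
		hence "x \<in> - D \<longleftrightarrow> infdist x (- D) = 0" for x
			by (rule in_closed_iff_infdist_zero)
		hence "x \<in> D \<longleftrightarrow> 0 < infdist x (- D)" for x
			using infdist_nonneg[of x "- D"] by (auto simp: less_le)
		thus ?thesis using False p(2) by (auto simp: g_def)
	qed
	ultimately show ?thesis using g0 by blast
qed

section \<open>Measurability of the paths\<close>

lemma space_history [simp]: "space (history X I) = paths X"
	unfolding history_def by (rule space_measure_of) auto

lemma sets_history: "sets (history X I) =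
	 sigma_sets (paths X) {pos X s -` B \<inter> paths X | s B. s \<in> I & B \<in> sets state_alg}"
	unfolding history_def by (rule sets_measure_of) auto

lemma history_mono: "I \<subseteq> J ==> sets (history X I) \<subseteq> sets (history X J)"
	unfolding sets_history by (rule sigma_sets_mono') auto

lemma measurable_history_mono:
	"f \<in> history X I \<rightarrow>\<^sub>M N ==> I \<subseteq> J ==> f \<in> history X J \<rightarrow>\<^sub>M N"
	using history_mono[of I J X] by (auto simp: measurable_def)

lemma measurable_pos: "s \<in> I ==> pos X s \<in> history X I \<rightarrow>\<^sub>M state_alg"
	by (rule measurableI) (auto simp: sets_history)

lemma measurable_into_history:
	assumes "f \<in> space N \<rightarrow> paths X"
		and "!!s. s \<in> I ==> (%x. pos X s (f x)) \<in> N \<rightarrow>\<^sub>M state_alg"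
	shows "f \<in> N \<rightarrow>\<^sub>M history X I"
proof (rule measurable_sigma_sets[OF sets_history _ assms(1)])
	fix A assume "A \<in> {pos X s -` B \<inter> paths X | s B. s \<in> I & B \<in> sets state_alg}"
	then obtain s B where A: "A = pos X s -` B \<inter> paths X" "s \<in> I" "B \<in> sets state_alg" by blast
	have "f -` A \<inter> space N = (%x. pos X s (f x)) -` B \<inter> space N"
		using assms(1) A by auto
	thus "f -` A \<inter> space N \<in> sets N"
		using measurable_sets[OF assms(2)[OF A(2)] A(3)] by simp
qed auto

locale hunt =
	fixes X :: "('w, 'a::heine_borel) process"
	assumes hunt: "hunt_process X"
begin

abbreviation "P \<equiv> law X"

abbreviation "H \<equiv> history X {0..}"

abbreviation "hist t \<equiv> sets (history X {0..t})"

abbreviation "hmeas \<equiv> borel_measurable H"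

abbreviation "EE x \<equiv> nn_integral (P x)"

lemma P_kernel: "P \<in> state_alg \<rightarrow>\<^sub>M prob_algebra H"
	using hunt by (simp add: hunt_process_def markov_paths_def)

lemma P_kernel_subprob [measurable]: "P \<in> state_alg \<rightarrow>\<^sub>M subprob_algebra H"
	using P_kernel by (rule measurable_prob_algebraD)

lemma P_space: "P x \<in> space (prob_algebra H)"
	using measurable_space[OF P_kernel] by simp

lemma sets_P [simp, measurable_cong]: "sets (P x) = sets H"
	using P_space[of x] by (simp add: space_prob_algebra)

lemma space_P [simp]: "space (P x) = paths X"
	using sets_eq_imp_space_eq[OF sets_P] by simp

lemma prob_space_P: "prob_space (P x)"
	using P_space[of x] by (simp add: space_prob_algebra)

sublocale P: prob_space "P x" for x
	by (rule prob_space_P)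

lemma measurable_P_iff: "f \<in> P x \<rightarrow>\<^sub>M N \<longleftrightarrow> f \<in> H \<rightarrow>\<^sub>M N"
	by (simp add: measurable_def)

lemma measurable_nn_integral_P:
	"f \<in> hmeas ==> (%x. \<integral>\<^sup>+w. f w \<partial>P x) \<in> smeas"
	by (rule measurable_compose[OF P_kernel_subprob nn_integral_measurable_subprob_algebra])

lemma AE_start: "AE w in P x. pos X 0 w = x"
	using hunt by (simp add: hunt_process_def markov_paths_def)

lemma pos_None: "w \<in> paths X ==> 0 <= s ==> s <= t ==> pos X s w = None ==> pos X t w = None"
	using hunt by (auto simp: hunt_process_def markov_paths_def)

lemma shift_paths: "w \<in> paths X ==> 0 <= t ==> shift X t w \<in> paths X"
	using hunt by (auto simp: hunt_process_def markov_paths_def)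

lemma pos_shift: "w \<in> paths X ==> 0 <= t ==> 0 <= s ==> pos X s (shift X t w) = pos X (s + t) w"
	using hunt by (auto simp: hunt_process_def markov_paths_def)

lemma pos_right_continuous:
	"w \<in> paths X ==> 0 <= t ==> limitin one_point (%s. pos X s w) (pos X t w) (at_right t)"
	using hunt by (auto simp: hunt_process_def markov_paths_def)

lemma ext0_right_continuous:
	assumes "g \<in> C0" "w \<in> paths X" "0 <= t"
	shows "((%s. ext0 g (pos X s w)) \<longlongrightarrow> ext0 g (pos X t w)) (at_right t)"
	using continuous_map_limit[OF continuous_map_ext0[OF assms(1)] pos_right_continuous[OF assms(2,3)]]
	by (simp add: o_def)

lemma stays_in_open:
	assumes "open D" "w \<in> paths X" "0 <= t" "pos X t w \<in> Some ` D"
	shows "\<exists>e>0. \<forall>s. t <= s & s < t + e --> pos X s w \<in> Some ` D"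
proof -
	have "eventually (%s. pos X s w \<in> Some ` D) (at_right t)"
		using limitinD[OF pos_right_continuous[OF assms(2,3)] openin_Some_image[OF assms(1)] assms(4)] .
	then obtain b where b: "b > t" "!!s. t < s ==> s < b ==> pos X s w \<in> Some ` D"
		by (auto simp: eventually_at_right_field)
	thus ?thesis using assms(4)
		by (intro exI[of _ "b - t"]) (auto simp: le_less)
qed

text \<open>
	Joint measurability up to time \<open>t\<close>: approximate the time from the right by a discrete grid,
	capped at \<open>t\<close> so that only the history up to \<open>t\<close> enters.
\<close>

lemma measurable_pos_joint_upto:
	assumes t: "0 <= t"
	shows "(%(u, w). pos X (max 0 (min u t)) w) \<in> borel \<Otimes>\<^sub>M history X {0..t} \<rightarrow>\<^sub>M state_alg"
		(is "?F \<in> ?N \<rightarrow>\<^sub>M _")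
proof (rule measurable_sigma_sets[OF sets_state_alg_generated])
	fix A :: "'a option set" assume "A \<in> {Some ` D | D. open D}"
	then obtain D where A: "A = Some ` D" "open D" by blast
	obtain g where g: "g \<in> C0" "!!x. 0 <= g x" "D = {x. 0 < g x}"
		using open_eq_C0_positive[OF A(2)] by blast
	\<comment> \<open>The grid point is strictly above \<open>u\<close>, so right continuity applies
	  even when \<open>u\<close> itself lies on a grid.\<close>
	define d where "d n u = (real_of_int \<lfloor>u * real (Suc n)\<rfloor> + 1) / real (Suc n)" for n u
	have d: "u < d n u" "d n u <= u + inv1 n" for n u
	proof -
		have "u * real (Suc n) < real_of_int \<lfloor>u * real (Suc n)\<rfloor> + 1" by linarith
		thus "u < d n u" unfolding d_def by (simp add: pos_less_divide_eq del: of_nat_Suc)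
		have "real_of_int \<lfloor>u * real (Suc n)\<rfloor> + 1 <= u * real (Suc n) + 1" by linarith
		thus "d n u <= u + inv1 n"
			unfolding d_def by (simp add: pos_divide_le_eq field_simps del: of_nat_Suc)
	qed
	have dlim: "(%n. d n u) \<longlonglongrightarrow> u" for u
	proof (rule tendsto_sandwich[of "%_. u" _ _ "%n. u + inv1 n"])
		show "(%n. u + inv1 n) \<longlonglongrightarrow> u"
			using LIMSEQ_inverse_real_of_nat_add[of u] by simp
	qed (use d in "auto intro!: always_eventually intro: less_imp_le simp del: of_nat_Suc")
	define G where "G n p = ext0 g (pos X (max 0 (min (d n (fst p)) t)) (snd p))" for n and p :: "real \<times> 'w"
	have G: "G n \<in> borel_measurable ?N" for n
	proof -
		have "(%p. (%k p. ext0 g (pos X (max 0 (min ((real_of_int k + 1) / real (Suc n)) t)) (snd p)))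
				(\<lfloor>fst p * real (Suc n)\<rfloor>) p) \<in> borel_measurable ?N"
		proof (rule measurable_compose_countable[where g = "%p. \<lfloor>fst p * real (Suc n)\<rfloor>" and
				f = "%k p. ext0 g (pos X (max 0 (min ((real_of_int k + 1) / real (Suc n)) t)) (snd p))"])
			fix k :: int
			have "pos X (max 0 (min ((real_of_int k + 1) / real (Suc n)) t)) \<in> history X {0..t} \<rightarrow>\<^sub>M state_alg"
				using t by (intro measurable_pos) auto
			from measurable_compose[OF measurable_compose[OF measurable_snd this] measurable_ext0[OF C0_measurable[OF g(1)]]]
			show "(%p. ext0 g (pos X (max 0 (min ((real_of_int k + 1) / real (Suc n)) t)) (snd p)))
					\<in> borel_measurable ?N" .
		next
			show "(%x. \<lfloor>fst x * real (Suc n)\<rfloor>) \<in> ?N \<rightarrow>\<^sub>M count_space UNIV"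
				by measurable
		qed
		thus ?thesis by (simp add: G_def[abs_def] d_def del: of_nat_Suc)
	qed
	have lim: "(%n. G n p) \<longlonglongrightarrow> ext0 g (?F p)" if p: "p \<in> space ?N" for p
	proof -
		obtain u w where p': "p = (u, w)" "w \<in> paths X"
			using p by (auto simp: space_pair_measure)
		consider "t <= u" | "u < 0" | "0 <= u" "u < t" by linarith
		thus ?thesis
		proof cases
			case 1
			hence "min (d n u) t = t" for n using d(1)[of u n] by linarith
			thus ?thesis using 1 t by (simp add: G_def p')
		next
			case 2
			hence "eventually (%n. d n u < 0) sequentially"
				using order_tendstoD(2)[OF dlim] by blast
			hence "eventually (%n. G n p = ext0 g (?F p)) sequentially"
				by eventually_elim (use 2 t in "simp add: G_def p' min_def max_def")
			thus ?thesis by (rule tendsto_eventually)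
		next
			case 3
			have "filterlim (%n. max 0 (min (d n u) t)) (at_right u) sequentially"
				unfolding filterlim_at
			proof
				show "\<forall>\<^sub>F n in sequentially. max 0 (min (d n u) t) \<in> {u<..} & max 0 (min (d n u) t) ~= u"
				proof (intro always_eventually allI)
					show "max 0 (min (d n u) t) \<in> {u<..} & max 0 (min (d n u) t) ~= u" for n
						using 3 d(1)[of u n] by (auto simp: max_def min_def)
				qed
				have "(%n. max 0 (min (d n u) t)) \<longlonglongrightarrow> max 0 (min u t)"
					by (intro tendsto_intros dlim)
				thus "(%n. max 0 (min (d n u) t)) \<longlonglongrightarrow> u" using 3 by simp
			qed
			from filterlim_compose[OF ext0_right_continuous[OF g(1) p'(2) 3(1)] this]
			show ?thesis using 3 by (simp add: G_def p')
		qed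
	qed
	have meas: "(%p. ext0 g (?F p)) \<in> borel_measurable ?N"
		by (rule borel_measurable_LIMSEQ_real[OF lim G])
	have "?F -` A \<inter> space ?N = (%p. ext0 g (?F p)) -` {0<..} \<inter> space ?N"
		unfolding A(1) g(3) by (auto simp: ext0_def image_iff split: option.splits)
	also have "... \<in> sets ?N"
		by (rule measurable_sets[OF meas]) simp
	finally show "?F -` A \<inter> space ?N \<in> sets ?N" .
qed auto

text \<open>Each \<open>u\<close> is covered by the integer cap
  \<open>nat \<lceil>u\<rceil>\<close>, so countably many capped versions can be glued
  together.\<close>

lemma measurable_pos_joint: "(%(u, w). pos X (max 0 u) w) \<in> borel \<Otimes>\<^sub>M H \<rightarrow>\<^sub>M state_alg"
proof -
	have "(%p. (%n p. pos X (max 0 (min (fst p) (real n))) (snd p)) (nat \<lceil>fst p\<rceil>) p) \<in> borel \<Otimes>\<^sub>M H \<rightarrow>\<^sub>M state_alg"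
	proof (rule measurable_compose_countable[where g = "%p. nat \<lceil>fst p\<rceil>" and
				f = "%n p. pos X (max 0 (min (fst p) (real n))) (snd p)"])
		fix n :: nat
		have "(%x. x) \<in> H \<rightarrow>\<^sub>M history X {0..real n}"
			by (rule measurable_into_history) (auto intro: measurable_pos)
		hence *: "(%p. (fst p, snd p)) \<in> borel \<Otimes>\<^sub>M H \<rightarrow>\<^sub>M (borel :: real measure) \<Otimes>\<^sub>M history X {0..real n}"
			by (intro measurable_Pair measurable_fst measurable_compose[OF measurable_snd])
		show "(%p. pos X (max 0 (min (fst p) (real n))) (snd p)) \<in> borel \<Otimes>\<^sub>M H \<rightarrow>\<^sub>M state_alg"
			using measurable_compose[OF * measurable_pos_joint_upto[of "real n"]] by simp
	qed measurable
	moreover have "min u (real (nat \<lceil>u\<rceil>)) = (if u \<ge> 0 then u else u)" for u :: real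
		by (auto simp: min_def) linarith+
	ultimately show ?thesis by (simp add: case_prod_beta')
qed

lemma measurable_pos_random:
	assumes [measurable]: "S \<in> N \<rightarrow>\<^sub>M borel" and f: "f \<in> N \<rightarrow>\<^sub>M H" and "!!x. x \<in> space N ==> 0 <= S x"
	shows "(%x. pos X (S x) (f x)) \<in> N \<rightarrow>\<^sub>M state_alg"
proof -
	have "(%x. (S x, f x)) \<in> N \<rightarrow>\<^sub>M borel \<Otimes>\<^sub>M H"
		using f by measurable
	from measurable_compose[OF this measurable_pos_joint]
	have "(%x. pos X (max 0 (S x)) (f x)) \<in> N \<rightarrow>\<^sub>M state_alg" by simp
	thus ?thesis
		by (rule measurable_cong[THEN iffD1, rotated]) (use assms(3) in simp)
qed

lemma measurable_pos_at:
	assumes "T \<in> hmeas"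
	shows "pos_at X T \<in> H \<rightarrow>\<^sub>M state_alg"
proof -
	have [measurable]: "(%w. pos X (enn2real (T w)) w) \<in> H \<rightarrow>\<^sub>M state_alg"
		using assms by (intro measurable_pos_random) auto
	note assms[measurable]
	have "(%w. if T w = \<infinity> then None else pos X (enn2real (T w)) w) \<in> H \<rightarrow>\<^sub>M state_alg"
		by measurable
	thus ?thesis by (simp add: pos_at_def[abs_def])
qed

lemma measurable_shift_random:
	assumes [measurable]: "S \<in> hmeas" and "!!w. w \<in> paths X ==> 0 <= S w"
	shows "(%w. shift X (S w) w) \<in> H \<rightarrow>\<^sub>M H"
proof (rule measurable_into_history)
	show "(%w. shift X (S w) w) \<in> space H \<rightarrow> paths X"
		using assms(2) by (auto intro: shift_paths)
	fix s :: real assume s: "s \<in> {0..}"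
	have "(%w. pos X (s + S w) w) \<in> H \<rightarrow>\<^sub>M state_alg"
		using assms(2) s by (intro measurable_pos_random) auto
	thus "(%w. pos X s (shift X (S w) w)) \<in> H \<rightarrow>\<^sub>M state_alg"
		by (rule measurable_cong[THEN iffD1, rotated]) (use assms(2) s in "simp add: pos_shift")
qed

lemma measurable_shift_history:
	assumes "0 <= s"
	shows "shift X s \<in> history X {s..s+t} \<rightarrow>\<^sub>M history X {0..t}"
proof (rule measurable_into_history)
	show "shift X s \<in> space (history X {s..s+t}) \<rightarrow> paths X"
		using assms by (auto intro: shift_paths)
	fix r assume r: "r \<in> {0..t}"
	have "pos X (r + s) \<in> history X {s..s+t} \<rightarrow>\<^sub>M state_alg"
		using r assms by (intro measurable_pos) auto
	thus "(%w. pos X r (shift X s w)) \<in> history X {s..s+t} \<rightarrow>\<^sub>M state_alg"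
		by (rule measurable_cong[THEN iffD1, rotated]) (use assms r in "simp add: pos_shift")
qed

end

section \<open>The strong Markov property for functionals of the path\<close>

text \<open>Two finite measures on \<open>N\<close> are compared: the image of \<open>M\<close>
  restricted to \<open>S\<close> under \<open>W\<close>, and the mixture of the kernels
  \<open>k (Z w)\<close> over \<open>S\<close>. They agree on an intersection-stable generator,
  hence as measures, hence on all nonnegative functions. This lifts the strong Markov property from
  events to functionals.\<close>

lemma kernel_transfer:
	fixes M :: "'x measure"
	assumes M: "finite_measure M" "space M ~= {}" and S: "S \<in> sets M"
		and Z: "Z \<in> M \<rightarrow>\<^sub>M K" and k: "k \<in> K \<rightarrow>\<^sub>M subprob_algebra N" and W: "W \<in> M \<rightarrow>\<^sub>M N"
		and G: "Int_stable G" "G \<subseteq> Pow (space N)" "sets N = sigma_sets (space N) G" "space N \<in> G"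
		and eq: "!!E. E \<in> G ==>
			emeasure M {w \<in> S. W w \<in> E} = (nn_integral M (%w. indicator S w * emeasure (k (Z w)) E))"
		and f: "f \<in> borel_measurable N"
	shows "(nn_integral M (%w. indicator S w * f (W w))) = (nn_integral M (%w. indicator S w * (nn_integral (k (Z w)) (%y. f y))))"
proof -
	define D where "D = density M (indicator S)"
	have D: "sets D = sets M" "space D = space M" by (simp_all add: D_def)
	have W': "W \<in> D \<rightarrow>\<^sub>M N" using W by (simp add: measurable_def D)
	have kZ: "(%w. k (Z w)) \<in> D \<rightarrow>\<^sub>M subprob_algebra N"
		using measurable_compose[OF Z k] by (simp add: measurable_def D)
	have ind: "indicator S \<in> borel_measurable M" using S by simp
	have inner: "(%w. \<integral>\<^sup>+y. h y \<partial>k (Z w)) \<in> borel_measurable M" if "h \<in> borel_measurable N" for h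
		using measurable_compose[OF measurable_compose[OF Z k] nn_integral_measurable_subprob_algebra[OF that]] .
	have sets2: "sets (D \<bind> (%w. k (Z w))) = sets N"
		by (rule sets_bind) (use sets_kernel[OF kZ] M D in auto)
	have e1: "emeasure (distr D N W) E = emeasure M {w \<in> S. W w \<in> E}" if "E \<in> sets N" for E
	proof -
		have "emeasure (distr D N W) E = emeasure D (W -` E \<inter> space M)"
			using W' that D by (simp add: emeasure_distr)
		also have "... = (nn_integral M (%w. indicator S w * indicator (W -` E \<inter> space M) w))"
			unfolding D_def using measurable_sets[OF W that] S by (subst emeasure_density) auto
		also have "... = (nn_integral M (%w. indicator (S \<inter> (W -` E \<inter> space M)) w))"
			by (simp add: indicator_inter_arith)
		also have "... = emeasure M (S \<inter> (W -` E \<inter> space M))"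
			using measurable_sets[OF W that] S by (subst nn_integral_indicator) auto
		also have "S \<inter> (W -` E \<inter> space M) = {w \<in> S. W w \<in> E}"
			using sets.sets_into_space[OF S] by auto
		finally show ?thesis .
	qed
	have e2: "emeasure (D \<bind> (%w. k (Z w))) E = (nn_integral M (%w. indicator S w * emeasure (k (Z w)) E))"
		if "E \<in> sets N" for E
	proof -
		have "emeasure (D \<bind> (%w. k (Z w))) E = (nn_integral D (%w. emeasure (k (Z w)) E))"
			using M D kZ that by (intro emeasure_bind) auto
		also have "... = (nn_integral M (%w. indicator S w * emeasure (k (Z w)) E))"
			unfolding D_def
			using measurable_compose[OF measurable_compose[OF Z k] measurable_emeasure_subprob_algebra[OF that]]
			by (intro nn_integral_density ind) auto
		finally show ?thesis .
	qed
	have GN: "E \<in> sets N" if "E \<in> G" for E using that G(3) by auto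
	have eqM: "distr D N W = D \<bind> (%w. k (Z w))"
	proof (rule measure_eqI_generator_eq[OF G(1,2), where A = "%_. space N"])
		show "emeasure (distr D N W) E = emeasure (D \<bind> (%w. k (Z w))) E" if "E \<in> G" for E
			using that e1 e2 eq GN by simp
		show "emeasure (distr D N W) (space N) ~= \<infinity>" for i :: nat
		proof -
			have "emeasure M {w \<in> S. W w \<in> space N} <= emeasure M (space M)"
				using sets.sets_into_space[OF S] by (intro emeasure_mono) auto
			thus ?thesis
				using e1[OF sets.top] finite_measure.emeasure_finite[OF M(1), of "space M"] by (auto simp: top_unique)
		qed
	qed (use G sets2 in auto)
	have "(nn_integral M (%w. indicator S w * f (W w))) = (nn_integral D (%w. f (W w)))"
		unfolding D_def using measurable_compose[OF W f] by (intro nn_integral_density[symmetric] ind)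
	also have "... = (nn_integral (distr D N W) (%y. f y))"
		using W' f by (simp add: nn_integral_distr)
	also have "... = (nn_integral D (%w. (nn_integral (k (Z w)) (%y. f y))))"
		unfolding eqM by (rule nn_integral_bind[OF f kZ])
	also have "... = (nn_integral M (%w. indicator S w * (nn_integral (k (Z w)) (%y. f y))))"
		unfolding D_def by (intro nn_integral_density ind inner f)
	finally show ?thesis .
qed

section \<open>Random times of the uncompleted history and the events known at them\<close>

context hunt
begin

text \<open>With strict inequalities and the uncompleted history, first entrances into open sets
  qualify by elementary means; right continuity of the augmented filtration turns such a time into
  an \<open>optional_time\<close>.\<close>

definition raw_time :: "('w => ennreal) => bool" where
	"raw_time T \<longleftrightarrow> (\<forall>t>0. {w \<in> paths X. T w < ennreal t} \<in> hist t)"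

definition past :: "('w => ennreal) => 'w set set" where
	"past T = {A \<in> sets H. \<forall>t>0. {w \<in> A. T w < ennreal t} \<in> hist t}"

text \<open>Carried as a measurable space, so that weights known at \<open>T\<close> are simply the
  functions measurable for \<open>pastM T\<close>.\<close>

definition pastM :: "('w => ennreal) => 'w measure" where
	"pastM T = sigma (paths X) (past T)"

lemma past_subset: "A \<in> past T ==> A \<subseteq> paths X"
	using sets.sets_into_space[of A H] by (auto simp: past_def)

lemma sigma_algebra_past:
	assumes "raw_time T"
	shows "sigma_algebra (paths X) (past T)"
	unfolding sigma_algebra_iff2
proof (intro conjI ballI allI impI)
	show "past T \<subseteq> Pow (paths X)" using past_subset by auto
	show "{} \<in> past T" by (auto simp: past_def)
	fix A assume A: "A \<in> past T"
	show "paths X - A \<in> past T"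
		unfolding past_def
	proof (intro CollectI conjI allI impI)
		show "paths X - A \<in> sets H"
			using A sets.compl_sets[of A H] by (auto simp: past_def)
		fix t :: real assume t: "0 < t"
		have "{w \<in> paths X - A. T w < ennreal t} = {w \<in> paths X. T w < ennreal t} - {w \<in> A. T w < ennreal t}"
			by auto
		also have "... \<in> hist t"
			using A assms t by (intro sets.Diff) (auto simp: past_def raw_time_def)
		finally show "{w \<in> paths X - A. T w < ennreal t} \<in> hist t" .
	qed
next
	fix A :: "nat => 'w set" assume A: "range A \<subseteq> past T"
	show "(\<Union>i. A i) \<in> past T"
		unfolding past_def
	proof (intro CollectI conjI allI impI)
		show "(\<Union>i. A i) \<in> sets H" using A by (intro sets.countable_UN) (auto simp: past_def)
		fix t :: real assume t: "0 < t"
		have "{w \<in> (\<Union>i. A i). T w < ennreal t} = (\<Union>i. {w \<in> A i. T w < ennreal t})" by auto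
		also have "... \<in> hist t"
			using A t by (intro sets.countable_UN) (auto simp: past_def)
		finally show "{w \<in> (\<Union>i. A i). T w < ennreal t} \<in> hist t" .
	qed
qed

lemma sets_pastM: "raw_time T ==> sets (pastM T) = past T"
	unfolding pastM_def by (simp add: sigma_algebra.sets_measure_of_eq[OF sigma_algebra_past])

lemma space_pastM [simp]: "space (pastM T) = paths X"
	unfolding pastM_def by (rule space_measure_of) (use past_subset in auto)

lemma raw_time_measurable:
	assumes "raw_time T"
	shows "T \<in> hmeas"
proof (rule borel_measurableI_less)
	have *: "{w \<in> paths X. T w < ennreal t} \<in> sets H" for t
	proof (cases "t > 0")
		case True
		thus ?thesis using assms history_mono[of "{0..t}" "{0..}" X] by (auto simp: raw_time_def)
	next
		case False
		thus ?thesis by (simp add: ennreal_neg)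
	qed
	fix y :: ennreal
	show "{w \<in> space H. T w < y} \<in> sets H"
	proof (cases y)
		case (real r)
		thus ?thesis using *[of r] by simp
	next
		case top
		have "{w \<in> space H. T w < y} = (\<Union>n. {w \<in> paths X. T w < ennreal (real n)})"
		proof -
			have "\<exists>n. T w < ennreal (real n)" if "T w < y" for w
				using ennreal_Ex_less_of_nat that by (auto simp: top ennreal_of_nat_eq_real_of_nat)
			moreover have "T w < y" if "T w < ennreal (real n)" for w n
				using that by (auto simp: top intro: order.strict_trans)
			ultimately show ?thesis by auto
		qed
		also have "... \<in> sets H" using * by (intro sets.countable_UN) auto
		finally show ?thesis .
	qed
qed

lemma pastM_sub: "raw_time T ==> f \<in> pastM T \<rightarrow>\<^sub>M N ==> f \<in> H \<rightarrow>\<^sub>M N"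
	by (auto simp: measurable_def sets_pastM past_def)

lemma raw_time_const: "0 <= c ==> raw_time (%_. ennreal c)"
	unfolding raw_time_def
proof (intro allI impI)
	fix t :: real assume "0 < t"
	show "{w \<in> paths X. ennreal c < ennreal t} \<in> hist t"
		using sets.top[of "history X {0..t}"] by (cases "ennreal c < ennreal t") auto
qed

lemma raw_time_min_measurable:
	assumes T: "raw_time T" and s: "0 <= s"
	shows "(%w. min (T w) (ennreal s)) \<in> borel_measurable (history X {0..s})"
proof (rule borel_measurableI_less)
	fix y :: ennreal
	show "{w \<in> space (history X {0..s}). min (T w) (ennreal s) < y} \<in> sets (history X {0..s})"
	proof (cases "ennreal s < y")
		case True
		hence "{w \<in> space (history X {0..s}). min (T w) (ennreal s) < y} = space (history X {0..s})"
			by (auto simp: min_less_iff_disj)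
		thus ?thesis using sets.top[of "history X {0..s}"] by simp
	next
		case False
		then obtain r where r: "y = ennreal r" "0 <= r" "r <= s"
			using s by (cases y) (auto simp: ennreal_less_iff not_less)
		have eq: "{w \<in> space (history X {0..s}). min (T w) (ennreal s) < y} = {w \<in> paths X. T w < ennreal r}"
			using False r by (auto simp: min_less_iff_disj)
		show ?thesis
			using T r history_mono[of "{0..r}" "{0..s}" X] unfolding eq
			by (cases "r = 0") (auto simp: raw_time_def)
	qed
qed

lemma raw_time_add_const:
	assumes T: "raw_time T" and c: "0 <= c"
	shows "raw_time (%w. T w + ennreal c)"
	unfolding raw_time_def
proof (intro allI impI)
	fix t :: real assume t: "0 < t"
	have eq: "{w \<in> paths X. T w + ennreal c < ennreal t}
		 = (if c < t then {w \<in> paths X. T w < ennreal (t - c)} else {})"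
	proof (cases "c < t")
		case True
		have "T w + ennreal c < ennreal t \<longleftrightarrow> T w < ennreal (t - c)" for w
			using True c by (cases "T w") (auto simp: ennreal_less_iff ennreal_plus[symmetric] simp del: ennreal_plus)
		thus ?thesis using True by simp
	next
		case False
		have "\<not> T w + ennreal c < ennreal t" for w
			using False c t by (cases "T w") (auto simp: ennreal_less_iff ennreal_plus[symmetric] simp del: ennreal_plus)
		thus ?thesis using False by simp
	qed
	show "{w \<in> paths X. T w + ennreal c < ennreal t} \<in> hist t"
		unfolding eq using T c history_mono[of "{0..t-c}" "{0..t}" X]
		by (auto simp: raw_time_def subset_iff)
qed

text \<open>Where \<open>T + c < t\<close>, the value of \<open>Y\<close> at \<open>T + c\<close> is
  its value at a random time measurable for the history up to \<open>t\<close>, and joint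
  measurability up to \<open>t\<close> composes. The delay \<open>c\<close> serves the induction
  over several time points in \<open>strong_markov_cyl\<close>.\<close>

lemma past_progressive:
	assumes Y: "!!t. 0 <= t ==> (%(u, w). Y (max 0 (min u t)) w) \<in> borel \<Otimes>\<^sub>M history X {0..t} \<rightarrow>\<^sub>M N"
		and B: "B \<in> sets N" and T: "raw_time T" and A: "A \<in> past T" and c: "0 <= c"
	shows "{w \<in> A. T w < \<infinity> & Y (enn2real (T w) + c) w \<in> B} \<in> past (%w. T w + ennreal c)"
		(is "?S \<in> _")
proof -
	have *: "{w \<in> ?S. T w + ennreal c < ennreal t} \<in> hist t" if t: "0 < t" for t
	proof (cases "c < t")
		case False
		have "\<not> T w + ennreal c < ennreal t" for w
			using False c t by (cases "T w") (auto simp: ennreal_less_iff ennreal_plus[symmetric] simp del: ennreal_plus)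
		thus ?thesis by simp
	next
		case True
		have iff: "T w + ennreal c < ennreal t \<longleftrightarrow> T w < ennreal (t - c)" for w
			using True c by (cases "T w") (auto simp: ennreal_less_iff ennreal_plus[symmetric] simp del: ennreal_plus)
		\<comment> \<open>Capping \<open>T\<close> at \<open>t - c\<close> keeps the time finite and
		  determined by the history up to \<open>t\<close>.\<close>
		let ?R = "%w. enn2real (min (T w) (ennreal (t - c))) + c"
		have [measurable]: "(%w. min (T w) (ennreal (t - c))) \<in> borel_measurable (history X {0..t})"
			using raw_time_min_measurable[OF T, of "t - c"] True c
			by (auto intro: measurable_history_mono)
		have "(%w. (?R w, w)) \<in> history X {0..t} \<rightarrow>\<^sub>M borel \<Otimes>\<^sub>M history X {0..t}"
			by measurable
		from measurable_compose[OF this Y[of t]] t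
		have Z: "(%w. Y (max 0 (min (?R w) t)) w) \<in> history X {0..t} \<rightarrow>\<^sub>M N" by simp
		have "{w \<in> ?S. T w + ennreal c < ennreal t} =
			{w \<in> A. T w < ennreal (t - c)} \<inter> ((%w. Y (max 0 (min (?R w) t)) w) -` B \<inter> space (history X {0..t}))"
			(is "?L = ?Q")
		proof -
			have "max 0 (min (?R w) t) = enn2real (T w) + c" if "T w < ennreal (t - c)" for w
			proof -
				have "min (T w) (ennreal (t - c)) = T w" using that by (intro min_absorb1) simp
				moreover have "enn2real (T w) < t - c"
					using that by (cases "T w") (auto simp: ennreal_less_iff)
				ultimately show ?thesis using c by auto
			qed
			thus ?thesis using past_subset[OF A] iff
				by (auto intro: order.strict_trans)
		qed
		also have "... \<in> hist t"
		proof (rule sets.Int)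
			have "{w \<in> A. T w < ennreal (t - c)} \<in> sets (history X {0..t - c})"
				using A True by (auto simp: past_def)
			thus "{w \<in> A. T w < ennreal (t - c)} \<in> hist t"
				using history_mono[of "{0..t-c}" "{0..t}" X] c by auto
		qed (rule measurable_sets[OF Z B])
		finally show ?thesis .
	qed
	have "?S = (\<Union>n. {w \<in> ?S. T w + ennreal c < ennreal (real (Suc n))})"
	proof -
		have "\<exists>n. T w + ennreal c < ennreal (real (Suc n))" if "T w < \<infinity>" for w
		proof -
			have "T w + ennreal c < \<infinity>" using that by (simp add: less_top[symmetric])
			from ennreal_Ex_less_of_nat[OF this[unfolded infinity_ennreal_def]]
			obtain n where "T w + ennreal c < of_nat n" ..
			also have "of_nat n <= ennreal (real (Suc n))"
				by (simp add: ennreal_of_nat_eq_real_of_nat)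
			finally show ?thesis ..
		qed
		thus ?thesis by blast
	qed
	also have "... \<in> sets H"
		using *[of "real (Suc _)"] history_mono[of "{0..real (Suc _)}" "{0..}" X]
		by (intro sets.countable_UN) (auto simp del: of_nat_Suc)
	finally show ?thesis using * by (auto simp: past_def)
qed

lemma sets_bind_init_laws: "\<mu> \<in> init_laws ==> sets (\<mu> \<bind> P) = sets H"
	by (rule sets_bind) (auto simp: init_laws_def space_prob_algebra dest!: sets_eq_imp_space_eq)

lemma history_events:
	assumes "A \<in> sets H"
	shows "A \<in> events X"
	unfolding events_def law_from_def
	using assms sets_bind_init_laws by (auto intro: sets_completionI_sets)

lemma history_events_upto:
	assumes "A \<in> hist t"
	shows "A \<in> events_upto X t"
	unfolding events_upto_def
proof (intro CollectI conjI ballI)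
	show "A \<in> events X" using assms history_mono[of "{0..t}" "{0..}" X] by (auto intro: history_events)
	show "\<exists>B\<in>hist t. A - B \<union> (B - A) \<in> null_sets (law_from X \<mu>)" for \<mu>
		using assms by (intro bexI[of _ A]) auto
qed

lemma events_upto_right:
	assumes "0 <= t" "!!s. t < s ==> A \<in> sets (history X {0..s})"
	shows "A \<in> events_upto X t"
proof -
	have "A \<in> (\<Inter>s\<in>{t<..}. events_upto X s)" using assms(2) history_events_upto by blast
	moreover have "(\<Inter>s\<in>{t<..}. events_upto X s) = events_upto X t"
		using hunt assms(1) unfolding hunt_process_def right_continuous_filtration_def by blast
	ultimately show ?thesis by (simp only:)
qed

text \<open>The event \<open>T \<le> t\<close> is the intersection of strict events
  \<open>T < t'\<close> for \<open>t'\<close> decreasing to \<open>t\<close>, all of them known by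
  time \<open>s\<close>.\<close>

lemma past_le_history:
	assumes A: "A \<in> past T" and t: "0 <= t" and s: "t < s"
	shows "{w \<in> A. T w <= ennreal t} \<in> sets (history X {0..s})"
proof -
	have "{w \<in> A. T w <= ennreal t} = (\<Inter>n. {w \<in> A. T w < ennreal (t + (s - t) / real (Suc n))})"
	proof (intro equalityI subsetI)
		fix w assume w: "w \<in> {w \<in> A. T w <= ennreal t}"
		have "ennreal t < ennreal (t + (s - t) / real (Suc n))" for n
			using s t by (intro ennreal_lessI) (auto simp del: of_nat_Suc intro!: add_nonneg_pos)
		thus "w \<in> (\<Inter>n. {w \<in> A. T w < ennreal (t + (s - t) / real (Suc n))})"
			using w by (auto intro: le_less_trans)
	next
		fix w assume w: "w \<in> (\<Inter>n. {w \<in> A. T w < ennreal (t + (s - t) / real (Suc n))})"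
		have "(%n. ennreal (t + (s - t) / real (Suc n))) \<longlonglongrightarrow> ennreal (t + 0)"
			by (intro tendsto_ennrealI tendsto_add tendsto_const LIMSEQ_Suc[OF lim_const_over_n])
		hence "T w <= ennreal (t + 0)"
			by (rule tendsto_lowerbound)
				(use w in "auto intro!: always_eventually intro: less_imp_le simp del: of_nat_Suc")
		thus "w \<in> {w \<in> A. T w <= ennreal t}" using w by auto
	qed
	also have "... \<in> sets (history X {0..s})"
	proof (rule sets.countable_INT)
		show "range (%n. {w \<in> A. T w < ennreal (t + (s - t) / real (Suc n))}) \<subseteq> sets (history X {0..s})"
		proof clarify
			fix n
			let ?r = "t + (s - t) / real (Suc n)"
			have "(s - t) / real (Suc n) <= (s - t) / 1"
				using s by (intro divide_left_mono) auto
			hence r: "0 < ?r" "?r <= s"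
				using s t by (auto simp del: of_nat_Suc intro!: add_nonneg_pos)
			have "{w \<in> A. T w < ennreal ?r} \<in> sets (history X {0..?r})"
				using A r by (auto simp: past_def)
			thus "{w \<in> A. T w < ennreal ?r} \<in> sets (history X {0..s})"
				using history_mono[of "{0..?r}" "{0..s}" X] r by auto
		qed
	qed simp
	finally show ?thesis .
qed

lemma past_le_events:
	assumes "A \<in> past T" "0 <= t"
	shows "{w \<in> A. T w <= ennreal t} \<in> events_upto X t"
	by (rule events_upto_right[OF assms(2) past_le_history[OF assms]])

lemma raw_time_paths_past: "raw_time T ==> paths X \<in> past T"
	using sets.top[of H] by (auto simp: past_def raw_time_def)

lemma raw_time_optional: "raw_time T ==> optional_time X T"
	unfolding optional_time_def using past_le_events[OF raw_time_paths_past] by auto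

lemma past_events_before: "A \<in> past T ==> A \<in> events_before X T"
	unfolding events_before_def using past_le_events history_events by (auto simp: past_def)

lemma return_init_laws: "return state_alg x \<in> init_laws"
	by (auto simp: init_laws_def space_prob_algebra intro!: prob_space_return)

lemma law_from_return: "law_from X (return state_alg x) = completion (P x)"
	unfolding law_from_def by (subst bind_return[OF P_kernel_subprob]) auto

lemma strong_markov_set:
	assumes T: "raw_time T" and A: "A \<in> past T" and t: "0 <= t" and B: "B \<in> sets state_alg"
	shows "emeasure (P x) {w \<in> A. T w < \<infinity> & pos X (enn2real (T w) + t) w \<in> B} =
		(EE x (%w. indicator (fin_on T A) w *
			 emeasure (P (pos_at X T w)) {w' \<in> paths X. pos X t w' \<in> B}))"
proof -
	let ?S = "{w \<in> A. T w < \<infinity> & pos X (enn2real (T w) + t) w \<in> B}"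
	have "?S \<in> past (%w. T w + ennreal t)"
		by (rule past_progressive[where Y = "pos X" and N = state_alg]) (use assms measurable_pos_joint_upto in auto)
	hence S: "?S \<in> sets (P x)" by (auto simp: past_def)
	have "emeasure (law_from X (return state_alg x)) ?S =
		(\<integral>\<^sup>+w\<in>fin_on T A. emeasure (P (pos_at X T w)) {w' \<in> paths X. pos X t w' \<in> B}
			\<partial>law_from X (return state_alg x))"
		using hunt raw_time_optional[OF T] past_events_before[OF A] t B return_init_laws[of x]
		unfolding hunt_process_def strong_markov_def by blast
	thus ?thesis
		using S by (simp add: law_from_return nn_integral_completion emeasure_completion main_part_sets mult.commute)
qed

lemma past_finite:
	assumes T: "raw_time T" and A: "A \<in> past T"
	shows "fin_on T A \<in> sets H"
proof -
	have [measurable]: "T \<in> hmeas" "A \<in> sets H"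
		using assms raw_time_measurable by (auto simp: past_def)
	have "fin_on T A = A \<inter> {w \<in> space H. T w < \<infinity>}" using past_subset[OF A] by auto
	also have "... \<in> sets H" by measurable
	finally show ?thesis .
qed

text \<open>\<open>kernel_transfer\<close> with the law of the position at the fixed time
  \<open>t\<close> as kernel.\<close>

lemma strong_markov_fun:
	assumes T: "raw_time T" and A: "A \<in> past T" and t: "0 <= t" and f: "f \<in> smeas"
	shows "(EE x (%w. indicator (fin_on T A) w * f (pos X (enn2real (T w) + t) w))) =
		(EE x (%w. indicator (fin_on T A) w * (EE (pos_at X T w) (%w'. f (pos X t w')))))"
proof -
	note Tm[measurable] = raw_time_measurable[OF T]
	let ?k = "%z. distr (P z) state_alg (pos X t)"
	have pt: "pos X t \<in> H \<rightarrow>\<^sub>M state_alg" using t by (intro measurable_pos) auto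
	hence pt': "pos X t \<in> P z \<rightarrow>\<^sub>M state_alg" for z by (simp add: measurable_P_iff)
	have k: "?k \<in> state_alg \<rightarrow>\<^sub>M subprob_algebra state_alg"
		using measurable_compose[OF P_kernel_subprob measurable_distr[OF pt]] .
	have "(EE x (%w. indicator (fin_on T A) w * f (pos X (enn2real (T w) + t) w))) =
		(EE x (%w. indicator (fin_on T A) w * (nn_integral (?k (pos_at X T w)) (%y. f y))))"
	proof (rule kernel_transfer[where K = state_alg and N = state_alg and G = "sets state_alg"])
		show "finite_measure (P x)" by (rule P.finite_measure_axioms)
		show "space (P x) ~= {}" by (rule P.not_empty)
		show "fin_on T A \<in> sets (P x)" using past_finite[OF T A] by simp
		show "pos_at X T \<in> P x \<rightarrow>\<^sub>M state_alg" using measurable_pos_at[OF Tm] by (simp add: measurable_P_iff)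
		show "?k \<in> state_alg \<rightarrow>\<^sub>M subprob_algebra state_alg" by (rule k)
		have "(%w. pos X (enn2real (T w) + t) w) \<in> H \<rightarrow>\<^sub>M state_alg"
			using t by (intro measurable_pos_random) auto
		thus "(%w. pos X (enn2real (T w) + t) w) \<in> P x \<rightarrow>\<^sub>M state_alg"
			by (simp add: measurable_P_iff)
		show "Int_stable (sets state_alg)" by (rule sets.Int_stable)
		show "sets (state_alg :: 'a option measure) = sigma_sets (space state_alg) (sets state_alg)"
			by (simp only: sets.sigma_sets_eq)
		fix E :: "'a option set" assume E: "E \<in> sets state_alg"
		have "emeasure (?k z) E = emeasure (P z) {w' \<in> paths X. pos X t w' \<in> E}" for z
			using pt' E by (subst emeasure_distr) (auto intro!: arg_cong[where f = "emeasure _"])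
		thus "emeasure (P x) {w \<in> fin_on T A. pos X (enn2real (T w) + t) w \<in> E} =
			(EE x (%w. indicator (fin_on T A) w * emeasure (?k (pos_at X T w)) E))"
			using strong_markov_set[OF T A t E, of x] by (simp add: conj_assoc)
	qed (use f sets.top[of "state_alg :: 'a option measure"] in "auto dest: sets.sets_into_space")
	moreover have "(nn_integral (?k z) (%y. f y)) = (EE z (%w'. f (pos X t w')))" for z
		using pt' f by (subst nn_integral_distr) auto
	ultimately show ?thesis by simp
qed

definition cyl :: "real set => (real => 'a option set) => 'w set" where
	"cyl F B = {w \<in> paths X. \<forall>t\<in>F. pos X t w \<in> B t}"

lemma sets_cyl:
	assumes "finite F" "F \<subseteq> {0..}" "!!t. B t \<in> sets state_alg"
	shows "cyl F B \<in> sets H"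
proof -
	have "cyl F B = (if F = {} then paths X else (\<Inter>t\<in>F. pos X t -` B t \<inter> space H))"
		by (auto simp: cyl_def)
	also have "... \<in> sets H"
	proof (cases "F = {}")
		case True
		thus ?thesis using sets.top[of H] by simp
	next
		case False
		have "(\<Inter>t\<in>F. pos X t -` B t \<inter> space H) \<in> sets H"
			by (rule sets.finite_INT[OF assms(1) False])
				(use assms in "auto simp del: space_history intro!: measurable_sets[OF measurable_pos]")
		thus ?thesis using False by simp
	qed
	finally show ?thesis .
qed

text \<open>Induction on the number of time points: the earliest time \<open>t0\<close> and its
  condition are absorbed into the random time \<open>T + t0\<close> and an event of its past, the
  induction hypothesis handles the remaining times relative to \<open>t0\<close>, and the
  single-time property leads back from \<open>T + t0\<close> to \<open>T\<close>.\<close>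

lemma strong_markov_cyl:
	assumes "card F = n" "finite F" "F \<subseteq> {0..}" "!!t. B t \<in> sets state_alg" "raw_time T" "A \<in> past T"
	shows "emeasure (P x) {w \<in> A. T w < \<infinity> & (\<forall>t\<in>F. pos X (enn2real (T w) + t) w \<in> B t)} =
		(EE x (%w. indicator (fin_on T A) w * emeasure (P (pos_at X T w)) (cyl F B)))"
	using assms
proof (induction n arbitrary: F B T A x)
	case 0
	hence F: "F = {}" by simp
	have "emeasure (P z) (cyl F B) = 1" for z
		using P.emeasure_space_1[of z] by (simp add: cyl_def F)
	thus ?case using past_finite[OF 0(5,6)] by (simp add: F nn_integral_indicator)
next
	case (Suc n)
	define t0 where "t0 = Min F"
	have ne: "F ~= {}" using Suc.prems by auto
	have t0: "t0 \<in> F" "0 <= t0" "!!t. t \<in> F ==> t0 <= t"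
		using Suc.prems ne by (auto simp: t0_def subset_iff)
	define F' where "F' = (%t. t - t0) ` (F - {t0})"
	define B' where "B' t = B (t + t0)" for t
	have cF': "card F' = n" "finite F'" "F' \<subseteq> {0..}"
		using Suc.prems t0 by (auto simp: F'_def card_image inj_on_def)
	have B': "B' t \<in> sets state_alg" for t using Suc.prems by (simp add: B'_def)
	have split: "(\<forall>t\<in>F. pos X (s + t) w \<in> B t) \<longleftrightarrow>
			pos X (s + t0) w \<in> B t0 & (\<forall>t\<in>F'. pos X (s + t0 + t) w \<in> B' t)" for s w
	proof -
		have "(\<forall>t\<in>F'. pos X (s + t0 + t) w \<in> B' t) \<longleftrightarrow> (\<forall>t\<in>F - {t0}. pos X (s + t) w \<in> B t)"
			by (auto simp: F'_def B'_def algebra_simps)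
		thus ?thesis using t0(1) by auto
	qed
	define Q where "Q z = emeasure (P z) (cyl F' B')" for z
	have Q: "Q \<in> smeas"
		unfolding Q_def by (rule measurable_emeasure_kernel[OF P_kernel_subprob]) (rule sets_cyl[OF cF'(2,3) B'])
	define f where "f z = indicator (B t0) z * Q z" for z
	have f: "f \<in> smeas"
		unfolding f_def using Q Suc.prems(4) by measurable
	have step: "emeasure (P x) {w \<in> A. T w < \<infinity> & (\<forall>t\<in>F. pos X (enn2real (T w) + t) w \<in> B t)} =
		 (EE x (%w. indicator (fin_on T A) w * (EE (pos_at X T w) (%w'. f (pos X t0 w')))))"
		if T: "raw_time T" and A: "A \<in> past T" for A T x
	proof -
		define T' where "T' w = T w + ennreal t0" for w
		define A' where "A' = {w \<in> A. T w < \<infinity> & pos X (enn2real (T w) + t0) w \<in> B t0}"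
		have T': "raw_time T'" unfolding T'_def by (rule raw_time_add_const[OF T t0(2)])
		have A': "A' \<in> past T'" unfolding A'_def T'_def
			by (rule past_progressive[where Y = "pos X", OF measurable_pos_joint_upto Suc.prems(4) T A t0(2)])
		have fin: "T' w < \<infinity> \<longleftrightarrow> T w < \<infinity>" for w by (simp add: T'_def less_top[symmetric])
		have real: "enn2real (T' w) = enn2real (T w) + t0" if "T w < \<infinity>" for w
			using that t0(2) by (simp add: T'_def enn2real_plus)
		have "{w \<in> A. T w < \<infinity> & (\<forall>t\<in>F. pos X (enn2real (T w) + t) w \<in> B t)} =
			{w \<in> A'. T' w < \<infinity> & (\<forall>t\<in>F'. pos X (enn2real (T' w) + t) w \<in> B' t)}"
			unfolding fin by (auto simp: A'_def real split)
		hence "emeasure (P x) {w \<in> A. T w < \<infinity> & (\<forall>t\<in>F. pos X (enn2real (T w) + t) w \<in> B t)} =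
			(EE x (%w. indicator {w \<in> A'. T' w < \<infinity>} w * Q (pos_at X T' w)))"
			unfolding Q_def using Suc.IH[OF cF' B' T' A', of x] by simp
		also have "... = (EE x (%w. indicator (fin_on T A) w * f (pos X (enn2real (T w) + t0) w)))"
		proof (intro nn_integral_cong)
			fix w
			show "indicator {w \<in> A'. T' w < \<infinity>} w * Q (pos_at X T' w) =
				indicator (fin_on T A) w * f (pos X (enn2real (T w) + t0) w)"
				using fin[of w] real[of w]
				by (cases "T w < \<infinity>") (auto simp: A'_def f_def pos_at_def indicator_def)
		qed
		also have "... = (EE x (%w. indicator (fin_on T A) w * (EE (pos_at X T w) (%w'. f (pos X t0 w')))))"
			by (rule strong_markov_fun[OF T A t0(2) f])
		finally show ?thesis .
	qed
	\<comment> \<open>\<open>step\<close> at \<open>T = 0\<close> identifies the inner expectation with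
	  the probability of the whole cylinder.\<close>
	have "(EE z (%w'. f (pos X t0 w'))) = emeasure (P z) (cyl F B)" for z
	proof -
		have c0: "raw_time (%_. 0)" using raw_time_const[of 0] by simp
		have "cyl F B = {w \<in> paths X. (0::ennreal) < \<infinity> & (\<forall>t\<in>F. pos X (enn2real 0 + t) w \<in> B t)}"
			by (simp add: cyl_def)
		hence "emeasure (P z) (cyl F B) = (EE z (%w. indicator {w \<in> paths X. (0::ennreal) < \<infinity>} w *
				(EE (pos_at X (%_. 0) w) (%w'. f (pos X t0 w')))))"
			using step[OF c0 raw_time_paths_past[OF c0], of z] by (simp only:)
		also have "... = (EE z (%w. (EE (pos X 0 w) (%w'. f (pos X t0 w')))))"
			by (intro nn_integral_cong) (auto simp: pos_at_def)
		also have "... = (EE z (%w. (EE z (%w'. f (pos X t0 w')))))"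
			by (rule nn_integral_cong_AE) (use AE_start[of z] in "eventually_elim, simp")
		also have "... = (EE z (%w'. f (pos X t0 w')))"
			using P.emeasure_space_1[of z] by simp
		finally show ?thesis ..
	qed
	thus ?case using step[OF Suc.prems(5,6), of x] by simp
qed

lemma H_generated: "sets H = sigma_sets (paths X) {cyl F B | F B. finite F & F \<subseteq> {0..} & (\<forall>t. B t \<in> sets state_alg)}"
	(is "_ = sigma_sets _ ?G")
	unfolding sets_history
proof (rule sigma_sets_eqI)
	fix A assume "A \<in> {pos X s -` B \<inter> paths X | s B. s \<in> {0..} & B \<in> sets state_alg}"
	then obtain s B where "A = pos X s -` B \<inter> paths X" "s \<in> {0..}" "B \<in> sets state_alg" by blast
	hence "A = cyl {s} (%_. B)" "finite {s}" "{s} \<subseteq> {0..}" "\<forall>t. (%_. B) t \<in> sets state_alg"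
		by (auto simp: cyl_def)
	hence "A \<in> ?G" by blast
	thus "A \<in> sigma_sets (paths X) ?G" by (rule sigma_sets.Basic)
next
	fix A assume "A \<in> ?G"
	thus "A \<in> sigma_sets (paths X) {pos X s -` B \<inter> paths X | s B. s \<in> {0..} & B \<in> sets state_alg}"
		using sets_cyl unfolding sets_history by blast
qed

lemma Int_stable_cyl: "Int_stable {cyl F B | F B. finite F & F \<subseteq> {0..} & (\<forall>t. B t \<in> sets state_alg)}"
proof (rule Int_stableI)
	fix A A' assume "A \<in> {cyl F B | F B. finite F & F \<subseteq> {0..} & (\<forall>t. B t \<in> sets state_alg)}"
		"A' \<in> {cyl F B | F B. finite F & F \<subseteq> {0..} & (\<forall>t. B t \<in> sets state_alg)}"
	then obtain F B F' B' where
		*: "A = cyl F B" "finite F" "F \<subseteq> {0..}" "!!t. B t \<in> sets state_alg"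
			"A' = cyl F' B'" "finite F'" "F' \<subseteq> {0..}" "!!t. B' t \<in> sets state_alg"
		by blast
	let ?B = "%t. (if t \<in> F then B t else UNIV) \<inter> (if t \<in> F' then B' t else UNIV)"
	have "A \<inter> A' = cyl (F \<union> F') ?B" by (auto simp: cyl_def * split: if_splits)
	moreover have "?B t \<in> sets state_alg" for t
		using * sets.top[of state_alg] by (intro sets.Int) (auto simp del: sets.top)
	ultimately show "A \<inter> A' \<in> {cyl F B | F B. finite F & F \<subseteq> {0..} & (\<forall>t. B t \<in> sets state_alg)}"
		using * by blast
qed

lemma shift_at_measurable:
	assumes [measurable]: "T \<in> hmeas"
	shows "(%w. shift X (enn2real (T w)) w) \<in> H \<rightarrow>\<^sub>M H"
	by (rule measurable_shift_random) auto

lemma strong_markov_indicator: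
	assumes T: "raw_time T" and A: "A \<in> past T" and h: "h \<in> hmeas"
	shows "(EE x (%w. indicator (fin_on T A) w * h (shift X (enn2real (T w)) w))) =
		(EE x (%w. indicator (fin_on T A) w * (EE (pos_at X T w) (%w'. h w'))))"
proof (rule kernel_transfer[where K = state_alg and N = H and
		G = "{cyl F B | F B. finite F & F \<subseteq> {0..} & (\<forall>t. B t \<in> sets state_alg)}"])
	show "finite_measure (P x)" by (rule P.finite_measure_axioms)
	show "space (P x) ~= {}" by (rule P.not_empty)
	show "fin_on T A \<in> sets (P x)" using past_finite[OF T A] by simp
	show "pos_at X T \<in> P x \<rightarrow>\<^sub>M state_alg"
		using measurable_pos_at[OF raw_time_measurable[OF T]] by (simp add: measurable_P_iff)
	show "P \<in> state_alg \<rightarrow>\<^sub>M subprob_algebra H" by (rule P_kernel_subprob)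
	show "(%w. shift X (enn2real (T w)) w) \<in> P x \<rightarrow>\<^sub>M H"
		using shift_at_measurable[OF raw_time_measurable[OF T]] by (simp add: measurable_P_iff)
	have "space H = cyl {} (%_. {})" by (simp add: cyl_def)
	thus "space H \<in> {cyl F B | F B. finite F & F \<subseteq> {0..} & (\<forall>t. B t \<in> sets state_alg)}"
		by (intro CollectI exI[of _ "{}"] exI[of _ "%_. {}"]) auto
	fix E assume "E \<in> {cyl F B | F B. finite F & F \<subseteq> {0..} & (\<forall>t. B t \<in> sets state_alg)}"
	then obtain F B where E: "E = cyl F B" "finite F" "F \<subseteq> {0..}" "!!t. B t \<in> sets state_alg" by blast
	have "{w \<in> fin_on T A. shift X (enn2real (T w)) w \<in> E} =
		{w \<in> A. T w < \<infinity> & (\<forall>t\<in>F. pos X (enn2real (T w) + t) w \<in> B t)}"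
		using past_subset[OF A] E(3) by (auto simp: E(1) cyl_def shift_paths pos_shift subset_iff add.commute)
	thus "emeasure (P x) {w \<in> fin_on T A. shift X (enn2real (T w)) w \<in> E} =
		(EE x (%w. indicator (fin_on T A) w * emeasure (P (pos_at X T w)) E))"
		using strong_markov_cyl[OF refl E(2,3,4) T A, of x] by (simp add: E(1))
qed (use h Int_stable_cyl H_generated in "auto simp: cyl_def")

text \<open>The weight \<open>q\<close> known at \<open>T\<close> is what later carries the survival
  probability up to \<open>T\<close>; it is built up from events of the past.\<close>

lemma strong_markov:
	assumes T: "raw_time T" and q: "q \<in> borel_measurable (pastM T)" and h: "h \<in> hmeas"
	shows "(EE x (%w. q w * indicator {w. T w < \<infinity>} w * h (shift X (enn2real (T w)) w))) =
		(EE x (%w. q w * indicator {w. T w < \<infinity>} w * (EE (pos_at X T w) (%w'. h w'))))"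
proof -
	note Tm[measurable] = raw_time_measurable[OF T]
	define L where "L w = indicator {w. T w < \<infinity>} w * h (shift X (enn2real (T w)) w)" for w
	define R where "R w = indicator {w. T w < \<infinity>} w * (EE (pos_at X T w) (%w'. h w'))" for w
	have [measurable]: "L \<in> borel_measurable (P x)" "R \<in> borel_measurable (P x)"
	proof -
		have [measurable]: "(%w. h (shift X (enn2real (T w)) w)) \<in> hmeas"
			by (rule measurable_compose[OF shift_at_measurable[OF Tm] h])
		have [measurable]: "(%w. \<integral>\<^sup>+w'. h w' \<partial>P (pos_at X T w)) \<in> hmeas"
			by (rule measurable_compose[OF measurable_pos_at[OF Tm] measurable_nn_integral_P[OF h]])
		show "L \<in> borel_measurable (P x)" "R \<in> borel_measurable (P x)"
			unfolding measurable_P_iff L_def R_def by measurable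
	qed
	have wH: "f \<in> borel_measurable (P x)" if "f \<in> borel_measurable (pastM T)" for f :: "'w => ennreal"
		using pastM_sub[OF T that] by (simp add: measurable_P_iff)
	have "(EE x (%w. q w * L w)) = (EE x (%w. q w * R w))"
		using q
	proof (induction q rule: borel_measurable_induct)
		case (cong f g)
		hence "(EE x (%w. f w * L w)) = (EE x (%w. g w * L w))"
			"(EE x (%w. f w * R w)) = (EE x (%w. g w * R w))"
			by (intro nn_integral_cong; simp)+
		thus ?case using cong by simp
	next
		case (set A)
		hence A: "A \<in> past T" using sets_pastM[OF T] by simp
		have eq: "indicator A w * (indicator {w. T w < \<infinity>} w * y) = indicator (fin_on T A) w * y"
			for w and y :: ennreal by (auto simp: indicator_def)
		show ?case unfolding L_def R_def eq by (rule strong_markov_indicator[OF T A h])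
	next
		case (mult u c)
		have [measurable]: "u \<in> borel_measurable (P x)" by (rule wH, fact)
		show ?case by (simp add: mult.assoc nn_integral_cmult mult.IH)
	next
		case (add u v)
		have [measurable]: "u \<in> borel_measurable (P x)" "v \<in> borel_measurable (P x)"
			by (rule wH, fact)+
		show ?case by (simp add: distrib_right nn_integral_add add.IH)
	next
		case (seq U)
		note [measurable] = wH[OF seq(1)]
		have "incseq (%i w. U i w * L w)" "incseq (%i w. U i w * R w)"
			using \<open>incseq U\<close> by (auto simp: incseq_def le_fun_def intro!: mult_right_mono)
		hence "(EE x (%w. (SUP i. U i w * L w))) = (SUP i. \<integral>\<^sup>+w. U i w * L w \<partial>P x)"
			"(EE x (%w. (SUP i. U i w * R w))) = (SUP i. \<integral>\<^sup>+w. U i w * R w \<partial>P x)"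
			by (intro nn_integral_monotone_convergence_SUP; simp)+
		moreover have "(SUP i. U i) w * y = (SUP i. U i w * y)" for w and y :: ennreal
			by (simp add: SUP_apply SUP_mult_right_ennreal image_comp)
		ultimately show ?case using seq.IH by simp
	qed
	thus ?thesis by (simp add: L_def R_def mult.assoc)
qed

end

section \<open>Exponentials of integrals of bounded functions\<close>

lemma exp_diff_bounds: "exp a * d <= exp (a + d) - exp a" "exp (a + d) - exp a <= exp (a + d) * d" for a d :: real
proof -
	have "exp a * (1 + d) <= exp a * exp d" "exp (a + d) * (1 + - d) <= exp (a + d) * exp (- d)"
		by (intro mult_left_mono exp_ge_add_one_self; simp)+
	thus "exp a * d <= exp (a + d) - exp a" "exp (a + d) - exp a <= exp (a + d) * d"
		by (simp_all add: exp_add[symmetric] algebra_simps)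
qed

text \<open>A killing rate along a path is only measurable, so its integral need not be
  differentiable. A quadratic bound on increments takes the place of computing a derivative.\<close>

lemma zero_derivative_of_quadratic_bound:
	fixes G :: "real => real"
	assumes "!!u v. a <= u ==> u <= v ==> v <= b ==> \<bar>G v - G u\<bar> <= K * (v - u)^2"
		and "a <= t" "t <= b"
	shows "G t = G a"
proof -
	have q: "\<bar>G v - G u\<bar> <= K * \<bar>v - u\<bar>^2" if "u \<in> {a..b}" "v \<in> {a..b}" for u v
	proof (cases "u <= v")
		case True
		thus ?thesis using assms(1)[of u v] that by simp
	next
		case False
		thus ?thesis using assms(1)[of v u] that by (simp add: abs_minus_commute power2_commute)
	qed
	have "(G has_field_derivative 0) (at x within {a..b})" if x: "x \<in> {a..b}" for x
		unfolding has_field_derivative_iff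
	proof (rule Lim_null_comparison)
		show "eventually (%y. norm ((G y - G x) / (y - x)) <= K * \<bar>y - x\<bar>) (at x within {a..b})"
			unfolding eventually_at_filter
		proof (intro always_eventually allI impI)
			fix y assume y: "y ~= x" "y \<in> {a..b}"
			thus "norm ((G y - G x) / (y - x)) <= K * \<bar>y - x\<bar>"
				using q[OF x y(2)] by (simp add: abs_divide divide_le_eq power2_eq_square mult.assoc)
		qed
		show "((%y. K * \<bar>y - x\<bar>) \<longlongrightarrow> 0) (at x within {a..b})"
			by (auto intro!: tendsto_eq_intros)
	qed
	then obtain c where "\<forall>x\<in>{a..b}. G x = c"
		using has_field_derivative_zero_constant[OF convex_closed_interval, of a b G] by blast
	thus ?thesis using assms by auto
qed

locale bounded_rate =
	fixes b :: "real => real" and c :: real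
	assumes meas [measurable]: "b \<in> bmeas" and nonneg: "!!s. 0 <= b s" and le: "!!s. b s <= c"
begin

lemma bound: "\<bar>b s\<bar> <= c" using nonneg[of s] le[of s] by simp

definition I :: "real => real" where
	"I t = (LINT s|lborel. indicator {0..t} s * b s)"

lemma c_nonneg: "0 <= c" using bound[of 0] by linarith

lemma integrable_indicator_Icc: "integrable lborel (indicator {u..v::real} :: real => real)"
	by (rule integrable_real_indicator) (simp, cases "u <= v", auto)

lemma integrable_bounded_on:
	fixes f :: "real => real"
	assumes [measurable]: "f \<in> bmeas" and "!!s. s \<in> {u..v} ==> \<bar>f s\<bar> <= K"
	shows "integrable lborel (%s. indicator {u..v} s * f s :: real)"
proof (rule Bochner_Integration.integrable_bound[where f = "%s. K * indicator {u..v} s :: real"])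
	show "integrable lborel (%s. K * indicator {u..v} s :: real)"
		using integrable_indicator_Icc[of u v] by simp
	show "AE x in lborel. norm (indicator {u..v} x * f x) <= norm (K * indicator {u..v} x)"
		using assms(2) by (intro AE_I2) (force simp: indicator_def)
qed measurable

lemma integral_bound_on:
	fixes f :: "real => real"
	assumes [measurable]: "f \<in> bmeas" and "!!s. s \<in> {u..v} ==> \<bar>f s\<bar> <= K" "u <= v"
	shows "\<bar>LINT s|lborel. indicator {u..v} s * f s :: real\<bar> <= K * (v - u)"
proof -
	have "\<bar>LINT s|lborel. indicator {u..v} s * f s\<bar> <= (LINT s|lborel. norm (indicator {u..v} s * f s :: real))"
		by (rule order_trans[OF _ integral_norm_bound]) simp
	also have "... <= (LINT s|lborel. K * indicator {u..v} s)"
	proof (rule integral_mono_AE)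
		show "integrable lborel (%s. norm (indicator {u..v} s * f s))"
			using integrable_bounded_on[OF assms(1,2)] by (rule integrable_norm)
		show "integrable lborel (%s. K * indicator {u..v} s :: real)"
			by (intro integrable_mult_right integrable_indicator_Icc)
	qed (use assms in "auto simp: indicator_def")
	also have "... = K * (v - u)" using assms(3) by simp
	finally show ?thesis .
qed

lemma split_integral:
	fixes f :: "real => real"
	assumes [measurable]: "f \<in> bmeas" and "!!s. s \<in> {0..v} ==> \<bar>f s\<bar> <= K" "0 <= u" "u <= v"
	shows "(LINT s|lborel. indicator {0..v} s * f s) - (LINT s|lborel. indicator {0..u} s * f s) =
		 (LINT s|lborel. indicator {u..v} s * f s :: real)"
proof -
	have i: "integrable lborel (%s. indicator {0..v} s * f s)"
		by (rule integrable_bounded_on[where K = K]) (use assms in auto)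
	have "\<bar>f s\<bar> <= K" if "s \<in> {0..u}" for s using assms(2)[of s] assms(4) that by auto
	hence i': "integrable lborel (%s. indicator {0..u} s * f s)"
		by (rule integrable_bounded_on[OF assms(1)])
	have "AE s in lborel. s ~= u" by (rule AE_lborel_singleton)
	hence "(LINT s|lborel. indicator {0..v} s * f s - indicator {0..u} s * f s) =
		 (LINT s|lborel. indicator {u..v} s * f s :: real)"
		using assms by (intro integral_cong_AE) (auto simp: indicator_def elim!: eventually_mono)
	thus ?thesis using i i' by simp
qed

lemma I_diff: "0 <= u ==> u <= v ==> I v - I u = (LINT s|lborel. indicator {u..v} s * b s)"
	unfolding I_def by (rule split_integral[OF meas]) (use bound in auto)

lemma I_nonpos [simp]: "t <= 0 ==> I t = 0"
proof -
	assume "t <= 0"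
	have "AE s in lborel. s ~= (0::real)" by (rule AE_lborel_singleton)
	hence "AE s in lborel. indicator {0..t} s * b s = 0"
		using \<open>t <= 0\<close> by (auto simp: indicator_def elim!: eventually_mono)
	thus ?thesis unfolding I_def by (rule integral_eq_zero_AE)
qed

lemma I_mono: "u <= v ==> I u <= I v"
	unfolding I_def by (intro integral_mono integrable_bounded_on[OF meas bound]) (auto simp: indicator_def nonneg)

lemma I_measurable [measurable]: "I \<in> bmeas"
	by (rule borel_measurable_mono) (auto intro: monoI I_mono)

lemma I_Lipschitz: "0 <= u ==> u <= v ==> I v - I u <= c * (v - u)"
	using integral_bound_on[OF meas bound, of u v] I_diff by simp

lemma exp_I_le:
	assumes "0 <= s" "s <= t" "\<sigma> = 1 \<or> \<sigma> = - 1"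
	shows "exp (\<sigma> * I s) <= exp (c * t)" "\<bar>b s * exp (\<sigma> * I s)\<bar> <= c * exp (c * t)"
proof -
	have "c * s <= c * t" using assms(2) c_nonneg by (rule mult_left_mono)
	thus *: "exp (\<sigma> * I s) <= exp (c * t)" using I_Lipschitz[of 0 s] I_mono[of 0 s] assms by auto
	show "\<bar>b s * exp (\<sigma> * I s)\<bar> <= c * exp (c * t)" unfolding abs_mult using bound[of s] * by (intro mult_mono) auto
qed

text \<open>
	On \<open>[u, v]\<close> the integral and the increment of \<open>\<sigma> exp (\<sigma> I)\<close> lie between the same two bounds, which differ by
	\<open>O((v - u)\<^sup>2)\<close>.
\<close>

lemma integral_exp:
	assumes t: "0 <= t" and \<sigma>: "\<sigma> = 1 \<or> \<sigma> = - 1"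
	shows "(LINT s|lborel. indicator {0..t} s * (b s * exp (\<sigma> * I s))) = \<sigma> * (exp (\<sigma> * I t) - 1)"
proof -
	define E where "E = exp (c * t)"
	define N where "N u = (LINT s|lborel. indicator {0..u} s * (b s * exp (\<sigma> * I s)))" for u
	define G where "G u = \<sigma> * exp (\<sigma> * I u) - N u" for u
	have main: "\<bar>G v - G u\<bar> <= (E * c^2) * (v - u)^2" if uv: "0 <= u" "u <= v" "v <= t" for u v
	proof -
		note bE = exp_I_le(2)[OF _ _ \<sigma>, of _ t]
		have Nd: "N v - N u = (LINT s|lborel. indicator {u..v} s * (b s * exp (\<sigma> * I s)))"
			unfolding N_def by (rule split_integral[where K = "c * E"]) (use bE uv in "auto simp: E_def")
		define d a e where "d = I v - I u" and "a = min (\<sigma> * I u) (\<sigma> * I v)" and "e = max (\<sigma> * I u) (\<sigma> * I v)"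
		have d: "d = (LINT s|lborel. indicator {u..v} s * b s)" "0 <= d" "d <= c * (v - u)"
			unfolding d_def by (rule I_diff) (use I_mono[of u v] I_Lipschitz[of u v] uv in simp_all)
		have e: "e = a + d" "\<sigma> * exp (\<sigma> * I v) - \<sigma> * exp (\<sigma> * I u) = exp e - exp a"
			using \<sigma> d(2) by (auto simp: a_def e_def d_def min_def max_def)
		have rng: "exp a <= exp (\<sigma> * I s)" "exp (\<sigma> * I s) <= exp e" if "s \<in> {u..v}" for s
			using \<sigma> I_mono[of u s] I_mono[of s v] that by (auto simp: a_def e_def)
		have i: "integrable lborel (%s. indicator {u..v} s * (b s * exp (\<sigma> * I s)))"
			by (rule integrable_bounded_on[where K = "c * E"]) (use bE uv in "auto simp: E_def")
		have i': "integrable lborel (%s. y * (indicator {u..v} s * b s))" for y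
			by (intro integrable_mult_right integrable_bounded_on[OF meas bound])
		have "(LINT s|lborel. exp a * (indicator {u..v} s * b s)) <= N v - N u"
			unfolding Nd by (rule integral_mono[OF i' i]) (simp add: indicator_def mult.commute[of _ "b _"] mult_left_mono rng[simplified] nonneg)
		moreover have "N v - N u <= (LINT s|lborel. exp e * (indicator {u..v} s * b s))"
			unfolding Nd by (rule integral_mono[OF i i']) (simp add: indicator_def mult.commute[of _ "b _"] mult_left_mono rng[simplified] nonneg)
		ultimately have N: "exp a * d <= N v - N u" "N v - N u <= exp e * d" using d(1) by auto
		have "\<bar>G v - G u\<bar> <= (exp e - exp a) * d"
			using N e(2) exp_diff_bounds[of a d] unfolding e(1)[symmetric] G_def left_diff_distrib abs_le_iff by linarith
		also have "... <= (exp e * d) * d" using exp_diff_bounds(2)[of a d] e(1) d(2) by (intro mult_right_mono) auto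
		also have "... <= E * (c * (v - u)) * (c * (v - u))"
			using exp_I_le(1)[OF _ _ \<sigma>, of u t] exp_I_le(1)[OF _ _ \<sigma>, of v t] uv d
			by (intro mult_mono) (auto simp: E_def e_def max_def)
		finally show ?thesis by (simp add: power2_eq_square algebra_simps)
	qed
	have "G t = G 0"
		using main by (rule zero_derivative_of_quadratic_bound[of 0 t]) (use t in auto)
	moreover have "AE s in lborel. indicator {0..0} s * (b s * exp (\<sigma> * I s)) = 0"
		using AE_lborel_singleton[of "0::real"] by eventually_elim simp
	hence "N 0 = 0" unfolding N_def by (rule integral_eq_zero_AE)
	ultimately show ?thesis by (simp add: G_def N_def right_diff_distrib)
qed

lemma nn_integral_exp:
	assumes t: "0 <= t" and \<sigma>: "\<sigma> = 1 \<or> \<sigma> = - 1"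
	shows "(Leb (%s. ennreal (indicator {0..t} s * (b s * exp (\<sigma> * I s))))) = ennreal (\<sigma> * (exp (\<sigma> * I t) - 1))"
proof -
	have "integrable lborel (%s. indicator {0..t} s * (b s * exp (\<sigma> * I s)))"
		by (rule integrable_bounded_on[where K = "c * exp (c * t)"]) (use exp_I_le(2)[OF _ _ \<sigma>] in auto)
	thus ?thesis by (subst nn_integral_eq_integral) (use nonneg integral_exp[OF assms] in auto)
qed

end

section \<open>Killing and resolvents\<close>

text \<open>Boundedness allows comparison with a constant rate \<open>l\<close>, which is how
  statements about general rates are reduced to the ordinary resolvent.\<close>

definition rate :: "('a::t2_space option => real) => bool" where
	"rate k \<longleftrightarrow> k \<in> smeas & (\<forall>x. 0 <= k x) & (\<exists>c. \<forall>x. k x <= c)"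

lemma rate_measurable: "rate k ==> k \<in> smeas"
	and rate_nonneg: "rate k ==> 0 <= k x"
	by (auto simp: rate_def)

lemma rate_const: "0 <= c ==> rate (%_. c)"
	by (auto simp: rate_def)

context hunt
begin

text \<open>Clipping negative times makes positions jointly measurable on the whole real line, where
  the time integrals live.\<close>

abbreviation Y :: "real => 'w => 'a option" where
	"Y t w \<equiv> pos X (max 0 t) w"

lemma measurable_Y [measurable (raw)]:
	assumes "f \<in> N \<rightarrow>\<^sub>M borel" "g \<in> N \<rightarrow>\<^sub>M H"
	shows "(%x. Y (f x) (g x)) \<in> N \<rightarrow>\<^sub>M state_alg"
	using measurable_compose[OF measurable_Pair[OF assms] measurable_pos_joint] by simp

lemma measurable_Y_path: "w \<in> paths X ==> (%s. Y s w) \<in> borel \<rightarrow>\<^sub>M state_alg"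
	by (rule measurable_Y) auto

lemma measurable_shift_joint [measurable (raw)]:
	assumes "f \<in> N \<rightarrow>\<^sub>M borel" "g \<in> N \<rightarrow>\<^sub>M H"
	shows "(%x. shift X (max 0 (f x)) (g x)) \<in> N \<rightarrow>\<^sub>M H"
proof (rule measurable_into_history)
	show "(%x. shift X (max 0 (f x)) (g x)) \<in> space N \<rightarrow> paths X"
		using measurable_space[OF assms(2)] by (auto intro!: shift_paths)
	fix s :: real assume s: "s \<in> {0..}"
	have "(%x. Y (s + max 0 (f x)) (g x)) \<in> N \<rightarrow>\<^sub>M state_alg"
		using assms by measurable
	thus "(%x. pos X s (shift X (max 0 (f x)) (g x))) \<in> N \<rightarrow>\<^sub>M state_alg"
		by (rule measurable_cong[THEN iffD1, rotated])
			(use measurable_space[OF assms(2)] s in "auto simp: pos_shift")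
qed

definition Acc :: "('a option => real) => real => 'w => real" where
	"Acc k t w = (LINT s|lborel. indicator {0..t} s * k (Y s w))"

text \<open>The conditional probability, given the path, of surviving killing at rate
  \<open>k\<close> up to time \<open>t\<close>.\<close>

definition M :: "('a option => real) => real => 'w => real" where
	"M k t w = exp (- Acc k t w)"

lemma rate_path:
	assumes "rate k" "w \<in> paths X"
	obtains c where "bounded_rate (%s. k (Y s w)) c" "\<forall>t. bounded_rate.I (%s. k (Y s w)) t = Acc k t w"
proof -
	obtain c where c: "!!x. k x <= c" using assms by (auto simp: rate_def)
	have m: "(%s. k (Y s w)) \<in> bmeas"
		by (rule measurable_compose[OF measurable_Y_path[OF assms(2)] rate_measurable[OF assms(1)]])
	have *: "bounded_rate (%s. k (Y s w)) c"
		using c rate_nonneg[OF assms(1)] by unfold_locales (auto simp: m)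
	show ?thesis
		by (rule that[OF *]) (simp add: bounded_rate.I_def[OF *] Acc_def)
qed

lemma Acc_measurable:
	assumes "rate k" and [measurable]: "f \<in> borel_measurable N" "g \<in> N \<rightarrow>\<^sub>M H"
	shows "(%x. Acc k (f x) (g x)) \<in> borel_measurable N"
proof -
	note [measurable] = rate_measurable[OF assms(1)]
	have [measurable]: "Measurable.pred (N \<Otimes>\<^sub>M lborel) (%p. snd p \<in> {0..f (fst p)})"
		unfolding atLeastAtMost_iff by measurable
	show ?thesis unfolding Acc_def
		by (rule sigma_finite_measure.borel_measurable_lebesgue_integral[OF sigma_finite_lborel])
			(simp add: case_prod_beta' indicator_def[abs_def] del: atLeastAtMost_iff)
qed

lemma M_measurable [measurable (raw)]:
	assumes "rate k" "f \<in> borel_measurable N" "g \<in> N \<rightarrow>\<^sub>M H"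
	shows "(%x. M k (f x) (g x)) \<in> borel_measurable N"
	using Acc_measurable[OF assms] unfolding M_def by measurable

lemma M_progressive:
	assumes k: "rate k" and t: "0 <= t"
	shows "(%(u, w). M k (max 0 (min u t)) w) \<in> borel_measurable (borel \<Otimes>\<^sub>M history X {0..t})"
proof -
	let ?N = "(borel :: real measure) \<Otimes>\<^sub>M history X {0..t}"
	note [measurable] = rate_measurable[OF k]
	have "(%q. (snd q, snd (fst q))) \<in> ?N \<Otimes>\<^sub>M lborel \<rightarrow>\<^sub>M borel \<Otimes>\<^sub>M history X {0..t}"
		by measurable
	from measurable_compose[OF this measurable_pos_joint_upto[OF t]]
	have [measurable]: "(%q. pos X (max 0 (min (snd q) t)) (snd (fst q))) \<in> ?N \<Otimes>\<^sub>M lborel \<rightarrow>\<^sub>M state_alg"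
		by simp
	have [measurable]: "Measurable.pred (?N \<Otimes>\<^sub>M lborel) (%p. snd p \<in> {0..max 0 (min (fst (fst p)) t)})"
		unfolding atLeastAtMost_iff by measurable
	\<comment> \<open>The inner clip at \<open>t\<close> does not change the integral, whose range ends
	  no later than \<open>t\<close>, but makes the integrand measurable for the history up to
	  \<open>t\<close>.\<close>
	have "(%p. LINT s|lborel. indicator {0..max 0 (min (fst p) t)} s * k (pos X (max 0 (min s t)) (snd p)))
			\<in> borel_measurable ?N"
		by (rule sigma_finite_measure.borel_measurable_lebesgue_integral[OF sigma_finite_lborel])
			(simp add: case_prod_beta' indicator_def[abs_def] del: atLeastAtMost_iff)
	moreover have "(LINT s|lborel. indicator {0..max 0 (min u t)} s * k (pos X (max 0 (min s t)) w)) =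
			Acc k (max 0 (min u t)) w" for u w
		unfolding Acc_def by (intro Bochner_Integration.integral_cong) (use t in "auto simp: indicator_def")
	ultimately have "(%p. Acc k (max 0 (min (fst p) t)) (snd p)) \<in> borel_measurable ?N" by simp
	thus ?thesis unfolding M_def case_prod_beta' by measurable
qed

lemma M_pos: "0 < M k t w"
	by (simp add: M_def)

lemma Acc_nonneg: "rate k ==> 0 <= Acc k t w"
	unfolding Acc_def by (rule integral_nonneg_AE) (simp add: rate_nonneg)

lemma M_le_1: "rate k ==> M k t w <= 1"
	using Acc_nonneg by (simp add: M_def)

lemma M_0 [simp]:
	assumes "rate k" "w \<in> paths X"
	shows "M k 0 w = 1"
proof -
	obtain c where *: "bounded_rate (%s. k (Y s w)) c" "\<forall>t. bounded_rate.I (%s. k (Y s w)) t = Acc k t w"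
		using rate_path[OF assms] by blast
	show ?thesis using bounded_rate.I_nonpos[OF *(1), of 0] by (simp add: M_def *(2))
qed

lemma integrable_rate:
	assumes "rate k" "w \<in> paths X"
	shows "integrable lborel (%s. indicator {u..v} s * k (Y s w))"
proof -
	obtain c where *: "bounded_rate (%s. k (Y s w)) c" "\<forall>t. bounded_rate.I (%s. k (Y s w)) t = Acc k t w"
		using rate_path[OF assms] by blast
	show ?thesis
		by (rule bounded_rate.integrable_bounded_on[OF *(1), where K = c])
			(use bounded_rate.meas[OF *(1)] bounded_rate.bound[OF *(1)] in auto)
qed

lemma Acc_mono_rate:
	assumes "rate k" "rate k'" "w \<in> paths X" "!!s. 0 <= s ==> s <= t ==> k (pos X s w) <= k' (pos X s w)"
	shows "Acc k t w <= Acc k' t w"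
	unfolding Acc_def
	by (rule integral_mono[OF integrable_rate[OF assms(1,3)] integrable_rate[OF assms(2,3)]])
		(use assms(4) in "auto simp: indicator_def")

lemma M_antimono_rate:
	assumes "rate k" "rate k'" "w \<in> paths X" "!!s. 0 <= s ==> s <= t ==> k (pos X s w) <= k' (pos X s w)"
	shows "M k' t w <= M k t w"
	using Acc_mono_rate[OF assms] by (simp add: M_def)

lemma Acc_const: "0 <= t ==> Acc (%_. c) t w = c * t"
	by (simp add: Acc_def)

lemma M_const: "0 <= t ==> M (%_. c) t w = exp (- c * t)"
	by (simp add: M_def Acc_const)

lemma Acc_add_rate:
	assumes "rate k" "rate k'" "w \<in> paths X"
	shows "Acc (%x. k x + k' x) t w = Acc k t w + Acc k' t w"
	unfolding Acc_def using integrable_rate[OF assms(1,3), of 0 t] integrable_rate[OF assms(2,3), of 0 t]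
	by (simp add: distrib_left)

lemma Acc_shift:
	assumes "rate k" "w \<in> paths X" "0 <= s" "0 <= t"
	shows "Acc k (s + t) w = Acc k s w + Acc k t (shift X s w)"
proof -
	obtain c where *: "bounded_rate (%s. k (Y s w)) c" "\<forall>t. bounded_rate.I (%s. k (Y s w)) t = Acc k t w"
		using rate_path[OF assms(1,2)] by blast
	have "Acc k (s + t) w - Acc k s w = (LINT r|lborel. indicator {s..s+t} r * k (Y r w))"
		using bounded_rate.I_diff[OF *(1), of s "s + t"] assms by (simp add: *(2))
	also have "... = (LINT r|lborel. indicator {s..s+t} (s + 1 * r) * k (Y (s + 1 * r) w))"
		using lborel_integral_real_affine[of 1 "%r. indicator {s..s+t} r * k (Y r w)" s] by simp
	also have "... = Acc k t (shift X s w)"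
		unfolding Acc_def
	proof (rule Bochner_Integration.integral_cong[OF refl])
		fix r
		show "indicator {s..s+t} (s + 1 * r) * k (Y (s + 1 * r) w) = indicator {0..t} r * k (Y r (shift X s w))"
			using assms by (cases "r \<in> {0..t}") (auto simp: pos_shift add.commute)
	qed
	finally show ?thesis by simp
qed

lemma M_shift:
	assumes "rate k" "w \<in> paths X" "0 <= s" "0 <= t"
	shows "M k (s + t) w = M k s w * M k t (shift X s w)"
	by (simp add: M_def Acc_shift[OF assms] exp_add[symmetric])

lemma nn_integral_rate_M:
	assumes "rate k" "w \<in> paths X" "0 <= t"
	shows "(Leb (%s. ennreal (indicator {0..t} s * (k (Y s w) * M k s w)))) = ennreal (1 - M k t w)"
proof -
	obtain c where *: "bounded_rate (%s. k (Y s w)) c" "\<forall>t. bounded_rate.I (%s. k (Y s w)) t = Acc k t w"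
		using rate_path[OF assms(1,2)] by blast
	show ?thesis
		using bounded_rate.nn_integral_exp[OF *(1) assms(3), of "- 1"]
		by (simp add: *(2) M_def)
qed

definition occ :: "('a option => real) => ('a option => ennreal) => ennreal => 'w => ennreal" where
	"occ k v s w = (Leb (%t. ennreal (M k t w) * v (Y t w) * indicator (before s) t))"

text \<open>The Feynman-Kac potential: for constant \<open>k\<close> the resolvent, for
  \<open>k = 0\<close> the potential of the process itself.\<close>

definition R :: "('a option => real) => ('a option => ennreal) => 'a option => ennreal" where
	"R k v x = (EE x (%w. occ k v \<infinity> w))"

lemma occ_measurable [measurable (raw)]:
	assumes "rate k" and [measurable]: "v \<in> smeas" "f \<in> borel_measurable N" "g \<in> N \<rightarrow>\<^sub>M H"
	shows "(%x. occ k v (f x) (g x)) \<in> borel_measurable N"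
proof -
	note [measurable] = M_measurable[OF assms(1)]
	have [measurable]: "Measurable.pred (N \<Otimes>\<^sub>M lborel) (%p. snd p \<in> before (f (fst p)))"
		unfolding mem_Collect_eq by measurable
	show ?thesis unfolding occ_def
		by (rule sigma_finite_measure.borel_measurable_nn_integral[OF sigma_finite_lborel])
			(simp add: case_prod_beta' indicator_def[abs_def] del: mem_Collect_eq)
qed

lemma R_measurable:
	assumes "rate k" "v \<in> smeas"
	shows "R k v \<in> smeas"
	unfolding R_def[abs_def] by (rule measurable_nn_integral_P) (rule occ_measurable[OF assms], auto)

lemma occ_shift:
	assumes "rate k" "v \<in> smeas" "w \<in> paths X" "0 <= s"
	shows "occ k v \<infinity> w = occ k v (ennreal s) w + ennreal (M k s w) * occ k v \<infinity> (shift X s w)"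
proof -
	note [measurable] = assms(2)
	have [measurable]: "(%s. Y s w) \<in> borel \<rightarrow>\<^sub>M state_alg" by (rule measurable_Y_path[OF assms(3)])
	have [measurable]: "(%s. M k s w) \<in> bmeas"
		by (rule M_measurable[OF assms(1)]) (use assms(3) in auto)
	have [measurable]: "(%t. M k t (shift X s w)) \<in> bmeas"
		by (rule M_measurable[OF assms(1)]) (use shift_paths[OF assms(3,4)] in auto)
	have [measurable]: "(%t. Y t (shift X s w)) \<in> borel \<rightarrow>\<^sub>M state_alg"
		by (rule measurable_Y_path[OF shift_paths[OF assms(3,4)]])
	have "occ k v \<infinity> w = (Leb (%t. ennreal (M k t w) * v (Y t w) * indicator (before s) t +
			ennreal (M k t w) * v (Y t w) * indicator {s..} t))"
		unfolding occ_def
		by (intro nn_integral_cong) (use assms(4) in "auto simp: indicator_def ennreal_less_iff")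
	also have "... = occ k v (ennreal s) w + (Leb (%t. ennreal (M k t w) * v (Y t w) * indicator {s..} t))"
		unfolding occ_def by (rule nn_integral_add) measurable
	also have "(Leb (%t. ennreal (M k t w) * v (Y t w) * indicator {s..} t)) =
		 (Leb (%t. ennreal (M k (s + t) w) * v (Y (s + t) w) * indicator {s..} (s + t)))"
		by (subst nn_integral_real_affine[where c = 1 and t = s]) auto
	also have "... = (Leb (%t. ennreal (M k s w) * (ennreal (M k t (shift X s w)) * v (Y t (shift X s w)) *
			 indicator (before \<infinity>) t)))"
	proof (rule nn_integral_cong)
		fix t
		show "ennreal (M k (s + t) w) * v (Y (s + t) w) * indicator {s..} (s + t) =
			ennreal (M k s w) * (ennreal (M k t (shift X s w)) * v (Y t (shift X s w)) *
			 indicator (before \<infinity>) t)"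
			using assms M_pos[of k s w] M_pos[of k t "shift X s w"]
			by (cases "0 <= t") (auto simp: M_shift pos_shift add.commute ennreal_mult mult.assoc)
	qed
	also have "... = ennreal (M k s w) * occ k v \<infinity> (shift X s w)"
		unfolding occ_def by (rule nn_integral_cmult) measurable
	finally show ?thesis .
qed

text \<open>The event that \<open>T\<close> is infinite is treated apart: there the indicator forces
  0, whatever \<open>enn2real\<close> returns.\<close>

lemma past_of_progressive:
	assumes Y: "!!t. 0 <= t ==> (%(u, w). Z (max 0 (min u t)) w) \<in> borel_measurable (borel \<Otimes>\<^sub>M history X {0..t})"
		and T: "raw_time T"
	shows "(%w. Z (enn2real (T w)) w * indicator {w. T w < \<infinity>} w :: ennreal) \<in> borel_measurable (pastM T)"
proof (rule measurableI)
	fix B :: "ennreal set" assume B: "B \<in> sets borel"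
	let ?F = "%w. Z (enn2real (T w)) w * indicator {w. T w < \<infinity>} w"
	interpret sigma_algebra "paths X" "past T" by (rule sigma_algebra_past[OF T])
	have 1: "{w \<in> paths X. T w < \<infinity> & Z (enn2real (T w)) w \<in> C} \<in> past T" if "C \<in> sets borel" for C
		using past_progressive[OF Y that T raw_time_paths_past[OF T] order_refl] by simp
	have "paths X - {w \<in> paths X. T w < \<infinity> & Z (enn2real (T w)) w \<in> UNIV} \<in> past T"
		by (intro compl_sets 1) simp
	hence 2: "{w \<in> paths X. \<not> T w < \<infinity>} \<in> past T"
		by (rule back_subst[of "%A. A \<in> past T"]) auto
	have "?F -` B \<inter> space (pastM T) = {w \<in> paths X. T w < \<infinity> & Z (enn2real (T w)) w \<in> B} \<union>
			(if 0 \<in> B then {w \<in> paths X. \<not> T w < \<infinity>} else {})"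
		(is "?L = ?Q")
	proof (rule set_eqI)
		show "w \<in> ?L \<longleftrightarrow> w \<in> ?Q" for w by (cases "T w < \<infinity>") auto
	qed
	also have "... \<in> past T" using 1[OF B] 2 by auto
	finally show "?F -` B \<inter> space (pastM T) \<in> sets (pastM T)" using sets_pastM[OF T] by simp
qed auto

lemma M_past: "rate k ==> raw_time T ==>
		(%w. ennreal (M k (enn2real (T w)) w) * indicator {w. T w < \<infinity>} w) \<in> borel_measurable (pastM T)"
	by (rule past_of_progressive) (use M_progressive in "simp add: case_prod_beta'")

text \<open>The payoff at \<open>T\<close> on the event of surviving until then. Together with
  \<open>R_upto\<close> it makes up every decomposition of a killed expectation at
  \<open>T\<close>.\<close>

definition stopped :: "('a option => real) => ('w => ennreal) => ('a option => ennreal) => 'a option => ennreal" where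
	"stopped k T f x =
		(EE x (%w. ennreal (M k (enn2real (T w)) w) * indicator {w. T w < \<infinity>} w * f (pos_at X T w)))"

definition R_upto :: "('a option => real) => ('w => ennreal) => ('a option => ennreal) => 'a option => ennreal" where
	"R_upto k T v x = (EE x (%w. occ k v (T w) w))"

text \<open>The occupation integral is cut at \<open>T\<close>; multiplicativity of \<open>M\<close>
  turns the later part into the survival weight at \<open>T\<close> times the occupation of the
  shifted path.\<close>

lemma R_strong_markov:
	assumes k: "rate k" and v: "v \<in> smeas" and T: "raw_time T"
	shows "R k v x = R_upto k T v x + stopped k T (R k v) x"
proof -
	note [measurable] = raw_time_measurable[OF T]
	let ?w = "%w. ennreal (M k (enn2real (T w)) w)"
	have w: "?w \<in> borel_measurable (P x)"
		unfolding measurable_P_iff by (rule measurable_compose[OF M_measurable[OF k] measurable_ennreal]) auto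
	have o: "(%w. occ k v (T w) w) \<in> borel_measurable (P x)"
		unfolding measurable_P_iff by (rule occ_measurable[OF k v]) auto
	have o': "occ k v \<infinity> \<in> hmeas" by (rule occ_measurable[OF k v]) auto
	have os: "(%w. occ k v \<infinity> (shift X (enn2real (T w)) w)) \<in> borel_measurable (P x)"
		unfolding measurable_P_iff by (rule measurable_compose[OF shift_at_measurable o']) auto
	have "R k v x = (EE x (%w. occ k v (T w) w +
			?w w * indicator {w. T w < \<infinity>} w * occ k v \<infinity> (shift X (enn2real (T w)) w)))"
		unfolding R_def
	proof (rule nn_integral_cong)
		fix w assume "w \<in> space (P x)"
		hence w: "w \<in> paths X" by simp
		show "occ k v \<infinity> w = occ k v (T w) w +
			?w w * indicator {w. T w < \<infinity>} w * occ k v \<infinity> (shift X (enn2real (T w)) w)"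
			using occ_shift[OF k v w, of "enn2real (T w)"] by (cases "T w") auto
	qed
	also have "... = R_upto k T v x +
		 (EE x (%w. ?w w * indicator {w. T w < \<infinity>} w * occ k v \<infinity> (shift X (enn2real (T w)) w)))"
		unfolding R_upto_def using w o os by (intro nn_integral_add) auto
	\<comment> \<open>The indicator is idempotent; one copy is joined to the weight, because the
	  product is what is known to be measurable for the past.\<close>
	also have "(EE x (%w. ?w w * indicator {w. T w < \<infinity>} w * occ k v \<infinity> (shift X (enn2real (T w)) w))) =
		 (EE x (%w. (?w w * indicator {w. T w < \<infinity>} w) * indicator {w. T w < \<infinity>} w * occ k v \<infinity> (shift X (enn2real (T w)) w)))"
		by (intro nn_integral_cong) (auto simp: indicator_def)
	also have "... = (EE x (%w. (?w w * indicator {w. T w < \<infinity>} w) * indicator {w. T w < \<infinity>} w * R k v (pos_at X T w)))"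
		unfolding R_def by (rule strong_markov[OF T M_past[OF k T] o'])
	also have "... = stopped k T (R k v) x"
		unfolding stopped_def by (intro nn_integral_cong) (auto simp: indicator_def)
	finally show ?thesis .
qed

subsection \<open>The resolvent equation\<close>

lemma M_past_const:
	assumes "rate k" "0 <= s"
	shows "(%w. ennreal (M k s w)) \<in> borel_measurable (pastM (%_. ennreal s))"
	using M_past[OF assms(1) raw_time_const[OF assms(2)]] assms(2) by simp

lemma pos_past_const:
	assumes "f \<in> smeas" "0 <= s"
	shows "(%w. f (pos X s w) :: ennreal) \<in> borel_measurable (pastM (%_. ennreal s))"
proof -
	have "(%w. f (pos X (enn2real (ennreal s)) w) * indicator {w. ennreal s < \<infinity>} w)
		 \<in> borel_measurable (pastM (%_. ennreal s))"
		by (rule past_of_progressive[OF _ raw_time_const[OF assms(2)]])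
			(use measurable_compose[OF measurable_pos_joint_upto assms(1)] in "simp add: case_prod_beta'")
	thus ?thesis using assms(2) by simp
qed

lemma markov:
	assumes s: "0 <= s" and q: "q \<in> borel_measurable (pastM (%_. ennreal s))" and h: "h \<in> hmeas"
	shows "(EE x (%w. q w * h (shift X s w))) = (EE x (%w. q w * (EE (pos X s w) (%w'. h w'))))"
	using strong_markov[OF raw_time_const[OF s] q h, of x] s by (simp add: pos_at_def)

lemma measurable_kernel_pos [measurable (raw)]:
	assumes "h \<in> hmeas" "f \<in> N \<rightarrow>\<^sub>M state_alg"
	shows "(%x. \<integral>\<^sup>+w. h w \<partial>P (f x)) \<in> borel_measurable N"
	by (rule measurable_compose[OF assms(2) measurable_nn_integral_P[OF assms(1)]])

text \<open>By Fubini the Markov property at each fixed time \<open>s\<close> may be used under the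
  time integral.\<close>

lemma markov_integrated:
	assumes q: "(%(s, w). q s w) \<in> borel_measurable (borel \<Otimes>\<^sub>M H)"
		and ws: "!!s. 0 <= s ==> q s \<in> borel_measurable (pastM (%_. ennreal s))"
		and h: "h \<in> hmeas"
	shows "(EE x (%w. (Leb (%s. indicator {0..} s * (q s w * h (shift X (max 0 s) w)))))) =
		(EE x (%w. (Leb (%s. indicator {0..} s * (q s w * (EE (Y s w) (%w'. h w')))))))"
proof -
	interpret pair_sigma_finite lborel "P x"
		by unfold_locales
	have w' [measurable]: "(%p. q (fst p) (snd p)) \<in> borel_measurable (borel \<Otimes>\<^sub>M H)"
		using q by (simp add: case_prod_beta')
	have [measurable]: "(%p. h (shift X (max 0 (fst p)) (snd p))) \<in> borel_measurable (borel \<Otimes>\<^sub>M H)"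
		by (rule measurable_compose[OF measurable_shift_joint h]) auto
	have [measurable]: "(%p. \<integral>\<^sup>+w'. h w' \<partial>P (Y (fst p) (snd p))) \<in> borel_measurable (borel \<Otimes>\<^sub>M H)"
		by (rule measurable_kernel_pos[OF h]) measurable
	have sw: "(%(s, w). f s w) \<in> borel_measurable (lborel \<Otimes>\<^sub>M P x)"
		if "(%p. f (fst p) (snd p)) \<in> borel_measurable (borel \<Otimes>\<^sub>M H)" for f :: "real => 'w => ennreal"
	proof -
		have "sets (lborel \<Otimes>\<^sub>M P x) = sets (borel \<Otimes>\<^sub>M H)" by (intro sets_pair_measure_cong) auto
		thus ?thesis unfolding case_prod_beta' using that measurable_cong_sets[OF _ refl] by blast
	qed
	have "(EE x (%w. (Leb (%s. indicator {0..} s * (q s w * h (shift X (max 0 s) w)))))) =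
		 (Leb (%s. (EE x (%w. indicator {0..} s * (q s w * h (shift X (max 0 s) w))))))"
		by (rule Fubini') (rule sw, measurable)
	also have "... = (Leb (%s. (EE x (%w. indicator {0..} s * (q s w * (EE (Y s w) (%w'. h w')))))))"
	proof (rule nn_integral_cong)
		fix s :: real
		show "(EE x (%w. indicator {0..} s * (q s w * h (shift X (max 0 s) w)))) =
			(EE x (%w. indicator {0..} s * (q s w * (EE (Y s w) (%w'. h w')))))"
			using markov[OF _ ws h, of s x] by (cases "0 <= s") auto
	qed
	also have "... = (EE x (%w. (Leb (%s. indicator {0..} s * (q s w * (EE (Y s w) (%w'. h w')))))))"
		by (rule Fubini'[symmetric]) (rule sw, measurable)
	finally show ?thesis .
qed

lemma path_measurable [measurable (raw)]:
	assumes "rate k" "w \<in> paths X"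
	shows "(%s. M k s w) \<in> bmeas"
	by (rule M_measurable[OF assms(1)]) (use assms(2) in auto)

text \<open>The quotient of the two weights is the exponential of the integral of
  \<open>k' - k\<close>, so both integrals are exact. The two forms correspond to the two orders of
  the resolvent equation.\<close>

lemma weight_identity:
	assumes k: "rate k" "rate k'" "!!x. k x <= k' x" and w: "w \<in> paths X" and t: "0 <= t"
	shows "(Leb (%s. ennreal (indicator {0..t} s * ((k' (Y s w) - k (Y s w)) * (M k' s w * (M k t w / M k s w))))))
			= ennreal (M k t w - M k' t w)" (is "?A = _")
		and "(Leb (%s. ennreal (indicator {0..t} s * ((k' (Y s w) - k (Y s w)) * (M k s w * (M k' t w / M k' s w))))))
			= ennreal (M k t w - M k' t w)" (is "?B = _")
proof -
	obtain c where c: "!!x. k' x <= c" using k(2) by (auto simp: rate_def)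
	have m: "(%s. k (Y s w)) \<in> bmeas" "(%s. k' (Y s w)) \<in> bmeas"
		using k by (auto intro!: measurable_compose[OF measurable_Y_path[OF w] rate_measurable])
	interpret b: bounded_rate "%s. k' (Y s w) - k (Y s w)" c
	proof
		show "0 <= k' (Y s w) - k (Y s w)" "k' (Y s w) - k (Y s w) <= c" for s
			using c[of "Y s w"] k(3)[of "Y s w"] rate_nonneg[OF k(1), of "Y s w"] by auto
	qed (use m in measurable)
	have I: "b.I s = Acc k' s w - Acc k s w" for s
		unfolding b.I_def Acc_def
		using integrable_rate[OF k(1) w, of 0 s] integrable_rate[OF k(2) w, of 0 s]
		by (simp add: right_diff_distrib)
	have e: "M k' s w / M k s w = exp (- b.I s)" "M k s w / M k' s w = exp (b.I s)" for s
		by (simp_all add: M_def I exp_diff[symmetric])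
	have M0: "0 <= M k t w" "0 <= M k' t w" using M_pos[of k t w] M_pos[of k' t w] by auto
	have "?A = (Leb (%s. ennreal (M k t w) * ennreal (indicator {0..t} s * ((k' (Y s w) - k (Y s w)) * exp (- b.I s)))))"
		unfolding ennreal_mult'[OF M0(1), symmetric] e(1)[symmetric]
		by (intro nn_integral_cong arg_cong[where f = ennreal]) (simp add: divide_inverse mult_ac)
	also have "... = ennreal (M k t w) * ennreal (1 - exp (- b.I t))"
		using b.nn_integral_exp[OF t, of "- 1"] by (subst nn_integral_cmult) auto
	also have "... = ennreal (M k t w - M k' t w)"
		unfolding ennreal_mult'[OF M0(1), symmetric] e(1)[symmetric] using M_pos[of k t w]
		by (simp add: right_diff_distrib)
	finally show "?A = ennreal (M k t w - M k' t w)" .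
	have "?B = (Leb (%s. ennreal (M k' t w) * ennreal (indicator {0..t} s * ((k' (Y s w) - k (Y s w)) * exp (b.I s)))))"
		unfolding ennreal_mult'[OF M0(2), symmetric] e(2)[symmetric]
		by (intro nn_integral_cong arg_cong[where f = ennreal]) (simp add: divide_inverse mult_ac)
	also have "... = ennreal (M k' t w) * ennreal (exp (b.I t) - 1)"
		using b.nn_integral_exp[OF t, of 1] by (subst nn_integral_cmult) auto
	also have "... = ennreal (M k t w - M k' t w)"
		unfolding ennreal_mult'[OF M0(2), symmetric] e(2)[symmetric] using M_pos[of k' t w]
		by (simp add: right_diff_distrib)
	finally show "?B = ennreal (M k t w - M k' t w)" .
qed

text \<open>
	Both orders of the resolvent equation come from one computation: by the Markov property
	\<open>R a (q R b v)\<close> is the expectation of \<open>\<integral> v(X\<^sub>t) \<integral>\<^sub>0\<^sup>t q(X\<^sub>s) M\<^sup>a\<^sub>s M\<^sup>b\<^sub>t / M\<^sup>b\<^sub>s ds dt\<close>.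
\<close>

lemma R_composition:
	assumes a: "rate a" and b: "rate b" and q: "rate q" and v[measurable]: "v \<in> smeas"
	shows "R a (%z. ennreal (q z) * R b v z) x = (EE x (%w. (Leb (%t. indicator {0..} t * (v (Y t w) *
		(Leb (%s. ennreal (indicator {0..t} s * (q (Y s w) * (M a s w * (M b t w / M b s w)))))))))))"
proof -
	note [measurable] = rate_measurable[OF a] rate_measurable[OF b] rate_measurable[OF q]
		M_measurable[OF a] M_measurable[OF b]
	let ?w = "%s w. ennreal (M a (max 0 s) w) * ennreal (q (Y s w))"
	have o': "occ b v \<infinity> \<in> hmeas" by (rule occ_measurable[OF b v]) auto
	have "R a (%z. ennreal (q z) * R b v z) x =
		 (EE x (%w. (Leb (%s. indicator {0..} s * (?w s w * (EE (Y s w) (%w'. occ b v \<infinity> w')))))))"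
		unfolding R_def occ_def
		by (intro nn_integral_cong) (auto simp: indicator_def mult.assoc)
	also have "... = (EE x (%w. (Leb (%s. indicator {0..} s * (?w s w * occ b v \<infinity> (shift X (max 0 s) w))))))"
	proof (rule markov_integrated[symmetric, OF _ _ o'])
		show "(%(s, w). ?w s w) \<in> borel_measurable (borel \<Otimes>\<^sub>M H)"
			unfolding case_prod_beta' by measurable
		show "?w s \<in> borel_measurable (pastM (%_. ennreal s))" if "0 <= s" for s
			using M_past_const[OF a that] pos_past_const[OF measurable_compose[OF rate_measurable[OF q] measurable_ennreal] that] that
			by (simp add: borel_measurable_times_ennreal)
	qed
	also have "... = (EE x (%w. (Leb (%t. indicator {0..} t * (v (Y t w) *
		(Leb (%s. ennreal (indicator {0..t} s * (q (Y s w) * (M a s w * (M b t w / M b s w)))))))))))"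
	proof (rule nn_integral_cong)
		fix w assume "w \<in> space (P x)"
		hence w: "w \<in> paths X" by simp
		note [measurable] = measurable_Y_path[OF w] path_measurable[OF a w] path_measurable[OF b w]
		let ?f = "%s t. v (Y t w) * ennreal (indicator {0..t} s * (q (Y s w) * (M a s w * (M b t w / M b s w))))"
		have f [measurable]: "(%(s, t). indicator {0..} t * ?f s t) \<in> borel_measurable (lborel \<Otimes>\<^sub>M lborel)"
		proof -
			have [measurable]: "Measurable.pred (lborel \<Otimes>\<^sub>M lborel) (%p. fst p \<in> {0..snd p :: real})"
				unfolding atLeastAtMost_iff by measurable
			show ?thesis unfolding case_prod_beta' indicator_def[abs_def] by measurable
		qed
		have "(Leb (%s. indicator {0..} s * (?w s w * occ b v \<infinity> (shift X (max 0 s) w)))) =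
			(Leb (%s. (Leb (%t. indicator {0..} t * ?f s t))))"
		proof (rule nn_integral_cong)
			fix s :: real
			show "indicator {0..} s * (?w s w * occ b v \<infinity> (shift X (max 0 s) w)) = (Leb (%t. indicator {0..} t * ?f s t))"
			proof (cases "0 <= s")
				case False
				thus ?thesis by (simp add: indicator_def)
			next
				case True
				note w' = shift_paths[OF w True]
				note [measurable] = measurable_Y_path[OF w'] path_measurable[OF b w']
				have "(Leb (%t. indicator {0..} t * ?f s t)) = (Leb (%t. indicator {0..} (s + t) * ?f s (s + t)))"
					by (subst nn_integral_real_affine[where c = 1 and t = s]) (use measurable_Pair2[OF f, of s] in auto)
				also have "... = (Leb (%t. ?w s w * (ennreal (M b t (shift X s w)) * v (Y t (shift X s w)) *
						indicator (before \<infinity>) t)))"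
				proof (rule nn_integral_cong)
					fix t :: real
					show "indicator {0..} (s + t) * ?f s (s + t) =
						?w s w * (ennreal (M b t (shift X s w)) * v (Y t (shift X s w)) * indicator (before \<infinity>) t)"
					proof (cases "0 <= t")
						case False
						thus ?thesis using True by (simp add: indicator_def)
					next
						case t: True
						have "M b (s + t) w / M b s w = M b t (shift X s w)"
							using M_shift[OF b w True t] M_pos[of b s w] by simp
						thus ?thesis using True t M_pos[of a s w] M_pos[of b t "shift X s w"] rate_nonneg[OF q, of "pos X s w"]
							by (simp add: pos_shift[OF w True t] add.commute[of t s] ennreal_mult' ennreal_mult'' mult_ac)
					qed
				qed
				also have "... = ?w s w * occ b v \<infinity> (shift X s w)"
					unfolding occ_def by (rule nn_integral_cmult) measurable
				finally show ?thesis using True by simp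
			qed
		qed
		also have "... = (Leb (%t. (Leb (%s. indicator {0..} t * ?f s t))))"
			by (rule lborel_pair.Fubini'[symmetric, OF f])
		also have "... = (Leb (%t. indicator {0..} t * (v (Y t w) *
			(Leb (%s. ennreal (indicator {0..t} s * (q (Y s w) * (M a s w * (M b t w / M b s w)))))))))"
		proof (rule nn_integral_cong)
			fix t :: real
			have "(%s. indicator {0..t} s * (q (Y s w) * (M a s w * (M b t w / M b s w)))) \<in> bmeas"
				by measurable
			thus "(Leb (%s. indicator {0..} t * ?f s t)) = indicator {0..} t * (v (Y t w) *
				(Leb (%s. ennreal (indicator {0..t} s * (q (Y s w) * (M a s w * (M b t w / M b s w)))))))"
				by (simp add: nn_integral_cmult)
		qed
		finally show "(Leb (%s. indicator {0..} s * (?w s w * occ b v \<infinity> (shift X (max 0 s) w)))) =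
			(Leb (%t. indicator {0..} t * (v (Y t w) *
			(Leb (%s. ennreal (indicator {0..t} s * (q (Y s w) * (M a s w * (M b t w / M b s w)))))))))" .
	qed
	finally show ?thesis .
qed

lemma R_difference:
	assumes k: "rate k" "rate k'" "!!x. k x <= k' x" and v[measurable]: "v \<in> smeas"
	shows "R k v x = R k' v x + (EE x (%w. (Leb (%t. indicator {0..} t * (v (Y t w) * ennreal (M k t w - M k' t w))))))"
proof -
	note [measurable] = M_measurable[OF k(1)] M_measurable[OF k(2)]
	have m: "occ k' v \<infinity> \<in> borel_measurable (P x)"
		unfolding measurable_P_iff by (rule occ_measurable[OF k(2) v]) auto
	have m': "(%w. \<integral>\<^sup>+t. indicator {0..} t * (v (Y t w) * ennreal (M k t w - M k' t w)) \<partial>lborel) \<in> borel_measurable (P x)"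
		unfolding measurable_P_iff
		by (rule sigma_finite_measure.borel_measurable_nn_integral[OF sigma_finite_lborel])
			(simp add: case_prod_beta')
	have "R k v x = (EE x (%w. occ k' v \<infinity> w + (Leb (%t. indicator {0..} t * (v (Y t w) * ennreal (M k t w - M k' t w))))))"
		unfolding R_def
	proof (rule nn_integral_cong)
		fix w assume "w \<in> space (P x)"
		hence w: "w \<in> paths X" by simp
		note [measurable] = measurable_Y_path[OF w] path_measurable[OF k(1) w] path_measurable[OF k(2) w]
		have "ennreal (M k t w) * v (Y t w) = ennreal (M k' t w) * v (Y t w) + v (Y t w) * ennreal (M k t w - M k' t w)"
			if "0 <= t" for t
		proof -
			have "M k' t w <= M k t w" using M_antimono_rate[OF k(1,2) w, of t] k(3) by simp
			hence "ennreal (M k t w) = ennreal (M k' t w) + ennreal (M k t w - M k' t w)"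
				using M_pos[of k' t w] by (subst ennreal_plus[symmetric]) auto
			thus ?thesis by (simp add: distrib_left mult.commute)
		qed
		hence "occ k v \<infinity> w = (Leb (%t. ennreal (M k' t w) * v (Y t w) * indicator (before \<infinity>) t +
			 indicator {0..} t * (v (Y t w) * ennreal (M k t w - M k' t w))))"
			unfolding occ_def by (intro nn_integral_cong) (auto simp: indicator_def)
		also have "... = occ k' v \<infinity> w + (Leb (%t. indicator {0..} t * (v (Y t w) * ennreal (M k t w - M k' t w))))"
			unfolding occ_def by (rule nn_integral_add) measurable
		finally show "occ k v \<infinity> w = ..." .
	qed
	also have "... = R k' v x + (EE x (%w. (Leb (%t. indicator {0..} t * (v (Y t w) * ennreal (M k t w - M k' t w))))))"
		unfolding R_def by (rule nn_integral_add[OF m m'])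
	finally show ?thesis .
qed

lemma rate_diff: "rate k ==> rate k' ==> (!!x. k x <= k' x) ==> rate (%x. k' x - k x)"
proof -
	assume k: "rate k" "rate k'" "!!x. k x <= k' x"
	obtain c where "!!x. k' x <= c" using k(2) by (auto simp: rate_def)
	hence "k' x - k x <= c" for x using rate_nonneg[OF k(1), of x] by (simp add: add_increasing2 diff_le_eq)
	thus ?thesis using k by (auto simp: rate_def)
qed

text \<open>In both orders the composed potential accumulates the weight
  \<open>M k t - M k' t\<close>, which is also the difference of the two potentials. Written
  additively, the identities hold for infinite values too.\<close>

lemma resolvent_equation:
	assumes k: "rate k" "rate k'" "!!x. k x <= k' x" and v: "v \<in> smeas"
	shows "R k v x = R k' v x + R k' (%z. ennreal (k' z - k z) * R k v z) x"
		and "R k v x = R k' v x + R k (%z. ennreal (k' z - k z) * R k' v z) x"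
proof -
	note q = rate_diff[OF k]
	show "R k v x = R k' v x + R k' (%z. ennreal (k' z - k z) * R k v z) x"
		unfolding R_difference[OF k v, of x] R_composition[OF k(2,1) q v]
	proof (intro arg_cong2[where f = "(+)"] refl nn_integral_cong)
		fix w t assume w: "w \<in> space (P x)"
		show "indicator {0..} t * (v (Y t w) * ennreal (M k t w - M k' t w)) = indicator {0..} t * (v (Y t w) *
			(Leb (%s. ennreal (indicator {0..t} s * ((k' (Y s w) - k (Y s w)) * (M k' s w * (M k t w / M k s w)))))))"
		proof (cases "0 <= t")
			case True
			from w have "w \<in> paths X" by simp
			from weight_identity(1)[OF k this True] show ?thesis by (simp only:)
		qed simp
	qed
	show "R k v x = R k' v x + R k (%z. ennreal (k' z - k z) * R k' v z) x"
		unfolding R_difference[OF k v, of x] R_composition[OF k(1,2) q v]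
	proof (intro arg_cong2[where f = "(+)"] refl nn_integral_cong)
		fix w t assume w: "w \<in> space (P x)"
		show "indicator {0..} t * (v (Y t w) * ennreal (M k t w - M k' t w)) = indicator {0..} t * (v (Y t w) *
			(Leb (%s. ennreal (indicator {0..t} s * ((k' (Y s w) - k (Y s w)) * (M k s w * (M k' t w / M k' s w)))))))"
		proof (cases "0 <= t")
			case True
			from w have "w \<in> paths X" by simp
			from weight_identity(2)[OF k this True] show ?thesis by (simp only:)
		qed simp
	qed
qed

end

lemma nn_integral_exp_decay:
	assumes "0 < (\<alpha>::real)"
	shows "(Leb (%t. ennreal (exp (- \<alpha> * t)) * indicator {0..} t)) = ennreal (1 / \<alpha>)"
proof -
	have "(Leb (%t. ennreal (exp (- \<alpha> * t)) * indicator {0..} t)) = ennreal (0 - (- exp (- \<alpha> * 0) / \<alpha>))"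
	proof (rule nn_integral_FTC_atLeast)
		show "((%t. - exp (- \<alpha> * t) / \<alpha>) has_real_derivative exp (- \<alpha> * x)) (at x)" for x
			using assms by (auto intro!: derivative_eq_intros)
		have "((%t. exp (- \<alpha> * t)) \<longlongrightarrow> 0) at_top"
			using assms by (intro filterlim_compose[OF exp_at_bot] filterlim_tendsto_neg_mult_at_bot[OF tendsto_const])
				(auto intro: filterlim_ident)
		from tendsto_divide[OF tendsto_minus[OF this] tendsto_const[of \<alpha>]] assms
		show "((%t. - exp (- \<alpha> * t) / \<alpha>) \<longlongrightarrow> 0) at_top" by simp
	qed auto
	thus ?thesis using assms by simp
qed

section \<open>Linearity, monotonicity and bounds of killed potentials\<close>

context hunt
begin

lemma occ_mono:
	assumes "!!z. v z <= v' z" "s <= s'"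
	shows "occ k v s w <= occ k v' s' w"
	unfolding occ_def using assms
	by (intro nn_integral_mono mult_mono) (auto simp: indicator_def intro: order.strict_trans2)

lemma R_mono: "(!!z. v z <= v' z) ==> R k v x <= R k v' x"
	unfolding R_def by (intro nn_integral_mono occ_mono) auto

lemma R_upto_mono: "(!!z. v z <= v' z) ==> R_upto k T v x <= R_upto k T v' x"
	unfolding R_upto_def by (intro nn_integral_mono occ_mono) auto

lemma R_upto_le_R: "R_upto k T v x <= R k v x"
	unfolding R_upto_def R_def by (intro nn_integral_mono occ_mono) auto

lemma occ_path_measurable:
	assumes "rate k" "v \<in> smeas" "w \<in> paths X"
	shows "(%t. ennreal (M k t w) * v (Y t w) * indicator (before s) t) \<in> bmeas"
proof -
	note [measurable] = measurable_Y_path[OF assms(3)] path_measurable[OF assms(1,3)] assms(2)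
	show ?thesis by measurable
qed

lemma occ_add:
	assumes "rate k" "v \<in> smeas" "v' \<in> smeas" "w \<in> paths X"
	shows "occ k (%z. v z + v' z) s w = occ k v s w + occ k v' s w"
	unfolding occ_def using occ_path_measurable[OF assms(1,2,4)] occ_path_measurable[OF assms(1,3,4)]
	by (simp add: distrib_left distrib_right nn_integral_add)

lemma occ_cmult:
	assumes "rate k" "v \<in> smeas" "w \<in> paths X"
	shows "occ k (%z. c * v z) s w = c * occ k v s w"
proof -
	have "occ k (%z. c * v z) s w = (Leb (%t. c * (ennreal (M k t w) * v (Y t w) * indicator (before s) t)))"
		unfolding occ_def by (intro nn_integral_cong) (simp add: mult_ac)
	thus ?thesis
		unfolding occ_def using occ_path_measurable[OF assms] by (simp add: nn_integral_cmult)
qed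

lemma occ_measurable_P:
	"rate k ==> v \<in> smeas ==> T \<in> hmeas ==>
		(%w. occ k v (T w) w) \<in> borel_measurable (P x)"
	unfolding measurable_P_iff by (rule occ_measurable) auto

lemma R_add:
	assumes "rate k" "v \<in> smeas" "v' \<in> smeas"
	shows "R k (%z. v z + v' z) x = R k v x + R k v' x"
proof -
	have "R k (%z. v z + v' z) x = (EE x (%w. occ k v \<infinity> w + occ k v' \<infinity> w))"
		unfolding R_def by (intro nn_integral_cong) (simp add: occ_add[OF assms])
	thus ?thesis unfolding R_def
		using occ_measurable_P[OF assms(1,2)] occ_measurable_P[OF assms(1,3)] by (simp add: nn_integral_add)
qed

lemma R_cmult:
	assumes "rate k" "v \<in> smeas"
	shows "R k (%z. c * v z) x = c * R k v x"
proof -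
	have "R k (%z. c * v z) x = (EE x (%w. c * occ k v \<infinity> w))"
		unfolding R_def by (intro nn_integral_cong) (simp add: occ_cmult[OF assms])
	thus ?thesis unfolding R_def
		using occ_measurable_P[OF assms] by (simp add: nn_integral_cmult)
qed

lemma occ_SUP:
	assumes "rate k" "!!i::nat. v i \<in> smeas" "incseq v" "w \<in> paths X"
	shows "occ k (%z. SUP i. v i z) s w = (SUP i. occ k (v i) s w)"
proof -
	have "occ k (%z. SUP i. v i z) s w = (Leb (%t. (SUP i. ennreal (M k t w) * v i (Y t w) * indicator (before s) t)))"
		unfolding occ_def by (simp add: SUP_mult_left_ennreal SUP_mult_right_ennreal)
	also have "... = (SUP i. occ k (v i) s w)"
		unfolding occ_def
		by (rule nn_integral_monotone_convergence_SUP)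
			(use occ_path_measurable[OF assms(1,2,4)] assms(3) in
				"auto simp: incseq_def le_fun_def intro!: mult_right_mono mult_left_mono")
	finally show ?thesis .
qed

lemma M_le_exp:
	assumes "rate k" "!!z. \<alpha> <= k z" "0 <= \<alpha>" "w \<in> paths X" "0 <= t"
	shows "M k t w <= exp (- \<alpha> * t)"
	using M_antimono_rate[OF rate_const[OF assms(3)] assms(1,4), of t] assms(2) M_const[OF assms(5)] by simp

text \<open>A rate bounded below by \<open>\<alpha>\<close> makes the survival weight decay
  exponentially; this is the source of all finiteness needed for cancellation.\<close>

lemma R_bound:
	assumes k: "rate k" "!!z. \<alpha> <= k z" "0 < \<alpha>" and v: "!!z. v z <= ennreal c" and c: "0 <= c"
	shows "R k v x <= ennreal (c / \<alpha>)"
proof -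
	have "occ k v \<infinity> w <= ennreal (c / \<alpha>)" if w: "w \<in> paths X" for w
	proof -
		have "occ k v \<infinity> w <= (Leb (%t. ennreal c * (ennreal (exp (- \<alpha> * t)) * indicator {0..} t)))"
			unfolding occ_def
		proof (rule nn_integral_mono)
			fix t :: real
			show "ennreal (M k t w) * v (Y t w) * indicator (before \<infinity>) t <=
				ennreal c * (ennreal (exp (- \<alpha> * t)) * indicator {0..} t)"
				using M_le_exp[OF k(1,2) _ w, of t] k(3) v[of "Y t w"]
				by (cases "0 <= t") (auto simp: mult.commute[of "ennreal c"] intro!: mult_mono ennreal_leI)
		qed
		also have "... = ennreal c * ennreal (1 / \<alpha>)"
			using nn_integral_exp_decay[OF k(3)] by (subst nn_integral_cmult) auto
		also have "... = ennreal (c / \<alpha>)" using c k(3) by (simp add: ennreal_mult[symmetric])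
		finally show ?thesis .
	qed
	hence "R k v x <= (EE x (%w. ennreal (c / \<alpha>)))"
		unfolding R_def by (intro nn_integral_mono) auto
	also have "... = ennreal (c / \<alpha>)" using P.emeasure_space_1[of x] by simp
	finally show ?thesis .
qed

lemma R_antimono_rate:
	assumes "rate k" "rate k'" "!!z. k z <= k' z" "v \<in> smeas"
	shows "R k' v x <= R k v x"
	using resolvent_equation(1)[OF assms, of x] by simp

lemma AE_None: "AE w in P None. \<forall>t\<ge>0. pos X t w = None"
	using AE_start[of None] AE_space by eventually_elim (auto intro: pos_None)

lemma R_None: "v None = 0 ==> R k v None = 0"
proof -
	assume v: "v None = 0"
	have "AE w in P None. occ k v \<infinity> w = 0"
		using AE_None by eventually_elim (auto simp: occ_def v intro!: nn_integral_zero')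
	hence "R k v None = (EE None (%w. 0))" unfolding R_def by (rule nn_integral_cong_AE)
	thus ?thesis by simp
qed

lemma expect_eq: "expect X x F = (EE (Some x) (%w. F w))"
	by (simp add: expect_def nn_integral_completion)

lemma resolvent_eq_R:
	assumes "0 <= \<alpha>"
	shows "resolvent X \<alpha> f x = R (%_. \<alpha>) (ext0 f) (Some x)"
	unfolding resolvent_def expect_eq R_def occ_def
	by (intro nn_integral_cong) (auto simp: indicator_def M_const)

lemma stopped_measurable:
	assumes k: "rate k" and T: "T \<in> hmeas" and f: "f \<in> smeas"
	shows "(%w. ennreal (M k (enn2real (T w)) w) * indicator {w. T w < \<infinity>} w * f (pos_at X T w)) \<in> borel_measurable (P x)"
proof -
	note [measurable] = T f measurable_pos_at[OF T] M_measurable[OF k]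
	show ?thesis unfolding measurable_P_iff by measurable
qed

lemma stopped_add:
	assumes "rate k" "T \<in> hmeas" "f \<in> smeas" "f' \<in> smeas"
	shows "stopped k T (%z. f z + f' z) x = stopped k T f x + stopped k T f' x"
	unfolding stopped_def
	using stopped_measurable[OF assms(1,2,3)] stopped_measurable[OF assms(1,2,4)]
	by (simp add: distrib_left nn_integral_add)

lemma stopped_cmult:
	assumes "rate k" "T \<in> hmeas" "f \<in> smeas"
	shows "stopped k T (%z. c * f z) x = c * stopped k T f x"
proof -
	have "stopped k T (%z. c * f z) x = (EE x (%w. c * (ennreal (M k (enn2real (T w)) w) * indicator {w. T w < \<infinity>} w * f (pos_at X T w))))"
		unfolding stopped_def by (intro nn_integral_cong) (simp add: mult_ac)
	thus ?thesis
		unfolding stopped_def using stopped_measurable[OF assms] by (simp add: nn_integral_cmult)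
qed

lemma stopped_mono: "(!!z. f z <= f' z) ==> stopped k T f x <= stopped k T f' x"
	unfolding stopped_def by (intro nn_integral_mono mult_left_mono) auto

lemma stopped_bound:
	assumes "rate k" "!!z. f z <= c"
	shows "stopped k T f x <= c"
proof -
	have "stopped k T f x <= (EE x (%w. c))"
		unfolding stopped_def
	proof (rule nn_integral_mono)
		fix w
		have "ennreal (M k (enn2real (T w)) w) * indicator {w. T w < \<infinity>} w * f (pos_at X T w) <= 1 * 1 * c"
			using M_le_1[OF assms(1)] assms(2)
			by (intro mult_mono) (auto simp: indicator_def)
		thus "ennreal (M k (enn2real (T w)) w) * indicator {w. T w < \<infinity>} w * f (pos_at X T w) <= c" by simp
	qed
	thus ?thesis using P.emeasure_space_1[of x] by simp
qed

subsection \<open>The generator\<close>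

lemma transition_nn:
	assumes f: "f \<in> bmeas" and b: "!!x. 0 <= f x" "!!x. f x <= B" and t: "0 <= t"
	shows "(EE z (%w. enn0 f (pos X t w))) = ext0 (%x. ennreal (transition X t f x)) z"
proof (cases z)
	case None
	have "AE w in P None. enn0 f (pos X t w) = 0"
		using AE_None by eventually_elim (use t in simp)
	hence "(EE None (%w. enn0 f (pos X t w))) = (EE None (%w. 0))"
		by (rule nn_integral_cong_AE)
	thus ?thesis using None by simp
next
	case (Some x)
	have [measurable]: "pos X t \<in> H \<rightarrow>\<^sub>M state_alg" using t by (intro measurable_pos) auto
	note [measurable] = measurable_ext0[OF f]
	have B: "0 <= B" using b[of x] by linarith
	have e: "\<bar>ext0 f z\<bar> <= B" "0 <= ext0 f z" for z using b B by (cases z; auto)+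
	have "integrable (P (Some x)) (%w. ext0 f (pos X t w))"
		by (rule P.integrable_const_bound[where B = B]) (use e in "auto simp: measurable_P_iff")
	hence "(EE (Some x) (%w. ennreal (ext0 f (pos X t w)))) = ennreal (transition X t f x)"
		unfolding transition_def by (rule nn_integral_eq_integral) (use e in auto)
	moreover have "ennreal (ext0 f z) = enn0 f z" for z by (cases z) auto
	ultimately show ?thesis using Some by simp
qed

text \<open>The occupation after time \<open>h\<close> is an integral of \<open>F\<close> at times
  \<open>s + h\<close>; the Markov property at time \<open>s\<close> replaces it by the semigroup at
  time \<open>h\<close> applied to \<open>F\<close>, read at time \<open>s\<close>.\<close>

lemma R_const_semigroup:
	assumes l: "0 < l" and F[measurable]: "F \<in> smeas" and h: "0 <= h"
	shows "R (%_. l) F x = (EE x (%w. occ (%_. l) F (ennreal h) w)) +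
		ennreal (exp (- l * h)) * R (%_. l) (%z. \<integral>\<^sup>+w. F (pos X h w) \<partial>P z) x"
proof -
	have k: "rate (%_ :: 'a option. l)" using l by (intro rate_const) simp
	have [measurable]: "pos X h \<in> H \<rightarrow>\<^sub>M state_alg" using h by (intro measurable_pos) auto
	have FX: "(%w. F (pos X h w)) \<in> hmeas" by measurable
	have "R (%_. l) (%z. \<integral>\<^sup>+w. F (pos X h w) \<partial>P z) x =
		(EE x (%w. (Leb (%s. indicator {0..} s * (ennreal (exp (- l * s)) * (EE (Y s w) (%w'. F (pos X h w'))))))))"
		unfolding R_def occ_def by (intro nn_integral_cong) (auto simp: indicator_def M_const)
	also have "... = (EE x (%w. (Leb (%s. indicator {0..} s * (ennreal (exp (- l * s)) * F (pos X h (shift X (max 0 s) w)))))))"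
		by (rule markov_integrated[symmetric]) (auto intro: FX)
	finally have A: "R (%_. l) (%z. \<integral>\<^sup>+w. F (pos X h w) \<partial>P z) x = ..." .
	have [measurable]: "(%w. \<integral>\<^sup>+s. indicator {0..} s * (ennreal (exp (- l * s)) * F (pos X h (shift X (max 0 s) w))) \<partial>lborel) \<in> borel_measurable (P x)"
	proof -
		have [measurable]: "(%p. F (pos X h (shift X (max 0 (snd p)) (fst p)))) \<in> borel_measurable (H \<Otimes>\<^sub>M lborel)"
			by (rule measurable_compose[OF _ FX]) measurable
		show ?thesis unfolding measurable_P_iff
			by (rule sigma_finite_measure.borel_measurable_nn_integral[OF sigma_finite_lborel])
				(simp add: case_prod_beta')
	qed
	have "R (%_. l) F x = (EE x (%w. occ (%_. l) F (ennreal h) w + ennreal (exp (- l * h)) *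
		(Leb (%s. indicator {0..} s * (ennreal (exp (- l * s)) * F (pos X h (shift X (max 0 s) w)))))))"
		unfolding R_def
	proof (rule nn_integral_cong)
		fix w assume "w \<in> space (P x)"
		hence w: "w \<in> paths X" by simp
		have "occ (%_. l) F \<infinity> (shift X h w) =
			(Leb (%s. indicator {0..} s * (ennreal (exp (- l * s)) * F (pos X h (shift X (max 0 s) w)))))"
			unfolding occ_def
			by (intro nn_integral_cong)
				(auto simp: indicator_def M_const pos_shift[OF w] h add.commute)
		thus "occ (%_. l) F \<infinity> w = occ (%_. l) F (ennreal h) w + ennreal (exp (- l * h)) *
			(Leb (%s. indicator {0..} s * (ennreal (exp (- l * s)) * F (pos X h (shift X (max 0 s) w)))))"
			using occ_shift[OF k F w h] by (simp add: M_const h)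
	qed
	also have "... = (EE x (%w. occ (%_. l) F (ennreal h) w)) + ennreal (exp (- l * h)) *
		 (EE x (%w. (Leb (%s. indicator {0..} s * (ennreal (exp (- l * s)) * F (pos X h (shift X (max 0 s) w)))))))"
		using occ_measurable_P[OF k F, of "%_. ennreal h" x] by (simp add: nn_integral_add nn_integral_cmult)
	finally show ?thesis by (simp add: A)
qed

text \<open>The mean occupation up to \<open>h\<close> is the integral over \<open>[0, h]\<close> of
  \<open>q\<close>, which tends to \<open>f x\<close> at 0, so its average does as well.\<close>

lemma occ_initial_bounds:
	assumes l: "0 < l" and f: "f \<in> bmeas" "!!x. 0 <= f x" "!!x. f x <= B"
		and lim: "((%t. transition X t f x) \<longlongrightarrow> f x) (at_right 0)"
	shows "((%h. enn2real (EE (Some x) (%w. occ (%_. l) (enn0 f) (ennreal h) w)) / h) \<longlongrightarrow> f x) (at_right 0)"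
proof -
	let ?F = "enn0 f"
	define q where "q t = exp (- l * t) * transition X t f x" for t
	have k: "rate (%_ :: 'a option. l)" using l by (intro rate_const) simp
	have Fm [measurable]: "?F \<in> smeas" using f(1) by (intro measurable_ext0) measurable
	have O: "(EE (Some x) (%w. occ (%_. l) ?F (ennreal h) w)) = (Leb (%t. ennreal (q t) * indicator {0..<h} t))" for h
	proof -
		interpret pair_sigma_finite lborel "P (Some x)" by unfold_locales
		have s: "sets (lborel \<Otimes>\<^sub>M P (Some x)) = sets (borel \<Otimes>\<^sub>M H)" by (intro sets_pair_measure_cong) auto
		have "(%p. ennreal (exp (- l * fst p)) * ?F (Y (fst p) (snd p)) * indicator {0..<h} (fst p)) \<in> borel_measurable (borel \<Otimes>\<^sub>M H)"
			by measurable
		hence m: "(%(t, w). ennreal (exp (- l * t)) * ?F (Y t w) * indicator {0..<h} t) \<in> borel_measurable (lborel \<Otimes>\<^sub>M P (Some x))"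
			unfolding case_prod_beta' using measurable_cong_sets[OF s refl] by blast
		have "(EE (Some x) (%w. occ (%_. l) ?F (ennreal h) w)) =
			(EE (Some x) (%w. (Leb (%t. ennreal (exp (- l * t)) * ?F (Y t w) * indicator {0..<h} t))))"
			unfolding occ_def
			by (intro nn_integral_cong) (auto simp: indicator_def M_const ennreal_less_iff)
		also have "... = (Leb (%t. (EE (Some x) (%w. ennreal (exp (- l * t)) * ?F (Y t w) * indicator {0..<h} t))))"
			by (rule Fubini'[OF m])
		also have "... = (Leb (%t. ennreal (q t) * indicator {0..<h} t))"
		proof (rule nn_integral_cong)
			fix t :: real
			have [measurable]: "(%w. ?F (Y t w)) \<in> borel_measurable (P (Some x))"
				unfolding measurable_P_iff by measurable
			have "(EE (Some x) (%w. ennreal (exp (- l * t)) * ?F (Y t w) * indicator {0..<h} t)) =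
				ennreal (exp (- l * t)) * (EE (Some x) (%w. ?F (Y t w))) * indicator {0..<h} t"
				by (simp add: nn_integral_cmult nn_integral_multc)
			thus "(EE (Some x) (%w. ennreal (exp (- l * t)) * ?F (Y t w) * indicator {0..<h} t)) = ennreal (q t) * indicator {0..<h} t"
				using transition_nn[OF f, of t "Some x"]
				by (cases "0 <= t") (auto simp: q_def ennreal_mult')
		qed
		finally show ?thesis .
	qed
	have "((%t. exp (- l * t) * transition X t f x) \<longlongrightarrow> exp (- l * 0) * f x) (at_right 0)"
		by (intro tendsto_intros lim)
	hence q: "(q \<longlongrightarrow> f x) (at_right 0)" by (simp add: q_def[abs_def])
	show ?thesis
	proof (rule tendstoI)
		fix e :: real assume e: "0 < e"
		hence "eventually (%t. dist (q t) (f x) < e / 2) (at_right 0)" using tendstoD[OF q, of "e/2"] by simp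
		then obtain b where b: "0 < b" "!!t. 0 < t ==> t < b ==> dist (q t) (f x) < e / 2"
			by (auto simp: eventually_at_right_field)
		show "eventually (%h. dist (enn2real (EE (Some x) (%w. occ (%_. l) ?F (ennreal h) w)) / h) (f x) < e) (at_right 0)"
			unfolding eventually_at_right_field
		proof (intro exI[of _ b] conjI b(1) allI impI)
			fix h assume h: "0 < h" "h < b"
			have AE0: "AE t in lborel. t ~= (0::real)" by (rule AE_lborel_singleton)
			have qb: "q t <= f x + e / 2" "f x - e / 2 <= q t" if "0 <= t" "t ~= 0" "t < h" for t
			proof -
				have "\<bar>q t - f x\<bar> < e / 2" using b(2)[of t] h that by (simp add: dist_real_def)
				thus "q t <= f x + e / 2" "f x - e / 2 <= q t" by linarith+
			qed
			have 1: "(Leb (%t. ennreal (q t) * indicator {0..<h} t)) <= ennreal ((f x + e / 2) * h)"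
			proof -
				have "(Leb (%t. ennreal (q t) * indicator {0..<h} t)) <= (Leb (%t. ennreal (f x + e / 2) * indicator {0..<h} t))"
					using AE0 by (intro nn_integral_mono_AE, eventually_elim)
						(use qb in "auto simp: indicator_def intro!: ennreal_leI")
				also have "... = ennreal ((f x + e / 2) * h)"
					using h f(2)[of x] e by (simp add: nn_integral_cmult_indicator ennreal_mult)
				finally show ?thesis .
			qed
			have 2: "ennreal ((f x - e / 2) * h) <= (Leb (%t. ennreal (q t) * indicator {0..<h} t))"
			proof -
				have "ennreal ((f x - e / 2) * h) = (Leb (%t. ennreal (f x - e / 2) * indicator {0..<h} t))"
					using h by (simp add: nn_integral_cmult_indicator ennreal_mult'')
				also have "... <= (Leb (%t. ennreal (q t) * indicator {0..<h} t))"
					using AE0 by (intro nn_integral_mono_AE, eventually_elim)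
						(use qb in "auto simp: indicator_def intro!: ennreal_leI")
				finally show ?thesis .
			qed
			let ?o = "enn2real (Leb (%t. ennreal (q t) * indicator {0..<h} t))"
			have fin: "(Leb (%t. ennreal (q t) * indicator {0..<h} t)) < \<infinity>" using 1 by (simp add: le_less_trans)
			have pos: "0 <= (f x + e / 2) * h" using f(2)[of x] e h by simp
			have o1: "?o <= (f x + e / 2) * h" using enn2real_mono[OF 1] pos by simp
			have o2: "(f x - e / 2) * h <= ?o"
				using enn2real_mono[OF 2] fin by (cases "0 <= (f x - e / 2) * h") (auto intro: order_trans[OF _ enn2real_nonneg])
			have "?o / h <= f x + e / 2" "f x - e / 2 <= ?o / h"
				using o1 o2 h by (simp_all add: pos_divide_le_eq pos_le_divide_eq)
			hence "\<bar>?o / h - f x\<bar> <= e / 2" by linarith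
			thus "dist (enn2real (EE (Some x) (%w. occ (%_. l) ?F (ennreal h) w)) / h) (f x) < e"
				unfolding O dist_real_def using e by simp
		qed
	qed
qed

lemma has_generator_pointwise:
	assumes "has_generator X f g"
	shows "((%t. (transition X t f x - f x) / t) \<longlongrightarrow> g x) (at_right 0)"
proof -
	have "uniform_limit UNIV (%t x. (transition X t f x - f x) / t) g (at_right 0)"
		using assms by (simp add: has_generator_def)
	from tendsto_uniform_limitI[OF this UNIV_I] show ?thesis .
qed

lemma has_generator_unique:
	assumes "has_generator X f g" "has_generator X f g'"
	shows "g = g'"
proof
	fix x
	have "((%t. (transition X t f x - f x) / t) \<longlongrightarrow> g x) (at_right 0)"
		"((%t. (transition X t f x - f x) / t) \<longlongrightarrow> g' x) (at_right 0)"
		using assms by (intro has_generator_pointwise; simp)+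
	thus "g x = g' x" by (intro tendsto_unique[of "at_right 0"]) auto
qed

lemma gen_eqI: "has_generator X f g ==> gen X f = g"
	unfolding gen_def by (rule the_equality) (auto intro: has_generator_unique)

lemma has_generator_gen: "f \<in> gen_dom X ==> has_generator X f (gen X f)"
	unfolding gen_dom_def using gen_eqI by auto

lemma has_generator_tendsto:
	assumes "has_generator X f g"
	shows "((%t. (transition X t f x - f x) / t) \<longlongrightarrow> g x) (at_right 0)"
		and "((%t. transition X t f x) \<longlongrightarrow> f x) (at_right 0)"
proof -
	show *: "((%t. (transition X t f x - f x) / t) \<longlongrightarrow> g x) (at_right 0)"
		by (rule has_generator_pointwise[OF assms])
	have "((%t. (transition X t f x - f x) / t * t + f x) \<longlongrightarrow> g x * 0 + f x) (at_right 0)"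
		by (intro tendsto_intros *)
	hence "((%t. (transition X t f x - f x) / t * t + f x) \<longlongrightarrow> f x) (at_right 0)" by simp
	thus "((%t. transition X t f x) \<longlongrightarrow> f x) (at_right 0)"
		by (rule Lim_transform_eventually) (auto simp: eventually_at_right_field intro!: exI[of _ 1])
qed

lemma transition_range:
	assumes f: "f \<in> bmeas" and b: "!!x. 0 <= f x" "!!x. f x <= B" and t: "0 <= t"
	shows "0 <= transition X t f x" "transition X t f x <= B"
proof -
	have B: "0 <= B" using b[of x] by linarith
	have e: "0 <= ext0 f z" for z using b by (cases z) auto
	show "0 <= transition X t f x" unfolding transition_def by (rule integral_nonneg_AE) (simp add: e)
	have "ennreal (transition X t f x) <= (EE (Some x) (%w. ennreal B))"
		unfolding transition_nn[OF f b t, of "Some x", simplified, symmetric]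
	proof (rule nn_integral_mono)
		show "enn0 f (pos X t w) <= ennreal B" for w
			using b by (cases "pos X t w") (auto intro: ennreal_leI)
	qed
	thus "transition X t f x <= B" using B P.emeasure_space_1[of "Some x"] by simp
qed

lemma transition_borel:
	assumes f: "f \<in> bmeas" and b: "!!x. 0 <= f x" "!!x. f x <= B" and t: "0 <= t"
	shows "transition X t f \<in> bmeas"
proof -
	have [measurable]: "pos X t \<in> H \<rightarrow>\<^sub>M state_alg" using t by (intro measurable_pos) auto
	have [measurable]: "enn0 f \<in> smeas"
		using f by (intro measurable_ext0) measurable
	have "(%w. enn0 f (pos X t w)) \<in> hmeas" by measurable
	from measurable_compose[OF measurable_Some measurable_nn_integral_P[OF this]]
	have "(%x. enn2real (EE (Some x) (%w. enn0 f (pos X t w)))) \<in> bmeas"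
		by measurable
	thus ?thesis
		using transition_nn[OF f b t] transition_range[OF f b t] by simp
qed

text \<open>
	With \<open>g = \<A>f\<close> this says \<open>f = R\<^sub>l (l f - g)\<close>; positive and negative parts of \<open>g\<close> are kept apart so that all
	terms are nonnegative. It is obtained by applying \<open>R\<^sub>l\<close> to \<open>(P\<^sub>h f - f) / h\<close> and letting \<open>h\<close> tend to 0.
\<close>

lemma generator_resolvent_const:
	assumes gen: "has_generator X f g" and f0: "!!x. 0 <= f x" and l: "0 < l"
	shows "enn0 f z + R (%_. l) (enn0 g) z =
		R (%_. l) (%z. ennreal l * enn0 f z + ext0 (%x. ennreal (- g x)) z) z"
proof (cases z)
	case None
	thus ?thesis by (simp add: R_None)
next
	case (Some x)
	let ?F = "enn0 f" and ?gp = "enn0 g" and ?gm = "ext0 (%x. ennreal (- g x))"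
	let ?R = "R (%_. l)"
	have k: "rate (%_ :: 'a option. l)" using l by (intro rate_const) simp
	have C0: "f \<in> C0" "g \<in> C0" using gen by (auto simp: has_generator_def)
	note [measurable] = C0_measurable[OF C0(1)] C0_measurable[OF C0(2)]
	have [measurable]: "?F \<in> smeas" "?gp \<in> smeas" "?gm \<in> smeas"
		by (intro measurable_ext0; measurable)+
	obtain B where B: "!!x. \<bar>f x\<bar> <= B" using C0_bounded[OF C0(1)] by blast
	obtain B' where B': "!!x. \<bar>g x\<bar> <= B'" using C0_bounded[OF C0(2)] by blast
	have B0: "0 <= B" "0 <= B'" using B[of x] B'[of x] by linarith+
	have fB: "f x <= B" for x using B[of x] by linarith
	have bF: "?F z <= ennreal B" "?gp z <= ennreal B'" "?gm z <= ennreal B'" for z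
		using B B' by (cases z; auto intro!: ennreal_leI simp: abs_le_iff)+
	have Rfin: "?R v z < \<infinity>" if "!!z. v z <= ennreal c" "0 <= c" for v c z
		by (rule le_less_trans[OF R_bound[OF k order_refl l that]]) auto
	define a b c where "a = enn2real (?R ?F z)" and "b = enn2real (?R ?gp z)" and "c = enn2real (?R ?gm z)"
	have abc: "?R ?F z = ennreal a" "?R ?gp z = ennreal b" "?R ?gm z = ennreal c"
		unfolding a_def b_def c_def using Rfin[OF bF(1) B0(1)] Rfin[OF bF(2) B0(2)] Rfin[OF bF(3) B0(2)] by auto
	have abc0: "0 <= a" "0 <= b" "0 <= c" by (auto simp: a_def b_def c_def)
	define p where "p h = enn2real (EE z (%w. occ (%_. l) ?F (ennreal h) w))" for h
	have plim: "((%h. p h / h) \<longlongrightarrow> f x) (at_right 0)"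
		unfolding p_def Some
		by (rule occ_initial_bounds[OF l _ f0 fB has_generator_tendsto(2)[OF gen]]) measurable
	\<comment> \<open>\<open>D h\<close> is the resolvent at \<open>l\<close> of
	  \<open>(P\<^sub>h f - f) / h - g\<close>, rewritten by \<open>R_const_semigroup\<close> so that
	  its limit can be read off.\<close>
	define D where "D h = (exp (l * h) - 1) / h * a - exp (l * h) * (p h / h) + c - b" for h
	have Dlim: "(D \<longlongrightarrow> l * a - f x + c - b) (at_right 0)"
	proof -
		have "((%h. (exp (l * h) - 1) / h) \<longlongrightarrow> l) (at 0)"
		proof -
			have "((%h. exp (l * h)) has_real_derivative l) (at 0)"
				by (auto intro!: derivative_eq_intros)
			thus ?thesis by (simp add: has_field_derivative_iff)
		qed
		hence 1: "((%h. (exp (l * h) - 1) / h) \<longlongrightarrow> l) (at_right 0)"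
			by (rule filterlim_mono) (auto simp: at_le)
		have "(D \<longlongrightarrow> l * a - exp (l * 0) * f x + c - b) (at_right 0)"
			unfolding D_def by (intro tendsto_intros 1 plim)
		thus ?thesis by simp
	qed
	\<comment> \<open>Uniform convergence makes the integrand at most \<open>e\<close> in absolute
	  value for small \<open>h\<close>, and the resolvent of the constant 1 is at most
	  \<open>1 / l\<close>. As \<open>e\<close> is arbitrary, the limit of \<open>D\<close> is
	  0.\<close>
	have bound: "\<bar>l * a - f x + c - b\<bar> <= e / l" if e: "0 < e" for e
	proof (rule tendsto_upperbound)
		show "((%h. \<bar>D h\<bar>) \<longlongrightarrow> \<bar>l * a - f x + c - b\<bar>) (at_right 0)"
			by (intro tendsto_rabs Dlim)
		have "eventually (%h. \<forall>x\<in>UNIV. dist ((transition X h f x - f x) / h) (g x) < e) (at_right 0)"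
			using gen e unfolding has_generator_def uniform_limit_iff by blast
		moreover have "eventually (%h::real. 0 < h) (at_right 0)" by (rule eventually_at_right_less)
		ultimately show "eventually (%h. \<bar>D h\<bar> <= e / l) (at_right 0)"
		proof eventually_elim
			case (elim h)
			hence h: "0 < h" and d: "!!x. dist ((transition X h f x - f x) / h) (g x) < e" by auto
			define T where "T x = transition X h f x" for x
			have T: "0 <= T x" "T x <= B" "T \<in> bmeas" for x
				unfolding T_def using h by (auto intro!: transition_range[OF _ f0 fB] transition_borel[OF _ f0 fB])
			have close: "\<bar>T x - f x - h * g x\<bar> <= e * h" for x
			proof -
				have "T x - f x - h * g x = h * ((T x - f x) / h - g x)" using h by (simp add: field_simps)
				hence "\<bar>T x - f x - h * g x\<bar> = h * \<bar>(T x - f x) / h - g x\<bar>" using h by (simp add: abs_mult)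
				also have "... <= h * e" using d[of x] h by (intro mult_left_mono) (auto simp: dist_real_def T_def)
				finally show ?thesis by (simp add: mult.commute)
			qed
			let ?T = "enn0 T"
			note [measurable] = T(3)
			have [measurable]: "?T \<in> smeas" by (intro measurable_ext0) measurable
			define w where "w = enn2real (?R ?T z)"
			have bT: "?T z <= ennreal B" for z using T by (cases z) (auto intro: ennreal_leI)
			have w: "?R ?T z = ennreal w" "0 <= w" unfolding w_def using Rfin[OF bT B0(1)] by auto
			have pt: "(%z. \<integral>\<^sup>+w. ?F (pos X h w) \<partial>P z) = ?T"
				unfolding T_def using h by (intro ext transition_nn[OF _ f0 fB]) auto
			have "ennreal a = (EE z (%w. occ (%_. l) ?F (ennreal h) w)) + ennreal (exp (- l * h)) * ennreal w"
				using R_const_semigroup[OF l _ less_imp_le[OF h], of ?F z] w by (simp add: pt abc)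
			moreover have "(EE z (%w. occ (%_. l) ?F (ennreal h) w)) = ennreal (p h)"
			proof -
				have "(EE z (%w. occ (%_. l) ?F (ennreal h) w)) <= ?R ?F z"

					using R_upto_le_R[where T = "%_. ennreal h" and k = "%_. l" and v = ?F and x = z]
					by (simp add: R_upto_def)
				thus ?thesis unfolding p_def using Rfin[OF bF(1) B0(1)] by (simp add: le_less_trans)
			qed
			moreover have "0 <= p h" by (simp add: p_def)
			ultimately have "ennreal a = ennreal (p h + exp (- l * h) * w)"
				using w(2) by (simp add: ennreal_mult' ennreal_plus)
			hence aw: "a = p h + exp (- l * h) * w"
				using abc0(1) w(2) \<open>0 <= p h\<close> by (subst (asm) ennreal_inj) auto
			hence "exp (l * h) * a = exp (l * h) * p h + (exp (l * h) * exp (- l * h)) * w"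
				by (simp add: algebra_simps)
			hence wa: "w = exp (l * h) * (a - p h)" by (simp add: exp_minus algebra_simps)
			have split: "ennreal (max u 0) = ennreal u" for u :: real by (simp add: max_def ennreal_neg)
			have upper: "w + h * c <= a + h * b + e * h / l"
			proof -
				have "?T z + ennreal h * ?gm z <= (?F z + ennreal h * ?gp z) + ennreal (e * h)" for z
				proof (cases z)
					case (Some y)
					have "T y + h * max (- g y) 0 <= f y + h * max (g y) 0 + e * h"
						using close[of y] h by (auto simp: max_def abs_le_iff algebra_simps)
					hence "ennreal (T y + h * max (- g y) 0) <= ennreal (f y + h * max (g y) 0 + e * h)"
						by (rule ennreal_leI)
					thus ?thesis using Some T f0 h e
						by (simp add: ennreal_plus ennreal_mult' split)
				qed simp
				hence "?R (%z. ?T z + ennreal h * ?gm z) z <= ?R (%z. (?F z + ennreal h * ?gp z) + ennreal (e * h)) z"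
					by (rule R_mono)
				also have "... = ?R ?F z + ennreal h * ?R ?gp z + ?R (%_. ennreal (e * h)) z"
					by (simp add: R_add[OF k] R_cmult[OF k])
				also have "?R (%_. ennreal (e * h)) z <= ennreal (e * h / l)"
					using e h by (intro R_bound[OF k order_refl l]) auto
				also have "?R (%z. ?T z + ennreal h * ?gm z) z = ?R ?T z + ennreal h * ?R ?gm z"
					by (simp add: R_add[OF k] R_cmult[OF k])
				finally have "ennreal w + ennreal h * ennreal c <= ennreal a + ennreal h * ennreal b + ennreal (e * h / l)"
					unfolding abc w(1) by (simp add: add_left_mono)
				hence "ennreal (w + h * c) <= ennreal (a + h * b + e * h / l)"
					using abc0 w(2) h e l by (simp add: ennreal_plus ennreal_mult')
				thus ?thesis using abc0 h e l by (subst (asm) ennreal_le_iff) auto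
			qed
			have lower: "a + h * b <= w + h * c + e * h / l"
			proof -
				have "?F z + ennreal h * ?gp z <= (?T z + ennreal h * ?gm z) + ennreal (e * h)" for z
				proof (cases z)
					case (Some y)
					have "f y + h * max (g y) 0 <= T y + h * max (- g y) 0 + e * h"
						using close[of y] h by (auto simp: max_def abs_le_iff algebra_simps)
					hence "ennreal (f y + h * max (g y) 0) <= ennreal (T y + h * max (- g y) 0 + e * h)"
						by (rule ennreal_leI)
					thus ?thesis using Some T f0 h e
						by (simp add: ennreal_plus ennreal_mult' split)
				qed simp
				hence "?R (%z. ?F z + ennreal h * ?gp z) z <= ?R (%z. (?T z + ennreal h * ?gm z) + ennreal (e * h)) z"
					by (rule R_mono)
				also have "... = ?R ?T z + ennreal h * ?R ?gm z + ?R (%_. ennreal (e * h)) z"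
					by (simp add: R_add[OF k] R_cmult[OF k])
				also have "?R (%_. ennreal (e * h)) z <= ennreal (e * h / l)"
					using e h by (intro R_bound[OF k order_refl l]) auto
				also have "?R (%z. ?F z + ennreal h * ?gp z) z = ?R ?F z + ennreal h * ?R ?gp z"
					by (simp add: R_add[OF k] R_cmult[OF k])
				finally have "ennreal a + ennreal h * ennreal b <= ennreal w + ennreal h * ennreal c + ennreal (e * h / l)"
					unfolding abc w(1) by (simp add: add_left_mono)
				hence "ennreal (a + h * b) <= ennreal (w + h * c + e * h / l)"
					using abc0 w(2) h e l by (simp add: ennreal_plus ennreal_mult')
				thus ?thesis using abc0 w(2) h e l by (subst (asm) ennreal_le_iff) auto
			qed
			have "D h * h = w + h * c - a - h * b"
				unfolding D_def wa using h by (simp add: field_simps)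
			hence "\<bar>D h\<bar> * h = \<bar>w + h * c - a - h * b\<bar>" using h abs_mult[of "D h" h] by simp
			also have "... <= e / l * h" using upper lower by (simp add: abs_le_iff)
			finally show "\<bar>D h\<bar> <= e / l" using h by (rule mult_right_le_imp_le)
		qed
	qed simp
	have "l * a - f x + c - b = 0"
	proof (rule ccontr)
		assume "l * a - f x + c - b ~= 0"
		hence "\<bar>l * a - f x + c - b\<bar> <= (l * \<bar>l * a - f x + c - b\<bar> / 2) / l"
			using l by (intro bound) auto
		thus False using l \<open>l * a - f x + c - b ~= 0\<close> by simp
	qed
	hence "ennreal (f x + b) = ennreal (l * a + c)" by (intro arg_cong[where f = ennreal]) linarith
	hence "ennreal (f x) + ennreal b = ennreal l * ennreal a + ennreal c"
		using f0 abc0 l by (simp add: ennreal_plus ennreal_mult')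
	thus ?thesis
		using Some by (simp add: R_add[OF k] R_cmult[OF k] abc[unfolded Some])
qed

text \<open>Passing from constant killing to a general rate by the resolvent equation.\<close>

lemma generator_resolvent:
	assumes gen: "has_generator X f g" and f0: "!!x. 0 <= f x"
		and k: "rate k" "!!z. \<alpha> <= k z" "0 < \<alpha>"
	shows "enn0 f z + R k (enn0 g) z =
		R k (%z. ennreal (k z) * enn0 f z + ext0 (%x. ennreal (- g x)) z) z"
proof -
	let ?F = "enn0 f" and ?gp = "enn0 g" and ?gm = "ext0 (%x. ennreal (- g x))"
	obtain l where l: "!!z. k z <= l" using k(1) by (auto simp: rate_def)
	have l0: "0 < l" using l[of None] k(2)[of None] k(3) by linarith
	let ?q = "%z. ennreal (l - k z)"
	let ?R = "R (%_. l)"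
	have kl: "rate (%_ :: 'a option. l)" using l0 by (intro rate_const) simp
	have C0: "f \<in> C0" "g \<in> C0" using gen by (auto simp: has_generator_def)
	note [measurable] = C0_measurable[OF C0(1)] C0_measurable[OF C0(2)] rate_measurable[OF k(1)]
	have [measurable]: "?F \<in> smeas" "?gp \<in> smeas" "?gm \<in> smeas"
		by (intro measurable_ext0; measurable)+
	note [measurable] = R_measurable[OF kl]
	obtain B where B: "0 < B" "!!x. \<bar>f x\<bar> <= B" using C0_bounded[OF C0(1)] by blast
	have qF: "?q z * ?F z <= ennreal (l * B)" for z
	proof (cases z)
		case (Some x)
		have "(l - k z) * f x <= l * B"
			using rate_nonneg[OF k(1), of z] l[of z] B(2)[of x] f0[of x] l0 by (intro mult_mono) auto
		thus ?thesis using Some l[of z] f0 by (auto simp: ennreal_mult[symmetric] intro!: ennreal_leI)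
	qed simp
	\<comment> \<open>This term appears on both sides of the computation below and is
	  cancelled.\<close>
	have fin: "R k (%z. ?q z * ?F z) z ~= \<infinity>"
	proof -
		have "R k (%z. ?q z * ?F z) z <= ennreal (l * B / \<alpha>)"
			by (rule R_bound[OF k qF]) (use l0 B(1) in simp)
		thus ?thesis by (auto simp: top_unique)
	qed
	have base: "?F z + ?R ?gp z = ?R (%z. ennreal l * ?F z + ?gm z) z" for z
		by (rule generator_resolvent_const[OF gen f0 l0])
	have lk: "ennreal (k z) + ?q z = ennreal l" for z
		using rate_nonneg[OF k(1), of z] l[of z] by (subst ennreal_plus[symmetric]) auto
	have "R k (%z. ennreal (k z) * ?F z + ?gm z) z + R k (%z. ?q z * ?F z) z =
			R k (%z. (ennreal (k z) * ?F z + ?gm z) + ?q z * ?F z) z"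
		by (rule R_add[OF k(1), symmetric]) measurable
	also have "(%z. (ennreal (k z) * ?F z + ?gm z) + ?q z * ?F z) = (%z. ennreal l * ?F z + ?gm z)"
	proof
		show "(ennreal (k z) * ?F z + ?gm z) + ?q z * ?F z = ennreal l * ?F z + ?gm z" for z
			using arg_cong[OF lk[of z], of "%y. y * ?F z"] by (simp add: distrib_right add_ac)
	qed
	also have "R k (%z. ennreal l * ?F z + ?gm z) z = ?R (%z. ennreal l * ?F z + ?gm z) z +
			R k (%z. ?q z * ?R (%z. ennreal l * ?F z + ?gm z) z) z"
		by (rule resolvent_equation(2)[OF k(1) kl l]) measurable
	also have "... = (?F z + ?R ?gp z) + R k (%z. ?q z * ?F z + ?q z * ?R ?gp z) z"
		unfolding base[symmetric] by (simp add: distrib_left)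
	also have "R k (%z. ?q z * ?F z + ?q z * ?R ?gp z) z = R k (%z. ?q z * ?F z) z + R k (%z. ?q z * ?R ?gp z) z"
		by (rule R_add[OF k(1)]) measurable
	also have "(?F z + ?R ?gp z) + (R k (%z. ?q z * ?F z) z + R k (%z. ?q z * ?R ?gp z) z) =
		 (?F z + (?R ?gp z + R k (%z. ?q z * ?R ?gp z) z)) + R k (%z. ?q z * ?F z) z"
		by (simp add: add_ac)
	also have "?R ?gp z + R k (%z. ?q z * ?R ?gp z) z = R k ?gp z"
		by (rule resolvent_equation(2)[OF k(1) kl l, symmetric]) measurable
	finally show ?thesis using fin by (simp add: add.commute[of _ "R k (%z. ?q z * ?F z) z"] ennreal_add_left_cancel)
qed

lemma R_upto_add:
	assumes "rate k" "T \<in> hmeas" "v \<in> smeas" "v' \<in> smeas"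
	shows "R_upto k T (%z. v z + v' z) x = R_upto k T v x + R_upto k T v' x"
proof -
	have "R_upto k T (%z. v z + v' z) x = (EE x (%w. occ k v (T w) w + occ k v' (T w) w))"
		unfolding R_upto_def by (intro nn_integral_cong) (simp add: occ_add[OF assms(1,3,4)])
	thus ?thesis unfolding R_upto_def
		using occ_measurable_P[OF assms(1,3,2)] occ_measurable_P[OF assms(1,4,2)] by (simp add: nn_integral_add)
qed

lemma R_upto_cmult:
	assumes "rate k" "T \<in> hmeas" "v \<in> smeas"
	shows "R_upto k T (%z. c * v z) x = c * R_upto k T v x"
proof -
	have "R_upto k T (%z. c * v z) x = (EE x (%w. c * occ k v (T w) w))"
		unfolding R_upto_def by (intro nn_integral_cong) (simp add: occ_cmult[OF assms(1,3)])
	thus ?thesis unfolding R_upto_def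
		using occ_measurable_P[OF assms(1,3,2)] by (simp add: nn_integral_cmult)
qed

text \<open>Both sides of \<open>generator_resolvent\<close> are split at \<open>T\<close>. The
  identity itself, used at the position at \<open>T\<close>, compares the later parts; the stopped
  potential of the positive part of \<open>g\<close> is common, finite because of
  \<open>\<alpha>\<close>, and cancels.\<close>

lemma Dynkin:
	assumes gen: "has_generator X f g" and f0: "!!x. 0 <= f x"
		and k: "rate k" "!!z. \<alpha> <= k z" "0 < \<alpha>" and T: "raw_time T"
	shows "enn0 f z + R_upto k T (enn0 g) z =
		stopped k T (enn0 f) z +
		R_upto k T (%z. ennreal (k z) * enn0 f z + ext0 (%x. ennreal (- g x)) z) z"
proof -
	let ?F = "enn0 f" and ?gp = "enn0 g" and ?gm = "ext0 (%x. ennreal (- g x))"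
	let ?v = "%z. ennreal (k z) * ?F z + ?gm z"
	have C0: "f \<in> C0" "g \<in> C0" using gen by (auto simp: has_generator_def)
	note [measurable] = C0_measurable[OF C0(1)] C0_measurable[OF C0(2)] rate_measurable[OF k(1)]
	have [measurable]: "?F \<in> smeas" "?gp \<in> smeas" "?gm \<in> smeas"
		by (intro measurable_ext0; measurable)+
	obtain B where B: "0 < B" "!!x. \<bar>g x\<bar> <= B" using C0_bounded[OF C0(2)] by blast
	have bg: "?gp z <= ennreal B" for z using B by (cases z) (auto intro!: ennreal_leI simp: abs_le_iff)
	have fin: "stopped k T (R k ?gp) z ~= \<infinity>"
	proof -
		have "stopped k T (R k ?gp) z <= ennreal (B / \<alpha>)"
			by (rule stopped_bound[OF k(1)], rule R_bound[OF k bg]) (use B(1) in simp)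
		thus ?thesis by (auto simp: top_unique)
	qed
	have eq: "?F z + R k ?gp z = R k ?v z" for z by (rule generator_resolvent[OF gen f0 k])
	have "(R_upto k T ?v z + stopped k T ?F z) + stopped k T (R k ?gp) z = R_upto k T ?v z + stopped k T (R k ?v) z"
		unfolding eq[symmetric] using R_measurable[OF k(1), of ?gp]
		by (subst stopped_add[OF k(1) raw_time_measurable[OF T]]) (auto simp: add_ac)
	also have "... = R k ?v z"
		by (rule R_strong_markov[OF k(1) _ T, symmetric]) measurable
	also have "... = ?F z + R k ?gp z" by (rule eq[symmetric])
	also have "R k ?gp z = R_upto k T ?gp z + stopped k T (R k ?gp) z"
		by (rule R_strong_markov[OF k(1) _ T]) measurable
	finally have "stopped k T (R k ?gp) z + (R_upto k T ?v z + stopped k T ?F z) =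
			stopped k T (R k ?gp) z + (?F z + R_upto k T ?gp z)"
		by (simp add: add_ac)
	thus ?thesis using fin by (simp add: ennreal_add_left_cancel add.commute)
qed

end

subsection \<open>Duality of the killed processes\<close>

lemma strong_dual_resolvent:
	assumes "strong_dual m X Xh" "0 < \<alpha>" "f \<in> bmeas" "g \<in> bmeas"
	shows "(nn_integral m (%x. f x * resolvent X \<alpha> g x)) = (nn_integral m (%x. resolvent Xh \<alpha> f x * g x))"
	using assms unfolding strong_dual_def by blast

text \<open>The resolvent equation presents the killed potential as an ordinary resolvent of a
  function that contains the potential itself, the form to which strong duality applies.\<close>

lemma resolvent_killed:
	fixes X :: "('w, 'a::heine_borel) process"
	assumes X: "hunt X" and k: "rate k" "!!z. k z <= l" and l: "0 < l" and f: "f \<in> bmeas"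
	shows "hunt.R X k (ext0 f) (Some x) =
		resolvent X l (%y. f y + ennreal (l - k (Some y)) * hunt.R X k (ext0 f) (Some y)) x"
		and "(%y. f y + ennreal (l - k (Some y)) * hunt.R X k (ext0 f) (Some y)) \<in> bmeas"
proof -
	interpret hunt X by (rule X)
	let ?F = "ext0 f"
	have kl: "rate (%_ :: 'a option. l)" using l by (intro rate_const) simp
	have [measurable]: "?F \<in> smeas" using f by (intro measurable_ext0)
	note [measurable] = rate_measurable[OF k(1)] R_measurable[OF k(1)]
	have "R k ?F (Some x) = R (%_. l) ?F (Some x) + R (%_. l) (%z. ennreal (l - k z) * R k ?F z) (Some x)"
		by (rule resolvent_equation(1)[OF k(1) kl k(2)]) measurable
	also have "... = R (%_. l) (%z. ?F z + ennreal (l - k z) * R k ?F z) (Some x)"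
		by (rule R_add[OF kl, symmetric]) measurable
	also have "(%z. ?F z + ennreal (l - k z) * R k ?F z) =
			ext0 (%y. f y + ennreal (l - k (Some y)) * R k (ext0 f) (Some y))"
	proof
		show "?F z + ennreal (l - k z) * R k ?F z = ext0 (%y. f y + ennreal (l - k (Some y)) * R k (ext0 f) (Some y)) z" for z
			by (cases z) (auto simp: R_None)
	qed
	finally show "R k (ext0 f) (Some x) = resolvent X l (%y. f y + ennreal (l - k (Some y)) * R k (ext0 f) (Some y)) x"
		by (simp add: resolvent_eq_R[OF less_imp_le[OF l]])
	note [measurable] = f measurable_compose[OF measurable_Some rate_measurable[OF k(1)]]
		measurable_compose[OF measurable_Some R_measurable[OF k(1), of ?F]]
	show "(%y. f y + ennreal (l - k (Some y)) * R k (ext0 f) (Some y)) \<in> bmeas"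
		by measurable
qed

text \<open>
	Both killed resolvents solve a perturbation equation for the unkilled ones; pairing the two equations, the
	perturbation terms coincide and cancel.
\<close>

lemma killed_duality:
	fixes X :: "('w, 'a::heine_borel) process" and Xh :: "('v, 'a) process"
	assumes X: "hunt X" and Xh: "hunt Xh" and dual: "strong_dual m X Xh" and m: "sets m = sets borel"
		and k: "rate k" "!!z. \<alpha> <= k z" "0 < \<alpha>"
		and f: "f \<in> bmeas" "(nn_integral m (%x. f x)) < \<infinity>"
		and g: "g \<in> bmeas" "!!x. g x <= ennreal c" "0 <= c"
	shows "(nn_integral m (%x. f x * hunt.R X k (ext0 g) (Some x))) = (nn_integral m (%x. hunt.R Xh k (ext0 f) (Some x) * g x))"
proof -
	interpret X: hunt X by (rule X)
	interpret Xh: hunt Xh by (rule Xh)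
	obtain l where l: "!!z. k z <= l" using k(1) by (auto simp: rate_def)
	have l0: "0 < l" using l[of None] k(2)[of None] k(3) by linarith
	have lm: "f \<in> borel_measurable m" if "f \<in> bmeas" for f :: "'a => ennreal"
		using that m measurable_cong_sets[OF m refl] by blast
	define q where "q y = ennreal (l - k (Some y))" for y
	define v where "v y = X.R k (ext0 g) (Some y)" for y
	define h where "h y = Xh.R k (ext0 f) (Some y)" for y
	have [measurable]: "ext0 f \<in> smeas" "ext0 g \<in> smeas"
		using f(1) g(1) by (auto intro: measurable_ext0)
	have qm: "q \<in> bmeas" unfolding q_def
		using measurable_compose[OF measurable_Some rate_measurable[OF k(1)]] by measurable
	have vm: "v \<in> bmeas" unfolding v_def
		by (rule measurable_compose[OF measurable_Some X.R_measurable[OF k(1)]]) measurable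
	have hm: "h \<in> bmeas" unfolding h_def
		by (rule measurable_compose[OF measurable_Some Xh.R_measurable[OF k(1)]]) measurable
	note [measurable] = lm[OF f(1)] lm[OF g(1)] lm[OF qm] lm[OF vm] lm[OF hm]
	have v: "v x = resolvent X l (%y. g y + q y * v y) x" "(%y. g y + q y * v y) \<in> bmeas" for x
		unfolding v_def q_def using resolvent_killed[OF X k(1) l l0 g(1)] by blast+
	have h: "h x = resolvent Xh l (%y. f y + q y * h y) x" "(%y. f y + q y * h y) \<in> bmeas" for x
		unfolding h_def q_def using resolvent_killed[OF Xh k(1) l l0 f(1)] by blast+
	have "(nn_integral m (%x. (f x + q x * h x) * resolvent X l (%y. g y + q y * v y) x)) =
		(nn_integral m (%x. resolvent Xh l (%y. f y + q y * h y) x * (g x + q x * v x)))"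
		by (rule strong_dual_resolvent[OF dual l0 h(2) v(2)])
	hence "(nn_integral m (%x. (f x + q x * h x) * v x)) = (nn_integral m (%x. h x * (g x + q x * v x)))"
		unfolding v(1)[symmetric] h(1)[symmetric] .
	moreover have "(nn_integral m (%x. (f x + q x * h x) * v x)) = (nn_integral m (%x. f x * v x)) + (nn_integral m (%x. q x * h x * v x))"
		by (simp add: distrib_right nn_integral_add)
	moreover have "(nn_integral m (%x. h x * (g x + q x * v x))) = (nn_integral m (%x. h x * g x)) + (nn_integral m (%x. q x * h x * v x))"
		by (simp add: distrib_left nn_integral_add mult_ac)
	\<comment> \<open>The term to be cancelled is finite: \<open>q\<close> and \<open>v\<close> are
	  bounded, and \<open>h\<close> lies below the \<open>\<alpha>\<close>-resolvent of
	  \<open>f\<close>, whose integral is found by duality with the constant 1.\<close>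
	moreover have "(nn_integral m (%x. q x * h x * v x)) ~= \<infinity>"
	proof -
		have ra: "rate (%_ :: 'a option. \<alpha>)" using k(3) by (intro rate_const) simp
		have vb: "v x <= ennreal (c / \<alpha>)" for x
			unfolding v_def by (rule X.R_bound[OF k _ g(3)]) (auto simp: ext0_def g(2) split: option.splits)
		have qb: "q x <= ennreal l" for x unfolding q_def using rate_nonneg[OF k(1), of "Some x"] by (intro ennreal_leI) simp
		have hb: "h x <= resolvent Xh \<alpha> f x" for x
			unfolding h_def Xh.resolvent_eq_R[OF less_imp_le[OF k(3)]]
			by (rule Xh.R_antimono_rate[OF ra k(1,2)]) measurable
		have "(nn_integral m (%x. q x * h x * v x)) <= (nn_integral m (%x. ennreal (l * (c / \<alpha>)) * (resolvent Xh \<alpha> f x * 1)))"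
		proof (rule nn_integral_mono)
			fix x
			have "q x * h x * v x <= ennreal l * resolvent Xh \<alpha> f x * ennreal (c / \<alpha>)"
				by (intro mult_mono qb hb vb) auto
			also have "... = (ennreal l * ennreal (c / \<alpha>)) * (resolvent Xh \<alpha> f x * 1)" by (simp add: mult_ac)
			also have "ennreal l * ennreal (c / \<alpha>) = ennreal (l * (c / \<alpha>))"
				using l0 g(3) k(3) by (intro ennreal_mult[symmetric]) auto
			finally show "q x * h x * v x <= ennreal (l * (c / \<alpha>)) * (resolvent Xh \<alpha> f x * 1)" .
		qed
		also have "... = ennreal (l * (c / \<alpha>)) * (nn_integral m (%x. resolvent Xh \<alpha> f x * 1))"
		proof (rule nn_integral_cmult)
			have "(%x. Xh.R (%_. \<alpha>) (ext0 f) (Some x)) \<in> bmeas"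
				by (rule measurable_compose[OF measurable_Some Xh.R_measurable[OF ra]]) measurable
			thus "(%x. resolvent Xh \<alpha> f x * 1) \<in> borel_measurable m"
				unfolding Xh.resolvent_eq_R[OF less_imp_le[OF k(3)]] mult_1_right by (rule lm)
		qed
		also have "(nn_integral m (%x. resolvent Xh \<alpha> f x * 1)) = (nn_integral m (%x. f x * resolvent X \<alpha> (%_. 1) x))"
			by (rule strong_dual_resolvent[OF dual k(3) f(1), symmetric]) simp
		also have "... <= (nn_integral m (%x. f x * ennreal (1 / \<alpha>)))"
		proof (intro nn_integral_mono mult_left_mono)
			show "resolvent X \<alpha> (%_. 1) x <= ennreal (1 / \<alpha>)" for x
				unfolding X.resolvent_eq_R[OF less_imp_le[OF k(3)]]
				by (rule X.R_bound[OF ra order_refl k(3)]) (auto simp: ext0_def split: option.splits)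
		qed simp
		also have "... = (nn_integral m (%x. f x)) * ennreal (1 / \<alpha>)" by (rule nn_integral_multc) measurable
		finally have "(nn_integral m (%x. q x * h x * v x)) <= ennreal (l * (c / \<alpha>)) * ((nn_integral m (%x. f x)) * ennreal (1 / \<alpha>))"
			by (simp add: mult_left_mono)
		also have "... < \<infinity>" using f(2) by (simp add: ennreal_mult_less_top)
		finally show ?thesis by simp
	qed
	ultimately have "(nn_integral m (%x. f x * v x)) = (nn_integral m (%x. h x * g x))"
		by (simp add: add.commute[of _ "\<integral>\<^sup>+x. q x * h x * v x \<partial>m"] ennreal_add_left_cancel)
	thus ?thesis by (simp add: v_def h_def)
qed

section \<open>Exit times of open sets\<close>

context hunt
begin

text \<open>The first entrance into the open set where \<open>g\<close> is below \<open>e\<close>;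
  unlike in \<open>hitting_time\<close>, time 0 counts.\<close>

definition below_time :: "('a => real) => real => 'w => ennreal" where
	"below_time g e w = Inf (ennreal ` {t. 0 <= t & ext0 g (pos X t w) < e})"

lemma below_time_less_iff:
	"below_time g e w < ennreal t \<longleftrightarrow> (\<exists>s. 0 <= s & s < t & ext0 g (pos X s w) < e)"
	unfolding below_time_def Inf_less_iff by (auto simp: ennreal_less_iff)

lemma stays_below:
	assumes "g \<in> C0" "w \<in> paths X" "0 <= s" "ext0 g (pos X s w) < e"
	shows "\<exists>b>s. \<forall>r. s <= r & r < b --> ext0 g (pos X r w) < e"
proof -
	have "eventually (%r. ext0 g (pos X r w) < e) (at_right s)"
		using order_tendstoD(2)[OF ext0_right_continuous[OF assms(1-3)] assms(4)] .
	then obtain b where "s < b" "!!r. s < r ==> r < b ==> ext0 g (pos X r w) < e"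
		by (auto simp: eventually_at_right_field)
	thus ?thesis using assms(4) by (intro exI[of _ b]) (auto simp: le_less)
qed

text \<open>By right continuity the strict inequality persists for a while, so rational times
  suffice.\<close>

lemma raw_time_below:
	assumes g: "g \<in> C0"
	shows "raw_time (below_time g e)"
	unfolding raw_time_def
proof (intro allI impI)
	fix t :: real assume t: "0 < t"
	let ?Q = "{q \<in> \<rat>. 0 <= q & q < t}"
	have "{w \<in> paths X. below_time g e w < ennreal t} =
		(\<Union>q\<in>?Q. (%w. ext0 g (pos X q w)) -` {..<e} \<inter> space (history X {0..t}))"
	proof (intro equalityI subsetI)
		fix w assume "w \<in> {w \<in> paths X. below_time g e w < ennreal t}"
		then obtain s where w: "w \<in> paths X" and s: "0 <= s" "s < t" "ext0 g (pos X s w) < e"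
			by (auto simp: below_time_less_iff)
		obtain b where b: "s < b" "!!r. s <= r ==> r < b ==> ext0 g (pos X r w) < e"
			using stays_below[OF g w s(1,3)] by blast
		obtain q where q: "q \<in> \<rat>" "s < q" "q < min b t" using Rats_dense_in_real[of s "min b t"] b s by auto
		hence "q \<in> ?Q" "ext0 g (pos X q w) < e" using s b(2)[of q] by auto
		thus "w \<in> (\<Union>q\<in>?Q. (%w. ext0 g (pos X q w)) -` {..<e} \<inter> space (history X {0..t}))"
			using w by auto
	next
		fix w assume "w \<in> (\<Union>q\<in>?Q. (%w. ext0 g (pos X q w)) -` {..<e} \<inter> space (history X {0..t}))"
		thus "w \<in> {w \<in> paths X. below_time g e w < ennreal t}"
			by (auto simp: below_time_less_iff)
	qed
	also have "... \<in> hist t"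
	proof (rule sets.countable_UN'')
		show "countable ?Q" using countable_rat by (rule countable_subset[rotated]) auto
		fix q assume "q \<in> ?Q"
		hence "pos X q \<in> history X {0..t} \<rightarrow>\<^sub>M state_alg" by (intro measurable_pos) auto
		from measurable_compose[OF this measurable_ext0[OF C0_measurable[OF g]]]
		show "(%w. ext0 g (pos X q w)) -` {..<e} \<inter> space (history X {0..t}) \<in> hist t"
			by (rule measurable_sets) simp
	qed
	finally show "{w \<in> paths X. below_time g e w < ennreal t} \<in> hist t" .
qed

lemma below_time_value:
	assumes g: "g \<in> C0" and w: "w \<in> paths X" and fin: "below_time g e w < \<infinity>"
	shows "ext0 g (pos_at X (below_time g e) w) <= e"
proof (rule ccontr)
	define s where "s = enn2real (below_time g e w)"
	have s: "below_time g e w = ennreal s" "0 <= s" using fin by (auto simp: s_def)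
	assume "\<not> ?thesis"
	moreover have "pos_at X (below_time g e) w = pos X s w" using fin by (auto simp: pos_at_def s_def)
	ultimately have "e < ext0 g (pos X s w)" by simp
	hence "eventually (%r. e < ext0 g (pos X r w)) (at_right s)"
		using order_tendstoD(1)[OF ext0_right_continuous[OF g w s(2)]] by blast
	then obtain b where b: "s < b" "!!r. s < r ==> r < b ==> e < ext0 g (pos X r w)"
		by (auto simp: eventually_at_right_field)
	have "below_time g e w < ennreal b" unfolding s(1) using b(1) s(2) by (simp add: ennreal_less_iff)
	then obtain r where r: "0 <= r" "r < b" "ext0 g (pos X r w) < e" by (auto simp: below_time_less_iff)
	have "below_time g e w <= ennreal r"
		unfolding below_time_def using r by (intro INF_lower) auto
	hence "s <= r" unfolding s(1) using r(1) by simp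
	thus False using b(2)[of r] r \<open>e < ext0 g (pos X s w)\<close> by (cases "s = r") auto
qed

lemma below_time_shift:
	assumes w: "w \<in> paths X" and s: "0 <= s" "ennreal s <= below_time g e w"
	shows "below_time g e w = ennreal s + below_time g e (shift X s w)"
proof -
	let ?A = "{t. 0 <= t & ext0 g (pos X t w) < e}" and ?B = "{t. 0 <= t & ext0 g (pos X t (shift X s w)) < e}"
	have ge: "s <= t" if "t \<in> ?A" for t
	proof -
		have "below_time g e w <= ennreal t" unfolding below_time_def using that by (intro INF_lower) auto
		hence "ennreal s <= ennreal t" using s(2) by simp
		thus ?thesis using that by simp
	qed
	have eq: "?A = (%t. s + t) ` ?B"
	proof (intro equalityI subsetI)
		fix t assume t: "t \<in> ?A"
		hence "t - s \<in> ?B" using ge[OF t] s w by (auto simp: pos_shift)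
		thus "t \<in> (%t. s + t) ` ?B" by (intro image_eqI[of _ _ "t - s"]) auto
	qed (use s w in "auto simp: pos_shift add.commute")
	have "below_time g e w = (INF t\<in>?B. ennreal s + ennreal t)"
		unfolding below_time_def eq image_image using s by (intro INF_cong refl) (auto simp: ennreal_plus)
	also have "... = ennreal s + below_time g e (shift X s w)"
	proof (rule antisym)
		let ?I = "INF t\<in>?B. ennreal s + ennreal t"
		have "?I - ennreal s <= below_time g e (shift X s w)"
			unfolding below_time_def
		proof (rule INF_greatest)
			fix t assume "t \<in> ?B"
			hence "?I <= ennreal s + ennreal t" by (rule INF_lower)
			thus "?I - ennreal s <= ennreal t" by (simp add: ennreal_minus_le_iff)
		qed
		thus "?I <= ennreal s + below_time g e (shift X s w)"
			by (simp add: ennreal_minus_le_iff)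
		show "ennreal s + below_time g e (shift X s w) <= ?I"
			unfolding below_time_def by (intro INF_greatest add_left_mono INF_lower) auto
	qed
	finally show ?thesis .
qed

definition sep :: "'a set => 'a => real" where
	"sep D = (SOME g. g \<in> C0 & (\<forall>x. 0 <= g x) & D = {x. 0 < g x})"

lemma sep: "open D ==> sep D \<in> C0 & (\<forall>x. 0 <= sep D x) & D = {x. 0 < sep D x}"
	using someI_ex[of "%g. g \<in> C0 & (\<forall>x. 0 <= g x) & D = {x. 0 < g x}"] open_eq_C0_positive[of D]
	unfolding sep_def by blast

lemma sep_Some_iff: "open D ==> z \<in> Some ` D \<longleftrightarrow> 0 < ext0 (sep D) z"
	using sep[of D] by (cases z) auto

text \<open>
	A version of the exit time that is measurable for the uncompleted history. By quasi-left-continuity the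
	position at that time lies outside \<open>D\<close>, so from starting points in \<open>D\<close> it agrees with the exit time.
\<close>

definition leave :: "'a set => 'w => ennreal" where
	"leave D w = (SUP n. below_time (sep D) (inv1 n) w)"

lemma below_time_antimono: "e <= e' ==> below_time g e' w <= below_time g e w"
	unfolding below_time_def by (intro INF_superset_mono) auto

lemma incseq_below_time: "incseq (%n. below_time g (inv1 n) w)"
	by (intro incseq_SucI below_time_antimono) (simp add: field_simps)

text \<open>The supremum can equal \<open>t\<close> although every \<open>T n\<close> is below
  \<open>t\<close>; hence the intermediate levels \<open>r m\<close> increasing to
  \<open>t\<close>.\<close>

lemma raw_time_SUP:
	assumes "!!n::nat. raw_time (T n)"
	shows "raw_time (%w. SUP n. T n w)"
	unfolding raw_time_def
proof (intro allI impI)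
	fix t :: real assume t: "0 < t"
	define r where "r m = t - t * inverse (real (Suc (Suc m)))" for m
	have r: "0 < r m" "r m < t" for m
	proof -
		have "inverse (real (Suc (Suc m))) < 1" by (simp add: inverse_less_1_iff del: of_nat_Suc)
		thus "0 < r m" using t by (simp add: r_def del: of_nat_Suc)
		show "r m < t" using t by (simp add: r_def del: of_nat_Suc)
	qed
	have rl: "r \<longlonglongrightarrow> t"
	proof -
		have "(%m. t - t * inverse (real (Suc (Suc m)))) \<longlonglongrightarrow> t - t * 0"
			by (intro tendsto_intros LIMSEQ_Suc[OF LIMSEQ_inverse_real_of_nat])
		thus ?thesis by (simp add: r_def[abs_def])
	qed
	have "{w \<in> paths X. (SUP n. T n w) < ennreal t} = (\<Union>m. \<Inter>n. {w \<in> paths X. T n w < ennreal (r m)})"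
	proof (intro equalityI subsetI)
		fix w assume w: "w \<in> {w \<in> paths X. (SUP n. T n w) < ennreal t}"
		have "(%m. ennreal (r m)) \<longlonglongrightarrow> ennreal t" by (intro tendsto_ennrealI rl)
		hence "eventually (%m. (SUP n. T n w) < ennreal (r m)) sequentially"
			using w by (intro order_tendstoD(1)) auto
		then obtain m where m: "(SUP n. T n w) < ennreal (r m)" by (auto simp: eventually_sequentially)
		have "T n w < ennreal (r m)" for n
			by (rule le_less_trans[OF SUP_upper[OF UNIV_I] m])
		thus "w \<in> (\<Union>m. \<Inter>n. {w \<in> paths X. T n w < ennreal (r m)})" using w by auto
	next
		fix w assume "w \<in> (\<Union>m. \<Inter>n. {w \<in> paths X. T n w < ennreal (r m)})"
		then obtain m where m: "w \<in> paths X" "!!n. T n w < ennreal (r m)" by auto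
		have "(SUP n. T n w) <= ennreal (r m)" using m(2) by (intro SUP_least) (auto intro: less_imp_le)
		also have "... < ennreal t" using r[of m] by (simp add: ennreal_less_iff)
		finally show "w \<in> {w \<in> paths X. (SUP n. T n w) < ennreal t}" using m(1) by simp
	qed
	also have "... \<in> hist t"
	proof (intro sets.countable_UN sets.countable_INT image_subsetI)
		fix m n
		have "{w \<in> paths X. T n w < ennreal (r m)} \<in> sets (history X {0..r m})"
			using assms[of n] r(1)[of m] by (auto simp: raw_time_def)
		thus "{w \<in> paths X. T n w < ennreal (r m)} \<in> hist t"
			using history_mono[of "{0..r m}" "{0..t}" X] r(2)[of m] by auto
	qed auto
	finally show "{w \<in> paths X. (SUP n. T n w) < ennreal t} \<in> hist t" .
qed

lemma raw_time_leave: "open D ==> raw_time (leave D)"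
	unfolding leave_def[abs_def] by (intro raw_time_SUP raw_time_below) (use sep in blast)

lemma leave_measurable [measurable]: "open D ==> leave D \<in> hmeas"
	by (rule raw_time_measurable[OF raw_time_leave])

lemma before_leave:
	assumes D: "open D" and t: "0 <= t" "ennreal t < leave D w"
	shows "pos X t w \<in> Some ` D"
proof -
	obtain n where "ennreal t < below_time (sep D) (inv1 n) w"
		using t(2) unfolding leave_def less_SUP_iff by blast
	hence "\<not> ext0 (sep D) (pos X t w) < inv1 n"
		unfolding below_time_def using t(1) by (auto simp: less_INF_D dest!: less_INF_D)
	moreover have "0 < inv1 n" by simp
	ultimately show ?thesis unfolding sep_Some_iff[OF D] by linarith
qed

text \<open>The entrance times into \<open>sep D < 1 / (n + 1)\<close> increase to
  \<open>leave D\<close>, and at the \<open>n\<close>-th one \<open>sep D\<close> is at most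
  \<open>1 / (n + 1)\<close>. Convergence of the positions makes \<open>sep D\<close> vanish at the
  limit.\<close>

lemma AE_at_leave:
	assumes D: "open D"
	shows "AE w in P x. leave D w < \<infinity> --> pos_at X (leave D) w \<notin> Some ` D"
proof -
	define T where "T n w = below_time (sep D) (inv1 n) w" for n w
	have g: "sep D \<in> C0" using sep[OF D] by blast
	have T: "raw_time (T n)" for n unfolding T_def[abs_def] by (rule raw_time_below[OF g])
	have "AE w in law_from X (return state_alg x). (SUP n. T n w) < \<infinity> -->
		 limitin one_point (%n. pos_at X (T n) w) (pos_at X (%w. SUP n. T n w) w) sequentially"
	proof -
		have "(\<forall>n. optional_time X (T n)) & (\<forall>n. \<forall>w\<in>paths X. T n w <= T (Suc n) w)"
			using raw_time_optional[OF T] incseq_below_time[of "sep D"] by (auto simp: T_def incseq_Suc_iff)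
		moreover have "quasi_left_continuous X" using hunt by (simp add: hunt_process_def)
		ultimately show ?thesis using return_init_laws[of x] unfolding quasi_left_continuous_def by blast
	qed
	hence "AE w in P x. (SUP n. T n w) < \<infinity> -->
		 limitin one_point (%n. pos_at X (T n) w) (pos_at X (%w. SUP n. T n w) w) sequentially"
		unfolding law_from_return AE_completion_iff .
	with AE_space show ?thesis
	proof eventually_elim
		case (elim w)
		hence w: "w \<in> paths X" by simp
		show ?case
		proof
			assume fin: "leave D w < \<infinity>"
			have leq: "leave D = (%w. SUP n. T n w)" by (simp add: leave_def[abs_def] T_def)
			have lim: "(%n. ext0 (sep D) (pos_at X (T n) w)) \<longlonglongrightarrow> ext0 (sep D) (pos_at X (leave D) w)"
				using continuous_map_limit[OF continuous_map_ext0[OF g], of "%n. pos_at X (T n) w"] elim fin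
				by (simp add: leq o_def)
			have "ext0 (sep D) (pos_at X (T n) w) <= inv1 n" for n
			proof -
				have "T n w <= leave D w" unfolding leq by (rule SUP_upper) simp
				thus ?thesis unfolding T_def[abs_def]
					using below_time_value[OF g w, of "inv1 n"] fin by (simp add: T_def le_less_trans)
			qed
			hence "ext0 (sep D) (pos_at X (leave D) w) <= 0"
				by (intro LIMSEQ_le[OF lim LIMSEQ_inverse_real_of_nat]) auto
			thus "pos_at X (leave D) w \<notin> Some ` D" unfolding sep_Some_iff[OF D] by simp
		qed
	qed
qed

lemma leave_shift:
	assumes D: "open D" and w: "w \<in> paths X" and s: "0 <= s" "ennreal s < leave D w"
	shows "leave D w = ennreal s + leave D (shift X s w)"
proof -
	let ?T = "%n w. below_time (sep D) (inv1 n) w"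
	obtain N where N: "ennreal s < ?T N w" using s(2) unfolding leave_def less_SUP_iff by blast
	\<comment> \<open>Only from index \<open>N\<close> on are the times known to exceed
	  \<open>s\<close>; dropping the earlier ones does not affect the supremum.\<close>
	have off: "(SUP n. ?T n w') = (SUP n. ?T (n + N) w')" for w'
	proof (rule antisym)
		show "(SUP n. ?T n w') <= (SUP n. ?T (n + N) w')"
		proof (rule SUP_least)
			show "?T n w' <= (SUP n. ?T (n + N) w')" for n
				using incseqD[OF incseq_below_time, of n "n + N" "sep D" w'] by (intro SUP_upper2[of n]) auto
		qed
		show "(SUP n. ?T (n + N) w') <= (SUP n. ?T n w')"
			by (rule SUP_least) (rule SUP_upper2[OF UNIV_I order_refl])
	qed
	have "?T (n + N) w = ennreal s + ?T (n + N) (shift X s w)" for n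
	proof -
		have "ennreal s <= ?T (n + N) w"
			using N incseqD[OF incseq_below_time, of N "n + N" "sep D" w] by (auto intro: less_imp_le order.strict_trans2)
		thus ?thesis by (rule below_time_shift[OF w s(1)])
	qed
	hence "leave D w = (SUP n. ennreal s + ?T (n + N) (shift X s w))"
		unfolding leave_def off[of w] by simp
	also have "... = ennreal s + (SUP n. ?T (n + N) (shift X s w))"
		by (rule ennreal_SUP_add_right[symmetric]) simp
	also have "... = ennreal s + leave D (shift X s w)" unfolding leave_def off[of "shift X s w"] ..
	finally show ?thesis .
qed

lemma leave_outside:
	assumes D: "open D" and w: "w \<in> paths X" and t: "0 <= t" "pos X t w \<notin> Some ` D"
	shows "leave D w <= ennreal t"
	using before_leave[OF D t(1), of w] t(2) by force

lemma leave_pos: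
	assumes D: "open D" and w: "w \<in> paths X" and 0: "pos X 0 w \<in> Some ` D"
	shows "0 < leave D w"
proof -
	have g: "sep D \<in> C0" using sep[OF D] by blast
	have "0 < ext0 (sep D) (pos X 0 w)" using 0 sep_Some_iff[OF D] by simp
	then obtain n where n: "inv1 n < ext0 (sep D) (pos X 0 w)"
		using reals_Archimedean by blast
	have "eventually (%r. inv1 n < ext0 (sep D) (pos X r w)) (at_right 0)"
		using order_tendstoD(1)[OF ext0_right_continuous[OF g w] n] by simp
	then obtain b where b: "0 < b" "!!r. 0 < r ==> r < b ==> inv1 n < ext0 (sep D) (pos X r w)"
		by (auto simp: eventually_at_right_field)
	have "\<not> below_time (sep D) (inv1 n) w < ennreal b"
	proof
		assume "below_time (sep D) (inv1 n) w < ennreal b"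
		then obtain s where "0 <= s" "s < b" "ext0 (sep D) (pos X s w) < inv1 n"
			by (auto simp: below_time_less_iff)
		thus False using b(2)[of s] n by (cases "s = 0") auto
	qed
	hence "ennreal b <= leave D w" unfolding leave_def by (intro SUP_upper2[of n]) auto
	moreover have "0 < ennreal b" using b(1) by simp
	ultimately show ?thesis by (metis order.strict_trans2)
qed

lemma AE_exit_time:
	assumes D: "open D" and x: "x \<in> D"
	shows "AE w in P (Some x). exit_time X D w = leave D w"
	using AE_start[of "Some x"] AE_at_leave[OF D, of "Some x"] AE_space
proof eventually_elim
	case (elim w)
	hence w: "w \<in> paths X" by simp
	have pos: "0 < leave D w" using leave_pos[OF D w] elim x by simp
	have "leave D w <= exit_time X D w"
		unfolding exit_time_def hitting_time_def
		by (rule INF_greatest) (use leave_outside[OF D w] in auto)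
	moreover have "exit_time X D w <= leave D w"
	proof (cases "leave D w")
		case (real t)
		hence "pos X t w \<notin> Some ` D" "0 < t" using elim pos by (auto simp: pos_at_def)
		thus ?thesis unfolding exit_time_def hitting_time_def real by (intro INF_lower) auto
	qed simp
	ultimately show ?case by simp
qed

text \<open>If both sets are left at the same time, the position is already outside \<open>D\<close>
  and the shifted exit time is 0, so additivity holds in this case as well.\<close>

lemma AE_leave_subset:
	assumes U: "open U" and D: "open D" and UD: "U \<subseteq> D"
	shows "AE w in P x. leave U w <= leave D w &
		(leave U w < \<infinity> --> leave D w = leave U w + leave D (shift X (enn2real (leave U w)) w))"
	using AE_at_leave[OF D, of x] AE_space
proof eventually_elim
	case (elim w)
	hence w: "w \<in> paths X" by simp
	have le: "leave U w <= leave D w"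
	proof (cases "leave D w")
		case (real t)
		hence "pos X t w \<notin> Some ` U" using elim UD by (auto simp: pos_at_def)
		thus ?thesis unfolding real using leave_outside[OF U w] real by blast
	qed simp
	moreover have "leave D w = leave U w + leave D (shift X (enn2real (leave U w)) w)" if fin: "leave U w < \<infinity>"
	proof -
		define s where "s = enn2real (leave U w)"
		have s: "leave U w = ennreal s" "0 <= s" using fin by (auto simp: s_def)
		show ?thesis
		proof (cases "leave U w < leave D w")
			case True
			thus ?thesis using leave_shift[OF D w s(2)] s by simp
		next
			case False
			hence eq: "leave D w = ennreal s" using le s by simp
			hence "pos X s w \<notin> Some ` D" using elim s by (simp add: pos_at_def)
			hence "leave D (shift X s w) <= ennreal 0"
				using s w by (intro leave_outside[OF D shift_paths]) (auto simp: pos_shift)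
			thus ?thesis using eq s by simp
		qed
	qed
	ultimately show ?case by simp
qed

lemma pos_at_shift:
	assumes "w \<in> paths X" "0 <= s" "leave D w = ennreal s + leave D (shift X s w)"
	shows "pos_at X (leave D) (shift X s w) = pos_at X (leave D) w"
proof (cases "leave D (shift X s w)")
	case (real r)
	hence "leave D w = ennreal (r + s)" using assms(2,3) by (simp add: ennreal_plus add.commute)
	thus ?thesis using real assms(1,2) by (simp add: pos_at_def pos_shift del: ennreal_plus)
next
	case top
	thus ?thesis using assms(3) by (simp add: pos_at_def)
qed

section \<open>Exit means and exit expectations, decomposed at an earlier exit\<close>

definition exit_mean :: "'a set => 'a option => ennreal" where
	"exit_mean D x = (EE x (%w. leave D w))"

text \<open>If \<open>D\<close> is never left, \<open>pos_at\<close> gives the cemetery, so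
  functions with \<open>f None = 0\<close> receive no contribution from such paths.\<close>

definition exit_value :: "'a set => ('a option => ennreal) => 'a option => ennreal" where
	"exit_value D f x = (EE x (%w. f (pos_at X (leave D) w)))"

lemma exit_value_measurable_path:
	"open D ==> f \<in> smeas ==> (%w. f (pos_at X (leave D) w)) \<in> hmeas"
	by (rule measurable_compose[OF measurable_pos_at[OF leave_measurable]])

lemma exit_value_None:
	assumes "f None = 0"
	shows "exit_value D f None = 0"
proof -
	have "AE w in P None. f (pos_at X (leave D) w) = 0"
		using AE_None by eventually_elim (auto simp: pos_at_def assms)
	hence "exit_value D f None = (EE None (%w. 0))" unfolding exit_value_def by (rule nn_integral_cong_AE)
	thus ?thesis by simp
qed

text \<open>The path after leaving \<open>U\<close> starts afresh and leaves \<open>D\<close> at the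
  same place as the original one; if \<open>U\<close> is never left, neither is
  \<open>D\<close>.\<close>

lemma exit_value_strong_markov:
	assumes U: "open U" and D: "open D" and UD: "U \<subseteq> D" and f: "f \<in> smeas" "f None = 0"
	shows "exit_value D f x = exit_value U (exit_value D f) x"
proof -
	let ?h = "%w. f (pos_at X (leave D) w)"
	have h: "?h \<in> hmeas" by (rule exit_value_measurable_path[OF D f(1)])
	have "AE w in P x. ?h w = 1 * indicator {w. leave U w < \<infinity>} w * ?h (shift X (enn2real (leave U w)) w)"
		using AE_leave_subset[OF U D UD, of x] AE_space
	proof eventually_elim
		case (elim w)
		show ?case
		proof (cases "leave U w < \<infinity>")
			case True
			hence "leave D w = ennreal (enn2real (leave U w)) + leave D (shift X (enn2real (leave U w)) w)"
				using elim by simp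
			from pos_at_shift[OF _ enn2real_nonneg this] show ?thesis using True elim by simp
		next
			case False
			hence "leave D w = \<infinity>" using elim by (simp add: not_less top_unique)
			thus ?thesis using False by (simp add: pos_at_def f)
		qed
	qed
	hence "exit_value D f x = (EE x (%w. 1 * indicator {w. leave U w < \<infinity>} w * ?h (shift X (enn2real (leave U w)) w)))"
		unfolding exit_value_def by (rule nn_integral_cong_AE)
	also have "... = (EE x (%w. 1 * indicator {w. leave U w < \<infinity>} w * (EE (pos_at X (leave U) w) (%w'. ?h w'))))"
		by (rule strong_markov[OF raw_time_leave[OF U] _ h]) simp
	also have "... = exit_value U (exit_value D f) x"
		unfolding exit_value_def[of U]
	proof (rule nn_integral_cong)
		show "1 * indicator {w. leave U w < \<infinity>} w * (EE (pos_at X (leave U) w) (%w'. ?h w')) =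
			 exit_value D f (pos_at X (leave U) w)" for w
			using exit_value_None[of f D, OF f(2)]
			by (cases "leave U w = \<infinity>") (auto simp: pos_at_def exit_value_def less_top)
	qed
	finally show ?thesis .
qed

text \<open>The value 0 at the cemetery also covers the paths that never leave
  \<open>U\<close>.\<close>

lemma exit_mean_strong_markov:
	assumes U: "open U" and D: "open D" and UD: "U \<subseteq> D"
	shows "exit_mean D x = exit_mean U x + exit_value U (%z. if z = None then 0 else exit_mean D z) x"
proof -
	have m [measurable]: "leave D \<in> hmeas" by (rule leave_measurable[OF D])
	have mU [measurable]: "leave U \<in> hmeas" by (rule leave_measurable[OF U])
	let ?s = "%w. 1 * indicator {w. leave U w < \<infinity>} w * leave D (shift X (enn2real (leave U w)) w)"
	have "AE w in P x. leave D w = leave U w + ?s w"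
		using AE_leave_subset[OF U D UD, of x] by eventually_elim (auto simp: indicator_def not_less top_unique)
	hence "exit_mean D x = (EE x (%w. leave U w + ?s w))"
		unfolding exit_mean_def by (rule nn_integral_cong_AE)
	also have "... = exit_mean U x + (EE x (%w. ?s w))"
		unfolding exit_mean_def
	proof (rule nn_integral_add)
		show "leave U \<in> borel_measurable (P x)" using mU by (simp add: measurable_P_iff)
		have [measurable]: "(%w. leave D (shift X (enn2real (leave U w)) w)) \<in> hmeas"
			by (rule measurable_compose[OF shift_at_measurable[OF mU] m])
		show "?s \<in> borel_measurable (P x)" unfolding measurable_P_iff by measurable
	qed
	also have "(EE x (%w. ?s w)) = (EE x (%w. 1 * indicator {w. leave U w < \<infinity>} w * (EE (pos_at X (leave U) w) (%w'. leave D w'))))"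
		by (rule strong_markov[OF raw_time_leave[OF U] _ m]) simp
	also have "... = exit_value U (%z. if z = None then 0 else exit_mean D z) x"
		unfolding exit_value_def
	proof (rule nn_integral_cong)
		fix w
		have "exit_mean D None = 0"
		proof -
			have "AE w in P None. leave D w = 0"
				using AE_None AE_space by eventually_elim (use leave_outside[OF D, of _ 0] in auto)
			hence "exit_mean D None = (EE None (%w. 0))" unfolding exit_mean_def by (rule nn_integral_cong_AE)
			thus ?thesis by simp
		qed
		thus "1 * indicator {w. leave U w < \<infinity>} w * (EE (pos_at X (leave U) w) (%w'. leave D w')) =
			 (if pos_at X (leave U) w = None then 0 else exit_mean D (pos_at X (leave U) w))"
			by (cases "leave U w = \<infinity>") (auto simp: pos_at_def exit_mean_def less_top)
	qed
	finally show ?thesis .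
qed

end

lemma emeasure_lborel_before: "emeasure lborel (before s) = s"
proof (cases s)
	case (real r)
	hence "before s = {0..<r}" by (auto simp: ennreal_less_iff)
	thus ?thesis using real by simp
next
	case top
	have "ennreal (real n) <= emeasure lborel {0::real..}" for n
		using emeasure_mono[of "{0..real n}" "{0::real..}" lborel] by auto
	hence "(SUP n. ennreal (real n)) <= emeasure lborel {0::real..}" by (rule SUP_least)
	moreover have "(SUP n. ennreal (real n)) = \<infinity>"
		using ennreal_SUP_of_nat_eq_top by (simp add: ennreal_of_nat_eq_real_of_nat)
	moreover have "before s = {0..}" using top by auto
	ultimately show ?thesis using top by (simp add: top_unique)
qed

lemma SUP_exp_const_mult:
	assumes "0 <= t"
	shows "(SUP n. ennreal (exp (- inv1 n * t)) * y) = (y :: ennreal)"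
		and "incseq (%n. ennreal (exp (- inv1 n * t)) * y)"
proof -
	show inc: "incseq (%n. ennreal (exp (- inv1 n * t)) * y)"
	proof (rule incseq_SucI, rule mult_right_mono, rule ennreal_leI)
		fix n
		have "inverse (real (Suc (Suc n))) * t <= inv1 n * t"
			using assms by (intro mult_right_mono) (auto simp: field_simps)
		thus "exp (- inv1 n * t) <= exp (- inverse (real (Suc (Suc n))) * t)" by simp
	qed simp
	have inc1: "incseq (%n. ennreal (exp (- inv1 n * t)))"
	proof (rule incseq_SucI, rule ennreal_leI)
		fix n
		have "inverse (real (Suc (Suc n))) * t <= inv1 n * t"
			using assms by (intro mult_right_mono) (auto simp: field_simps)
		thus "exp (- inv1 n * t) <= exp (- inverse (real (Suc (Suc n))) * t)" by simp
	qed
	have "(%n. ennreal (exp (- inv1 n * t))) \<longlonglongrightarrow> ennreal (exp (- 0 * t))"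
		by (intro tendsto_ennrealI tendsto_intros LIMSEQ_inverse_real_of_nat)
	hence "(SUP n. ennreal (exp (- inv1 n * t))) = 1"
		using LIMSEQ_unique[OF LIMSEQ_SUP[OF inc1]] by simp
	thus "(SUP n. ennreal (exp (- inv1 n * t)) * y) = y"
		by (simp add: SUP_mult_right_ennreal[symmetric])
qed

context hunt
begin

lemma past_const_right:
	assumes s: "0 <= s" and A: "!!t. s < t ==> A \<in> hist t"
	shows "A \<in> past (%_. ennreal s)"
	unfolding past_def
proof (intro CollectI conjI allI impI)
	show "A \<in> sets H" using A[of "s + 1"] history_mono[of "{0..s+1}" "{0..}" X] by auto
	fix t :: real assume t: "0 < t"
	show "{w \<in> A. ennreal s < ennreal t} \<in> hist t"
		using A[of t] s t by (cases "s < t") (auto simp: ennreal_less_iff)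
qed

text \<open>The event \<open>T \<le> s\<close> is known only in the histories up to times after
  \<open>s\<close>; the past of the constant time \<open>s\<close>, being defined by strict
  inequalities, admits exactly such events.\<close>

lemma indicator_before_past:
	assumes T: "raw_time T" and s: "0 <= s"
	shows "(%w. indicator {w. ennreal s < T w} w :: ennreal) \<in> borel_measurable (pastM (%_. ennreal s))"
proof -
	have "{w \<in> paths X. T w <= ennreal s} \<in> past (%_. ennreal s)"
		by (rule past_const_right[OF s past_le_history[OF raw_time_paths_past[OF T] s]])
	hence "{w \<in> paths X. T w <= ennreal s} \<in> sets (pastM (%_. ennreal s))"
		by (simp add: sets_pastM[OF raw_time_const[OF s]])
	from sets.compl_sets[OF this]
	have "(indicator (paths X - {w \<in> paths X. T w <= ennreal s}) :: _ => ennreal) \<in> borel_measurable (pastM (%_. ennreal s))"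
		by (intro borel_measurable_indicator) simp
	thus ?thesis
		by (rule measurable_cong[THEN iffD1, rotated]) (auto simp: indicator_def)
qed

text \<open>
	The exit distribution splits into the part not killed before the exit and the part killed at rate \<open>k\<close>: on
	the latter, the Markov property at the killing time replaces \<open>f(X\<^sub>T)\<close> by its conditional expectation.
\<close>

lemma exit_value_killed:
	assumes D: "open D" and k: "rate k" and f: "f \<in> smeas" "f None = 0"
	shows "exit_value D f x = stopped k (leave D) f x + R_upto k (leave D) (%z. ennreal (k z) * exit_value D f z) x"
proof -
	note T = raw_time_leave[OF D]
	note [measurable] = leave_measurable[OF D] f(1) rate_measurable[OF k] measurable_pos_at[OF leave_measurable[OF D]]
		M_measurable[OF k]
	let ?h = "%w. f (pos_at X (leave D) w)"
	have h [measurable]: "?h \<in> hmeas" by (rule exit_value_measurable_path[OF D f(1)])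
	let ?w = "%s w. indicator {w. ennreal s < leave D w} w * (ennreal (M k (max 0 s) w) * ennreal (k (Y s w)))"
	have "AE w in P x. ?h w = ennreal (M k (enn2real (leave D w)) w) * indicator {w. leave D w < \<infinity>} w * ?h w +
		 (Leb (%s. indicator {0..} s * (?w s w * ?h (shift X (max 0 s) w))))"
		using AE_space
	proof eventually_elim
		case (elim w)
		hence w: "w \<in> paths X" by simp
		note [measurable] = measurable_Y_path[OF w] path_measurable[OF k w]
		have hs: "indicator {0..} s * (?w s w * ?h (shift X (max 0 s) w)) = indicator {0..} s * (?w s w * ?h w)" for s
		proof (cases "0 <= s & ennreal s < leave D w")
			case True
			hence "leave D w = ennreal s + leave D (shift X s w)" using leave_shift[OF D w] by simp
			from pos_at_shift[OF w _ this] True show ?thesis by simp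
		qed (auto simp: indicator_def)
		show ?case
		proof (cases "leave D w")
			case (real t)
			have "(Leb (%s. indicator {0..} s * (?w s w * ?h w))) =
				(Leb (%s. ennreal (indicator {0..t} s * (k (Y s w) * M k s w)) * ?h w))"
			proof (rule nn_integral_cong_AE)
				show "AE s in lborel. indicator {0..} s * (?w s w * ?h w) = ennreal (indicator {0..t} s * (k (Y s w) * M k s w)) * ?h w"
					using AE_lborel_singleton[of t]
				proof eventually_elim
					case (elim s)
					have M0: "0 <= M k s w" using M_pos[of k s w] by simp
					show ?case using elim real rate_nonneg[OF k, of "Y s w"] M0
						by (cases "0 <= s") (auto simp: indicator_def ennreal_less_iff ennreal_mult mult_ac)
				qed
			qed
			also have "... = ennreal (1 - M k t w) * ?h w"
				using nn_integral_rate_M[OF k w real(1)] by (subst nn_integral_multc) auto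
			finally have "(Leb (%s. indicator {0..} s * (?w s w * ?h (shift X (max 0 s) w)))) = ennreal (1 - M k t w) * ?h w"
				unfolding hs .
			moreover have "ennreal (M k t w) + ennreal (1 - M k t w) = 1"
				using M_pos[of k t w] M_le_1[OF k, of t w] by (subst ennreal_plus[symmetric]) auto
			ultimately show ?thesis using real by (simp add: distrib_right[symmetric])
		next
			case top
			hence "?h w = 0" by (simp add: pos_at_def f)
			thus ?thesis unfolding hs by simp
		qed
	qed
	hence "exit_value D f x = (EE x (%w. ennreal (M k (enn2real (leave D w)) w) * indicator {w. leave D w < \<infinity>} w * ?h w +
		 (Leb (%s. indicator {0..} s * (?w s w * ?h (shift X (max 0 s) w))))))"
		unfolding exit_value_def by (rule nn_integral_cong_AE)
	also have "... = stopped k (leave D) f x + (EE x (%w. (Leb (%s. indicator {0..} s * (?w s w * ?h (shift X (max 0 s) w))))))"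
		unfolding stopped_def
	proof (rule nn_integral_add)
		show "(%w. ennreal (M k (enn2real (leave D w)) w) * indicator {w. leave D w < \<infinity>} w * ?h w) \<in> borel_measurable (P x)"
			by (rule stopped_measurable[OF k leave_measurable[OF D] f(1)])
		have [measurable]: "(%p. ?h (shift X (max 0 (snd p)) (fst p))) \<in> borel_measurable (H \<Otimes>\<^sub>M lborel)"
			by (rule measurable_compose[OF measurable_shift_joint h]) measurable
		show "(%w. \<integral>\<^sup>+s. indicator {0..} s * (?w s w * ?h (shift X (max 0 s) w)) \<partial>lborel) \<in> borel_measurable (P x)"
			unfolding measurable_P_iff
			by (rule sigma_finite_measure.borel_measurable_nn_integral[OF sigma_finite_lborel])
				(simp add: case_prod_beta' indicator_def[abs_def])
	qed
	also have "(EE x (%w. (Leb (%s. indicator {0..} s * (?w s w * ?h (shift X (max 0 s) w)))))) =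
		(EE x (%w. (Leb (%s. indicator {0..} s * (?w s w * (EE (Y s w) (%w'. ?h w')))))))"
	proof (rule markov_integrated[OF _ _ h])
		show "(%(s, w). ?w s w) \<in> borel_measurable (borel \<Otimes>\<^sub>M H)"
			unfolding case_prod_beta' indicator_def[abs_def] by measurable
		show "?w s \<in> borel_measurable (pastM (%_. ennreal s))" if "0 <= s" for s
			using M_past_const[OF k that] pos_past_const[OF measurable_compose[OF rate_measurable[OF k] measurable_ennreal] that]
				indicator_before_past[OF T that] that
			by (simp add: borel_measurable_times_ennreal)
	qed
	also have "... = R_upto k (leave D) (%z. ennreal (k z) * exit_value D f z) x"
		unfolding R_upto_def occ_def exit_value_def
		by (intro nn_integral_cong) (auto simp: indicator_def mult_ac)
	finally show ?thesis .
qed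

subsection \<open>Removing the killing\<close>

lemma M_zero [simp]: "M (%_. 0) t w = 1"
	by (simp add: M_def Acc_def)

lemma stopped_const_SUP:
	assumes T: "T \<in> hmeas" and f: "f \<in> smeas"
	shows "(SUP n. stopped (%_. inv1 n) T f x) = stopped (%_. 0) T f x"
proof -
	let ?k = "%n _. inv1 n"
	let ?F = "%n w. ennreal (exp (- inv1 n * enn2real (T w))) * (indicator {w. T w < \<infinity>} w * f (pos_at X T w))"
	have e: "stopped (?k n) T f x = (EE x (%w. ?F n w))" for n
		unfolding stopped_def by (intro nn_integral_cong) (simp add: M_const mult_ac)
	have "(SUP n. stopped (?k n) T f x) = (EE x (%w. (SUP n. ?F n w)))"
		unfolding e
	proof (rule nn_integral_monotone_convergence_SUP[symmetric])
		show "incseq ?F"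
			using SUP_exp_const_mult(2)[OF enn2real_nonneg] by (auto simp: incseq_def le_fun_def)
		show "?F n \<in> borel_measurable (P x)" for n
			using measurable_pos_at[OF T] T f unfolding measurable_P_iff by measurable
	qed
	also have "... = stopped (%_. 0) T f x"
		unfolding stopped_def SUP_exp_const_mult(1)[OF enn2real_nonneg] by (simp add: mult.assoc)
	finally show ?thesis .
qed

lemma R_upto_const_SUP:
	assumes T: "T \<in> hmeas" and v: "v \<in> smeas"
	shows "(SUP n. R_upto (%_. inv1 n) T v x) = R_upto (%_. 0) T v x"
proof -
	let ?k = "%n _ :: 'a option. inv1 n"
	have k: "rate (?k n)" for n by (rule rate_const) simp
	let ?F = "%w n t. ennreal (exp (- inv1 n * max 0 t)) * (v (Y t w) * indicator (before (T w)) t)"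
	have e: "occ (?k n) v (T w) w = (Leb (%t. ?F w n t))" for n w
		unfolding occ_def by (intro nn_integral_cong) (auto simp: M_const indicator_def)
	have inc: "incseq (?F w)" for w
		using SUP_exp_const_mult(2)[of "max 0 _"] by (auto simp: incseq_def le_fun_def)
	have occ: "(SUP n. occ (?k n) v (T w) w) = occ (%_. 0) v (T w) w" if w: "w \<in> paths X" for w
	proof -
		note [measurable] = measurable_Y_path[OF w] v
		have "(SUP n. occ (?k n) v (T w) w) = (Leb (%t. (SUP n. ?F w n t)))"
			unfolding e by (rule nn_integral_monotone_convergence_SUP[OF inc, symmetric]) measurable
		also have "... = occ (%_. 0) v (T w) w"
			unfolding occ_def SUP_exp_const_mult(1)[OF max.cobounded1] by (simp add: mult.assoc)
		finally show ?thesis .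
	qed
	have "(SUP n. R_upto (?k n) T v x) = (EE x (%w. (SUP n. occ (?k n) v (T w) w)))"
		unfolding R_upto_def
	proof (rule nn_integral_monotone_convergence_SUP[symmetric])
		show "incseq (%n w. occ (?k n) v (T w) w)"
			unfolding incseq_def le_fun_def e
		proof (intro allI impI nn_integral_mono)
			fix a b :: nat and w t assume "a <= b"
			thus "?F w a t <= ?F w b t" using inc[of w] unfolding incseq_def le_fun_def by blast
		qed
		show "(%w. occ (?k n) v (T w) w) \<in> borel_measurable (P x)" for n
			by (rule occ_measurable_P[OF k v T])
	qed
	also have "... = R_upto (%_. 0) T v x"
		unfolding R_upto_def by (intro nn_integral_cong) (simp add: occ del: of_nat_Suc)
	finally show ?thesis .
qed

lemma stopped_zero:
	assumes "f None = 0"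
	shows "stopped (%_. 0) (leave D) f x = exit_value D f x"
	unfolding stopped_def exit_value_def
	by (intro nn_integral_cong) (auto simp: indicator_def pos_at_def assms less_top)

lemma R_upto_cong:
	assumes D: "open D" and v: "!!y. y \<in> D ==> v (Some y) = v' (Some y)"
	shows "R_upto k (leave D) v x = R_upto k (leave D) v' x"
	unfolding R_upto_def occ_def
proof (intro nn_integral_cong)
	fix w t
	show "ennreal (M k t w) * v (Y t w) * indicator (before (leave D w)) t =
		ennreal (M k t w) * v' (Y t w) * indicator (before (leave D w)) t"
	proof (cases "0 <= t & ennreal t < leave D w")
		case True
		hence "pos X t w \<in> Some ` D" using before_leave[OF D] by blast
		thus ?thesis using v True by auto
	qed simp
qed

lemma R_upto_mono_on:
	assumes D: "open D" and v: "!!y. y \<in> D ==> v (Some y) <= v' (Some y)"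
	shows "R_upto k (leave D) v x <= R_upto k (leave D) v' x"
proof -
	have "R_upto k (leave D) v x = R_upto k (leave D) (%z. if z \<in> Some ` D then v z else 0) x"
		by (rule R_upto_cong[OF D]) auto
	also have "... <= R_upto k (leave D) (%z. if z \<in> Some ` D then v' z else 0) x"
		by (rule R_upto_mono) (use v in auto)
	also have "... = R_upto k (leave D) v' x"
		by (rule R_upto_cong[OF D]) auto
	finally show ?thesis .
qed

lemma R_upto_zero_const:
	assumes "open D"
	shows "R_upto (%_. 0) (leave D) (%_. c) x = c * exit_mean D x"
proof -
	have "occ (%_. 0) (%_. c) s w = c * s" for s w
	proof -
		have [measurable]: "before s \<in> sets borel" by measurable
		show ?thesis unfolding occ_def by (simp add: nn_integral_cmult_indicator emeasure_lborel_before)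
	qed
	thus ?thesis
		unfolding R_upto_def exit_mean_def
		using leave_measurable[OF assms] by (simp add: nn_integral_cmult measurable_P_iff)
qed

lemma R_upto_antimono_rate:
	assumes "rate k" "rate k'" "!!z. k z <= k' z"
	shows "R_upto k' T v x <= R_upto k T v x"
	unfolding R_upto_def occ_def
proof (intro nn_integral_mono mult_right_mono)
	fix w t assume "w \<in> space (P x)"
	thus "ennreal (M k' t w) <= ennreal (M k t w)"
		using M_antimono_rate[OF assms(1,2)] assms(3) by (auto intro!: ennreal_leI)
qed auto

lemma stopped_antimono_rate:
	assumes "rate k" "rate k'" "!!z. k z <= k' z"
	shows "stopped k' T f x <= stopped k T f x"
	unfolding stopped_def
proof (intro nn_integral_mono mult_right_mono)
	fix w assume "w \<in> space (P x)"
	thus "ennreal (M k' (enn2real (T w)) w) <= ennreal (M k (enn2real (T w)) w)"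
		using M_antimono_rate[OF assms(1,2)] assms(3) by (auto intro!: ennreal_leI)
qed auto

lemma stopped_cong_outside:
	assumes D: "open D" and f: "!!z. z \<notin> Some ` D ==> f z = f' z"
	shows "stopped k (leave D) f x = stopped k (leave D) f' x"
	unfolding stopped_def
proof (rule nn_integral_cong_AE)
	show "AE w in P x. ennreal (M k (enn2real (leave D w)) w) * indicator {w. leave D w < \<infinity>} w * f (pos_at X (leave D) w) =
			ennreal (M k (enn2real (leave D w)) w) * indicator {w. leave D w < \<infinity>} w * f' (pos_at X (leave D) w)"
		using AE_at_leave[OF D, of x] by eventually_elim (auto simp: indicator_def f)
qed

lemma exit_value_mono_outside:
	assumes D: "open D" and f: "!!z. z \<notin> Some ` D ==> f z <= f' z"
	shows "exit_value D f x <= exit_value D f' x"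
	unfolding exit_value_def
proof (rule nn_integral_mono_AE)
	show "AE w in P x. f (pos_at X (leave D) w) <= f' (pos_at X (leave D) w)"
		using AE_at_leave[OF D, of x]
	proof eventually_elim
		case (elim w)
		hence "pos_at X (leave D) w \<notin> Some ` D"
			by (cases "leave D w = \<infinity>") (auto simp: pos_at_def less_top)
		thus ?case by (rule f)
	qed
qed

text \<open>One-sided information suffices: the nonnegative integral on the stopped side of
  \<open>Dynkin\<close> is dropped, \<open>g\<close> is replaced by its upper bound on
  \<open>W\<close>, and the constant killing rate tends to 0.\<close>

lemma Dynkin_upper:
	assumes gen: "has_generator X f g" and f0: "!!x. 0 <= f x" and W: "open W" and c: "!!x. x \<in> W ==> g x <= c"
	shows "exit_value W (enn0 f) (Some y) <= ennreal (f y) + ennreal c * exit_mean W (Some y)"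
proof -
	let ?F = "enn0 f"
	have C0: "f \<in> C0" using gen by (auto simp: has_generator_def)
	note [measurable] = C0_measurable[OF C0]
	have Fm: "?F \<in> smeas" by (intro measurable_ext0) measurable
	have "stopped (%_. inv1 n) (leave W) ?F (Some y) <= ennreal (f y) + ennreal c * exit_mean W (Some y)" for n
	proof -
		let ?k = "%_ :: 'a option. inv1 n"
		have k: "rate ?k" "rate (%_ :: 'a option. 0)" by (rule rate_const; simp)+
		have "stopped ?k (leave W) ?F (Some y) <= ennreal (f y) + R_upto ?k (leave W) (enn0 g) (Some y)"
			using Dynkin[OF gen f0 k(1) order_refl _ raw_time_leave[OF W], of "Some y"] by simp
		also have "R_upto ?k (leave W) (enn0 g) (Some y) <= R_upto ?k (leave W) (%_. ennreal c) (Some y)"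
			by (rule R_upto_mono_on[OF W]) (use c in "auto intro: ennreal_leI")
		also have "... <= R_upto (%_. 0) (leave W) (%_. ennreal c) (Some y)"
			by (rule R_upto_antimono_rate[OF k(2,1)]) simp
		finally show ?thesis by (simp add: R_upto_zero_const[OF W] add_left_mono)
	qed
	hence "(SUP n. stopped (%_. inv1 n) (leave W) ?F (Some y)) <= ennreal (f y) + ennreal c * exit_mean W (Some y)"
		by (rule SUP_least)
	thus ?thesis
		unfolding stopped_const_SUP[OF leave_measurable[OF W] Fm] by (simp add: stopped_zero)
qed

end

section \<open>The Levy system at an exit time\<close>

lemma nn_integral_kernel_measurable:
	fixes J :: "'a::topological_space => 'a measure"
	assumes "!!x. sets (J x) = sets borel" "!!A. A \<in> sets borel ==> (%x. emeasure (J x) A) \<in> bmeas"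
		and "g \<in> bmeas"
	shows "(%x. \<integral>\<^sup>+y. g y \<partial>J x) \<in> bmeas"
	using assms(3)
proof (induction g rule: borel_measurable_induct)
	case (cong f g)
	hence "f = g" by auto
	thus ?case using cong by simp
next
	case (set A)
	thus ?case using assms(1,2) by simp
next
	case (mult u c)
	have "u \<in> borel_measurable (J x)" for x using mult(2) assms(1) measurable_cong_sets by blast
	thus ?case using mult.IH by (simp add: nn_integral_cmult)
next
	case (add u v)
	have "u \<in> borel_measurable (J x)" "v \<in> borel_measurable (J x)" for x
		using \<open>u \<in> bmeas\<close> \<open>v \<in> bmeas\<close> assms(1) measurable_cong_sets by blast+
	thus ?case using add.IH by (simp add: nn_integral_add)
next
	case (seq U)
	have "U i \<in> borel_measurable (J x)" for i x using seq(1)[of i] assms(1) measurable_cong_sets by blast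
	hence "(nn_integral (J x) (%y. (SUP i. U i y))) = (SUP i. \<integral>\<^sup>+y. U i y \<partial>J x)" for x
		using \<open>incseq U\<close> by (intro nn_integral_monotone_convergence_SUP) auto
	thus ?case using seq.IH by (simp add: image_comp)
qed

text \<open>A representation of Daniell type. It turns both sides of the Levy system formula into
  measures, which can then be compared through test functions.\<close>

lemma functional_is_integral:
	fixes L :: "('a::topological_space => ennreal) => ennreal"
	assumes add: "!!f g. f \<in> bmeas ==> g \<in> bmeas ==> L (%x. f x + g x) = L f + L g"
		and cmult: "!!c f. f \<in> bmeas ==> L (%x. c * f x) = c * L f"
		and SUP: "!!F :: nat => _. (!!i. F i \<in> bmeas) ==> incseq F ==> L (%x. SUP i. F i x) = (SUP i. L (F i))"
	obtains N where "sets N = sets borel" "!!f. f \<in> bmeas ==> (nn_integral N (%x. f x)) = L f"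
proof -
	have L0: "L (%_. 0) = 0" using cmult[of "%_. 0" 0] by simp
	have sum: "L (%x. \<Sum>i<n. f i x) = (\<Sum>i<n. L (f i))" if "!!i. f i \<in> bmeas" for f :: "nat => 'a => ennreal" and n
		using that by (induction n) (auto simp: L0 add)
	define N where "N = measure_of UNIV (sets borel) (%A. L (indicator A))"
	have sa: "sigma_algebra UNIV (sets (borel :: 'a measure))" using sets.sigma_algebra_axioms[of "borel :: 'a measure"] by simp
	have sN: "sets N = sets borel" unfolding N_def by (simp add: sigma_algebra.sets_measure_of_eq[OF sa])
	have "countably_additive (sets borel) (%A. L (indicator A))"
		unfolding countably_additive_def
	proof (intro allI impI)
		fix B :: "nat => 'a set" assume B: "range B \<subseteq> sets borel" "disjoint_family B"
		have m: "(indicator (B i) :: 'a => ennreal) \<in> bmeas" for i using B(1) by (intro borel_measurable_indicator) auto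
		have "L (indicator (\<Union>i. B i)) = L (%x. SUP n. \<Sum>i<n. indicator (B i) x)"
			by (intro arg_cong[where f = L] ext) (simp only: suminf_indicator[OF B(2), symmetric] suminf_eq_SUP)
		also have "... = (SUP n. \<Sum>i<n. L (indicator (B i)))"
			unfolding sum[OF m, symmetric] by (rule SUP) (use m in "auto intro!: monotoneI le_funI sum_mono2")
		finally show "(\<Sum>i. L (indicator (B i))) = L (indicator (\<Union>i. B i))" by (simp add: suminf_eq_SUP)
	qed
	hence N: "emeasure N B = L (indicator B)" if "B \<in> sets borel" for B
		unfolding N_def using that emeasure_measure_of_sigma[OF sa] L0 by (simp add: positive_def indicator_def[abs_def])
	have cs: "f \<in> bmeas ==> f \<in> borel_measurable N" for f :: "'a => ennreal"
		using measurable_cong_sets[OF sN refl] by blast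
	have "(nn_integral N (%x. f x)) = L f" if "f \<in> bmeas" for f
		using that
	proof (induction f rule: borel_measurable_induct)
		case (cong f g)
		hence "f = g" by auto
		thus ?case using cong by simp
	next
		case (seq U)
		have "(SUP i. U i) = (%x. SUP i. U i x)" by (auto simp: image_comp)
		moreover have "(nn_integral N (%x. (SUP i. U i x))) = (SUP i. \<integral>\<^sup>+x. U i x \<partial>N)"
			by (rule nn_integral_monotone_convergence_SUP[OF \<open>incseq U\<close> cs[OF seq(1)]])
		ultimately show ?case by (simp only: SUP[OF seq(1) \<open>incseq U\<close>] seq.IH)
	qed (use N sN in "simp_all add: nn_integral_add nn_integral_cmult add cmult cs")
	with sN show ?thesis by (rule that)
qed

text \<open>A bump lies between the indicators of a compact set and an open neighbourhood, so equal
  integrals of bumps yield only these crossed inequalities. Exhausting an open set by compact sets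
  turns them into equality on open sets.\<close>

lemma density_eq_by_fattening:
	fixes N1 N2 :: "'a::heine_borel measure"
	assumes s: "sets N1 = sets borel" "sets N2 = sets borel" and V: "open V" and fin: "emeasure N1 UNIV < \<infinity>"
		and le: "!!C U. compact C ==> open U ==> C \<subseteq> U ==> U \<subseteq> V ==>
			emeasure N2 C <= emeasure N1 U & emeasure N1 C <= emeasure N2 U"
	shows "density N1 (indicator V) = density N2 (indicator V)"
proof -
	have op: "emeasure N1 U = emeasure N2 U" if U: "open U" "U \<subseteq> V" for U
	proof -
		obtain g :: "'a => real" where g: "g \<in> C0" "\<forall>x. 0 <= g x" "U = {x. 0 < g x}"
			using open_eq_C0_positive[OF U(1)] by metis
		define K where "K n = {x. inv1 n <= g x}" for n
		have K: "compact (K n)" "K n \<subseteq> U" for n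
		proof -
			have p: "0 < inv1 n" by simp
			obtain C where C: "compact C" "!!x. x \<notin> C ==> \<bar>g x\<bar> < inv1 n"
				using g(1) p unfolding C0_def by blast
			hence "K n \<subseteq> C" unfolding K_def by force
			moreover have "closed (K n)" unfolding K_def using g(1) by (intro closed_Collect_le) (auto simp: C0_def)
			ultimately show "compact (K n)" using C(1) by (metis compact_Int_closed inf.absorb_iff2)
			show "K n \<subseteq> U" unfolding K_def g(3) using less_le_trans[OF p] by blast
		qed
		have un: "(\<Union>n. K n) = U"
		proof (intro equalityI subsetI)
			fix x assume "x \<in> U"
			then obtain n where "inv1 n < g x" using reals_Archimedean[of "g x"] g(3) by auto
			thus "x \<in> (\<Union>n. K n)" unfolding K_def by (auto intro: less_imp_le)
		qed (use K(2) in auto)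
		have inc: "incseq K"
		proof (intro monotoneI subsetI)
			fix i l :: nat and x assume "i <= l" "x \<in> K i"
			moreover from this have "inverse (real (Suc l)) <= inverse (real (Suc i))" by (intro le_imp_inverse_le) auto
			ultimately show "x \<in> K l" unfolding K_def mem_Collect_eq by (meson order_trans)
		qed
		have "(SUP n. emeasure N1 (K n)) = emeasure N1 U" "(SUP n. emeasure N2 (K n)) = emeasure N2 U"
			unfolding un[symmetric] by (rule SUP_emeasure_incseq; use inc K(1) s in "auto intro: borel_compact")+
		moreover have "emeasure N2 (K n) <= emeasure N1 U" "emeasure N1 (K n) <= emeasure N2 U" for n
			using le[OF K(1) U(1) K(2) U(2)] by auto
		ultimately show ?thesis by (metis SUP_least antisym)
	qed
	have D: "emeasure (density N1 (indicator V)) B = emeasure N1 (V \<inter> B)" "emeasure (density N2 (indicator V)) B = emeasure N2 (V \<inter> B)"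
		if "open B" for B using that V s by (simp_all add: emeasure_restricted)
	show ?thesis
	proof (rule measure_eqI_generator_eq[where E = "{C. open C}" and \<Omega> = UNIV and A = "%_. UNIV"])
		show "Int_stable {C :: 'a set. open C}" by (auto simp: Int_stable_def)
		show "sets (density N1 (indicator V)) = sigma_sets UNIV {C. open C}" "sets (density N2 (indicator V)) = sigma_sets UNIV {C. open C}"
			by (simp_all only: sets_density s sets_borel)
		have "emeasure N1 V <= emeasure N1 UNIV" using s by (intro emeasure_mono) auto
		thus "emeasure (density N1 (indicator V)) UNIV ~= \<infinity>" using fin D(1)[of UNIV] by (auto simp: top_unique)
		fix C :: "'a set" assume "C \<in> {C. open C}"
		thus "emeasure (density N1 (indicator V)) C = emeasure (density N2 (indicator V)) C"
			using op[of "V \<inter> C"] V by (simp add: D open_Int)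
	qed auto
qed

text \<open>A form of (B) stated for one process at a time, so that it applies to \<open>X\<close>
  and to its dual alike.\<close>

definition many_bumps :: "('w, 'a::metric_space) process => bool" where
	"many_bumps X \<longleftrightarrow> (\<forall>K D. compact K & open D & K \<subseteq> D -->
		 (\<exists>f\<in>gen_dom X. (\<forall>x\<in>K. f x = 1) & (\<forall>x. x \<notin> D --> f x = 0) & (\<forall>x. 0 <= f x & f x <= 1)))"

context hunt
begin

text \<open>Away from the support of \<open>f\<close> the difference quotient is
  \<open>P\<^sub>t f / t\<close>, whose limit is also given by the Levy kernel.\<close>

lemma generator_off_support:
	assumes J: "levy_kernel X J" and gen: "has_generator X f g" and W: "open W"
		and f: "!!x. 0 <= f x" "!!x. x \<in> W ==> f x = 0" and y: "y \<in> W"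
	shows "ennreal (g y) = (nn_integral (J y) (%x. ennreal (f x)))" "0 <= g y"
proof -
	have "f \<in> C0" using gen by (simp add: has_generator_def)
	hence fc: "continuous_on UNIV f" "bounded (range f)" by (auto simp: C0_def)
	have "W \<inter> closure {x. f x ~= 0} = {}" using f(2) W by (subst open_Int_closure_eq_empty) auto
	hence ns: "y \<notin> closure {x. f x ~= 0}" using y by blast
	hence int: "integrable (J y) f" and lim: "((%t. transition X t f y / t) \<longlongrightarrow> (\<integral>x. f x \<partial>J y)) (at_right 0)"
		using J fc unfolding levy_kernel_def by blast+
	have "((%t. transition X t f y / t) \<longlongrightarrow> g y) (at_right 0)"
		using has_generator_pointwise[OF gen, of y] f(2)[OF y] by simp
	hence g: "g y = (\<integral>x. f x \<partial>J y)" using lim by (intro tendsto_unique[of "at_right 0"]) auto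
	show "0 <= g y" unfolding g using f(1) by (intro integral_nonneg_AE) auto
	show "ennreal (g y) = (nn_integral (J y) (%x. ennreal (f x)))"
		unfolding g using f(1) by (intro nn_integral_eq_integral[OF int, symmetric]) auto
qed

text \<open>For \<open>f\<close> vanishing on \<open>W\<close> the starting value and the killing
  term in \<open>Dynkin\<close> are 0 and the generator is nonnegative on \<open>W\<close>; what
  remains equates exit payoff and accumulated jump rate.\<close>

lemma exit_bump:
	assumes J: "levy_kernel X J" and k: "rate k" "!!z. \<alpha> <= k z" "0 < \<alpha>"
		and gen: "has_generator X f g" and W: "open W"
		and f: "!!x. 0 <= f x" "!!x. x \<in> W ==> f x = 0" and y: "y \<in> W"
	shows "stopped k (leave W) (enn0 f) (Some y) =
		R_upto k (leave W) (ext0 (%x. \<integral>\<^sup>+z. ennreal (f z) \<partial>J x)) (Some y)"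
proof -
	note off = generator_off_support[OF J gen W f]
	have "R_upto k (leave W) (ext0 (%x. \<integral>\<^sup>+z. ennreal (f z) \<partial>J x)) (Some y) = R_upto k (leave W) (enn0 g) (Some y)"
		by (rule R_upto_cong[OF W]) (simp add: off)
	also have "... = stopped k (leave W) (enn0 f) (Some y) +
		 R_upto k (leave W) (%z. ennreal (k z) * enn0 f z + ext0 (%x. ennreal (- g x)) z) (Some y)"
		using Dynkin[OF gen f(1) k raw_time_leave[OF W], of "Some y"] f(2)[OF y] by simp
	also have "R_upto k (leave W) (%z. ennreal (k z) * enn0 f z + ext0 (%x. ennreal (- g x)) z) (Some y) =
		R_upto k (leave W) (%_. 0) (Some y)"
		by (rule R_upto_cong[OF W]) (use off(2) f(2) in "simp add: ennreal_neg")
	also have "... = 0" by (simp add: R_upto_def occ_def)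
	finally show ?thesis by simp
qed

lemma stopped_SUP:
	assumes "rate k" "T \<in> hmeas" "!!i::nat. f i \<in> smeas" "incseq f"
	shows "stopped k T (%z. SUP i. f i z) x = (SUP i. stopped k T (f i) x)"
proof -
	have "stopped k T (%z. SUP i. f i z) x = (EE x (%w. (SUP i. ennreal (M k (enn2real (T w)) w) * indicator {w. T w < \<infinity>} w * f i (pos_at X T w))))"
		unfolding stopped_def by (simp add: SUP_mult_left_ennreal)
	also have "... = (SUP i. stopped k T (f i) x)"
		unfolding stopped_def
		by (rule nn_integral_monotone_convergence_SUP)
			(use stopped_measurable[OF assms(1-3)] assms(4) in "auto simp: incseq_def le_fun_def intro!: mult_left_mono")
	finally show ?thesis .
qed

lemma R_upto_SUP:
	assumes "rate k" "T \<in> hmeas" "!!i::nat. v i \<in> smeas" "incseq v"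
	shows "R_upto k T (%z. SUP i. v i z) x = (SUP i. R_upto k T (v i) x)"
proof -
	have "R_upto k T (%z. SUP i. v i z) x = (EE x (%w. (SUP i. occ k (v i) (T w) w)))"
		unfolding R_upto_def by (intro nn_integral_cong) (simp add: occ_SUP[OF assms(1,3,4)])
	also have "... = (SUP i. R_upto k T (v i) x)"
		unfolding R_upto_def
		by (rule nn_integral_monotone_convergence_SUP)
			(use occ_measurable_P[OF assms(1,3,2)] assms(4) in "auto simp: incseq_def le_fun_def intro!: occ_mono")
	finally show ?thesis .
qed

text \<open>As functionals of the payoff both sides are measures. \<open>exit_bump\<close> equates
  them on bumps supported off \<open>closure W\<close>, and fattening extends this to all Borel
  payoffs there.\<close>

lemma levy_system_killed:
	assumes J: "levy_kernel X J" and bumps: "many_bumps X" and k: "rate k" "!!z. \<alpha> <= k z" "0 < \<alpha>"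
		and W: "open W" and y: "y \<in> W" and h: "h \<in> bmeas" and A: "A \<in> sets borel" "A \<inter> closure W = {}"
	shows "stopped k (leave W) (ext0 (%x. h x * indicator A x)) (Some y) =
		R_upto k (leave W) (ext0 (%x. \<integral>\<^sup>+z. h z * indicator A z \<partial>J x)) (Some y)"
proof -
	define L1 where "L1 f = stopped k (leave W) (ext0 f) (Some y)" for f
	define L2 where "L2 f = R_upto k (leave W) (ext0 (%x. \<integral>\<^sup>+z. f z \<partial>J x)) (Some y)" for f
	note T = leave_measurable[OF W]
	have sJ: "sets (J x) = sets borel" for x using J by (simp add: levy_kernel_def)
	have mk: "(%x. \<integral>\<^sup>+z. f z \<partial>J x) \<in> bmeas" if "f \<in> bmeas" for f
		using J that by (intro nn_integral_kernel_measurable) (auto simp: levy_kernel_def)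
	have cs: "f \<in> bmeas ==> f \<in> borel_measurable (J x)" for f :: "'a => ennreal" and x
		using measurable_cong_sets[OF sJ refl] by blast
	have e: "ext0 (%x. f x + g x) = (%z. ext0 f z + ext0 g z)" "ext0 (%x. c * f x) = (%z. c * ext0 f z)"
		"ext0 (%x. SUP i. F i x) = (%z. SUP i. ext0 (F i) z)" "incseq F ==> incseq (%i. ext0 (F i))"
		for f g :: "'a => ennreal" and F :: "nat => 'a => ennreal" and c
		by (auto simp: ext0_def fun_eq_iff incseq_def le_fun_def split: option.splits)
	obtain N1 where N1: "sets N1 = sets borel" "!!f. f \<in> bmeas ==> (nn_integral N1 (%x. f x)) = L1 f"
	proof (rule functional_is_integral[of L1])
		show "L1 (%x. SUP i. F i x) = (SUP i. L1 (F i))" if "!!i. F i \<in> bmeas" "incseq F" for F :: "nat => _"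
			unfolding L1_def e(3) by (rule stopped_SUP[OF k(1) T measurable_ext0[OF that(1)] e(4)[OF that(2)]])
	qed (auto simp: L1_def e(1,2) stopped_add[OF k(1) T] stopped_cmult[OF k(1) T] measurable_ext0)
	obtain N2 where N2: "sets N2 = sets borel" "!!f. f \<in> bmeas ==> (nn_integral N2 (%x. f x)) = L2 f"
	proof (rule functional_is_integral[of L2])
		show "L2 (%x. SUP i. F i x) = (SUP i. L2 (F i))" if F: "!!i. F i \<in> bmeas" "incseq F" for F :: "nat => _"
		proof -
			have "(nn_integral (J x) (%z. (SUP i. F i z))) = (SUP i. \<integral>\<^sup>+z. F i z \<partial>J x)" for x
				by (rule nn_integral_monotone_convergence_SUP[OF F(2) cs[OF F(1)]])
			moreover have "incseq (%i x. \<integral>\<^sup>+z. F i z \<partial>J x)"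
				using F(2) by (auto simp: incseq_def le_fun_def intro!: nn_integral_mono)
			ultimately show ?thesis
				unfolding L2_def by (simp only: e(3) R_upto_SUP[OF k(1) T measurable_ext0[OF mk[OF F(1)]] e(4)])
		qed
	qed (auto simp: L2_def e(1,2) cs nn_integral_add nn_integral_cmult R_upto_add[OF k(1) T] R_upto_cmult[OF k(1) T] measurable_ext0 mk)
	have eq: "density N1 (indicator (- closure W)) = density N2 (indicator (- closure W))"
	proof (rule density_eq_by_fattening[OF N1(1) N2(1)])
		have "emeasure N1 UNIV = L1 (indicator UNIV)" using N1(2)[of "indicator UNIV"] sets_eq_imp_space_eq[OF N1(1)] by simp
		also have "... <= 1" unfolding L1_def by (rule stopped_bound[OF k(1)]) (auto simp: ext0_def split: option.splits)
		finally show "emeasure N1 UNIV < \<infinity>" by (auto intro: le_less_trans)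
		fix C U :: "'a set" assume C: "compact C" and U: "open U" "C \<subseteq> U" "U \<subseteq> - closure W"
		obtain f where f: "f \<in> gen_dom X" "!!x. x \<in> C ==> f x = 1" "!!x. x \<notin> U ==> f x = 0" "!!x. 0 <= f x" "!!x. f x <= 1"
			using bumps C U unfolding many_bumps_def by meson
		have fW: "f x = 0" if "x \<in> W" for x using f(3) U(3) that closure_subset by blast
		have fm: "f \<in> bmeas" using f(1) C0_measurable unfolding gen_dom_def has_generator_def by blast
		have "L1 (%x. ennreal (f x)) = L2 (%x. ennreal (f x))"
			unfolding L1_def L2_def by (rule exit_bump[OF J k has_generator_gen[OF f(1)] W f(4) fW y])
		hence I: "(nn_integral N1 (%x. ennreal (f x))) = (nn_integral N2 (%x. ennreal (f x)))" using N1(2) N2(2) fm by simp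
		have "emeasure N C <= (nn_integral N (%x. ennreal (f x)))" "(nn_integral N (%x. ennreal (f x))) <= emeasure N U" if "sets N = sets borel" for N
		proof -
			have "C \<in> sets N" "U \<in> sets N" using that C U by (auto intro: borel_compact)
			moreover have "(nn_integral N (%x. indicator C x)) <= (nn_integral N (%x. ennreal (f x)))" "(nn_integral N (%x. ennreal (f x))) <= (nn_integral N (%x. indicator U x))"
				using f by (auto intro!: nn_integral_mono simp: indicator_def ennreal_le_1)
			ultimately show "emeasure N C <= (nn_integral N (%x. ennreal (f x)))" "(nn_integral N (%x. ennreal (f x))) <= emeasure N U" by simp_all
		qed
		thus "emeasure N2 C <= emeasure N1 U & emeasure N1 C <= emeasure N2 U"
			using I N1(1) N2(1) by (metis order_trans)
	qed auto
	let ?f = "%x. h x * indicator A x"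
	have f: "?f \<in> bmeas" using h A(1) by measurable
	have restr: "(nn_integral (density N (indicator (- closure W))) (%x. ?f x)) = (nn_integral N (%x. ?f x))" if "sets N = sets borel" for N
	proof -
		have "?f \<in> borel_measurable N" "(indicator (- closure W) :: 'a => ennreal) \<in> borel_measurable N"
			using f that by (auto simp: measurable_cong_sets[OF that refl] intro!: borel_measurable_indicator)
		thus ?thesis using A(2) by (auto simp: nn_integral_density indicator_def intro!: nn_integral_cong)
	qed
	have "L1 ?f = L2 ?f" using restr[OF N1(1)] restr[OF N2(1)] N1(2)[OF f] N2(2)[OF f] eq by simp
	thus ?thesis by (simp add: L1_def L2_def)
qed

text \<open>The constant rates \<open>1 / (n + 1)\<close> decrease to 0, and both sides increase
  accordingly.\<close>

lemma levy_system:
	assumes J: "levy_kernel X J" and bumps: "many_bumps X"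
		and W: "open W" and y: "y \<in> W" and h: "h \<in> bmeas" and A: "A \<in> sets borel" "A \<inter> closure W = {}"
	shows "exit_value W (ext0 (%x. h x * indicator A x)) (Some y) =
		R_upto (%_. 0) (leave W) (ext0 (%x. \<integral>\<^sup>+z. h z * indicator A z \<partial>J x)) (Some y)"
proof -
	have sJ: "sets (J x) = sets borel" for x using J by (simp add: levy_kernel_def)
	have mJ: "(%x. emeasure (J x) A) \<in> bmeas" if "A \<in> sets borel" for A
		using J that by (simp add: levy_kernel_def)
	note [measurable] = h A(1)
	have m: "(%x. h x * indicator A x) \<in> bmeas" by measurable
	have "exit_value W (ext0 (%x. h x * indicator A x)) (Some y) =
		 (SUP n. stopped (%_. inv1 n) (leave W) (ext0 (%x. h x * indicator A x)) (Some y))"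
		unfolding stopped_const_SUP[OF leave_measurable[OF W] measurable_ext0[OF m]] by (simp add: stopped_zero)
	also have "... = (SUP n. R_upto (%_. inv1 n) (leave W) (ext0 (%x. \<integral>\<^sup>+z. h z * indicator A z \<partial>J x)) (Some y))"
		by (intro SUP_cong refl levy_system_killed[OF J bumps _ order_refl _ W y h A] rate_const) auto
	also have "... = R_upto (%_. 0) (leave W) (ext0 (%x. \<integral>\<^sup>+z. h z * indicator A z \<partial>J x)) (Some y)"
		by (rule R_upto_const_SUP[OF leave_measurable[OF W] measurable_ext0[OF nn_integral_kernel_measurable[OF sJ mJ m]]])
	finally show ?thesis .
qed

end

section \<open>Irregular boundary points are not hit\<close>

context hunt
begin

lemma AE_shift:
	assumes s: "0 <= s" and Q: "{w \<in> paths X. \<not> Q w} \<in> sets H" and ae: "!!z. AE w in P z. Q w"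
	shows "AE w in P x. Q (shift X s w)"
proof -
	let ?B = "{w \<in> paths X. \<not> Q w}"
	have h: "indicator ?B \<in> hmeas" using Q by simp
	have z: "(EE z (%w. indicator ?B w)) = 0" for z
	proof -
		have "AE w in P z. indicator ?B w = (0::ennreal)" using ae[of z] by eventually_elim simp
		thus ?thesis by (simp cong: nn_integral_cong_AE)
	qed
	have "(EE x (%w. 1 * indicator ?B (shift X s w))) = (EE x (%w. 1 * (EE (pos X s w) (%w'. indicator ?B w'))))"
		by (rule markov[OF s _ h]) simp
	hence "(EE x (%w. indicator ?B (shift X s w))) = 0" by (simp add: z)
	moreover have "(%w. indicator ?B (shift X s w) :: ennreal) \<in> borel_measurable (P x)"
		unfolding measurable_P_iff by (rule measurable_compose[OF measurable_shift_random h]) (use s in auto)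
	ultimately have "AE w in P x. indicator ?B (shift X s w) = (0 :: ennreal)"
		by (simp add: nn_integral_0_iff_AE)
	with AE_space show ?thesis
		by eventually_elim (use s in "auto simp: indicator_def shift_paths split: if_splits")
qed

text \<open>The first exit at or after time \<open>1 / (k + 1)\<close>, so that behaviour at time 0
  plays no part in it.\<close>

definition late :: "'a set => nat => 'w => ennreal" where
	"late D k w = ennreal (inverse (real (Suc k))) + leave D (shift X (inverse (real (Suc k))) w)"

text \<open>A measurable version of the exit time for starting points outside \<open>D\<close>.\<close>

definition leave_pos_time :: "'a set => 'w => ennreal" where
	"leave_pos_time D w = (INF k. late D k w)"

lemma late_antimono:
	assumes D: "open D" and w: "w \<in> paths X" and "k <= l"
	shows "late D l w <= late D k w"
proof -
	define a b where "a = inverse (real (Suc l))" and "b = inverse (real (Suc k))"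
	have ab: "0 <= a" "a <= b" unfolding a_def b_def using \<open>k <= l\<close> by (auto intro: le_imp_inverse_le)
	have *: "leave D (shift X a w) <= ennreal (b - a) + leave D (shift X b w)"
	proof (cases "ennreal (b - a) < leave D (shift X a w)")
		case True
		have "leave D (shift X a w) = ennreal (b - a) + leave D (shift X (b - a) (shift X a w))"
			by (rule leave_shift[OF D shift_paths[OF w ab(1)] _ True]) (use ab in simp)
		moreover have "leave D (shift X (b - a) (shift X a w)) = leave D (shift X b w)"
		proof -
			have "pos X t (shift X (b - a) (shift X a w)) = pos X t (shift X b w)" if "0 <= t" for t
				using ab w that by (simp add: pos_shift shift_paths)
			thus ?thesis
				unfolding leave_def below_time_def by (intro SUP_cong refl arg_cong[where f = Inf] image_cong) auto
		qed
		ultimately show ?thesis by simp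
	next
		case False
		hence "leave D (shift X a w) <= ennreal (b - a) + 0" by simp
		also have "... <= ennreal (b - a) + leave D (shift X b w)" by (intro add_left_mono) simp
		finally show ?thesis .
	qed
	have "ennreal a + leave D (shift X a w) <= ennreal a + (ennreal (b - a) + leave D (shift X b w))"
		by (rule add_left_mono[OF *])
	also have "... = ennreal b + leave D (shift X b w)"
		using ab by (simp add: add.assoc[symmetric] ennreal_plus[symmetric] del: ennreal_plus)
	finally show ?thesis unfolding late_def a_def b_def .
qed

lemma raw_time_late:
	assumes D: "open D"
	shows "raw_time (late D k)"
	unfolding raw_time_def
proof (intro allI impI)
	fix t :: real assume t: "0 < t"
	define e where "e = inverse (real (Suc k))"
	have e: "0 <= e" by (simp add: e_def)
	show "{w \<in> paths X. late D k w < ennreal t} \<in> hist t"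
	proof (cases "e < t")
		case False
		hence "\<not> late D k w < ennreal t" for w
			unfolding late_def e_def[symmetric] by (auto simp: not_less intro!: add_increasing2 ennreal_leI)
		thus ?thesis by simp
	next
		case True
		have iff: "late D k w < ennreal t \<longleftrightarrow> leave D (shift X e w) < ennreal (t - e)" for w
			unfolding late_def e_def[symmetric] using True e
			by (cases "leave D (shift X e w)")
				(auto simp: ennreal_less_iff ennreal_plus[symmetric] simp del: ennreal_plus)
		have "{w \<in> paths X. leave D w < ennreal (t - e)} \<in> sets (history X {0..t - e})"
			using raw_time_leave[OF D] True by (auto simp: raw_time_def)
		from measurable_sets[OF measurable_shift_history[OF e] this]
		have "shift X e -` {w \<in> paths X. leave D w < ennreal (t - e)} \<inter> paths X \<in> sets (history X {e..t})" by simp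
		moreover have "shift X e -` {w \<in> paths X. leave D w < ennreal (t - e)} \<inter> paths X = {w \<in> paths X. late D k w < ennreal t}"
			using e by (auto simp: iff shift_paths)
		ultimately show ?thesis using history_mono[of "{e..t}" "{0..t}" X] e by auto
	qed
qed

lemma raw_time_leave_pos:
	assumes D: "open D"
	shows "raw_time (leave_pos_time D)"
	unfolding raw_time_def
proof (intro allI impI)
	fix t :: real assume t: "0 < t"
	have "{w \<in> paths X. leave_pos_time D w < ennreal t} = (\<Union>k. {w \<in> paths X. late D k w < ennreal t})"
		by (auto simp: leave_pos_time_def INF_less_iff)
	also have "... \<in> hist t"
		using raw_time_late[OF D] t by (intro sets.countable_UN) (auto simp: raw_time_def)
	finally show "{w \<in> paths X. leave_pos_time D w < ennreal t} \<in> hist t" .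
qed

text \<open>\<open>exit_time\<close> counts positive times only and is therefore approximated by
  exits after \<open>1 / (k + 1)\<close>; at these the position is outside \<open>D\<close> by
  \<open>AE_at_leave\<close> for the shifted paths.\<close>

lemma AE_exit_time_eq:
	assumes D: "open D"
	shows "AE w in P x. exit_time X D w = leave_pos_time D w"
proof -
	define Q where "Q w \<longleftrightarrow> (leave D w < \<infinity> --> pos_at X (leave D) w \<notin> Some ` D)" for w
	have Qm: "{w \<in> paths X. \<not> Q w} \<in> sets H"
	proof -
		note [measurable] = leave_measurable[OF D] measurable_pos_at[OF leave_measurable[OF D]]
		have [measurable]: "Some ` D \<in> sets state_alg" using D by (intro Some_image_sets_state_alg) simp
		have "{w \<in> space H. leave D w < \<infinity> & pos_at X (leave D) w \<in> Some ` D} \<in> sets H" by measurable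
		thus ?thesis by (simp add: Q_def)
	qed
	have "AE w in P x. \<forall>k. Q (shift X (inverse (real (Suc k))) w)"
		unfolding AE_all_countable
	proof
		show "AE w in P x. Q (shift X (inverse (real (Suc k))) w)" for k
			by (rule AE_shift[OF _ Qm]) (use AE_at_leave[OF D] in "simp_all add: Q_def")
	qed
	with AE_space show ?thesis
	proof eventually_elim
		case (elim w)
		hence w: "w \<in> paths X" and Q: "!!k. Q (shift X (inverse (real (Suc k))) w)" by auto
		show ?case
		proof (rule antisym)
			show "leave_pos_time D w <= exit_time X D w"
				unfolding exit_time_def hitting_time_def
			proof (rule INF_greatest)
				fix t assume "t \<in> {t. 0 < t & pos X t w \<in> - Some ` D}"
				hence t: "0 < t" "pos X t w \<notin> Some ` D" by auto
				obtain k where k: "inverse (real (Suc k)) < t" using reals_Archimedean[OF t(1)] by blast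
				define e where "e = inverse (real (Suc k))"
				have e: "0 <= e" "e < t" using k by (auto simp: e_def)
				have "leave D (shift X e w) <= ennreal (t - e)"
					by (rule leave_outside[OF D shift_paths[OF w e(1)]]) (use e t w in "auto simp: pos_shift")
				hence "ennreal e + leave D (shift X e w) <= ennreal e + ennreal (t - e)" by (rule add_left_mono)
				also have "... = ennreal t" using e by (simp add: ennreal_plus[symmetric] del: ennreal_plus)
				finally have "late D k w <= ennreal t" unfolding late_def e_def .
				thus "leave_pos_time D w <= ennreal t" unfolding leave_pos_time_def by (rule INF_lower2[OF UNIV_I])
			qed
			show "exit_time X D w <= leave_pos_time D w"
				unfolding leave_pos_time_def
			proof (rule INF_greatest)
				fix k
				define e where "e = inverse (real (Suc k))"
				have e: "0 < e" by (simp add: e_def)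
				show "exit_time X D w <= late D k w"
				proof (cases "leave D (shift X e w)")
					case (real r)
					hence "pos X r (shift X e w) \<notin> Some ` D" using Q[of k] by (simp add: Q_def e_def pos_at_def)
					hence "pos X (e + r) w \<in> - Some ` D" using real e w by (simp add: pos_shift add.commute)
					hence "exit_time X D w <= ennreal (e + r)"
						unfolding exit_time_def hitting_time_def using e real by (intro INF_lower) auto
					thus ?thesis unfolding late_def e_def[symmetric] using real e by simp
				next
					case top
					thus ?thesis unfolding late_def e_def[symmetric] by simp
				qed
			qed
		qed
	qed
qed

lemma history_zero:
	assumes "B \<in> sets (history X {0..0})"
	shows "\<exists>C\<in>sets state_alg. B = pos X 0 -` C \<inter> paths X"
	using assms unfolding sets_history
proof induction
	case (Basic a)
	thus ?case by auto
next
	case Empty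
	show ?case by (rule bexI[of _ "{}"]) auto
next
	case (Compl a)
	then obtain C where "C \<in> sets state_alg" "a = pos X 0 -` C \<inter> paths X" by blast
	thus ?case using sets.compl_sets[of C state_alg] by (intro bexI[of _ "space state_alg - C"]) auto
next
	case (Union a)
	then obtain C where "!!i. C i \<in> sets state_alg" "!!i. a i = pos X 0 -` C i \<inter> paths X" by metis
	thus ?case by (intro bexI[of _ "\<Union>i. C i"]) auto
qed

text \<open>Blumenthal's law: right continuity of the augmented filtration puts the event
  \<open>T = 0\<close> into the information at time 0, which up to null sets depends on the starting
  point alone.\<close>

lemma zero_one_law:
	assumes T: "raw_time T"
	shows "(AE w in P x. T w = 0) \<or> (AE w in P x. T w ~= 0)"
proof -
	let ?A = "{w \<in> paths X. T w <= ennreal 0}"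
	have "?A \<in> events_upto X 0" by (rule past_le_events[OF raw_time_paths_past[OF T]]) simp
	then obtain B where B: "B \<in> sets (history X {0..0})" "?A - B \<union> (B - ?A) \<in> null_sets (law_from X (return state_alg x))"
		unfolding events_upto_def using return_init_laws[of x] by blast
	have "AE w in law_from X (return state_alg x). w \<notin> ?A - B \<union> (B - ?A)" by (rule AE_not_in[OF B(2)])
	hence ae: "AE w in P x. w \<notin> ?A - B \<union> (B - ?A)"
		unfolding law_from_return AE_completion_iff .
	obtain C where C: "B = pos X 0 -` C \<inter> paths X" using history_zero[OF B(1)] by blast
	show ?thesis
	proof (cases "x \<in> C")
		case True
		have "AE w in P x. T w = 0" using ae AE_start[of x] AE_space
			by eventually_elim (use True C in auto)
		thus ?thesis ..
	next
		case False
		have "AE w in P x. T w ~= 0" using ae AE_start[of x] AE_space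
			by eventually_elim (use False C in auto)
		thus ?thesis ..
	qed
qed

text \<open>
	Probabilities of leaving shortly after time \<open>1 / (k + 1)\<close> are continuous in the starting point by the strong
	Feller property.
\<close>

lemma continuous_late:
	assumes sf: "strongly_feller X" and D: "open D"
	shows "continuous_on UNIV (%x. measure (P (Some x)) {w \<in> paths X. late D k w < ennreal t})"
proof -
	define e where "e = inverse (real (Suc k))"
	have e: "0 < e" by (simp add: e_def)
	let ?E = "{w \<in> paths X. ennreal e + leave D w < ennreal t}"
	have E: "?E \<in> sets H"
	proof -
		note [measurable] = leave_measurable[OF D]
		have "{w \<in> space H. ennreal e + leave D w < ennreal t} \<in> sets H" by measurable
		thus ?thesis by simp
	qed
	define b where "b z = measure (P z) ?E" for z
	define b0 where "b0 y = b (Some y)" for y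
	have b: "0 <= b z" "b z <= 1" for z by (auto simp: b_def)
	have em: "emeasure (P z) ?E = ennreal (b z)" for z by (simp add: b_def P.emeasure_eq_measure)
	have bm: "b \<in> smeas"
		unfolding b_def measure_def by (intro measurable_compose[OF measurable_emeasure_kernel[OF P_kernel_subprob E]]) simp
	have b0m: "b0 \<in> bmeas" unfolding b0_def by (rule measurable_compose[OF measurable_Some bm])
	have pe [measurable]: "pos X e \<in> H \<rightarrow>\<^sub>M state_alg" using e by (intro measurable_pos) auto
	have eq: "measure (P (Some x)) {w \<in> paths X. late D k w < ennreal t} =
			transition X e b0 x + b None * (1 - transition X e (%_. 1) x)" for x
	proof -
		have int: "integrable (P (Some x)) (%w. h (pos X e w))" if "h \<in> smeas" "!!z. \<bar>h z\<bar> <= 1"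
			for h :: "'a option => real"
			by (rule P.integrable_const_bound[where B = 1]) (use that in "auto simp: measurable_P_iff")
		have "{w \<in> paths X. late D k w < ennreal t} \<in> sets H"
			using raw_time_late[OF D] history_mono[of "{0..t}" "{0..}" X]
			by (cases "0 < t") (auto simp: raw_time_def ennreal_neg)
		hence "emeasure (P (Some x)) {w \<in> paths X. late D k w < ennreal t} =
			(EE (Some x) (%w. indicator {w \<in> paths X. late D k w < ennreal t} w))" by simp
		also have "... = (EE (Some x) (%w. 1 * indicator ?E (shift X e w)))"
			by (intro nn_integral_cong) (use e in "auto simp: indicator_def late_def e_def shift_paths")
		also have "... = (EE (Some x) (%w. 1 * (EE (pos X e w) (%w'. indicator ?E w'))))"
			by (rule markov) (use e E in auto)
		also have "... = (EE (Some x) (%w. ennreal (b (pos X e w))))"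
			using E by (intro nn_integral_cong) (simp add: em)
		also have "... = ennreal (\<integral>w. b (pos X e w) \<partial>P (Some x))"
			by (rule nn_integral_eq_integral[OF int]) (use b bm in auto)
		finally have 1: "measure (P (Some x)) {w \<in> paths X. late D k w < ennreal t} = (\<integral>w. b (pos X e w) \<partial>P (Some x))"
			using b by (subst (asm) P.emeasure_eq_measure) (auto intro!: integral_nonneg_AE)
		\<comment> \<open>\<open>transition\<close> gives the cemetery the value 0, so the contribution of
		  paths dead by time \<open>e\<close> is restored through the transition of the constant
		  1.\<close>
		have 2: "b z = ext0 b0 z + b None * (1 - ext0 (%_. 1) z)" for z
			by (cases z) (auto simp: b0_def)
		have i1: "integrable (P (Some x)) (%w. ext0 b0 (pos X e w))"
		proof (rule int[OF measurable_ext0[OF b0m]])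
			show "\<bar>ext0 b0 z\<bar> <= 1" for z using b by (cases z) (auto simp: b0_def)
		qed
		have i2: "integrable (P (Some x)) (%w. ext0 (%_. 1) (pos X e w) :: real)"
		proof (rule int[OF measurable_ext0])
			show "\<bar>ext0 (%_. 1) z\<bar> <= (1 :: real)" for z :: "'a option" by (cases z) auto
		qed simp
		have "(\<integral>w. b (pos X e w) \<partial>P (Some x)) =
				(\<integral>w. ext0 b0 (pos X e w) + b None * (1 - ext0 (%_. 1) (pos X e w)) \<partial>P (Some x))"
			by (rule Bochner_Integration.integral_cong[OF refl 2])
		also have "... = transition X e b0 x + b None * (1 - transition X e (%_. 1) x)"
			unfolding transition_def using i1 i2 P.prob_space[of "Some x"] by simp
		finally show ?thesis using 1 by simp
	qed
	have "bounded (range b0)" unfolding bounded_iff using b by (intro exI[of _ 1]) (auto simp: b0_def)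
	hence "continuous_on UNIV (transition X e b0)" using sf e b0m unfolding strongly_feller_def by blast
	moreover have "bounded (range (%_ :: 'a. 1 :: real))" by (auto simp: bounded_iff)
	hence "continuous_on UNIV (transition X e (%_. 1))" using sf e unfolding strongly_feller_def by fastforce
	ultimately show ?thesis unfolding eq by (intro continuous_intros)
qed

lemma AE_hitting_pos_of_closed:
	assumes A: "closed A" and x: "x \<notin> A"
	shows "AE w in P (Some x). hitting_time X (Some ` A) w > 0"
	using AE_start[of "Some x"] AE_space
proof eventually_elim
	case (elim w)
	then obtain e where e: "e > 0" "!!s. 0 <= s ==> s < 0 + e ==> pos X s w \<in> Some ` (- A)"
		using stays_in_open[of "- A" w 0] A x by auto
	have "ennreal e <= hitting_time X (Some ` A) w"
		unfolding hitting_time_def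
	proof (rule INF_greatest)
		fix t assume "t \<in> {t. 0 < t & pos X t w \<in> Some ` A}"
		hence t: "0 < t" "pos X t w \<in> Some ` A" by auto
		have "\<not> t < e"
		proof
			assume "t < e"
			hence "pos X t w \<in> Some ` (- A)" using e(2)[of t] t by simp
			thus False using t(2) by auto
		qed
		thus "ennreal e <= ennreal t" by (intro ennreal_leI) simp
	qed
	moreover have "0 < ennreal e" using e(1) by simp
	ultimately show ?case by (metis order.strict_trans2)
qed

text \<open>The irregular points lie in the union of the sets \<open>A n\<close>, from whose points
  an exit before \<open>1 / (n + 1)\<close> has probability at most \<open>1 - 1 / (n + 1)\<close>.
  These sets are closed by \<open>continuous_late\<close>, and thin: hitting \<open>A n\<close>
  requires being outside \<open>D\<close>, which by the zero-one law takes positive time from points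
  of \<open>A n\<close>; from other points closedness suffices.\<close>

lemma irregular_points_not_hit:
	assumes sf: "strongly_feller X" and sp: "!!A. semi_polar X A ==> polar X A" and D: "open D"
	shows "AE w in P (Some x). \<forall>t>0. \<forall>y. pos X t w = Some y & y \<notin> D --> y \<in> - closure D \<union> regular_boundary X D"
proof -
	define p where "p k n x = measure (P (Some x)) {w \<in> paths X. late D k w < ennreal (inv1 n)}" for k n x
	\<comment> \<open>Testing every \<open>late D k\<close> expresses a bound for their infimum
	  \<open>leave_pos_time D\<close> by functions continuous in the starting point.\<close>
	define A where "A n = {x. x \<notin> D} \<inter> (\<Inter>k. {x. p k n x <= 1 - inv1 n})" for n
	have closed: "closed (A n)" for n
	proof -
		have "closed {x. p k n x <= 1 - inv1 n}" for k
			unfolding p_def by (intro closed_Collect_le continuous_late[OF sf D] continuous_intros)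
		moreover have "{x. x \<notin> D} = - D" by auto
		ultimately show ?thesis using D unfolding A_def by (auto intro!: closed_Int closed_INT)
	qed
	let ?T = "leave_pos_time D"
	note T = raw_time_leave_pos[OF D]
	have sm: "{w \<in> paths X. late D k w < ennreal t} \<in> sets H" for k t
		using raw_time_late[OF D] history_mono[of "{0..t}" "{0..}" X]
		by (cases "0 < t") (auto simp: raw_time_def ennreal_neg)
	have un: "{w \<in> paths X. ?T w < ennreal t} = (\<Union>k. {w \<in> paths X. late D k w < ennreal t})" for t
		by (auto simp: leave_pos_time_def INF_less_iff)
	have pos_exit: "AE w in P (Some x). exit_time X D w > 0" if x: "x \<in> A n" for x n
	proof -
		let ?t = "ennreal (inv1 n)"
		have "emeasure (P (Some x)) {w \<in> paths X. ?T w < ?t} = (SUP k. emeasure (P (Some x)) {w \<in> paths X. late D k w < ?t})"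
			unfolding un
			by (rule SUP_emeasure_incseq[symmetric])
				(use sm in "auto simp: incseq_def intro: le_less_trans[OF late_antimono[OF D]]")
		also have "... <= ennreal (1 - inv1 n)"
		proof (rule SUP_least)
			fix k
			have "p k n x <= 1 - inv1 n" using x by (auto simp: A_def)
			thus "emeasure (P (Some x)) {w \<in> paths X. late D k w < ?t} <= ennreal (1 - inv1 n)"
				unfolding p_def P.emeasure_eq_measure by (rule ennreal_leI)
		qed
		also have "... < 1"
			by (subst ennreal_1[symmetric], subst ennreal_less_iff) (auto simp: field_simps)
		finally have lt: "emeasure (P (Some x)) {w \<in> paths X. ?T w < ?t} < 1" .
		have "\<not> (AE w in P (Some x). ?T w = 0)"
		proof
			assume "AE w in P (Some x). ?T w = 0"
			hence "AE w in P (Some x). w \<in> {w \<in> paths X. ?T w < ?t}"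
				using AE_space by eventually_elim (auto simp del: of_nat_Suc)
			moreover have "{w \<in> paths X. ?T w < ?t} \<in> sets (P (Some x))"
				unfolding un using sm by auto
			ultimately have "emeasure (P (Some x)) {w \<in> paths X. ?T w < ?t} = 1"
				using P.emeasure_eq_1_AE by blast
			thus False using lt by simp
		qed
		hence "AE w in P (Some x). ?T w ~= 0" using zero_one_law[OF T] by blast
		thus ?thesis using AE_exit_time_eq[OF D, of "Some x"]
			by eventually_elim (auto simp: zero_less_iff_neq_zero)
	qed
	have thin: "thin X (A n)" for n
		unfolding thin_def
	proof (intro exI[of _ "A n"] conjI allI order_refl)
		show "nearly_borel X (A n)"
			unfolding nearly_borel_def
			by (intro ballI bexI[of _ "A n"]) (use closed[of n] in auto)
		fix x
		show "AE w in P (Some x). hitting_time X (Some ` A n) w > 0"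
		proof (cases "x \<in> A n")
			case False
			thus ?thesis using AE_hitting_pos_of_closed[OF closed] by blast
		next
			case True
			have "exit_time X D w <= hitting_time X (Some ` A n) w" for w
				unfolding exit_time_def hitting_time_def
				by (intro INF_superset_mono) (auto simp: A_def)
			thus ?thesis using pos_exit[OF True] by (auto elim!: eventually_mono intro: order.strict_trans2)
		qed
	qed
	have "semi_polar X (\<Union>n. A n)" unfolding semi_polar_def using thin by blast
	then obtain B where B: "(\<Union>n. A n) \<subseteq> B" "!!x. AE w in P (Some x). hitting_time X (Some ` B) w = \<infinity>"
		using sp unfolding polar_def by blast
	have irr: "y \<in> (\<Union>n. A n)" if y: "y \<notin> D" "y \<in> closure D" "y \<notin> regular_boundary X D" for y
	proof -
		have "y \<in> frontier D" using y D by (simp add: frontier_def interior_open)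
		hence "\<not> (AE w in P (Some y). exit_time X D w = 0)" using y(3) by (simp add: regular_boundary_def)
		moreover have "AE w in P (Some y). exit_time X D w = 0" if "AE w in P (Some y). ?T w = 0"
			using that AE_exit_time_eq[OF D, of "Some y"] by eventually_elim simp
		ultimately have "\<not> (AE w in P (Some y). ?T w = 0)" by blast
		hence ne: "AE w in P (Some y). ?T w ~= 0" using zero_one_law[OF T] by blast
		define E where "E n = {w \<in> paths X. ?T w < ennreal (inv1 n)}" for n
		have E: "E n \<in> sets (P (Some y))" for n unfolding E_def un using sm by auto
		have "(%n. emeasure (P (Some y)) (E n)) \<longlonglongrightarrow> emeasure (P (Some y)) (\<Inter>n. E n)"
		proof (rule Lim_emeasure_decseq)
			show "decseq E"
				unfolding decseq_def E_def
			proof (intro allI impI subsetI)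
				fix m n :: nat and w assume mn: "m <= n" and w: "w \<in> {w \<in> paths X. ?T w < ennreal (inv1 n)}"
				have "ennreal (inv1 n) <= ennreal (inverse (real (Suc m)))"
					using mn by (intro ennreal_leI le_imp_inverse_le) auto
				thus "w \<in> {w \<in> paths X. ?T w < ennreal (inverse (real (Suc m)))}"
					using w by (auto intro: less_le_trans)
			qed
		qed (use E in "auto simp: P.emeasure_eq_measure")
		moreover have "emeasure (P (Some y)) (\<Inter>n. E n) = 0"
		proof -
			have "(\<Inter>n. E n) \<subseteq> {w \<in> paths X. ?T w = 0}"
			proof
				fix w assume w: "w \<in> (\<Inter>n. E n)"
				have "(%n. ennreal (inv1 n)) \<longlonglongrightarrow> ennreal 0"
					by (intro tendsto_ennrealI LIMSEQ_inverse_real_of_nat)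
				hence "?T w <= ennreal 0"
					by (rule LIMSEQ_le_const) (use w in "auto simp: E_def intro: less_imp_le")
				thus "w \<in> {w \<in> paths X. ?T w = 0}" using w by (auto simp: E_def)
			qed
			hence "AE w in P (Some y). \<not> w \<in> (\<Inter>n. E n)" using ne by (auto elim!: eventually_mono)
			from emeasure_eq_0_AE[OF this]
			have "emeasure (P (Some y)) {w \<in> space (P (Some y)). w \<in> (\<Inter>n. E n)} = 0" .
			moreover have "{w \<in> space (P (Some y)). w \<in> (\<Inter>n. E n)} = (\<Inter>n. E n)" by (auto simp: E_def)
			ultimately show ?thesis by simp
		qed
		ultimately have "(%n. emeasure (P (Some y)) (E n)) \<longlonglongrightarrow> 0" by simp
		hence "eventually (%n. emeasure (P (Some y)) (E n) < ennreal (1 / 2)) sequentially"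
			by (rule order_tendstoD(2)) (rule ennreal_less_zero_iff[THEN iffD2], simp)
		then obtain N where N: "!!n. N <= n ==> emeasure (P (Some y)) (E n) < ennreal (1 / 2)"
			by (auto simp: eventually_sequentially)
		\<comment> \<open>The index is at least 1 because \<open>inv1 1 = 1 / 2\<close>, so that a
		  probability of at most \<open>1 / 2\<close> is at most \<open>1 - inv1 n\<close>.\<close>
		define n where "n = max N 1"
		have "p k n y <= 1 - inv1 n" for k
		proof -
			have "{w \<in> paths X. late D k w < ennreal (inv1 n)} \<subseteq> E n"
				unfolding E_def un by blast
			hence "emeasure (P (Some y)) {w \<in> paths X. late D k w < ennreal (inv1 n)} <= emeasure (P (Some y)) (E n)"
				by (rule emeasure_mono[OF _ E])
			also have "... <= ennreal (1 / 2)" using N[of n] by (simp add: n_def less_imp_le)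
			finally have "p k n y <= 1 / 2" unfolding p_def P.emeasure_eq_measure by (subst (asm) ennreal_le_iff) auto
			moreover have "inv1 n <= 1 / 2" unfolding n_def by (simp add: field_simps)
			ultimately show ?thesis by linarith
		qed
		thus ?thesis using y(1) by (auto simp: A_def)
	qed
	show ?thesis using B(2)[of x]
	proof eventually_elim
		case (elim w)
		show ?case
		proof (intro allI impI)
			fix t y assume t: "0 < t" and y: "pos X t w = Some y & y \<notin> D"
			have "y \<notin> B"
			proof
				assume "y \<in> B"
				hence "hitting_time X (Some ` B) w <= ennreal t"
					unfolding hitting_time_def using t y by (intro INF_lower) auto
				thus False using elim by (simp add: top_unique)
			qed
			hence "y \<notin> (\<Union>n. A n)" using B(1) by blast
			thus "y \<in> - closure D \<union> regular_boundary X D" using irr y by blast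
		qed
	qed
qed

end

section \<open>Strong killing off an open set\<close>

lemma INF_exp_eq_0:
	assumes "0 < (a::real)" "(y::ennreal) < \<infinity>"
	shows "(INF n. ennreal (exp (- real n * a)) * y) = 0"
proof -
	have "filterlim (%n. real n * a) at_top sequentially"
		using assms(1) by (intro filterlim_at_top_mult_tendsto_pos[OF tendsto_const _ filterlim_real_sequentially]) auto
	hence "(%n. exp (- (real n * a))) \<longlonglongrightarrow> 0"
		by (intro filterlim_compose[OF exp_at_bot] filterlim_compose[OF filterlim_uminus_at_bot_at_top])
	hence "(%n. ennreal (exp (- real n * a))) \<longlonglongrightarrow> ennreal 0" by (intro tendsto_ennrealI) simp
	hence "(%n. ennreal (exp (- real n * a)) * y) \<longlonglongrightarrow> 0 * y"
		using assms(2) by (intro tendsto_mult_ennreal tendsto_const) auto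
	hence lim: "(%n. ennreal (exp (- real n * a)) * y) \<longlonglongrightarrow> 0" by simp
	have "(INF n. ennreal (exp (- real n * a)) * y) <= 0"
		by (rule LIMSEQ_le_const[OF lim]) (auto intro: INF_lower)
	thus ?thesis by simp
qed

context hunt
begin

lemma Acc_cmult: "Acc (%z. c * k z) t w = c * Acc k t w"
	unfolding Acc_def by (simp add: mult.left_commute)

text \<open>By right continuity a visit to the open set \<open>V\<close> lasts for an interval of
  time, over which the positive rate has a positive integral.\<close>

lemma Acc_pos_of_visit:
	assumes k: "rate k" and w: "w \<in> paths X" and V: "open V" "!!y. y \<in> V ==> 0 < k (Some y)"
		and s: "0 <= s" "s < t" "pos X s w \<in> Some ` V"
	shows "0 < Acc k t w"
proof -
	obtain e where e: "e > 0" "!!r. s <= r ==> r < s + e ==> pos X r w \<in> Some ` V"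
		using stays_in_open[OF V(1) w s(1,3)] by blast
	have nn: "0 <= indicator {0..t} r * k (Y r w)" for r using rate_nonneg[OF k, of "Y r w"] by simp
	have "Acc k t w ~= 0"
	proof
		assume "Acc k t w = 0"
		hence "AE r in lborel. indicator {0..t} r * k (Y r w) = 0"
			unfolding Acc_def using integral_nonneg_eq_0_iff_AE[OF integrable_rate[OF k w]] nn by simp
		hence "AE r in lborel. r \<notin> {s..<min t (s + e)}"
		proof eventually_elim
			case (elim r)
			show ?case
			proof
				assume r: "r \<in> {s..<min t (s + e)}"
				hence "pos X r w \<in> Some ` V" using e(2)[of r] by auto
				thus False using elim r s(1) V(2) by (auto simp: indicator_def dest!: V(2))
			qed
		qed
		hence "emeasure lborel {s..<min t (s + e)} = 0"
			by (subst (asm) AE_iff_measurable[where N = "{s..<min t (s + e)}"]) auto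
		thus False using e(1) s(2) by auto
	qed
	moreover have "0 <= Acc k t w" by (rule Acc_nonneg[OF k])
	ultimately show ?thesis by simp
qed

lemma rate_add_cmult: "rate k ==> rate k' ==> 0 <= c ==> rate (%z. k z + c * k' z)"
proof -
	assume k: "rate k" "rate k'" "0 <= c"
	obtain b b' where "!!z. k z <= b" "!!z. k' z <= b'" using k by (auto simp: rate_def)
	hence "k z + c * k' z <= b + c * b'" for z using k(3) by (intro add_mono mult_left_mono)
	thus ?thesis using k by (auto simp: rate_def intro!: exI[of _ "b + c * b'"])
qed

lemma occ_bound:
	assumes k: "rate k" "!!z. \<alpha> <= k z" "0 < \<alpha>" and v: "!!z. v z <= ennreal c" and c: "0 <= c" and w: "w \<in> paths X"
	shows "occ k v \<infinity> w <= ennreal (c / \<alpha>)"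
proof -
	have "occ k v \<infinity> w <= (Leb (%t. ennreal c * (ennreal (exp (- \<alpha> * t)) * indicator {0..} t)))"
		unfolding occ_def
	proof (rule nn_integral_mono)
		fix t :: real
		show "ennreal (M k t w) * v (Y t w) * indicator (before \<infinity>) t <=
			ennreal c * (ennreal (exp (- \<alpha> * t)) * indicator {0..} t)"
			using M_le_exp[OF k(1,2) _ w, of t] k(3) v[of "Y t w"]
			by (cases "0 <= t") (auto simp: mult.commute[of "ennreal c"] intro!: mult_mono ennreal_leI)
	qed
	also have "... = ennreal c * ennreal (1 / \<alpha>)"
		using nn_integral_exp_decay[OF k(3)] by (subst nn_integral_cmult) auto
	also have "... = ennreal (c / \<alpha>)" using c k(3) by (simp add: ennreal_mult[symmetric])
	finally show ?thesis .
qed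

text \<open>
	Killing at a rate \<open>n \<eta>\<close> that is positive off \<open>B\<close> forces the process, as \<open>n\<close> grows, to die upon leaving \<open>B\<close>:
	after the exit it spends a positive amount of time where \<open>\<eta>\<close> is positive.
\<close>

lemma R_strong_killing:
	assumes k: "rate k" "!!z. \<alpha> <= k z" "0 < \<alpha>" and \<eta>: "rate \<eta>"
		and V: "open V" "!!y. y \<in> V ==> 0 < \<eta> (Some y)" and B: "open B" "- B \<subseteq> V"
		and v: "v \<in> smeas" "!!z. v z <= ennreal c" "v None = 0"
	shows "(INF n. R (%z. k z + real n * \<eta> z) v x) <= R_upto (%_. 0) (leave B) v x"
proof -
	let ?k = "%n z. k z + real n * \<eta> z"
	define c' where "c' = max c 0"
	have c': "v z <= ennreal c'" "0 <= c'" for z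
		using v(2)[of z] by (auto simp: c'_def max_def ennreal_neg)
	have kn: "rate (?k n)" for n by (rule rate_add_cmult[OF k(1) \<eta>]) simp
	have kn\<alpha>: "\<alpha> <= ?k n z" for n z using k(2)[of z] rate_nonneg[OF \<eta>, of z] by (simp add: add_increasing2)
	have mono: "?k i z <= ?k j z" if "i <= j" for i j z
		using that rate_nonneg[OF \<eta>, of z] by (intro add_left_mono mult_right_mono) auto
	have fin: "occ (?k n) v \<infinity> w < \<infinity>" if "w \<in> paths X" for n w
		by (rule le_less_trans[OF occ_bound[OF kn kn\<alpha> k(3) c' that]]) simp
	let ?f = "%w n t. ennreal (M (?k n) t w) * v (Y t w) * indicator (before \<infinity>) t"
	have dec: "decseq (?f w)" if w: "w \<in> paths X" for w
		by (intro monotoneI le_funI mult_right_mono ennreal_leI M_antimono_rate[OF kn kn w] mono) auto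
	have occ_le: "AE w in P x. (INF n. occ (?k n) v \<infinity> w) <= occ (%_. 0) v (leave B w) w"
		using AE_at_leave[OF B(1), of x] AE_space
	proof eventually_elim
		case (elim w)
		hence w: "w \<in> paths X" by simp
		have "(INF n. occ (?k n) v \<infinity> w) = (Leb (%t. (INF n. ?f w n t)))"
			unfolding occ_def
			by (rule nn_integral_monotone_convergence_INF_decseq[OF dec[OF w], symmetric, where i = 0])
				(use occ_path_measurable[OF kn v(1) w, of _ \<infinity>] fin[OF w, of 0] in "simp_all add: occ_def")
		also have "... <= occ (%_. 0) v (leave B w) w"
			unfolding occ_def
		proof (rule nn_integral_mono_AE)
			\<comment> \<open>At the exit instant itself no killing has yet taken place in \<open>V\<close>;
			  this single time is discarded.\<close>
			have "AE t in lborel. t ~= enn2real (leave B w)" by (rule AE_lborel_singleton)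
			thus "AE t in lborel. (INF n. ?f w n t) <=
					ennreal (M (%_. 0) t w) * v (Y t w) * indicator (before (leave B w)) t"
			proof eventually_elim
				case (elim t)
				show ?case
				proof (cases "0 <= t & \<not> ennreal t < leave B w")
					case False
					have "(INF n. ?f w n t) <= ?f w 0 t" by (rule INF_lower) simp
					also have "... <= ennreal (M (%_. 0) t w) * v (Y t w) * indicator (before (leave B w)) t"
					proof (cases "0 <= t")
						case True
						have "ennreal (M (?k 0) t w) * v (Y t w) <= 1 * v (Y t w)"
							using M_le_1[OF kn, of 0 t w] by (intro mult_right_mono) auto
						thus ?thesis using True False by simp
					qed simp
					finally show ?thesis .
				next
					case True
					hence "leave B w <= ennreal t" by (elim conjE) (rule leI)
					then obtain s where s: "leave B w = ennreal s" "0 <= s" by (cases "leave B w") (auto simp: top_unique)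
					have st: "s < t" using True elim(1) s by (auto simp: less_le)
					have out: "pos X s w \<notin> Some ` B" using \<open>leave B w < \<infinity> --> pos_at X (leave B) w \<notin> Some ` B\<close> s
						by (simp add: pos_at_def)
					\<comment> \<open>At the exit time \<open>s\<close> the path is either dead, with
					  \<open>v = 0\<close> from then on, or in \<open>V\<close>, where the growing rate sends the
					  weight to 0.\<close>
					have "(INF n. ?f w n t) = 0"
					proof (cases "pos X s w")
						case None
						hence "pos X t w = None" using pos_None[OF w s(2), of t] st by simp
						thus ?thesis using st s(2) by (simp add: v(3))
					next
						case (Some y)
						hence "pos X s w \<in> Some ` V" using out B(2) by auto
						from Acc_pos_of_visit[OF \<eta> w V s(2) st this] have a: "0 < Acc \<eta> t w" .
						have "M (?k n) t w = exp (- real n * Acc \<eta> t w) * M k t w" for n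
							unfolding M_def
							using Acc_add_rate[OF k(1) _ w, of "%z. real n * \<eta> z" t] rate_add_cmult[OF rate_const[OF order_refl] \<eta>, of "real n"]
							by (simp add: Acc_cmult exp_add[symmetric])
						hence "(INF n. ?f w n t) = (INF n. ennreal (exp (- real n * Acc \<eta> t w)) * (ennreal (M k t w) * v (Y t w) * indicator (before \<infinity>) t))"
							using M_pos[of k t w] by (intro INF_cong refl) (simp add: ennreal_mult' mult.assoc)
						also have "... = 0"
						proof (rule INF_exp_eq_0[OF a])
							show "ennreal (M k t w) * v (Y t w) * indicator (before \<infinity>) t < \<infinity>"
								using c'(1)[of "Y t w"] by (auto simp: ennreal_mult_less_top indicator_def intro: le_less_trans)
						qed
						finally show ?thesis .
					qed
					thus ?thesis by simp
				qed
			qed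
		qed
		finally show ?case .
	qed
	have "(INF n. R (?k n) v x) = (EE x (%w. (INF n. occ (?k n) v \<infinity> w)))"
	proof -
		define g where "g n w = occ (?k n) v \<infinity> w * indicator (paths X) w" for n w
		have Rg: "R (?k n) v x = (EE x (%w. g n w))" for n
			unfolding R_def g_def by (intro nn_integral_cong) simp
		have "(EE x (%w. (INF n. g n w))) = (INF n. \<integral>\<^sup>+w. g n w \<partial>P x)"
		proof (rule nn_integral_monotone_convergence_INF_decseq[where i = 0])
			show "decseq g"
				unfolding g_def occ_def
			proof (intro monotoneI le_funI)
				fix i j :: nat and w assume ij: "i <= j"
				show "(Leb (%t. ?f w j t)) * indicator (paths X) w <= (Leb (%t. ?f w i t)) * indicator (paths X) w"
				proof (cases "w \<in> paths X")
					case True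
					show ?thesis
						by (intro mult_right_mono nn_integral_mono le_funD[OF monotoneD[OF dec[OF True] ij]]) simp
				qed simp
			qed
			show "g n \<in> borel_measurable (P x)" for n
			proof -
				have "paths X \<in> sets (P x)" using sets.top[of "P x"] by simp
				thus ?thesis unfolding g_def using occ_measurable_P[OF kn v(1), of "%_. \<infinity>"]
					by (intro borel_measurable_times_ennreal borel_measurable_indicator) auto
			qed
			have "R (?k 0) v x <= ennreal (c' / \<alpha>)" by (rule R_bound[OF kn kn\<alpha> k(3) c'])
			thus "(EE x (%w. g 0 w)) < \<infinity>" unfolding Rg[symmetric] by (simp add: le_less_trans)
		qed
		moreover have "(EE x (%w. (INF n. g n w))) = (EE x (%w. (INF n. occ (?k n) v \<infinity> w)))"
			unfolding g_def by (intro nn_integral_cong) simp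
		ultimately show ?thesis unfolding Rg by simp
	qed
	also have "... <= R_upto (%_. 0) (leave B) v x"
		unfolding R_upto_def by (rule nn_integral_mono_AE[OF occ_le])
	finally show ?thesis .
qed

text \<open>A path that leaves \<open>U'\<close> strictly before \<open>U\<close> is in
  \<open>V\<close> before its exit from \<open>U\<close>, so its weight tends to 0; on all other
  paths the two exit positions agree. Finiteness of the exit value justifies the decreasing
  limit.\<close>

lemma stopped_strong_killing:
	assumes k: "!!n. rate (k n)" "!!n z. k n z <= k (Suc n) z" "!!n z. real n * \<eta> z <= k n z" and \<eta>: "rate \<eta>"
		and V: "open V" "!!y. y \<in> V ==> 0 < \<eta> (Some y)"
		and U: "open U" "open U'" "U' \<subseteq> U" "U - U' \<subseteq> V"
		and f: "f \<in> smeas" "f None = 0" "!!z. f z < \<infinity>" and fin: "exit_value U f x < \<infinity>"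
	shows "(INF n. stopped (k n) (leave U) f x) <= exit_value U' f x"
proof -
	have mono: "k i z <= k j z" if "i <= j" for i j z
		using lift_Suc_mono_le[of "%n. k n z"] k(2) that by blast
	define g where "g n w = ennreal (M (k n) (enn2real (leave U w)) w) * indicator {w. leave U w < \<infinity>} w *
		 f (pos_at X (leave U) w) * indicator (paths X) w" for n w
	have sg: "stopped (k n) (leave U) f x = (EE x (%w. g n w))" for n
		unfolding stopped_def g_def by (intro nn_integral_cong) simp
	have "(INF n. stopped (k n) (leave U) f x) = (EE x (%w. (INF n. g n w)))"
		unfolding sg
	proof (rule nn_integral_monotone_convergence_INF_decseq[where i = 0, symmetric])
		show "decseq g"
		proof (intro monotoneI le_funI)
			fix i j :: nat and w assume "i <= j"
			thus "g j w <= g i w"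
				unfolding g_def
				by (cases "w \<in> paths X") (auto intro!: mult_right_mono ennreal_leI M_antimono_rate[OF k(1) k(1)] mono)
		qed
		show "g n \<in> borel_measurable (P x)" for n
		proof -
			have "paths X \<in> sets (P x)" using sets.top[of "P x"] by simp
			thus ?thesis unfolding g_def
				using stopped_measurable[OF k(1) leave_measurable[OF U(1)] f(1)]
				by (intro borel_measurable_times_ennreal[OF stopped_measurable borel_measurable_indicator])
					(use k(1) leave_measurable[OF U(1)] f(1) in auto)
		qed
		have "stopped (k 0) (leave U) f x <= stopped (%_. 0) (leave U) f x"
			by (rule stopped_antimono_rate[OF rate_const k(1)]) (use rate_nonneg[OF k(1)] in auto)
		also have "... = exit_value U f x" by (rule stopped_zero) (rule f(2))
		finally show "(EE x (%w. g 0 w)) < \<infinity>" unfolding sg[symmetric] using fin by (rule le_less_trans)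
	qed
	also have "... <= exit_value U' f x"
		unfolding exit_value_def
	proof (rule nn_integral_mono_AE)
		show "AE w in P x. (INF n. g n w) <= f (pos_at X (leave U') w)"
			using AE_leave_subset[OF U(2,1,3), of x] AE_at_leave[OF U(2), of x] AE_space
		proof eventually_elim
			case (elim w)
			hence w: "w \<in> paths X" by simp
			show ?case
			proof (cases "leave U' w = leave U w")
				case True
				hence "pos_at X (leave U') w = pos_at X (leave U) w" by (simp add: pos_at_def)
				moreover have "(INF n. g n w) <= 1 * 1 * f (pos_at X (leave U) w) * 1"
					by (rule INF_lower2[OF UNIV_I[of 0]], unfold g_def, intro mult_mono)
						(use M_le_1[OF k(1)] in "auto simp: indicator_def")
				ultimately show ?thesis by simp
			next
				case False
				hence lt: "leave U' w < leave U w" using elim by (auto simp: less_le)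
				show ?thesis
				proof (cases "leave U w")
					case top
					hence "g 0 w = 0" by (simp add: g_def)
					hence "(INF n. g n w) <= 0" by (intro INF_lower2[OF UNIV_I[of 0]]) simp
					thus ?thesis by simp
				next
					case (real t)
					obtain s where s: "leave U' w = ennreal s" "0 <= s" using lt by (cases "leave U' w") auto
					have st: "s < t" using lt real s by (simp add: ennreal_less_iff)
					have "pos X s w \<notin> Some ` U'" using elim s by (simp add: pos_at_def)
					moreover have "pos X s w \<in> Some ` U" by (rule before_leave[OF U(1) s(2)]) (use lt s in simp)
					ultimately have "pos X s w \<in> Some ` V" using U(4) by auto
					from Acc_pos_of_visit[OF \<eta> w V s(2) st this] have a: "0 < Acc \<eta> t w" .
					have "g n w <= ennreal (exp (- real n * Acc \<eta> t w)) * f (pos_at X (leave U) w)" for n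
					proof -
						have r: "rate (%z. real n * \<eta> z)"
							using rate_add_cmult[OF rate_const[OF order_refl] \<eta>, of "real n"] by simp
						have "M (k n) t w <= M (%z. real n * \<eta> z) t w"
							by (rule M_antimono_rate[OF r k(1) w]) (rule k(3))
						also have "... = exp (- real n * Acc \<eta> t w)" by (simp add: M_def Acc_cmult)
						finally show ?thesis using w real by (simp add: g_def ennreal_leI mult_right_mono)
					qed
					hence "(INF n. g n w) <= (INF n. ennreal (exp (- real n * Acc \<eta> t w)) * f (pos_at X (leave U) w))"
						by (rule INF_mono')
					also have "... = 0" by (rule INF_exp_eq_0[OF a f(3)])
					finally show ?thesis by simp
				qed
			qed
		qed
	qed
	finally show ?thesis .
qed

section \<open>Green potentials, mean exit times and harmonicity in terms of
  \<open>leave\<close>\<close>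

lemma green_R_upto:
	assumes G: "green_function m X G" and D: "open D" and x: "x \<in> D" and f: "f \<in> bmeas"
	shows "R_upto (%_. 0) (leave D) (ext0 f) (Some x) = (\<integral>\<^sup>+y\<in>D. f y * G D x y \<partial>m)"
proof -
	have "R_upto (%_. 0) (leave D) (ext0 f) (Some x) =
		(EE (Some x) (%w. (\<integral>\<^sup>+t\<in>before (exit_time X D w). ext0 f (pos X t w) \<partial>lborel)))"
		unfolding R_upto_def occ_def
	proof (rule nn_integral_cong_AE)
		show "AE w in P (Some x). (Leb (%t. ennreal (M (%_. 0) t w) * ext0 f (Y t w) * indicator (before (leave D w)) t)) =
			(\<integral>\<^sup>+t\<in>before (exit_time X D w). ext0 f (pos X t w) \<partial>lborel)"
			using AE_exit_time[OF D x] by eventually_elim (auto simp: indicator_def intro!: nn_integral_cong)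
	qed
	also have "... = (\<integral>\<^sup>+y\<in>D. f y * G D x y \<partial>m)"
		using G D x f unfolding green_function_def expect_eq by blast
	finally show ?thesis .
qed

lemma exit_mean_eq_expect:
	assumes "open D" "x \<in> D"
	shows "expect X x (exit_time X D) = exit_mean D (Some x)"
	unfolding expect_eq exit_mean_def
	by (rule nn_integral_cong_AE) (rule AE_exit_time[OF assms])

lemma regular_harmonic_exit_value:
	assumes u: "regular_harmonic X D u" and D: "open D" and x: "x \<in> D"
	shows "ennreal (u x) = exit_value D (enn0 u) (Some x)"
proof -
	have "ennreal (u x) = (EE (Some x) (%w. enn0 u (pos_at X (exit_time X D) w)))"
		using u x unfolding regular_harmonic_def expect_eq by blast
	also have "... = exit_value D (enn0 u) (Some x)"
		unfolding exit_value_def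
		by (rule nn_integral_cong_AE) (use AE_exit_time[OF D x] in "auto simp: pos_at_def elim!: eventually_mono")
	finally show ?thesis .
qed

lemma exit_value_outside:
	assumes D: "open D" and z: "z \<notin> Some ` D"
	shows "exit_value D f z = f z"
proof -
	have "AE w in P z. f (pos_at X (leave D) w) = f z"
		using AE_start[of z] AE_space
	proof eventually_elim
		case (elim w)
		hence "leave D w <= ennreal 0" using z by (intro leave_outside[OF D]) auto
		thus ?case using elim by (simp add: pos_at_def)
	qed
	hence "exit_value D f z = (EE z (%w. f z))" unfolding exit_value_def by (rule nn_integral_cong_AE)
	thus ?thesis using P.emeasure_space_1[of z] by simp
qed

text \<open>From outside \<open>D\<close> the exit is immediate, so \<open>f\<close> equals its exit
  value from \<open>D\<close> everywhere, and the decomposition at leaving \<open>U\<close> passes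
  the identity on.\<close>

lemma harmonic_subset:
	assumes harm: "!!x. x \<in> D ==> f (Some x) = exit_value D f (Some x)" and D: "open D" and U: "open U" "U \<subseteq> D"
		and f: "f \<in> smeas" "f None = 0"
	shows "exit_value U f z = f z"
proof -
	have e: "exit_value D f = f"
	proof
		fix z
		show "exit_value D f z = f z"
		proof (cases "z \<in> Some ` D")
			case True
			thus ?thesis using harm by auto
		qed (rule exit_value_outside[OF D])
	qed
	have "exit_value D f z = exit_value U (exit_value D f) z" by (rule exit_value_strong_markov[OF U(1) D U(2) f])
	thus ?thesis by (simp only: e)
qed

end

section \<open>The setting at a point\<close>

lemma doubling_scale:
	fixes f :: "real => real"
	assumes mono: "!!r s. 0 < r ==> r <= s ==> f r <= f s" and c: "1 <= c" "!!r. 0 < r ==> f (2 * r) <= c * f r" and t: "0 < t"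
	obtains C where "1 <= C" "!!r. 0 < r ==> f (t * r) <= C * f r"
proof -
	have pow: "f (2 ^ n * r) <= c ^ n * f r" if "0 < r" for n r
	proof (induction n)
		case (Suc n)
		have "f (2 ^ Suc n * r) <= c * f (2 ^ n * r)" using c(2)[of "2 ^ n * r"] that by (simp add: mult.assoc)
		also have "... <= c * (c ^ n * f r)" using Suc c(1) by (intro mult_left_mono) auto
		finally show ?case by (simp add: mult.assoc)
	qed simp
	obtain n where n: "t < 2 ^ n" using real_arch_pow[of 2 t] by auto
	show ?thesis
	proof (rule that[of "c ^ n"])
		show "1 <= c ^ n" using c(1) by simp
		show "f (t * r) <= c ^ n * f r" if "0 < r" for r
			using mono[of "t * r" "2 ^ n * r"] pow[OF that, of n] n t that by (simp add: mult_right_mono)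
	qed
qed

lemma closure_annulus: "annulus z r s \<subseteq> closure (annulus z r s)"
	by (rule closure_subset)

lemma closure_ball_subset: "closure (ball z r) \<subseteq> cball z r"
	by (rule closure_minimal) auto

lemma in_ball_subset_closure: "x \<in> ball z r ==> x \<in> closure (ball z r)"
	using closure_subset by blast

locale point_setting =
	fixes m :: "'a::heine_borel measure"
		and X :: "('w, 'a) process" and Xh :: "('v, 'a) process"
		and \<D> :: "('a => real) set"
		and G Gh :: "'a set => 'a => 'a => ennreal"
		and j jh :: "'a => 'a => real"
		and \<Phi> :: "real => real"
		and R0 r0 :: ereal and n0 :: nat and z0 :: 'a
	assumes space: "state_space m R0"
		and A: "assumption_A m X Xh"
		and green: "dual_green_functions m X Xh G Gh"
		and B: "assumption_B m X Xh \<D>"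
		and C: "assumption_C m X Xh j jh"
		and r0: "0 < r0" "r0 <= R0"
		and V1: "assumption_V1 m z0"
		and V2: "assumption_V2 m z0 r0 n0"
		and Phi: "assumption_Phi \<Phi>"
		and B1a: "assumption_B1a m X Xh \<D> \<Phi> z0 r0"
		and B1c: "assumption_B1c m X Xh \<D> \<Phi> z0 r0"
		and C1: "assumption_C1 m j jh \<Phi> z0 r0"
		and D1: "assumption_D1 m G Gh \<Phi> z0 r0"
begin

sublocale X: hunt X
	using A by unfold_locales (simp add: assumption_A_def)

sublocale Xh: hunt Xh
	using A by unfold_locales (simp add: assumption_A_def)

lemma sets_m [measurable_cong]: "sets m = sets borel"
	using space by (simp add: state_space_def)

lemma space_m [simp]: "space m = UNIV"
	using sets_eq_imp_space_eq[OF sets_m] by simp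

sublocale m: sigma_finite_measure m
	using space by (simp add: state_space_def)

lemma dual: "strong_dual m X Xh"
	using A by (simp add: assumption_A_def)

lemma J: "levy_kernel X (%x. density m (%y. ennreal (j x y)))"
	and Jh: "levy_kernel Xh (%x. density m (%y. ennreal (jh x y)))"
	and j_measurable [measurable]: "j x \<in> bmeas" "jh x \<in> bmeas"
	and j_eq: "x ~= y ==> jh y x = j x y"
	and j_pos: "x ~= y ==> 0 < j x y"
	using C unfolding assumption_C_def by metis+

lemma nn_integral_J:
	assumes "f \<in> bmeas"
	shows "(nn_integral (density m (%y. ennreal (j x y))) (%y. f y)) = (nn_integral m (%y. ennreal (j x y) * f y))"
		and "(nn_integral (density m (%y. ennreal (jh x y))) (%y. f y)) = (nn_integral m (%y. ennreal (jh x y) * f y))"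
	using assms by (auto intro!: nn_integral_density)

lemma bump_ex:
	assumes "compact K" "open V" "K \<subseteq> V"
	shows "\<exists>f. f \<in> bump m \<D> K V"
	using B assms unfolding assumption_B_def by (elim conjE) (simp add: ex_in_conv)

lemma bumpD:
	assumes "f \<in> bump m \<D> K V"
	shows "f \<in> gen_dom X" "f \<in> gen_dom Xh" "!!x. x \<in> K ==> f x = 1" "!!x. x \<notin> V ==> f x = 0" "!!x. 0 <= f x" "!!x. f x <= 1"
proof -
	have "\<D> \<subseteq> gen_dom X \<inter> gen_dom Xh" using B unfolding assumption_B_def by (elim conjE)
	moreover have "f \<in> \<D>" using assms by (simp add: bump_def)
	ultimately show "f \<in> gen_dom X" "f \<in> gen_dom Xh" by auto
qed (use assms in "simp_all add: bump_def")

lemma many_bumps_X: "many_bumps X" and many_bumps_Xh: "many_bumps Xh"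
proof -
	have "\<exists>f\<in>gen_dom X \<inter> gen_dom Xh. (\<forall>x\<in>K. f x = 1) & (\<forall>x. x \<notin> V --> f x = 0) & (\<forall>x. 0 <= f x & f x <= 1)"
		if KV: "compact K" "open V" "K \<subseteq> V" for K V
	proof -
		obtain f where "f \<in> bump m \<D> K V" using bump_ex[OF KV] by blast
		from bumpD[OF this] show ?thesis by (intro bexI[of _ f]) auto
	qed
	note * = this
	show "many_bumps X"
		unfolding many_bumps_def
	proof (intro allI impI, elim conjE)
		fix K V :: "'a set" assume "compact K" "open V" "K \<subseteq> V"
		from *[OF this] show "\<exists>f\<in>gen_dom X. (\<forall>x\<in>K. f x = 1) & (\<forall>x. x \<notin> V --> f x = 0) & (\<forall>x. 0 <= f x & f x <= 1)" by blast
	qed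
	show "many_bumps Xh"
		unfolding many_bumps_def
	proof (intro allI impI, elim conjE)
		fix K V :: "'a set" assume "compact K" "open V" "K \<subseteq> V"
		from *[OF this] show "\<exists>f\<in>gen_dom Xh. (\<forall>x\<in>K. f x = 1) & (\<forall>x. x \<notin> V --> f x = 0) & (\<forall>x. 0 <= f x & f x <= 1)" by blast
	qed
qed

lemma bump_continuous:
	assumes "f \<in> bump m \<D> K V"
	shows "continuous_on UNIV f" "bounded (range f)" "f \<in> bmeas"
proof -
	have "f \<in> C0" using bumpD(1)[OF assms] unfolding gen_dom_def has_generator_def by auto
	thus "continuous_on UNIV f" "bounded (range f)" by (auto simp: C0_def)
	thus "f \<in> bmeas" by (simp add: borel_measurable_continuous_onI)
qed

text \<open>The bounds for \<open>jh\<close> become bounds for \<open>j\<close> in its second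
  argument, so that \<open>j\<close> alone appears from here on. The points compared are distinct
  because \<open>a r < r\<close>.\<close>

lemma C1_comparable:
	assumes a: "1 / 2 < a" "a < 1"
	obtains c where "1 <= c"
		"!!r x y. 0 < r ==> ereal r < r0 ==> dist z0 x < a * r ==> r <= dist z0 y ==>
			j x y <= c * j z0 y & j z0 y <= c * j x y & j y x <= c * j y z0 & j y z0 <= c * j y x"
proof -
	obtain c where c: "1 <= c" "!!r x y. 0 < r ==> ereal r < r0 ==> x \<in> ball z0 (a * r) ==> y \<in> - ball z0 r ==>
			inverse c * j z0 y <= j x y & j x y <= c * j z0 y & inverse c * jh z0 y <= jh x y & jh x y <= c * jh z0 y"
		using C1 a unfolding assumption_C1_def by meson
	show ?thesis
	proof (rule that[OF c(1)])
		fix r x y assume r: "0 < r" "ereal r < r0" "dist z0 x < a * r" "r <= dist z0 y"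
		have "a * r < r" using a r by simp
		hence "dist z0 x < dist z0 y" "0 < dist z0 y" using r(1,3,4) by linarith+
		hence ne: "y ~= x" "y ~= z0" by auto
		have "inverse c * j z0 y <= j x y & j x y <= c * j z0 y & inverse c * jh z0 y <= jh x y & jh x y <= c * jh z0 y"
			using c(2)[OF r(1,2), of x y] r by auto
		thus "j x y <= c * j z0 y & j z0 y <= c * j x y & j y x <= c * j y z0 & j y z0 <= c * j y x"
			using c(1) j_eq[OF ne(1)] j_eq[OF ne(2)] by (auto simp: field_simps)
	qed
qed

section \<open>Volumes, the function \<open>\<Phi>\<close> and the size of the jump density near
  \<open>z0\<close>\<close>

lemma small_radius: obtains \<rho> where "0 < \<rho>" "ereal \<rho> < r0"
	using ereal_dense2[of 0 r0] r0(1) by (metis ereal_less(2))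

definition v :: "real => real" where "v r = measure m (ball z0 r)"

text \<open>Finite volume is derived: a bump around \<open>z0\<close> is integrable for the Levy
  kernel at a distant point \<open>y\<close>, where \<open>j y\<close> is bounded below near
  \<open>z0\<close> by a multiple of \<open>j y z0\<close>. Doubling carries finiteness to all
  radii.\<close>

lemma V_finite: "emeasure m (ball z0 r) < \<infinity>"
proof (cases "0 < r")
	case True
	obtain \<rho> where \<rho>: "0 < \<rho>" "ereal \<rho> < r0" by (rule small_radius)
	\<comment> \<open>The localization radius supplies a point off the support of the bump.\<close>
	obtain y where y: "2 * \<rho> <= dist z0 y"
		using space r0(2) \<rho> unfolding state_space_def by (metis ComplD all_not_in_conv mem_ball not_less order_less_le_trans)
	obtain f where f: "f \<in> bump m \<D> (cball z0 (\<rho> / 2)) (ball z0 \<rho>)"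
		using bump_ex[of "cball z0 (\<rho> / 2)" "ball z0 \<rho>"] \<rho> by (fastforce simp: subset_iff)
	have "closure {x. f x ~= 0} \<subseteq> cball z0 \<rho>"
		by (rule closure_minimal) (use bumpD(4)[OF f] in "force simp: not_less")+
	hence "y \<notin> closure {x. f x ~= 0}" using y \<rho> by auto
	hence int: "integrable (density m (%z. ennreal (j y z))) f"
		using J bump_continuous[OF f] unfolding levy_kernel_def by blast
	obtain c where c: "1 <= c" "!!r x y. 0 < r ==> ereal r < r0 ==> dist z0 x < 3/4 * r ==> r <= dist z0 y ==>
			j x y <= c * j z0 y & j z0 y <= c * j x y & j y x <= c * j y z0 & j y z0 <= c * j y x"
		by (rule C1_comparable[of "3/4"]) auto
	define e where "e = ennreal (j y z0 / c)"
	have "y ~= z0" using y \<rho> by auto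
	hence e: "0 < e" using j_pos[of y z0] c(1) by (simp add: e_def)
	have "e * emeasure m (ball z0 (\<rho> / 2)) = (nn_integral m (%z. e * indicator (ball z0 (\<rho> / 2)) z))"
		by (subst nn_integral_cmult_indicator) (auto simp: sets_m)
	also have "... <= (nn_integral m (%z. ennreal (j y z) * ennreal (f z)))"
	proof (intro nn_integral_mono)
		fix z
		show "e * indicator (ball z0 (\<rho> / 2)) z <= ennreal (j y z) * ennreal (f z)"
		proof (cases "z \<in> ball z0 (\<rho> / 2)")
			case True
			hence "j y z0 <= c * j y z" using c(2)[of \<rho> z y] \<rho> y by auto
			hence "e <= ennreal (j y z)" unfolding e_def using c(1) by (intro ennreal_leI) (simp add: field_simps)
			moreover have "f z = 1" using bumpD(3)[OF f] True by auto
			ultimately show ?thesis using True by simp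
		qed simp
	qed
	also have "... = (nn_integral (density m (%z. ennreal (j y z))) (%z. ennreal (f z)))"
		using bump_continuous(3)[OF f] by (subst nn_integral_J) auto
	also have "... < \<infinity>"
		using int bumpD(5)[OF f] unfolding integrable_iff_bounded by simp
	finally have fin: "emeasure m (ball z0 (\<rho> / 2)) < \<infinity>"
		using e by (auto simp: ennreal_mult_less_top top.not_eq_extremum)
	obtain c' where c': "!!r. 0 < r ==> vol m z0 (2 * r) <= ennreal c' * vol m z0 r"
		using V1 unfolding assumption_V1_def by auto
	have "vol m z0 (2 ^ n * (\<rho> / 2)) < \<infinity>" for n
	proof (induction n)
		case 0
		thus ?case using fin by (simp add: vol_def)
	next
		case (Suc n)
		have "vol m z0 (2 ^ Suc n * (\<rho> / 2)) <= ennreal c' * vol m z0 (2 ^ n * (\<rho> / 2))"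
			using c'[of "2 ^ n * (\<rho> / 2)"] \<rho> by (simp add: mult.assoc)
		also have "... < \<infinity>" using Suc by (simp add: ennreal_mult_less_top)
		finally show ?case .
	qed
	moreover obtain n where "r / (\<rho> / 2) < 2 ^ n" using real_arch_pow[of 2 "r / (\<rho> / 2)"] by auto
	hence "r <= 2 ^ n * (\<rho> / 2)" using \<rho> by (simp add: field_simps)
	hence "emeasure m (ball z0 r) <= vol m z0 (2 ^ n * (\<rho> / 2))"
		unfolding vol_def by (intro emeasure_mono subset_ball) (auto simp: sets_m)
	ultimately show ?thesis using le_less_trans by blast
next
	case False
	thus ?thesis by (simp add: ball_empty)
qed

lemma vol_eq: "vol m z0 r = ennreal (v r)"
	unfolding vol_def v_def using V_finite[of r] by (simp add: emeasure_eq_ennreal_measure top.not_eq_extremum)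

lemma v_pos:
	assumes "0 < r"
	shows "0 < v r"
proof -
	have "0 < emeasure m (ball z0 r)" using space assms unfolding state_space_def by auto
	thus ?thesis using vol_eq[of r] by (simp add: vol_def)
qed

lemma v_mono: "r <= s ==> v r <= v s"
	unfolding v_def using V_finite[of s] by (intro measure_mono_fmeasurable) (auto simp: sets_m fmeasurable_def)

lemma v_scale:
	assumes "0 < t"
	obtains K where "1 <= K" "!!r. 0 < r ==> v (t * r) <= K * v r"
proof -
	obtain c where c: "1 < c" "!!r. 0 < r ==> vol m z0 (2 * r) <= ennreal c * vol m z0 r"
		using V1 unfolding assumption_V1_def by auto
	have "v (2 * r) <= c * v r" if "0 < r" for r
		using c(2)[OF that] c(1) v_pos[OF that] unfolding vol_eq by (simp add: ennreal_mult[symmetric] ennreal_le_iff)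
	thus ?thesis
		using doubling_scale[of v c t] v_mono c(1) assms that by (metis less_imp_le)
qed

lemma C1_lower_annulus:
	assumes a: "1 / 2 < a" "a < 1"
	obtains c where "0 < c"
		"!!r y. 0 < r ==> ereal r < r0 ==> a * r < dist z0 y ==> dist z0 y < r ==>
			ennreal c / ennreal (v r * \<Phi> r) <= ennreal (min (j z0 y) (j y z0))"
proof -
	obtain c where c: "0 < c" "!!r. 0 < r ==> ereal r < r0 ==> ennreal c / (vol m z0 r * ennreal (\<Phi> r))
					<= (INF y\<in>closure (annulus z0 (a * r) r). ennreal (min (j z0 y) (jh z0 y)))"
		using C1 a unfolding assumption_C1_def by meson
	show ?thesis
	proof (rule that[OF c(1)])
		fix r y assume r: "0 < r" "ereal r < r0" "a * r < dist z0 y" "dist z0 y < r"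
		have y: "y \<in> closure (annulus z0 (a * r) r)"
			using closure_annulus r by (auto simp: annulus_def)
		have "0 < a * r" using a r by simp
		hence "y ~= z0" using r by auto
		hence "jh z0 y = j y z0" by (rule j_eq)
		moreover have "vol m z0 r * ennreal (\<Phi> r) = ennreal (v r * \<Phi> r)"
			unfolding vol_eq using v_pos[OF r(1)] by (simp add: ennreal_mult')
		ultimately show "ennreal c / ennreal (v r * \<Phi> r) <= ennreal (min (j z0 y) (j y z0))"
			using c(2)[OF r(1,2)] INF_lower[OF y, of "%y. ennreal (min (j z0 y) (jh z0 y))"] by auto
	qed
qed

lemma Phi_mono: "0 <= r ==> r <= s ==> \<Phi> r <= \<Phi> s"
	using Phi unfolding assumption_Phi_def mono_on_def by auto

lemma Phi_scale:
	assumes "0 < t"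
	obtains K where "1 <= K" "!!r. 0 < r ==> \<Phi> (t * r) <= K * \<Phi> r"
proof -
	obtain c where "1 < c" "!!r. 0 < r ==> \<Phi> (2 * r) <= c * \<Phi> r"
		using Phi unfolding assumption_Phi_def by auto
	thus ?thesis
		using doubling_scale[of \<Phi> c t] Phi_mono assms that by (metis less_imp_le)
qed

lemma n0: "2 <= n0" using V2 by (simp add: assumption_V2_def)

lemma volume_growth:
	obtains c where "1 < c" "!!r. 0 < r ==> ereal r <= r0 ==> c * v r <= v (real n0 * r)"
proof -
	obtain c where c: "1 < c" "!!r. 0 < r ==> ereal r <= r0 ==> ennreal c * vol m z0 r <= vol m z0 (real n0 * r)"
		using V2 unfolding assumption_V2_def by auto
	have "c * v r <= v (real n0 * r)" if "0 < r" "ereal r <= r0" for r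
		using c(2)[OF that] c(1) v_pos[OF that(1)] unfolding vol_eq
		by (simp add: ennreal_mult[symmetric] ennreal_le_iff v_def)
	thus ?thesis using that c(1) by blast
qed

text \<open>
	If \<open>\<Phi>\<close> vanished at one radius, it would vanish everywhere by doubling, and the lower bound on \<open>j\<close> in (C1)
	would be infinite on an annulus that (V2') shows to be nonempty.
\<close>

lemma Phi_pos:
	assumes "0 < r"
	shows "0 < \<Phi> r"
proof -
	obtain \<rho> where \<rho>: "0 < \<rho>" "ereal \<rho> < r0" by (rule small_radius)
	\<comment> \<open>Then \<open>n0 s = \<rho> / 2\<close>, and (V2') at radius \<open>s\<close>
	  yields a point of \<open>B(z0, \<rho> / 2)\<close> outside \<open>B(z0, s)\<close>.\<close>
	define s where "s = \<rho> / (2 * real n0)"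
	have s: "0 < s" "real n0 * s = \<rho> / 2" using \<rho> n0 by (auto simp: s_def)
	hence "s <= \<rho>" unfolding s_def using \<rho> n0 by (simp add: field_simps)
	hence "ereal s <= r0" using \<rho>(2) by (meson ereal_less_eq(3) less_imp_le order_trans)
	obtain c where c: "1 < c" "!!r. 0 < r ==> ereal r <= r0 ==> c * v r <= v (real n0 * r)"
		by (rule volume_growth) (rule that)
	have "1 * v s < c * v s" by (rule mult_strict_right_mono[OF c(1) v_pos[OF s(1)]])
	also have "... <= v (\<rho> / 2)" using c(2)[OF s(1) \<open>ereal s <= r0\<close>] s(2) by simp
	finally have "v s < v (\<rho> / 2)" by simp
	hence "\<not> ball z0 (\<rho> / 2) \<subseteq> ball z0 s"
		using V_finite[of s] measure_mono_fmeasurable[of "ball z0 (\<rho> / 2)" "ball z0 s" m]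
		by (auto simp: v_def sets_m fmeasurable_def)
	then obtain y where y: "s <= dist z0 y" "dist z0 y < \<rho> / 2" unfolding subset_iff mem_ball not_all not_imp not_less by blast
	\<comment> \<open>This places \<open>y\<close> at distance \<open>3 t / 4\<close>, within the
	  annulus from \<open>2 t / 3\<close> to \<open>t\<close>, with \<open>t < \<rho>\<close>.\<close>
	define t where "t = dist z0 y / (3/4)"
	have t: "0 < t" "t < \<rho>" using y s \<rho> by (auto simp: t_def)
	hence t0: "ereal t < r0" using \<rho>(2) by (meson ereal_less_eq(3) le_less_trans less_imp_le)
	obtain c where c: "0 < c" "!!r y. 0 < r ==> ereal r < r0 ==> 2/3 * r < dist z0 y ==> dist z0 y < r ==>
			ennreal c / ennreal (v r * \<Phi> r) <= ennreal (min (j z0 y) (j y z0))"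
		by (rule C1_lower_annulus[of "2/3"]) auto
	have le: "ennreal c / ennreal (v t * \<Phi> t) <= ennreal (min (j z0 y) (j y z0))"
		by (rule c(2)[OF t(1) t0]) (use y s in "auto simp: t_def")
	have "\<Phi> t ~= 0"
	proof
		assume "\<Phi> t = 0"
		hence "ennreal c / ennreal (v t * \<Phi> t) = \<infinity>" using c(1) by (simp add: ennreal_divide_zero)
		thus False using le by (simp add: top_unique)
	qed
	hence pos: "0 < \<Phi> t" using Phi t(1) unfolding assumption_Phi_def by (metis less_eq_real_def)
	obtain K where "1 <= K" "\<Phi> (t / r * r) <= K * \<Phi> r"
		using Phi_scale[of "t / r"] t assms by (metis divide_pos_pos)
	thus ?thesis using pos assms by (simp add: zero_less_mult_iff) (smt (verit) mult_nonneg_nonpos)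
qed

text \<open>A point at distance \<open>d\<close> lies in the annulus from \<open>2/3\<close> to 1
  relative to the radius \<open>4 d / 3\<close>, which is below \<open>r0\<close> by hypothesis; the
  doubling conditions lead back to \<open>d\<close>.\<close>

lemma j_lower:
	obtains c where "0 < c"
		"!!y. y ~= z0 ==> ereal (dist z0 y) < ereal (3/4) * r0 ==>
			c <= j z0 y * (v (dist z0 y) * \<Phi> (dist z0 y)) & c <= j y z0 * (v (dist z0 y) * \<Phi> (dist z0 y))"
proof -
	obtain c where c: "0 < c" "!!r y. 0 < r ==> ereal r < r0 ==> 2/3 * r < dist z0 y ==> dist z0 y < r ==>
			ennreal c / ennreal (v r * \<Phi> r) <= ennreal (min (j z0 y) (j y z0))"
		by (rule C1_lower_annulus[of "2/3"]) auto
	obtain K1 where K1: "1 <= K1" "!!r. 0 < r ==> v (4/3 * r) <= K1 * v r" by (rule v_scale[of "4/3"]) auto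
	obtain K2 where K2: "1 <= K2" "!!r. 0 < r ==> \<Phi> (4/3 * r) <= K2 * \<Phi> r" by (rule Phi_scale[of "4/3"]) auto
	show ?thesis
	proof (rule that[of "c / (K1 * K2)"])
		show "0 < c / (K1 * K2)" using c K1 K2 by simp
		fix y assume y: "y ~= z0" "ereal (dist z0 y) < ereal (3/4) * r0"
		define d where "d = dist z0 y"
		have d: "0 < d" using y by (simp add: d_def)
		have "ereal (4/3 * d) < r0"
			using y(2) by (cases r0) (auto simp: d_def)
		hence "ennreal c / ennreal (v (4/3 * d) * \<Phi> (4/3 * d)) <= ennreal (min (j z0 y) (j y z0))"
			using c(2)[of "4/3 * d" y] d by (auto simp: d_def)
		moreover have p: "0 < v (4/3 * d) * \<Phi> (4/3 * d)" using v_pos[of "4/3 * d"] Phi_pos[of "4/3 * d"] d by simp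
		ultimately have "ennreal (c / (v (4/3 * d) * \<Phi> (4/3 * d))) <= ennreal (min (j z0 y) (j y z0))"
			using c(1) by (simp add: divide_ennreal)
		hence "c / (v (4/3 * d) * \<Phi> (4/3 * d)) <= min (j z0 y) (j y z0)"
			using j_pos[of z0 y] j_pos[of y z0] y(1) by (subst (asm) ennreal_le_iff) auto
		hence 1: "c <= min (j z0 y) (j y z0) * (v (4/3 * d) * \<Phi> (4/3 * d))" using p by (simp only: pos_divide_le_eq)
		have "v (4/3 * d) * \<Phi> (4/3 * d) <= (K1 * v d) * (K2 * \<Phi> d)"
			using K1(2)[OF d] K2(2)[OF d] v_pos[OF d] Phi_pos[of "4/3 * d"] K1 d by (intro mult_mono) auto
		hence "c <= min (j z0 y) (j y z0) * ((K1 * v d) * (K2 * \<Phi> d))"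
			using j_pos[of z0 y] j_pos[of y z0] y(1) by (intro order_trans[OF 1] mult_left_mono) auto
		hence "c / (K1 * K2) <= min (j z0 y) (j y z0) * (v d * \<Phi> d)"
			using K1 K2 by (simp add: field_simps)
		moreover have "min (j z0 y) (j y z0) * (v d * \<Phi> d) <= j z0 y * (v d * \<Phi> d)"
			"min (j z0 y) (j y z0) * (v d * \<Phi> d) <= j y z0 * (v d * \<Phi> d)"
			using v_pos[OF d] Phi_pos[OF d] by (auto intro!: mult_right_mono)
		ultimately show "c / (K1 * K2) <= j z0 y * (v (dist z0 y) * \<Phi> (dist z0 y)) & c / (K1 * K2) <= j y z0 * (v (dist z0 y) * \<Phi> (dist z0 y))"
			unfolding d_def by linarith
	qed
qed

section \<open>Test functions with explicit generator bounds\<close>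

lemma ereal_less_divide_bound: "ereal c / ereal p < ereal (2 * c / p)" if "0 < c" "0 < p" for c p :: real
	using that by (simp add: field_simps)

text \<open>The infimum in (B1-a) need not be attained; doubling the constant makes the inequality
  strict and leaves room for an actual bump.\<close>

lemma ball_bump:
	assumes a: "1 / 2 < a" "a < 1"
	obtains c where "0 < c"
		"!!r. 0 < r ==> ereal r < r0 ==> \<exists>f\<in>bump m \<D> (closure (ball z0 (a * r))) (ball z0 r).
			 \<forall>x. gen X f x <= c / \<Phi> r & gen Xh f x <= c / \<Phi> r"
proof -
	obtain c where c: "0 < c" "!!r. 0 < r ==> ereal r < r0 ==>
			(INF f\<in>bump m \<D> (closure (ball z0 (a * r))) (ball z0 r). SUP x. max_gen X Xh f x) <= ereal c / ereal (\<Phi> r)"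
		using B1a a unfolding assumption_B1a_def by meson
	show ?thesis
	proof (rule that[of "2 * c"])
		fix r assume r: "0 < r" "ereal r < r0"
		have "(INF f\<in>bump m \<D> (closure (ball z0 (a * r))) (ball z0 r). SUP x. max_gen X Xh f x) < ereal (2 * c / \<Phi> r)"
			by (rule le_less_trans[OF c(2)[OF r] ereal_less_divide_bound[OF c(1) Phi_pos[OF r(1)]]])
		then obtain f where f: "f \<in> bump m \<D> (closure (ball z0 (a * r))) (ball z0 r)" "(SUP x. max_gen X Xh f x) < ereal (2 * c / \<Phi> r)"
			unfolding INF_less_iff by auto
		have "max_gen X Xh f x <= ereal (2 * c / \<Phi> r)" for x
			using f(2) SUP_upper[of x UNIV "max_gen X Xh f"] by auto
		thus "\<exists>f\<in>bump m \<D> (closure (ball z0 (a * r))) (ball z0 r). \<forall>x. gen X f x <= 2 * c / \<Phi> r & gen Xh f x <= 2 * c / \<Phi> r"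
			using f(1) unfolding max_gen_def by (intro bexI[of _ f]) auto
	qed (use c in simp)
qed

lemma annulus_bump:
	assumes a: "1 / 2 < b" "b < a" "a < 1"
	obtains c where "0 < c"
		"!!r. 0 < r ==> ereal r < r0 ==> \<exists>f\<in>bump m \<D> (closure (annulus z0 (b * r) (a * r))) (annulus z0 (r / 2) r).
			 \<forall>x. gen X f x <= c / \<Phi> r"
proof -
	obtain c where c: "0 < c" "!!r. 0 < r ==> ereal r < r0 ==>
			(INF f\<in>bump m \<D> (closure (annulus z0 (b * r) (a * r))) (annulus z0 (r / 2) r). SUP x. max_gen X Xh f x) <= ereal c / ereal (\<Phi> r)"
		using B1c a unfolding assumption_B1c_def by meson
	show ?thesis
	proof (rule that[of "2 * c"])
		fix r assume r: "0 < r" "ereal r < r0"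
		have "(INF f\<in>bump m \<D> (closure (annulus z0 (b * r) (a * r))) (annulus z0 (r / 2) r). SUP x. max_gen X Xh f x) < ereal (2 * c / \<Phi> r)"
			by (rule le_less_trans[OF c(2)[OF r] ereal_less_divide_bound[OF c(1) Phi_pos[OF r(1)]]])
		then obtain f where f: "f \<in> bump m \<D> (closure (annulus z0 (b * r) (a * r))) (annulus z0 (r / 2) r)" "(SUP x. max_gen X Xh f x) < ereal (2 * c / \<Phi> r)"
			unfolding INF_less_iff by auto
		have "max_gen X Xh f x <= ereal (2 * c / \<Phi> r)" for x
			using f(2) SUP_upper[of x UNIV "max_gen X Xh f"] by auto
		thus "\<exists>f\<in>bump m \<D> (closure (annulus z0 (b * r) (a * r))) (annulus z0 (r / 2) r). \<forall>x. gen X f x <= 2 * c / \<Phi> r"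
			using f(1) unfolding max_gen_def by (intro bexI[of _ f]) auto
	qed (use c in simp)
qed

text \<open>The upper bound for \<open>j\<close> is obtained by testing the generator with a bump near \<open>z0\<close>.\<close>

lemma j_upper:
	obtains c where "0 < c"
		"!!r x. 0 < r ==> ereal r < r0 ==> r <= dist z0 x ==> j z0 x * v r * \<Phi> r <= c"
proof -
	obtain c where c: "1 <= c" "!!r x y. 0 < r ==> ereal r < r0 ==> dist z0 x < 3/4 * r ==> r <= dist z0 y ==>
			j x y <= c * j z0 y & j z0 y <= c * j x y & j y x <= c * j y z0 & j y z0 <= c * j y x"
		by (rule C1_comparable[of "3/4"]) auto
	obtain c1 where c1: "0 < c1" "!!r. 0 < r ==> ereal r < r0 ==> \<exists>f\<in>bump m \<D> (closure (ball z0 (3/4 * r))) (ball z0 r).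
			 \<forall>x. gen X f x <= c1 / \<Phi> r & gen Xh f x <= c1 / \<Phi> r"
		by (rule ball_bump[of "3/4"]) auto
	obtain K1 where K1: "1 <= K1" "!!r. 0 < r ==> v (8/3 * r) <= K1 * v r" by (rule v_scale[of "8/3"]) auto
	obtain K2 where K2: "1 <= K2" "!!r. 0 < r ==> \<Phi> (2 * r) <= K2 * \<Phi> r" by (rule Phi_scale[of 2]) auto
	show ?thesis
	proof (rule that[of "c * K1 * (c1 * K2)"])
		show "0 < c * K1 * (c1 * K2)" using c c1 K1 K2 by simp
		fix r x assume r: "0 < r" "ereal r < r0" "r <= dist z0 x"
		\<comment> \<open>At half the radius the bump vanishes near \<open>x\<close>, so the dual
		  generator there is a pure jump integral, while the plateau \<open>B(z0, 3 r / 8)\<close> still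
		  has volume comparable to \<open>v r\<close>.\<close>
		have r2: "0 < r / 2" "ereal (r / 2) < r0" using r(1,2) by (auto intro: le_less_trans[rotated])
		obtain f where f: "f \<in> bump m \<D> (closure (ball z0 (3/4 * (r / 2)))) (ball z0 (r / 2))"
				"!!x. gen Xh f x <= c1 / \<Phi> (r / 2)" using c1(2)[OF r2] by auto
		have gen: "has_generator Xh f (gen Xh f)" by (rule Xh.has_generator_gen[OF bumpD(2)[OF f(1)]])
		have "ennreal (gen Xh f x) = (nn_integral (density m (%z. ennreal (jh x z))) (%z. ennreal (f z)))"
			by (rule Xh.generator_off_support(1)[OF Jh gen, of "- cball z0 (r / 2)"])
				(use bumpD[OF f(1)] r in auto)
		also have "... = (nn_integral m (%z. ennreal (jh x z) * ennreal (f z)))"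
			using bump_continuous(3)[OF f(1)] by (subst nn_integral_J) auto
		also have "... \<ge> (nn_integral m (%z. ennreal (j z0 x / c) * indicator (ball z0 (3/8 * r)) z))"
		proof (rule nn_integral_mono)
			fix z
			show "ennreal (j z0 x / c) * indicator (ball z0 (3/8 * r)) z <= ennreal (jh x z) * ennreal (f z)"
			proof (cases "z \<in> ball z0 (3/8 * r)")
				case True
				hence "j z0 x <= c * j z x" using c(2)[OF r(1,2), of z x] r by auto
				moreover have "jh x z = j z x" using True r by (intro j_eq) auto
				ultimately have "ennreal (j z0 x / c) <= ennreal (jh x z)" using c(1) by (intro ennreal_leI) (simp add: field_simps)
				moreover have "f z = 1" using True by (intro bumpD(3)[OF f(1)] in_ball_subset_closure) simp
				ultimately show ?thesis using True by simp
			qed simp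
		qed
		also have "(nn_integral m (%z. ennreal (j z0 x / c) * indicator (ball z0 (3/8 * r)) z)) = ennreal (j z0 x / c) * ennreal (v (3/8 * r))"
			by (subst nn_integral_cmult_indicator) (auto simp: sets_m vol_eq[symmetric] vol_def)
		also have "... = ennreal (j z0 x / c * v (3/8 * r))"
			using v_pos[of "3/8 * r"] r by (subst ennreal_mult'') auto
		finally have "ennreal (j z0 x / c * v (3/8 * r)) <= ennreal (c1 / \<Phi> (r / 2))"
			using f(2)[of x] by (meson ennreal_leI order_trans)
		hence 1: "j z0 x / c * v (3/8 * r) <= c1 / \<Phi> (r / 2)"
			using c1(1) Phi_pos[OF r2(1)] by (subst (asm) ennreal_le_iff) auto
		have v: "v r <= K1 * v (3/8 * r)" using K1(2)[of "3/8 * r"] r by simp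
		have P: "\<Phi> r <= K2 * \<Phi> (r / 2)" using K2(2)[OF r2(1)] by simp
		have jn: "0 <= j z0 x" using j_pos[of z0 x] r by (cases "x = z0") auto
		have "j z0 x * v r * \<Phi> r <= j z0 x * (K1 * v (3/8 * r)) * (K2 * \<Phi> (r / 2))"
			using v P jn K1 v_pos[of r] v_pos[of "3/8 * r"] Phi_pos[of r] r by (intro mult_mono) auto
		also have "... = (j z0 x / c * v (3/8 * r)) * (c * K1 * K2 * \<Phi> (r / 2))" using c(1) by simp
		also have "... <= (c1 / \<Phi> (r / 2)) * (c * K1 * K2 * \<Phi> (r / 2))"
			using 1 c(1) K1 K2 Phi_pos[OF r2(1)] by (intro mult_right_mono) auto
		also have "... = c * K1 * (c1 * K2)" using Phi_pos[OF r2(1)] by simp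
		finally show "j z0 x * v r * \<Phi> r <= c * K1 * (c1 * K2)" .
	qed
qed

end

section \<open>Exit estimates\<close>

context hunt
begin

lemma exit_value_mono: "(!!z. f z <= f' z) ==> exit_value W f x <= exit_value W f' x"
	unfolding exit_value_def by (intro nn_integral_mono) auto

lemma exit_value_le:
	assumes "!!z. f z <= c"
	shows "exit_value W f x <= c"
proof -
	have "exit_value W f x <= (EE x (%w. c))" unfolding exit_value_def by (intro nn_integral_mono assms)
	thus ?thesis using P.emeasure_space_1[of x] by simp
qed

lemma exit_value_add:
	assumes "open W" "f \<in> smeas" "f' \<in> smeas"
	shows "exit_value W (%z. f z + f' z) x = exit_value W f x + exit_value W f' x"
	unfolding exit_value_def
	by (rule nn_integral_add; unfold measurable_P_iff; rule exit_value_measurable_path) (use assms in auto)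

lemma exit_value_cmult:
	assumes "open W" "f \<in> smeas"
	shows "exit_value W (%z. c * f z) x = c * exit_value W f x"
	unfolding exit_value_def
	by (rule nn_integral_cmult; unfold measurable_P_iff; rule exit_value_measurable_path) (use assms in auto)

lemma exit_mean_outside:
	assumes D: "open D" and z: "z \<notin> Some ` D"
	shows "exit_mean D z = 0"
proof -
	have "AE w in P z. leave D w = 0"
		using AE_start[of z] AE_space
	proof eventually_elim
		case (elim w)
		hence "leave D w <= ennreal 0" using z by (intro leave_outside[OF D]) auto
		thus ?case by simp
	qed
	hence "exit_mean D z = (EE z (%w. 0))" unfolding exit_mean_def by (rule nn_integral_cong_AE)
	thus ?thesis by simp
qed

lemma exit_mean_subset:
	assumes "open U" "open D" "U \<subseteq> D"
	shows "exit_mean U x <= exit_mean D x"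
	using exit_mean_strong_markov[OF assms, of x] by simp

lemma R_upto_zero_mono_const:
	assumes W: "open W"
	shows "(!!x. x \<in> W ==> f (Some x) <= c) ==> R_upto (%_. 0) (leave W) f y <= c * exit_mean W y"
		and "(!!x. x \<in> W ==> c <= f (Some x)) ==> c * exit_mean W y <= R_upto (%_. 0) (leave W) f y"
proof -
	show "R_upto (%_. 0) (leave W) f y <= c * exit_mean W y" if "!!x. x \<in> W ==> f (Some x) <= c"
		unfolding R_upto_zero_const[OF W, symmetric] by (rule R_upto_mono_on[OF W]) (rule that)
	show "c * exit_mean W y <= R_upto (%_. 0) (leave W) f y" if "!!x. x \<in> W ==> c <= f (Some x)"
		unfolding R_upto_zero_const[OF W, symmetric] by (rule R_upto_mono_on[OF W]) (rule that)
qed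

end

context point_setting
begin

lemma levy_exit:
	assumes W: "open W" and y: "y \<in> W" and h[measurable]: "h \<in> bmeas" and A[measurable]: "A \<in> sets borel" and AW: "A \<inter> closure W = {}"
	shows "X.exit_value W (ext0 (%z. h z * indicator A z)) (Some y) =
		X.R_upto (%_. 0) (X.leave W) (ext0 (%x. \<integral>\<^sup>+z. ennreal (j x z) * (h z * indicator A z) \<partial>m)) (Some y)"
	unfolding X.levy_system[OF J many_bumps_X W y h A AW] by (subst nn_integral_J) auto

lemma levy_exit_upper:
	assumes "open W" "y \<in> W" "h \<in> bmeas" "A \<in> sets borel" "A \<inter> closure W = {}"
		and g: "!!x z. x \<in> W ==> z \<in> A ==> j x z <= g z"
	shows "X.exit_value W (ext0 (%z. h z * indicator A z)) (Some y) <=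
		(\<integral>\<^sup>+z\<in>A. ennreal (g z) * h z \<partial>m) * X.exit_mean W (Some y)"
	unfolding levy_exit[OF assms(1-5)]
proof (rule X.R_upto_zero_mono_const(1)[OF assms(1)])
	fix x assume "x \<in> W"
	thus "ext0 (%x. \<integral>\<^sup>+z. ennreal (j x z) * (h z * indicator A z) \<partial>m) (Some x) <= (\<integral>\<^sup>+z\<in>A. ennreal (g z) * h z \<partial>m)"
		by (auto simp: ext0_simps indicator_def intro!: nn_integral_mono mult_right_mono ennreal_leI g)
qed

lemma levy_exit_lower:
	assumes "open W" "y \<in> W" "h \<in> bmeas" "A \<in> sets borel" "A \<inter> closure W = {}"
		and g: "!!x z. x \<in> W ==> z \<in> A ==> g z <= j x z"
	shows "(\<integral>\<^sup>+z\<in>A. ennreal (g z) * h z \<partial>m) * X.exit_mean W (Some y) <=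
		X.exit_value W (ext0 (%z. h z * indicator A z)) (Some y)"
	unfolding levy_exit[OF assms(1-5)]
proof (rule X.R_upto_zero_mono_const(2)[OF assms(1)])
	fix x assume "x \<in> W"
	thus "(\<integral>\<^sup>+z\<in>A. ennreal (g z) * h z \<partial>m) <= ext0 (%x. \<integral>\<^sup>+z. ennreal (j x z) * (h z * indicator A z) \<partial>m) (Some x)"
		by (auto simp: ext0_simps indicator_def intro!: nn_integral_mono mult_right_mono ennreal_leI g)
qed

text \<open>The condition \<open>r < r0 / (2 n0)\<close> without the quotient. Since
  \<open>n0 \<ge> 2\<close>, radii up to \<open>4 r\<close> stay below \<open>r0\<close>.\<close>

definition small :: "real => bool" where
	"small r \<longleftrightarrow> 0 < r & ereal (2 * real n0 * r) < r0"

lemma small_pos: "small r ==> 0 < r"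
	by (simp add: small_def)

lemma small_scale:
	assumes "small r" "t <= 4"
	shows "ereal (t * r) < r0"
proof -
	have "t * r <= (2 * real n0) * r" using assms n0 by (intro mult_right_mono) (auto simp: small_def)
	thus ?thesis using assms(1) unfolding small_def by (meson ereal_less_eq(3) le_less_trans)
qed

lemma small_less: "small r ==> ereal r < r0"
	using small_scale[of r 1] by simp

lemma dist_sets [measurable]:
	"{z. c <= dist z0 z} \<in> sets borel" "{z. c <= dist z0 z & dist z0 z < c'} \<in> sets borel" "{z. dist z0 z < c} \<in> sets borel"
	by measurable

text \<open>From \<open>B(z0, r)\<close> the process jumps at rate at least \<open>c / \<Phi>(r)\<close> into a larger annulus.\<close>

lemma exit_mean_ball:
	obtains c where "0 < c" "!!r W y. small r ==> open W ==> W \<subseteq> ball z0 r ==> X.exit_mean W y <= ennreal (c * \<Phi> r)"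
proof -
	obtain c1 where c1: "1 <= c1" "!!r x y. 0 < r ==> ereal r < r0 ==> dist z0 x < 10/11 * r ==> r <= dist z0 y ==>
			j x y <= c1 * j z0 y & j z0 y <= c1 * j x y & j y x <= c1 * j y z0 & j y z0 <= c1 * j y x"
		by (rule C1_comparable[of "10/11"]) auto
	obtain c2 where c2: "0 < c2" "!!y. y ~= z0 ==> ereal (dist z0 y) < ereal (3/4) * r0 ==>
			c2 <= j z0 y * (v (dist z0 y) * \<Phi> (dist z0 y)) & c2 <= j y z0 * (v (dist z0 y) * \<Phi> (dist z0 y))"
		by (rule j_lower) (rule that)
	obtain c3 where c3: "1 < c3" "!!r. 0 < r ==> ereal r <= r0 ==> c3 * v r <= v (real n0 * r)"
		by (rule volume_growth) (rule that)
	obtain K1 where K1: "1 <= K1" "!!r. 0 < r ==> v (11/10 * real n0 * r) <= K1 * v r"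
		using n0 by (rule_tac v_scale[of "11/10 * real n0"]) auto
	obtain K2 where K2: "1 <= K2" "!!r. 0 < r ==> \<Phi> (11/10 * real n0 * r) <= K2 * \<Phi> r"
		using n0 by (rule_tac Phi_scale[of "11/10 * real n0"]) auto
	define q where "q = c2 / (c1 * (K1 * K2))"
	have q: "0 < q" using c1 c2 K1 K2 by (simp add: q_def)
	define e where "e = q * (c3 - 1)"
	have e: "0 < e" using q c3 by (simp add: e_def)
	show ?thesis
	proof (rule that[of "1 / e"])
		show "0 < 1 / e" using e by simp
		fix r W and y' :: "'a option" assume r: "small r" and W: "open W" "W \<subseteq> ball z0 r"
		have r': "0 < r" "0 < \<Phi> r" "0 < v r" using r Phi_pos v_pos by (auto simp: small_def)
		show "X.exit_mean W y' <= ennreal (1 / e * \<Phi> r)"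
		proof (cases "y' \<in> Some ` W")
			case False
			thus ?thesis using X.exit_mean_outside[OF W(1)] by simp
		next
			case True
			then obtain y where y: "y' = Some y" "y \<in> W" by auto
			\<comment> \<open>The gap between \<open>r\<close> and \<open>s\<close> separates the target
			  annulus from \<open>closure W\<close> and matches (C1) with the ratio
			  \<open>10/11\<close>.\<close>
			define s where "s = 11/10 * r"
			define A where "A = {z. s <= dist z0 z & dist z0 z < real n0 * s}"
			have A[measurable]: "A \<in> sets borel" unfolding A_def by measurable
			have s: "0 < s" "ereal s < r0" using small_scale[OF r, of "11/10"] r' by (auto simp: s_def)
			have cl: "closure W \<subseteq> cball z0 r" using closure_ball_subset closure_mono[OF W(2)] by blast
			hence AW: "A \<inter> closure W = {}" using r'(1) by (force simp: A_def s_def)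
			have low: "q / (v r * \<Phi> r) <= j x z" if "x \<in> W" "z \<in> A" for x z
			proof -
				have z: "z ~= z0" "dist z0 z < 11/10 * real n0 * r" using that s by (auto simp: A_def s_def)
				\<comment> \<open>Since \<open>11/10 n0 r < 3/4 (2 n0 r)\<close>, the factor \<open>2 n0\<close>
				  in the bound on \<open>r\<close> provides the range of \<open>j_lower\<close>.\<close>
				have "ereal (dist z0 z) < ereal (3/4) * r0"
				proof -
					have "0 < real n0 * r" using n0 r'(1) by simp
					moreover have "11/10 * real n0 * r = 11/10 * (real n0 * r)" "3/4 * (2 * real n0 * r) = 3/2 * (real n0 * r)" by simp_all
					ultimately have "dist z0 z < 3/4 * (2 * real n0 * r)" using z(2) by linarith
					moreover have "ereal (2 * real n0 * r) < r0" using r by (simp add: small_def)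
					ultimately have "dist z0 z < 3/4 * (2 * real n0 * r)" "ereal (2 * real n0 * r) < r0" by auto
					moreover have "dist z0 z < 3/4 * q" if "2 * real n0 * r < q" for q using that calculation(1) by linarith
					ultimately show ?thesis by (cases r0) auto
				qed
				hence "c2 <= j z0 z * (v (dist z0 z) * \<Phi> (dist z0 z))" using c2(2)[OF z(1)] by blast
				also have "... <= (c1 * j x z) * ((K1 * v r) * (K2 * \<Phi> r))"
				proof (intro mult_mono)
					show "j z0 z <= c1 * j x z" using c1(2)[OF s, of x z] that W(2) by (auto simp: A_def s_def)
					show "v (dist z0 z) <= K1 * v r" using v_mono[of "dist z0 z" "11/10 * real n0 * r"] K1(2)[OF r'(1)] z(2) by simp
					show "\<Phi> (dist z0 z) <= K2 * \<Phi> r" using Phi_mono[of "dist z0 z" "11/10 * real n0 * r"] K2(2)[OF r'(1)] z(2) by simp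
					have "x ~= z" using that AW closure_subset by blast
					thus "0 <= c1 * j x z" using c1(1) j_pos[of x z] by simp
				qed (use z r' K1 v_pos Phi_pos in "auto intro!: less_imp_le mult_pos_pos")
				also have "... = c1 * (K1 * K2) * (j x z * (v r * \<Phi> r))" by simp
				finally have "q <= j x z * (v r * \<Phi> r)" unfolding q_def using c1 K1 K2 by (simp add: pos_divide_le_eq mult.commute)
				thus ?thesis using r' by (simp add: pos_divide_le_eq)
			qed
			\<comment> \<open>Volume growth makes the annulus carry at least the fixed proportion
			  \<open>c3 - 1\<close> of the volume of the ball.\<close>
			have mA: "ennreal ((c3 - 1) * v r) <= emeasure m A"
			proof -
				have Aeq: "A = ball z0 (real n0 * s) - ball z0 s" by (auto simp: A_def)
				have ns: "s <= real n0 * s" using s n0 by simp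
				have "measure m A = v (real n0 * s) - v s"
					unfolding Aeq v_def using V_finite[of "real n0 * s"] ns
					by (intro measure_Diff) (auto simp: sets_m)
				moreover have "c3 * v s <= v (real n0 * s)" using c3(2)[OF s(1)] s(2) by simp
				ultimately have "(c3 - 1) * v s <= measure m A" by (simp add: left_diff_distrib)
				moreover have "(c3 - 1) * v r <= (c3 - 1) * v s" using c3(1) v_mono[of r s] r' by (intro mult_left_mono) (auto simp: s_def)
				moreover have "emeasure m A < \<infinity>"
					by (rule le_less_trans[OF emeasure_mono V_finite[of "real n0 * s"]]) (auto simp: A_def sets_m)
				hence "emeasure m A = ennreal (measure m A)" by (simp add: emeasure_eq_ennreal_measure)
				ultimately show ?thesis by (simp add: ennreal_leI)
			qed
			have "ennreal (e / \<Phi> r) <= ennreal (q / (v r * \<Phi> r)) * emeasure m A"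
			proof -
				have "e / \<Phi> r = q / (v r * \<Phi> r) * ((c3 - 1) * v r)" using r' by (simp add: e_def)
				hence "ennreal (e / \<Phi> r) = ennreal (q / (v r * \<Phi> r)) * ennreal ((c3 - 1) * v r)"
					using q r' c3(1) by (simp only: ennreal_mult'' mult_nonneg_nonneg less_imp_le diff_ge_0_iff_ge)
				thus ?thesis using mA by (simp add: mult_left_mono)
			qed
			also have "... = (\<integral>\<^sup>+z\<in>A. ennreal (q / (v r * \<Phi> r)) * 1 \<partial>m)"
				by (simp add: nn_integral_cmult_indicator sets_m)
			finally have "ennreal (e / \<Phi> r) * X.exit_mean W (Some y) <= (\<integral>\<^sup>+z\<in>A. ennreal (q / (v r * \<Phi> r)) * 1 \<partial>m) * X.exit_mean W (Some y)"
				by (rule mult_right_mono) simp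
			also have "... <= X.exit_value W (ext0 (%z. 1 * indicator A z)) (Some y)"
				by (rule levy_exit_lower[OF W(1) y(2) _ A AW low]) auto
			\<comment> \<open>The exit distribution has mass at most 1; dividing by the jump rate bounds the
			  mean exit time.\<close>
			also have "... <= 1" by (rule X.exit_value_le) (auto simp: ext0_def indicator_def split: option.split)
			finally have "ennreal (e / \<Phi> r) * X.exit_mean W (Some y) <= 1" .
			hence "ennreal (1 / e * \<Phi> r) * (ennreal (e / \<Phi> r) * X.exit_mean W (Some y)) <= ennreal (1 / e * \<Phi> r) * 1"
				by (rule mult_left_mono) simp
			moreover have "ennreal (1 / e * \<Phi> r) * ennreal (e / \<Phi> r) = 1"
				using e r' by (simp add: ennreal_mult[symmetric])
			ultimately show ?thesis by (simp add: mult.assoc[symmetric] y(1))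
		qed
	qed
qed

text \<open>The annulus is covered by the plateaus of four annular bumps. Each bump vanishes at
  \<open>y\<close>, because its scale \<open>t \<ge> 1/4\<close> puts its support beyond
  \<open>r / 8\<close>, so \<open>Dynkin_upper\<close> leaves only the generator term.\<close>

lemma exit_near:
	obtains c where "0 < c"
		"!!r U y. small r ==> open U ==> dist z0 y < r / 8 ==>
			X.exit_value U (ext0 (indicator {z. r / 5 <= dist z0 z & dist z0 z < r})) (Some y) <= ennreal (c / \<Phi> r) * X.exit_mean U (Some y)"
proof -
	obtain c1 where c1: "0 < c1" "!!r. 0 < r ==> ereal r < r0 ==>
			\<exists>f\<in>bump m \<D> (closure (annulus z0 (51/100 * r) (99/100 * r))) (annulus z0 (r / 2) r). \<forall>x. gen X f x <= c1 / \<Phi> r"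
		by (rule annulus_bump[of "51/100" "99/100"]) auto
	obtain K where K: "1 <= K" "!!r. 0 < r ==> \<Phi> (4 * r) <= K * \<Phi> r" by (rule Phi_scale[of 4]) auto
	show ?thesis
	proof (rule that[of "4 * (c1 * K)"])
		show "0 < 4 * (c1 * K)" using c1 K by simp
		fix r and U :: "'a set" and y assume r: "small r" and U: "open U" and y: "dist z0 y < r / 8"
		have r': "0 < r" "0 < \<Phi> r" using r Phi_pos by (auto simp: small_def)
		let ?c = "ennreal (c1 * K / \<Phi> r) * X.exit_mean U (Some y)"
		define Q where "Q t f \<longleftrightarrow> f \<in> bmeas & (\<forall>z. 0 <= f z) & (\<forall>z. 51/100 * (t * r) < dist z0 z & dist z0 z < 99/100 * (t * r) --> f z = 1) &
				X.exit_value U (enn0 f) (Some y) <= ?c" for t and f :: "'a => real"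
		have ex: "\<exists>f. Q t f" if t: "1 / 4 <= t" "t <= 4" for t
		proof -
			have tr: "0 < t * r" "ereal (t * r) < r0" using small_scale[OF r t(2)] t r' by auto
			obtain f where f: "f \<in> bump m \<D> (closure (annulus z0 (51/100 * (t * r)) (99/100 * (t * r)))) (annulus z0 (t * r / 2) (t * r))"
					"!!x. gen X f x <= c1 / \<Phi> (t * r)" using c1(2)[OF tr] by blast
			have "y \<notin> annulus z0 (t * r / 2) (t * r)"
			proof
				assume "y \<in> annulus z0 (t * r / 2) (t * r)"
				moreover have "1 / 4 * r <= t * r" using t r' by (intro mult_right_mono) auto
				ultimately show False using y by (simp add: annulus_def)
			qed
			hence fy: "f y = 0" by (rule bumpD(4)[OF f(1)])
			have "\<Phi> r <= K * \<Phi> (r / 4)" using K(2)[of "r / 4"] r' by simp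
			also have "... <= K * \<Phi> (t * r)"
			proof -
				have "1 / 4 * r <= t * r" using t r' by (intro mult_right_mono) auto
				thus ?thesis using K(1) Phi_mono[of "r / 4" "t * r"] r' by (intro mult_left_mono) auto
			qed
			finally have "c1 / \<Phi> (t * r) <= c1 * K / \<Phi> r"
				using r' Phi_pos[OF tr(1)] c1(1) by (simp add: field_simps)
			hence g: "gen X f x <= c1 * K / \<Phi> r" for x using f(2)[of x] by simp
			have "X.exit_value U (enn0 f) (Some y) <= ennreal (f y) + ?c"
				by (rule X.Dynkin_upper[OF X.has_generator_gen[OF bumpD(1)[OF f(1)]] bumpD(5)[OF f(1)] U g])
			hence "X.exit_value U (enn0 f) (Some y) <= ?c" using fy by simp
			moreover have "f z = 1" if "51/100 * (t * r) < dist z0 z & dist z0 z < 99/100 * (t * r)" for z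
				by (rule bumpD(3)[OF f(1)], rule subsetD[OF closure_annulus]) (use that in "simp add: annulus_def")
			ultimately show ?thesis unfolding Q_def using bump_continuous(3)[OF f(1)] bumpD(5)[OF f(1)] by blast
		qed
		obtain f where Qf: "!!t. 1/4 <= t ==> t <= 4 ==> Q t (f t)" using ex by metis
		have f: "!!t. 1/4 <= t ==> t <= 4 ==> f t \<in> bmeas"
			"!!t z. 1/4 <= t ==> t <= 4 ==> 0 <= f t z"
			"!!t z. 1/4 <= t ==> t <= 4 ==> 51/100 * (t * r) < dist z0 z ==> dist z0 z < 99/100 * (t * r) ==> f t z = 1"
			"!!t. 1/4 <= t ==> t <= 4 ==> X.exit_value U (ext0 (%z. ennreal (f t z))) (Some y) <= ?c"
			using Qf unfolding Q_def by auto
		let ?f = "%t. ext0 (%z. ennreal (f t z))"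
		have fm: "?f t \<in> smeas" if "1/4 <= t" "t <= 4" for t
			using f(1)[OF that] by (intro measurable_ext0) measurable
		let ?A = "{z. r / 5 <= dist z0 z & dist z0 z < r}"
		have "X.exit_value U (ext0 (indicator ?A)) (Some y) <=
			X.exit_value U (%z. ?f (1/4) z + (?f (9/20) z + (?f (17/20) z + ?f (8/5) z))) (Some y)"
		proof (rule X.exit_value_mono)
			fix z' show "ext0 (indicator ?A) z' <= ?f (1/4) z' + (?f (9/20) z' + (?f (17/20) z' + ?f (8/5) z'))"
			proof (cases z')
				case (Some z)
				show ?thesis
				proof (cases "z \<in> ?A")
					case True
					let ?d = "dist z0 z"
					\<comment> \<open>In units of \<open>r\<close> the plateaus are (0.1275, 0.2475), (0.2295,
					  0.4455), (0.4335, 0.8415) and (0.816, 1.584); they overlap and cover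
					  \<open>[1/5, 1)\<close>.\<close>
					have "(51/100 * (1/4 * r) < ?d & ?d < 99/100 * (1/4 * r)) \<or> (51/100 * (9/20 * r) < ?d & ?d < 99/100 * (9/20 * r)) \<or>
						(51/100 * (17/20 * r) < ?d & ?d < 99/100 * (17/20 * r)) \<or> (51/100 * (8/5 * r) < ?d & ?d < 99/100 * (8/5 * r))"
						using True r'(1) by auto
					hence "f (1/4) z = 1 \<or> f (9/20) z = 1 \<or> f (17/20) z = 1 \<or> f (8/5) z = 1"
						using f(3)[of "1/4" z] f(3)[of "9/20" z] f(3)[of "17/20" z] f(3)[of "8/5" z] by auto
					thus ?thesis using Some True by (auto simp: ext0_simps add_increasing add_increasing2)
				qed (simp add: Some ext0_simps)
			qed (simp add: ext0_simps)
		qed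
		also have "... = X.exit_value U (?f (1/4)) (Some y) + (X.exit_value U (?f (9/20)) (Some y) +
			(X.exit_value U (?f (17/20)) (Some y) + X.exit_value U (?f (8/5)) (Some y)))"
			using fm[of "1/4"] fm[of "9/20"] fm[of "17/20"] fm[of "8/5"] by (simp add: X.exit_value_add[OF U])
		also have "... <= ?c + (?c + (?c + ?c))" by (intro add_mono f(4)) auto
		also have "... = (ennreal (c1 * K / \<Phi> r) + (ennreal (c1 * K / \<Phi> r) + (ennreal (c1 * K / \<Phi> r) + ennreal (c1 * K / \<Phi> r)))) * X.exit_mean U (Some y)"
			by (simp add: distrib_right)
		also have "ennreal (c1 * K / \<Phi> r) + (ennreal (c1 * K / \<Phi> r) + (ennreal (c1 * K / \<Phi> r) + ennreal (c1 * K / \<Phi> r))) = ennreal (4 * (c1 * K) / \<Phi> r)"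
			using c1 K r' by (simp flip: ennreal_plus)
		finally show "X.exit_value U (ext0 (indicator ?A)) (Some y) <= ennreal (4 * (c1 * K) / \<Phi> r) * X.exit_mean U (Some y)" .
	qed
qed

text \<open>After \<open>U\<close> is left, time in \<open>D\<close> remains only from points at
  distance at least \<open>r / 5\<close>, and its mean is then \<open>O(\<Phi> r)\<close>; this
  factor cancels against \<open>1 / \<Phi> r\<close> in \<open>exit_near\<close>.\<close>

lemma exit_mean_compare:
	obtains c where "1 <= c"
		"!!r D x. small r ==> open D ==> D \<subseteq> ball z0 r ==> dist z0 x < r / 8 ==>
			X.exit_mean D (Some x) <= ennreal c * X.exit_mean (D \<inter> ball z0 (r / 5)) (Some x)"
proof -
	obtain c1 where c1: "0 < c1" "!!r W y. small r ==> open W ==> W \<subseteq> ball z0 r ==> X.exit_mean W y <= ennreal (c1 * \<Phi> r)"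
		using exit_mean_ball by blast
	obtain c2 where c2: "0 < c2" "!!r U y. small r ==> open U ==> dist z0 y < r / 8 ==>
			X.exit_value U (ext0 (indicator {z. r / 5 <= dist z0 z & dist z0 z < r})) (Some y) <= ennreal (c2 / \<Phi> r) * X.exit_mean U (Some y)"
		using exit_near by blast
	show ?thesis
	proof (rule that[of "1 + c1 * c2"])
		show "1 <= 1 + c1 * c2" using c1 c2 by simp
		fix r D x assume r: "small r" and D: "open D" "D \<subseteq> ball z0 r" and x: "dist z0 x < r / 8"
		have r': "0 < \<Phi> r" using Phi_pos[OF small_pos[OF r]] .
		let ?U = "D \<inter> ball z0 (r / 5)" and ?A = "{z. r / 5 <= dist z0 z & dist z0 z < r}"
		have U: "open ?U" "?U \<subseteq> D" using D by auto
		have "X.exit_value ?U (%z. if z = None then 0 else X.exit_mean D z) (Some x) <=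
				X.exit_value ?U (%z. ennreal (c1 * \<Phi> r) * ext0 (indicator ?A) z) (Some x)"
		proof (rule X.exit_value_mono_outside[OF U(1)])
			fix z assume z: "z \<notin> Some ` ?U"
			show "(if z = None then 0 else X.exit_mean D z) <= ennreal (c1 * \<Phi> r) * ext0 (indicator ?A) z"
			proof (cases "z \<in> Some ` D")
				case True
				then obtain y where y: "z = Some y" "y \<in> D" by auto
				hence "y \<in> ?A" using z D(2) by (auto simp: not_less)
				thus ?thesis using y(1) c1(2)[OF r D, of z] by (simp add: ext0_simps)
			next
				case False
				thus ?thesis using X.exit_mean_outside[OF D(1)] by simp
			qed
		qed
		also have "... = ennreal (c1 * \<Phi> r) * X.exit_value ?U (ext0 (indicator ?A)) (Some x)"
			by (rule X.exit_value_cmult[OF U(1)]) (intro measurable_ext0, measurable)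
		also have "... <= ennreal (c1 * \<Phi> r) * (ennreal (c2 / \<Phi> r) * X.exit_mean ?U (Some x))"
			by (intro mult_left_mono c2(2)[OF r U(1) x]) simp
		also have "... = ennreal (c1 * c2) * X.exit_mean ?U (Some x)"
			using c1 c2 r' by (simp add: mult.assoc[symmetric] ennreal_mult[symmetric])
		finally have "X.exit_mean D (Some x) <= X.exit_mean ?U (Some x) + ennreal (c1 * c2) * X.exit_mean ?U (Some x)"
			unfolding X.exit_mean_strong_markov[OF U(1) D(1) U(2), of "Some x"] by (intro add_left_mono)
		also have "... = ennreal (1 + c1 * c2) * X.exit_mean ?U (Some x)"
			using c1 c2 by (simp add: ennreal_plus distrib_right)
		finally show "X.exit_mean D (Some x) <= ennreal (1 + c1 * c2) * X.exit_mean ?U (Some x)" .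
	qed
qed

text \<open>The lower bound only uses jumps out of \<open>D \<inter> B(z0, r / 5)\<close>.\<close>

lemma harmonic_lower:
	obtains c where "1 <= c"
		"!!r D u x A. small r ==> open D ==> D \<subseteq> ball z0 r ==> u \<in> bmeas ==> regular_harmonic X D u ==>
			x \<in> D ==> dist z0 x < r / 8 ==> A \<in> sets borel ==> A \<subseteq> {z. r / 4 <= dist z0 z} ==>
			X.exit_mean D (Some x) * (\<integral>\<^sup>+z\<in>A. ennreal (j z0 z) * ennreal (u z) \<partial>m) <= ennreal c * ennreal (u x)"
proof -
	\<comment> \<open>\<open>4/5\<close> is the ratio of \<open>r / 5\<close> to \<open>r / 4\<close>,
	  the radii bounding \<open>U\<close> and the target set.\<close>
	obtain c1 where c1: "1 <= c1" "!!r x y. 0 < r ==> ereal r < r0 ==> dist z0 x < 4/5 * r ==> r <= dist z0 y ==>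
			j x y <= c1 * j z0 y & j z0 y <= c1 * j x y & j y x <= c1 * j y z0 & j y z0 <= c1 * j y x"
		by (rule C1_comparable[of "4/5"]) auto
	obtain c2 where c2: "1 <= c2" "!!r D x. small r ==> open D ==> D \<subseteq> ball z0 r ==> dist z0 x < r / 8 ==>
			X.exit_mean D (Some x) <= ennreal c2 * X.exit_mean (D \<inter> ball z0 (r / 5)) (Some x)"
		using exit_mean_compare by blast
	show ?thesis
	proof (rule that[of "c2 * c1"])
		show "1 <= c2 * c1" using c1(1) c2(1) by (simp add: mult_ge1_I)
		fix r D u x A
		assume r: "small r" and D: "open D" "D \<subseteq> ball z0 r" and u: "u \<in> bmeas" "regular_harmonic X D u"
			and x: "x \<in> D" "dist z0 x < r / 8" and A[measurable]: "A \<in> sets borel" and A4: "A \<subseteq> {z. r / 4 <= dist z0 z}"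
		note [measurable] = u(1)
		let ?U = "D \<inter> ball z0 (r / 5)"
		have U: "open ?U" "?U \<subseteq> D" "x \<in> ?U" using D x small_pos[OF r] by auto
		have cl: "closure ?U \<subseteq> cball z0 (r / 5)" using closure_ball_subset closure_mono[of ?U "ball z0 (r / 5)"] by blast
		have AU: "A \<inter> closure ?U = {}" using cl A4 small_pos[OF r] by force
		let ?K = "\<integral>\<^sup>+z\<in>A. ennreal (j z0 z) * ennreal (u z) \<partial>m"
		have Keq: "(\<integral>\<^sup>+z\<in>A. ennreal (j z0 z / c1) * ennreal (u z) \<partial>m) = ennreal (1 / c1) * ?K"
			using c1(1) by (subst nn_integral_cmult[symmetric])
				(auto intro!: nn_integral_cong simp: ennreal_mult'[symmetric] mult.assoc[symmetric])
		have "ennreal (1 / c1) * ?K * X.exit_mean ?U (Some x) <= X.exit_value ?U (ext0 (%z. ennreal (u z) * indicator A z)) (Some x)"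
			unfolding Keq[symmetric]
		proof (rule levy_exit_lower[OF U(1,3) _ A AU])
			fix y z assume "y \<in> ?U" "z \<in> A"
			hence "j z0 z <= c1 * j y z" using c1(2)[of "r / 4" y z] small_scale[OF r, of "1/4"] small_pos[OF r] A4 by auto
			thus "j z0 z / c1 <= j y z" using c1(1) by (simp add: field_simps)
		qed simp
		also have "... <= X.exit_value ?U (enn0 u) (Some x)"
			by (rule X.exit_value_mono) (auto simp: ext0_def indicator_def split: option.split)
		also have "... = ennreal (u x)" using X.harmonic_subset[OF _ D(1) U(1,2), of "enn0 u" "Some x"] X.regular_harmonic_exit_value[OF u(2) D(1)] u(1)
			by (simp add: measurable_ext0 ext0_simps)
		finally have le: "ennreal (1 / c1) * ?K * X.exit_mean ?U (Some x) <= ennreal (u x)" .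
		have "X.exit_mean D (Some x) * ?K <= (ennreal c2 * X.exit_mean ?U (Some x)) * ?K"
			by (intro mult_right_mono c2(2)[OF r D x(2)]) simp
		also have "... = ennreal c2 * (ennreal c1 * (ennreal (1 / c1) * ?K * X.exit_mean ?U (Some x)))"
		proof -
			have "ennreal c1 * ennreal (1 / c1) = 1" using c1(1) by (simp add: ennreal_mult[symmetric])
			hence "ennreal c1 * (ennreal (1 / c1) * ?K * X.exit_mean ?U (Some x)) = ?K * X.exit_mean ?U (Some x)"
				by (simp add: mult.assoc[symmetric])
			thus ?thesis by (simp add: ac_simps)
		qed
		also have "... <= ennreal c2 * (ennreal c1 * ennreal (u x))" by (intro mult_left_mono le) auto
		also have "... = ennreal (c2 * c1) * ennreal (u x)" using c1 c2 by (simp add: ennreal_mult mult.assoc)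
		finally show "X.exit_mean D (Some x) * ?K <= ennreal (c2 * c1) * ennreal (u x)" .
	qed
qed

end

section \<open>A potential estimate for the killed dual process\<close>

text \<open>The term \<open>\<delta> (1 - \<phi>)\<close> makes the rate at least
  \<open>\<delta> / \<epsilon>\<close> where \<open>\<phi> = 0\<close> and leaves a surplus in the
  supersolution inequality where \<open>\<phi>\<close> is small. The cemetery has rate 0.\<close>

definition penalty :: "('v, 'a::metric_space) process => ('a => real) => real => real => 'a option => real" where
	"penalty Xh \<phi> \<delta> \<epsilon> = ext0 (%x. (max 0 (gen Xh \<phi> x) + \<delta> * (1 - \<phi> x)) / (\<phi> x + \<epsilon>))"

lemma INF_cmult_decseq:
	fixes f :: "nat => ennreal"
	assumes f: "decseq f" and a: "a < \<infinity>"
	shows "(INF n. a * f n) = a * (INF n. f n)"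
proof -
	have "(%n. a * f n) \<longlonglongrightarrow> a * (INF n. f n)"
		using LIMSEQ_INF[OF f] a by (intro ennreal_tendsto_cmult) auto
	moreover have "(%n. a * f n) \<longlonglongrightarrow> (INF n. a * f n)"
		by (rule LIMSEQ_INF) (intro monotoneI mult_left_mono monotoneD[OF f], auto)
	ultimately show ?thesis using LIMSEQ_unique by blast
qed

context hunt
begin

text \<open>\<open>k M\<close> is the density of the killing time along a path, with integral
  \<open>1 - M\<close> up to each finite time.\<close>

lemma R_rate_le_1:
	assumes k: "rate k"
	shows "R k (%z. ennreal (k z)) x <= 1"
proof -
	have "occ k (%z. ennreal (k z)) \<infinity> w <= 1" if w: "w \<in> paths X" for w
	proof -
		let ?f = "%n s. ennreal (indicator {0..real n} s * (k (Y s w) * M k s w))"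
		have m: "?f n \<in> borel_measurable lborel" for n
			using path_measurable[OF k w] measurable_compose[OF measurable_Y_path[OF w] rate_measurable[OF k]] by measurable
		have "occ k (%z. ennreal (k z)) \<infinity> w = (Leb (%s. (SUP n. ?f n s)))"
			unfolding occ_def
		proof (rule nn_integral_cong)
			fix s
			have p: "0 <= k (Y s w) * M k s w" using rate_nonneg[OF k, of "Y s w"] M_pos[of k s w] by simp
			show "ennreal (M k s w) * ennreal (k (Y s w)) * indicator (before \<infinity>) s = (SUP n. ?f n s)"
			proof (cases "0 <= s")
				case True
				obtain N where N: "s <= real N" using real_arch_simple by blast
				have "(SUP n. ?f n s) = ennreal (k (Y s w) * M k s w)"
				proof (rule antisym)
					show "(SUP n. ?f n s) <= ennreal (k (Y s w) * M k s w)" using p by (intro SUP_least) (auto simp: indicator_def)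
					show "ennreal (k (Y s w) * M k s w) <= (SUP n. ?f n s)" by (rule SUP_upper2[of N]) (use True N in auto)
				qed
				thus ?thesis using True rate_nonneg[OF k, of "Y s w"] M_pos[of k s w] by (simp add: ennreal_mult mult.commute)
			qed simp
		qed
		also have "... = (SUP n. \<integral>\<^sup>+s. ?f n s \<partial>lborel)"
		proof (rule nn_integral_monotone_convergence_SUP[OF _ m])
			have "?f i s <= ?f j s" if "i <= j" for i j s
				using that rate_nonneg[OF k, of "Y s w"] M_pos[of k s w] by (intro ennreal_leI mult_right_mono) (auto simp: indicator_def)
			thus "incseq ?f" by (auto intro!: monotoneI le_funI)
		qed
		also have "... <= 1"
			using nn_integral_rate_M[OF k w] M_pos[of k _ w] by (intro SUP_least) (simp add: ennreal_le_1 less_imp_le)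
		finally show ?thesis .
	qed
	hence "R k (%z. ennreal (k z)) x <= (EE x (%w. 1))" unfolding R_def by (intro nn_integral_mono) simp
	thus ?thesis using P.emeasure_space_1[of x] by simp
qed

lemma stopped_INF:
	assumes k: "rate k" and T: "T \<in> hmeas" and f: "!!n::nat. f n \<in> smeas"
		and dec: "decseq f" and bd: "!!z. f 0 z <= c" "c < \<infinity>"
	shows "(INF n. stopped k T (f n) x) = stopped k T (%z. INF n. f n z) x"
proof -
	define g where "g n w = ennreal (M k (enn2real (T w)) w) * indicator {w. T w < \<infinity>} w * f n (pos_at X T w)" for n w
	have sg: "stopped k T (f n) x = (EE x (%w. g n w))" for n
		unfolding stopped_def g_def ..
	have fmono: "f j z <= f i z" if "i <= j" for i j z using monotoneD[OF dec that] by (simp add: le_fun_def)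
	have "(INF n. stopped k T (f n) x) = (EE x (%w. (INF n. g n w)))"
		unfolding sg
	proof (rule nn_integral_monotone_convergence_INF_decseq[where i = 0, symmetric])
		show "decseq g" unfolding g_def by (intro monotoneI le_funI mult_left_mono fmono) auto
		show "g n \<in> borel_measurable (P x)" for n unfolding g_def by (rule stopped_measurable[OF k T f])
		show "(EE x (%w. g 0 w)) < \<infinity>" unfolding sg[symmetric] by (rule le_less_trans[OF stopped_bound[OF k bd(1)] bd(2)])
	qed
	also have "... = stopped k T (%z. INF n. f n z) x"
		unfolding stopped_def g_def
	proof (rule nn_integral_cong)
		fix w
		let ?a = "ennreal (M k (enn2real (T w)) w) * indicator {w. T w < \<infinity>} w :: ennreal"
		show "(INF n. ?a * f n (pos_at X T w)) = ?a * (INF n. f n (pos_at X T w))"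
			by (rule INF_cmult_decseq) (auto intro!: monotoneI fmono simp: indicator_def)
	qed
	finally show ?thesis .
qed

text \<open>The positive maximum principle. It makes the penalty vanish where
  \<open>\<phi> = 1\<close>.\<close>

lemma generator_nonpos_at_max:
	assumes gen: "has_generator X f g" and f: "!!x. 0 <= f x" "!!x. f x <= 1" and x: "f x = 1"
	shows "g x <= 0"
proof (rule tendsto_upperbound[OF has_generator_pointwise[OF gen]])
	have fm: "f \<in> bmeas" using gen by (intro C0_measurable) (simp add: has_generator_def)
	show "\<forall>\<^sub>F t in at_right 0. (transition X t f x - f x) / t <= 0"
		using eventually_at_right_less[of "0::real"]
	proof eventually_elim
		case (elim t)
		hence "transition X t f x <= 1" using transition_range(2)[OF fm f] by simp
		thus ?case using elim x by (simp add: divide_le_0_iff)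
	qed
qed simp

end

text \<open>The radii in units of \<open>r\<close>: \<open>E\<close> lies within 1/2, the Green
  function is controlled beyond 6/10, dual jumps go from beyond 7/10 to within 65/100,
  \<open>\<phi>\<close> is 1 up to 7/10 and 0 from 8/10 on. The constants \<open>c1\<close>,
  \<open>c2\<close>, \<open>c3\<close> bound the Green function, the mean exit time and the dual
  jump density, and \<open>\<delta>\<close> the dual generator.\<close>

locale killing = point_setting m X Xh \<D> G Gh j jh \<Phi> R0 r0 n0 z0
	for m :: "'a::heine_borel measure"
		and X :: "('w, 'a) process" and Xh :: "('v, 'a) process"
		and \<D> G Gh j jh \<Phi> R0 r0 n0 z0 +
	fixes r \<alpha> \<epsilon> \<delta> c1 c2 c3 :: real and \<phi> :: "'a => real" and E :: "'a set"
	assumes r: "small r" and pos: "0 < \<alpha>" "0 < \<epsilon>" "0 < \<delta>" "0 <= c1" "0 <= c2" "0 <= c3"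
		and \<phi>: "\<phi> \<in> bump m \<D> (closure (ball z0 (7/10 * r))) (ball z0 (8/10 * r))"
		and gen_le: "!!x. gen Xh \<phi> x <= \<delta>"
		and E: "E \<in> sets borel" "E \<subseteq> ball z0 (r / 2)"
		and green_bound: "!!x y. 6/10 * r < dist z0 x ==> dist z0 x < r ==> dist z0 y < r / 2 ==> Gh (ball z0 r) x y <= ennreal c1"
		and mean_bound: "!!y. X.exit_mean (ball z0 r) y <= ennreal c2"
		and jump_bound: "!!x z. 7/10 * r <= dist z0 x ==> dist z0 z < 65/100 * r ==> jh x z <= c3"
begin

abbreviation \<psi> :: "'a option => real" where
	"\<psi> \<equiv> penalty Xh \<phi> \<delta> \<epsilon>"

text \<open>A further rate that sets in only beyond \<open>9 r / 10\<close>. Taken \<open>n\<close>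
  times with \<open>n\<close> growing, it confines the killed processes to \<open>B(z0, r)\<close>
  and brings in the Green function of that ball.\<close>

definition \<eta> :: "'a option => real" where
	"\<eta> = ext0 (%x. min 1 (max 0 (dist z0 x - 9/10 * r)))"

definition kn :: "nat => 'a option => real" where
	"kn n z = (\<alpha> + \<psi> z) + real n * \<eta> z"

definition h :: "nat => 'a option => ennreal" where
	"h n = Xh.R (kn n) (ext0 (indicator E))"

text \<open>For fixed \<open>n\<close> the potential still counts excursions out of the ball; the
  decreasing limit is dominated by the potential of the dual process stopped at leaving
  \<open>B(z0, r)\<close>.\<close>

definition hh :: "'a option => ennreal" where
	"hh z = (INF n. h n z)"

lemma r_pos: "0 < r" using r by (simp add: small_def)

lemma has_gen: "has_generator Xh \<phi> (gen Xh \<phi>)"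
	by (rule Xh.has_generator_gen[OF bumpD(2)[OF \<phi>]])

lemma gen_measurable [measurable]: "gen Xh \<phi> \<in> bmeas"
	using has_gen by (intro C0_measurable) (simp add: has_generator_def)

lemma \<phi>_measurable [measurable]: "\<phi> \<in> bmeas"
	by (rule bump_continuous[OF \<phi>])

lemma \<phi>_range: "0 <= \<phi> x" "\<phi> x <= 1"
	by (rule bumpD[OF \<phi>])+

lemma \<phi>_inside: "dist z0 x < 7/10 * r ==> \<phi> x = 1"
	by (rule bumpD(3)[OF \<phi>]) (simp add: in_ball_subset_closure)

lemma \<phi>_outside: "8/10 * r <= dist z0 x ==> \<phi> x = 0"
	by (rule bumpD(4)[OF \<phi>]) simp

lemma \<psi>_nonneg: "0 <= \<psi> z"
	using \<phi>_range pos by (cases z) (auto simp: penalty_def ext0_simps intro!: divide_nonneg_nonneg add_nonneg_nonneg)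

lemma \<psi>_identity: "\<psi> (Some x) * (\<phi> x + \<epsilon>) = max 0 (gen Xh \<phi> x) + \<delta> * (1 - \<phi> x)"
	using \<phi>_range[of x] pos by (simp add: penalty_def ext0_simps)

lemma \<psi>_numerator: "max 0 (gen Xh \<phi> x) + \<delta> * (1 - \<phi> x) <= 2 * \<delta>"
proof -
	have "\<delta> * (1 - \<phi> x) <= \<delta> * 1" using \<phi>_range[of x] pos by (intro mult_left_mono) auto
	moreover have "max 0 (gen Xh \<phi> x) <= \<delta>" using gen_le[of x] pos by simp
	ultimately show ?thesis by linarith
qed

lemma \<psi>_inside:
	assumes "dist z0 x < 7/10 * r"
	shows "\<psi> (Some x) = 0"
proof -
	have "gen Xh \<phi> x <= 0" by (rule Xh.generator_nonpos_at_max[OF has_gen \<phi>_range \<phi>_inside[OF assms]])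
	thus ?thesis using \<phi>_inside[OF assms] by (simp add: penalty_def ext0_simps)
qed

lemma rate_\<psi>: "rate \<psi>"
	unfolding rate_def
proof (intro conjI allI exI[of _ "2 * \<delta> / \<epsilon>"])
	show "\<psi> \<in> smeas" unfolding penalty_def by (intro measurable_ext0) measurable
	show "0 <= \<psi> z" for z by (rule \<psi>_nonneg)
	show "\<psi> z <= 2 * \<delta> / \<epsilon>" for z
	proof (cases z)
		case (Some x)
		have "(max 0 (gen Xh \<phi> x) + \<delta> * (1 - \<phi> x)) / (\<phi> x + \<epsilon>) <= 2 * \<delta> / \<epsilon>"
			using \<psi>_numerator[of x] \<phi>_range[of x] pos by (intro frac_le) auto
		thus ?thesis by (simp add: Some penalty_def ext0_simps)
	qed (use pos in "simp add: penalty_def ext0_simps")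
qed

lemma rate_\<eta>: "rate \<eta>"
	unfolding rate_def
proof (intro conjI allI exI[of _ 1])
	show "\<eta> \<in> smeas" unfolding \<eta>_def by (intro measurable_ext0) measurable
	show "0 <= \<eta> z" "\<eta> z <= 1" for z by (auto simp: \<eta>_def ext0_def split: option.split)
qed

lemma \<eta>_inside: "dist z0 x <= 9/10 * r ==> \<eta> (Some x) = 0"
	by (simp add: \<eta>_def ext0_simps)

lemma \<eta>_outside: "9/10 * r < dist z0 x ==> 0 < \<eta> (Some x)"
	by (simp add: \<eta>_def ext0_simps)

lemma rate_k: "rate (%z. \<alpha> + \<psi> z)"
	using Xh.rate_add_cmult[OF rate_const rate_\<psi>, of \<alpha> 1] pos by simp

lemma k_ge: "\<alpha> <= \<alpha> + \<psi> z"
	using \<psi>_nonneg[of z] by simp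

lemma rate_kn: "rate (kn n)"
	unfolding kn_def[abs_def] by (rule Xh.rate_add_cmult[OF rate_k rate_\<eta>]) simp

lemma kn_ge: "\<alpha> + \<psi> z <= kn n z" "\<alpha> <= kn n z"
	unfolding kn_def using rate_nonneg[OF rate_\<eta>, of z] \<psi>_nonneg[of z] by auto

lemma kn_mono: "i <= l ==> kn i z <= kn l z"
	unfolding kn_def using rate_nonneg[OF rate_\<eta>, of z] by (intro add_left_mono mult_right_mono) auto

lemma E_fin: "emeasure m E < \<infinity>"
	by (rule le_less_trans[OF emeasure_mono[OF E(2)] V_finite]) (simp add: sets_m)

lemma E_ind [measurable]: "ext0 (indicator E :: 'a => ennreal) \<in> smeas"
	using E(1) by (intro measurable_ext0 borel_measurable_indicator)

lemma E_ind_le: "ext0 (indicator E) z <= ennreal 1"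
	by (auto simp: ext0_def indicator_def split: option.split)

lemma h_measurable: "h n \<in> smeas"
	unfolding h_def by (rule Xh.R_measurable[OF rate_kn E_ind])

lemma hh_measurable: "hh \<in> smeas"
	unfolding hh_def[abs_def] using h_measurable by measurable

lemma hh_measurable' [measurable]: "(%x. hh (Some x)) \<in> bmeas"
	by (rule measurable_compose[OF measurable_Some hh_measurable])

lemma h_bound: "h n z <= ennreal (1 / \<alpha>)"
	unfolding h_def by (rule Xh.R_bound[OF rate_kn kn_ge(2) pos(1) E_ind_le]) simp

lemma h_decseq: "decseq h"
	unfolding h_def[abs_def] by (intro monotoneI le_funI Xh.R_antimono_rate[OF rate_kn rate_kn kn_mono E_ind])

lemma hh_None: "hh None = 0"
proof -
	have "h 0 None = 0" unfolding h_def by (rule Xh.R_None) (simp add: ext0_simps)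
	hence "hh None <= 0" unfolding hh_def by (intro INF_lower2[of 0]) auto
	thus ?thesis by simp
qed

lemma hh_green: "hh x <= Xh.R_upto (%_. 0) (Xh.leave (ball z0 r)) (ext0 (indicator E)) x"
	unfolding hh_def h_def kn_def[abs_def]
proof (rule Xh.R_strong_killing[OF rate_k k_ge pos(1) rate_\<eta>, of "{x. 9/10 * r < dist z0 x}" _ _ 1])
	show "open {x. 9/10 * r < dist z0 x}" by (intro open_Collect_less continuous_intros)
	show "- ball z0 r \<subseteq> {x. 9/10 * r < dist z0 x}" using r_pos by auto
qed (use \<eta>_outside E_ind_le E_ind in "auto simp: ext0_simps")

lemma hh_annulus:
	assumes x: "6/10 * r < dist z0 x" "dist z0 x < r"
	shows "hh (Some x) <= ennreal c1 * emeasure m E"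
proof -
	have "green_function m Xh Gh" using green by (simp add: dual_green_functions_def)
	hence "Xh.R_upto (%_. 0) (Xh.leave (ball z0 r)) (ext0 (indicator E)) (Some x) = (\<integral>\<^sup>+y\<in>ball z0 r. indicator E y * Gh (ball z0 r) x y \<partial>m)"
		using E(1) x by (intro Xh.green_R_upto) auto
	also have "... <= (nn_integral m (%y. ennreal c1 * indicator E y))"
		using green_bound[OF x] E(2) by (intro nn_integral_mono) (auto simp: indicator_def)
	also have "... = ennreal c1 * emeasure m E" using E(1) by (simp add: nn_integral_cmult_indicator sets_m)
	finally show ?thesis using hh_green[of "Some x"] by (rule order_trans[rotated])
qed

text \<open>By duality this is the mean time that \<open>X\<close>, started in \<open>E\<close>, spends in the ball.\<close>

lemma hh_mass: "(\<integral>\<^sup>+x\<in>ball z0 (65/100 * r). hh (Some x) \<partial>m) <= ennreal c2 * emeasure m E"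
proof -
	let ?B = "ball z0 (65/100 * r)"
	let ?g = "%n x. indicator E x * X.R (kn n) (ext0 (indicator ?B)) (Some x) :: ennreal"
	have B_ind: "ext0 (indicator ?B :: 'a => ennreal) \<in> smeas" by (intro measurable_ext0 borel_measurable_indicator) simp
	have B_le: "ext0 (indicator ?B) z <= ennreal 1" for z
		by (auto simp: ext0_def indicator_def split: option.split)
	have gm: "?g n \<in> borel_measurable m" for n
	proof -
		have [measurable]: "(%x. X.R (kn n) (ext0 (indicator ?B)) (Some x)) \<in> bmeas"
			by (rule measurable_compose[OF measurable_Some X.R_measurable[OF rate_kn B_ind]])
		show ?thesis using E(1) by measurable
	qed
	have "(\<integral>\<^sup>+x\<in>?B. hh (Some x) \<partial>m) <= (INF n. \<integral>\<^sup>+x. ?g n x \<partial>m)"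
	proof (rule INF_greatest)
		fix n
		have "(\<integral>\<^sup>+x\<in>?B. hh (Some x) \<partial>m) <= (nn_integral m (%x. Xh.R (kn n) (ext0 (indicator E)) (Some x) * indicator ?B x))"
			unfolding hh_def h_def by (intro nn_integral_mono mult_right_mono INF_lower) auto
		also have "... = (nn_integral m (%x. ?g n x))"
			by (rule killed_duality[OF X.hunt_axioms Xh.hunt_axioms dual sets_m rate_kn kn_ge(2) pos(1), of _ _ 1, symmetric])
				(use E(1) E_fin in "auto simp: sets_m intro!: borel_measurable_indicator split: split_indicator")
		finally show "(\<integral>\<^sup>+x\<in>?B. hh (Some x) \<partial>m) <= (nn_integral m (%x. ?g n x))" .
	qed
	also have "(INF n. \<integral>\<^sup>+x. ?g n x \<partial>m) = (nn_integral m (%x. (INF n. ?g n x)))"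
	proof (rule nn_integral_monotone_convergence_INF_decseq[where i = 0, symmetric])
		show "decseq ?g"
			by (intro monotoneI le_funI mult_left_mono X.R_antimono_rate[OF rate_kn rate_kn kn_mono B_ind]) auto
		show "?g n \<in> borel_measurable m" for n by (rule gm)
		have "(nn_integral m (%x. ?g 0 x)) <= (nn_integral m (%x. ennreal (1 / \<alpha>) * indicator E x))"
			using X.R_bound[OF rate_kn kn_ge(2) pos(1) B_le] by (intro nn_integral_mono) (simp add: indicator_def)
		also have "... < \<infinity>" using E(1) E_fin by (simp add: nn_integral_cmult_indicator sets_m ennreal_mult_less_top)
		finally show "(nn_integral m (%x. ?g 0 x)) < \<infinity>" .
	qed
	also have "... <= (nn_integral m (%x. ennreal c2 * indicator E x))"
	proof (rule nn_integral_mono)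
		fix x
		have "(INF n. X.R (kn n) (ext0 (indicator ?B)) (Some x)) <= X.R_upto (%_. 0) (X.leave (ball z0 r)) (ext0 (indicator ?B)) (Some x)"
			unfolding kn_def[abs_def]
		proof (rule X.R_strong_killing[OF rate_k k_ge pos(1) rate_\<eta>, of "{x. 9/10 * r < dist z0 x}" _ _ 1])
			show "open {x. 9/10 * r < dist z0 x}" by (intro open_Collect_less continuous_intros)
			show "- ball z0 r \<subseteq> {x. 9/10 * r < dist z0 x}" using r_pos by auto
		qed (use \<eta>_outside B_le B_ind in "auto simp: ext0_simps")
		also have "... <= 1 * X.exit_mean (ball z0 r) (Some x)"
			by (rule X.R_upto_zero_mono_const(1)) (use B_le[of "Some _"] in "simp_all add: ext0_simps")
		also have "... <= ennreal c2" using mean_bound by simp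
		finally show "(INF n. ?g n x) <= ennreal c2 * indicator E x"
			by (auto simp: indicator_def intro: INF_lower2[of 0])
	qed
	also have "... = ennreal c2 * emeasure m E" using E(1) by (simp add: nn_integral_cmult_indicator sets_m)
	finally show ?thesis .
qed

text \<open>Off \<open>W\<close> a constant is at most twice itself times \<open>\<phi>\<close>, so
  plain bounds are good enough there; on \<open>W\<close> the surplus
  \<open>\<delta> (1 - \<phi>)\<close> is at least \<open>\<delta> / 2\<close>.\<close>

definition W :: "'a set" where "W = {x. \<phi> x < 1 / 2}"

lemma W_open: "open W"
	unfolding W_def using bump_continuous(1)[OF \<phi>] by (intro open_Collect_less) auto

lemma W_far: "x \<in> W ==> 7/10 * r <= dist z0 x"
	using \<phi>_inside[of x] by (force simp: W_def not_less[symmetric])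

lemma closure_W: "closure W \<subseteq> {x. 7/10 * r <= dist z0 x}"
proof (rule closure_minimal)
	show "W \<subseteq> {x. 7/10 * r <= dist z0 x}" using W_far by blast
	show "closed {x. 7/10 * r <= dist z0 x}" by (intro closed_Collect_le continuous_intros)
qed

text \<open>Dynkin's formula for \<open>\<phi>\<close> is combined with the pointwise inequality
  \<open>pw\<close>. The part \<open>\<epsilon> \<psi>\<close> costs at most
  \<open>\<epsilon>\<close>, since the killing time has mass at most 1, and the surplus on
  \<open>W\<close> controls the weighted occupation time of \<open>W\<close>.\<close>

lemma supersolution:
	"Xh.stopped (%z. \<alpha> + \<psi> z) (Xh.leave W) (enn0 \<phi>) (Some y) +
		ennreal (\<delta> / 2) * Xh.R_upto (%z. \<alpha> + \<psi> z) (Xh.leave W) (%_. 1) (Some y) <= ennreal (\<phi> y + \<epsilon>)"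
proof -
	let ?k = "%z. \<alpha> + \<psi> z" and ?T = "Xh.leave W" and ?F = "enn0 \<phi>"
	let ?gp = "ext0 (%x. ennreal (gen Xh \<phi> x))" and ?gm = "ext0 (%x. ennreal (- gen Xh \<phi> x))"
	let ?d = "ext0 (%x. ennreal (\<delta> * (1 - \<phi> x)))"
	have T: "?T \<in> borel_measurable Xh.H" "Xh.raw_time ?T" using Xh.leave_measurable[OF W_open] Xh.raw_time_leave[OF W_open] by auto
	have [measurable]: "?F \<in> smeas" "?gp \<in> smeas" "?gm \<in> smeas" "?d \<in> smeas"
		by (intro measurable_ext0; measurable)+
	have [measurable]: "\<psi> \<in> smeas" by (rule rate_measurable[OF rate_\<psi>])
	let ?Ru = "%f. Xh.R_upto ?k ?T f (Some y)"
	have fin: "?Ru ?gp < \<infinity>"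
	proof -
		have "?Ru ?gp <= Xh.R ?k ?gp (Some y)" by (rule Xh.R_upto_le_R)
		also have "... <= ennreal (\<delta> / \<alpha>)"
			by (rule Xh.R_bound[OF rate_k k_ge pos(1)]) (use gen_le pos in "auto simp: ext0_def ennreal_leI split: option.split")
		finally show ?thesis by (simp add: le_less_trans)
	qed
	have \<psi>1: "?Ru (%z. ennreal (\<psi> z)) <= 1"
	proof -
		have "?Ru (%z. ennreal (\<psi> z)) <= Xh.R ?k (%z. ennreal (\<psi> z)) (Some y)" by (rule Xh.R_upto_le_R)
		also have "... <= Xh.R ?k (%z. ennreal (?k z)) (Some y)" using pos by (intro Xh.R_mono ennreal_leI) auto
		also have "... <= 1" by (rule Xh.R_rate_le_1[OF rate_k])
		finally show ?thesis .
	qed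
	\<comment> \<open>The left side equals \<open>\<psi> (\<phi> + \<epsilon>)\<close> whatever the
	  sign of the generator, by the definition of the penalty.\<close>
	have pw: "?gp z + ?d z <= (ennreal (?k z) * ?F z + ?gm z) + ennreal \<epsilon> * ennreal (\<psi> z)" for z
	proof (cases z)
		case (Some x)
		have "ennreal (gen Xh \<phi> x) + ennreal (\<delta> * (1 - \<phi> x)) = ennreal (\<psi> (Some x) * (\<phi> x + \<epsilon>))"
			unfolding \<psi>_identity using \<phi>_range[of x] pos by (cases "0 <= gen Xh \<phi> x") (auto simp: ennreal_neg ennreal_plus max_def)
		also have "... <= ennreal ((\<alpha> + \<psi> (Some x)) * \<phi> x + \<epsilon> * \<psi> (Some x))"
			using \<phi>_range[of x] pos by (intro ennreal_leI) (simp add: algebra_simps)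
		also have "... = ennreal (\<alpha> + \<psi> (Some x)) * ennreal (\<phi> x) + ennreal \<epsilon> * ennreal (\<psi> (Some x))"
			using \<phi>_range[of x] pos \<psi>_nonneg[of "Some x"] by (subst ennreal_plus) (auto simp: ennreal_mult)
		also have "... <= (ennreal (\<alpha> + \<psi> (Some x)) * ennreal (\<phi> x) + ?gm z) + ennreal \<epsilon> * ennreal (\<psi> (Some x))"
			by (intro add_mono) auto
		finally show ?thesis by (simp add: Some ext0_simps)
	qed (simp add: ext0_simps)
	have "?Ru ?gp + ?Ru ?d = ?Ru (%z. ?gp z + ?d z)" by (rule Xh.R_upto_add[OF rate_k T(1), symmetric]) measurable
	also have "... <= ?Ru (%z. (ennreal (?k z) * ?F z + ?gm z) + ennreal \<epsilon> * ennreal (\<psi> z))" by (rule Xh.R_upto_mono[OF pw])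
	also have "... = ?Ru (%z. ennreal (?k z) * ?F z + ?gm z) + ?Ru (%z. ennreal \<epsilon> * ennreal (\<psi> z))"
		by (rule Xh.R_upto_add[OF rate_k T(1)]) measurable
	also have "?Ru (%z. ennreal \<epsilon> * ennreal (\<psi> z)) = ennreal \<epsilon> * ?Ru (%z. ennreal (\<psi> z))"
		by (rule Xh.R_upto_cmult[OF rate_k T(1)]) measurable
	also have "... <= ennreal \<epsilon> * 1" by (intro mult_left_mono \<psi>1) simp
	finally have 1: "?Ru ?gp + ?Ru ?d <= ?Ru (%z. ennreal (?k z) * ?F z + ?gm z) + ennreal \<epsilon>" by simp
	have D: "?F (Some y) + ?Ru ?gp = Xh.stopped ?k ?T ?F (Some y) + ?Ru (%z. ennreal (?k z) * ?F z + ?gm z)"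
		by (rule Xh.Dynkin[OF has_gen \<phi>_range(1) rate_k k_ge pos(1) T(2)])
	have "?Ru ?gp + (Xh.stopped ?k ?T ?F (Some y) + ?Ru ?d) = Xh.stopped ?k ?T ?F (Some y) + (?Ru ?gp + ?Ru ?d)" by (simp add: ac_simps)
	also have "... <= Xh.stopped ?k ?T ?F (Some y) + (?Ru (%z. ennreal (?k z) * ?F z + ?gm z) + ennreal \<epsilon>)" by (intro add_left_mono 1)
	also have "... = ?Ru ?gp + (?F (Some y) + ennreal \<epsilon>)" using D by (simp add: ac_simps)
	finally have 2: "Xh.stopped ?k ?T ?F (Some y) + ?Ru ?d <= ?F (Some y) + ennreal \<epsilon>"
		using fin by (subst (asm) ennreal_add_left_cancel_le) auto
	have "ennreal (\<delta> / 2) * ?Ru (%_. 1) = ?Ru (%_. ennreal (\<delta> / 2) * 1)"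
		by (rule Xh.R_upto_cmult[OF rate_k T(1), symmetric]) simp
	also have "... <= ?Ru ?d"
	proof (rule Xh.R_upto_mono_on[OF W_open])
		fix x assume "x \<in> W"
		hence "\<delta> * (1 / 2) <= \<delta> * (1 - \<phi> x)" using pos by (intro mult_left_mono) (auto simp: W_def)
		thus "ennreal (\<delta> / 2) * 1 <= ?d (Some x)" by (simp add: ext0_simps ennreal_leI)
	qed
	finally show ?thesis using 2 \<phi>_range[of y] pos
		by (simp add: ext0_simps ennreal_plus) (meson add_left_mono order_trans)
qed

text \<open>\<open>E\<close> and \<open>W\<close> are disjoint, so the potential of \<open>E\<close>
  collects nothing before \<open>W\<close> is left and its value is passed on to the exit point;
  dropping \<open>n \<eta>\<close> from the rate only increases the weight.\<close>

lemma hh_stopped: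
	assumes y: "y \<in> W"
	shows "hh (Some y) <= Xh.stopped (%z. \<alpha> + \<psi> z) (Xh.leave W) hh (Some y)"
proof -
	have T: "Xh.leave W \<in> borel_measurable Xh.H" by (rule Xh.leave_measurable[OF W_open])
	have "h n (Some y) <= Xh.stopped (%z. \<alpha> + \<psi> z) (Xh.leave W) (h n) (Some y)" for n
	proof -
		have "Xh.R_upto (kn n) (Xh.leave W) (ext0 (indicator E)) (Some y) = Xh.R_upto (kn n) (Xh.leave W) (%_. 0) (Some y)"
		proof (rule Xh.R_upto_cong[OF W_open])
			fix x assume "x \<in> W"
			hence "x \<notin> E" using W_far[of x] E(2) r_pos by auto
			thus "ext0 (indicator E) (Some x) = (0 :: ennreal)" by (simp add: ext0_simps)
		qed
		hence "Xh.R_upto (kn n) (Xh.leave W) (ext0 (indicator E)) (Some y) = 0"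
			by (simp add: Xh.R_upto_def Xh.occ_def)
		hence "h n (Some y) = Xh.stopped (kn n) (Xh.leave W) (h n) (Some y)"
			using Xh.R_strong_markov[OF rate_kn E_ind Xh.raw_time_leave[OF W_open], of n "Some y"] by (simp add: h_def)
		also have "... <= Xh.stopped (%z. \<alpha> + \<psi> z) (Xh.leave W) (h n) (Some y)"
			by (rule Xh.stopped_antimono_rate[OF rate_k rate_kn kn_ge(1)])
		finally show ?thesis .
	qed
	hence "hh (Some y) <= (INF n. Xh.stopped (%z. \<alpha> + \<psi> z) (Xh.leave W) (h n) (Some y))"
		unfolding hh_def by (rule INF_mono')
	also have "... = Xh.stopped (%z. \<alpha> + \<psi> z) (Xh.leave W) (%z. INF n. h n z) (Some y)"
		by (rule Xh.stopped_INF[OF rate_k T h_measurable h_decseq h_bound]) simp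
	finally show ?thesis by (simp add: hh_def[abs_def])
qed

text \<open>From \<open>y\<close> in \<open>W\<close> the value of \<open>hh\<close> is carried to
  the exit point. Exit points beyond \<open>65 r / 100\<close> have
  \<open>\<phi> \<ge> 1 / 2\<close>, so the Green bound there is a multiple of
  \<open>\<phi>\<close>. Points within \<open>65 r / 100\<close> are reached only by jumps, and the
  Levy system bounds their share by \<open>c3\<close> times the mass of \<open>hh\<close> times the
  occupation time of \<open>W\<close>. Both parts are controlled by
  \<open>supersolution\<close>.\<close>

lemma hh_near_boundary:
	assumes y: "6/10 * r < dist z0 y" "dist z0 y < r"
	shows "hh (Some y) <= ennreal (2 * c1 + 2 * c2 * c3 / \<delta>) * emeasure m E * ennreal (\<phi> y + \<epsilon>)"
proof (cases "y \<in> W")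
	case False
	hence "1 / 2 <= \<phi> y" by (simp add: W_def)
	hence "c1 * 1 <= (2 * c1 + 2 * c2 * c3 / \<delta>) * (\<phi> y + \<epsilon>)"
	proof -
		assume p: "1 / 2 <= \<phi> y"
		have "c1 * 1 = (2 * c1) * (1 / 2)" by simp
		also have "... <= (2 * c1 + 2 * c2 * c3 / \<delta>) * (\<phi> y + \<epsilon>)" using p pos by (intro mult_mono) auto
		finally show ?thesis .
	qed
	hence "ennreal c1 <= ennreal (2 * c1 + 2 * c2 * c3 / \<delta>) * ennreal (\<phi> y + \<epsilon>)"
		using pos \<phi>_range[of y] by (subst ennreal_mult[symmetric]) (auto intro: ennreal_leI)
	hence "ennreal c1 * emeasure m E <= ennreal (2 * c1 + 2 * c2 * c3 / \<delta>) * ennreal (\<phi> y + \<epsilon>) * emeasure m E"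
		by (rule mult_right_mono) simp
	thus ?thesis using hh_annulus[OF y] by (simp add: ac_simps)
next
	case True
	let ?k = "%z. \<alpha> + \<psi> z" and ?T = "Xh.leave W" and ?F = "enn0 \<phi>"
	let ?A = "{z. dist z0 z < 65/100 * r}" and ?e = "emeasure m E"
	have T: "?T \<in> borel_measurable Xh.H" by (rule Xh.leave_measurable[OF W_open])
	have Fm: "?F \<in> smeas" by (intro measurable_ext0) measurable
	have Am: "ext0 (%x. hh (Some x) * indicator ?A x) \<in> smeas" by (intro measurable_ext0) measurable
	have "hh (Some y) <= Xh.stopped ?k ?T hh (Some y)" by (rule hh_stopped[OF True])
	also have "... = Xh.stopped ?k ?T (%z. hh z * indicator (- Some ` W) z) (Some y)"
		by (rule Xh.stopped_cong_outside[OF W_open]) simp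
	also have "... <= Xh.stopped ?k ?T (%z. ennreal (2 * c1) * ?e * ?F z + ext0 (%x. hh (Some x) * indicator ?A x) z) (Some y)"
	proof (rule Xh.stopped_mono)
		fix z show "hh z * indicator (- Some ` W) z <= ennreal (2 * c1) * ?e * ?F z + ext0 (%x. hh (Some x) * indicator ?A x) z"
		proof (cases z)
			case (Some x)
			show ?thesis
			proof (cases "x \<in> W \<or> x \<in> ?A")
				case True
				have "hh z * indicator (- Some ` W) z <= ext0 (%x. hh (Some x) * indicator ?A x) z"
					using True Some by (auto simp: ext0_simps indicator_def)
				thus ?thesis by (simp add: add_increasing)
			next
				case False
				hence x: "1 / 2 <= \<phi> x" "65/100 * r <= dist z0 x" by (auto simp: W_def)
				hence "dist z0 x < r" using \<phi>_outside[of x] r_pos by (cases "8/10 * r <= dist z0 x") auto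
				hence "hh (Some x) <= ennreal c1 * ?e" using x r_pos by (intro hh_annulus) auto
				also have "... <= (ennreal (2 * c1) * ennreal (\<phi> x)) * ?e"
					using x pos by (intro mult_right_mono) (auto simp: ennreal_mult[symmetric] intro!: ennreal_leI mult_left_mono[of "1/2" "\<phi> x" "2 * c1", simplified])
				finally have "hh (Some x) <= ennreal (2 * c1) * ?e * ennreal (\<phi> x)" by (simp add: ac_simps)
				moreover have "hh (Some x) * indicator (- Some ` W) (Some x) <= hh (Some x)" by (simp add: indicator_def)
				ultimately show ?thesis using Some by (simp add: ext0_simps add_increasing2)
			qed
		qed (simp add: hh_None)
	qed
	also have "... = Xh.stopped ?k ?T (%z. ennreal (2 * c1) * ?e * ?F z) (Some y) + Xh.stopped ?k ?T (ext0 (%x. hh (Some x) * indicator ?A x)) (Some y)"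
		using Fm Am by (intro Xh.stopped_add[OF rate_k T]) measurable
	also have "Xh.stopped ?k ?T (%z. ennreal (2 * c1) * ?e * ?F z) (Some y) = ennreal (2 * c1) * ?e * Xh.stopped ?k ?T ?F (Some y)"
		by (rule Xh.stopped_cmult[OF rate_k T Fm])
	also have "Xh.stopped ?k ?T (ext0 (%x. hh (Some x) * indicator ?A x)) (Some y) <= ennreal (c2 * c3) * ?e * Xh.R_upto ?k ?T (%_. 1) (Some y)"
	proof -
		have dj: "?A \<inter> closure W = {}" using closure_W r_pos by force
		have "Xh.stopped ?k ?T (ext0 (%x. hh (Some x) * indicator ?A x)) (Some y) =
				Xh.R_upto ?k ?T (ext0 (%x. \<integral>\<^sup>+z. hh (Some z) * indicator ?A z \<partial>density m (%y. ennreal (jh x y)))) (Some y)"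
			by (rule Xh.levy_system_killed[OF Jh many_bumps_Xh rate_k k_ge pos(1) W_open True hh_measurable' _ dj]) measurable
		also have "... <= Xh.R_upto ?k ?T (%_. ennreal (c2 * c3) * ?e * 1) (Some y)"
		proof (rule Xh.R_upto_mono_on[OF W_open])
			fix x assume x: "x \<in> W"
			have "(nn_integral (density m (%y. ennreal (jh x y))) (%z. hh (Some z) * indicator ?A z)) = (nn_integral m (%z. ennreal (jh x z) * (hh (Some z) * indicator ?A z)))"
				by (rule nn_integral_J(2)) measurable
			also have "... <= (nn_integral m (%z. ennreal c3 * (hh (Some z) * indicator (ball z0 (65/100 * r)) z)))"
				using jump_bound[OF W_far[OF x]] by (intro nn_integral_mono) (auto simp: indicator_def intro!: mult_right_mono ennreal_leI)
			also have "... = ennreal c3 * (\<integral>\<^sup>+z\<in>ball z0 (65/100 * r). hh (Some z) \<partial>m)"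
			proof (rule nn_integral_cmult)
				have [measurable]: "ball z0 (65/100 * r) \<in> sets borel" by simp
				show "(%z. hh (Some z) * indicator (ball z0 (65/100 * r)) z) \<in> borel_measurable m" by measurable
			qed
			also have "... <= ennreal c3 * (ennreal c2 * ?e)" by (intro mult_left_mono hh_mass) simp
			also have "... = ennreal (c2 * c3) * ?e * 1" using pos by (simp add: ennreal_mult ac_simps)
			finally show "ext0 (%x. \<integral>\<^sup>+z. hh (Some z) * indicator ?A z \<partial>density m (%y. ennreal (jh x y))) (Some x) <= ennreal (c2 * c3) * ?e * 1"
				by (simp add: ext0_simps)
		qed
		also have "... = ennreal (c2 * c3) * ?e * Xh.R_upto ?k ?T (%_. 1) (Some y)"
			by (rule Xh.R_upto_cmult[OF rate_k T]) simp
		finally show ?thesis .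
	qed
	finally have le: "hh (Some y) <= ennreal (2 * c1) * ?e * Xh.stopped ?k ?T ?F (Some y) + ennreal (c2 * c3) * ?e * Xh.R_upto ?k ?T (%_. 1) (Some y)"
		by simp
	let ?b = "ennreal (\<phi> y + \<epsilon>)"
	have "Xh.stopped ?k ?T ?F (Some y) <= ?b" "ennreal (\<delta> / 2) * Xh.R_upto ?k ?T (%_. 1) (Some y) <= ?b"
		using supersolution[of y] by (meson add_increasing add_increasing2 order_trans zero_le order_refl)+
	hence "hh (Some y) <= ennreal (2 * c1) * ?e * ?b + ennreal (2 * c2 * c3 / \<delta>) * ?e * ?b"
	proof -
		assume s: "Xh.stopped ?k ?T ?F (Some y) <= ?b" "ennreal (\<delta> / 2) * Xh.R_upto ?k ?T (%_. 1) (Some y) <= ?b"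
		have "ennreal (c2 * c3) = ennreal (2 * c2 * c3 / \<delta>) * ennreal (\<delta> / 2)" using pos by (simp add: ennreal_mult[symmetric])
		hence "ennreal (c2 * c3) * ?e * Xh.R_upto ?k ?T (%_. 1) (Some y) =
			ennreal (2 * c2 * c3 / \<delta>) * ?e * (ennreal (\<delta> / 2) * Xh.R_upto ?k ?T (%_. 1) (Some y))" by (simp add: ac_simps)
		also have "... <= ennreal (2 * c2 * c3 / \<delta>) * ?e * ?b" by (intro mult_left_mono s(2)) simp
		finally show ?thesis using le s(1) by (meson add_mono mult_left_mono order_trans zero_le)
	qed
	also have "... = ennreal (2 * c1 + 2 * c2 * c3 / \<delta>) * ?e * ?b"
		using pos by (subst ennreal_plus) (auto simp: distrib_right)
	finally show ?thesis .
qed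

text \<open>The factor \<open>\<phi> + \<epsilon>\<close> in the bound for \<open>hh\<close> cancels
  the denominator of the penalty, so the result does not depend on \<open>\<epsilon>\<close> or
  \<open>\<alpha>\<close>.\<close>

lemma hh_\<psi>:
	assumes y: "dist z0 y < r"
	shows "hh (Some y) * ennreal (\<psi> (Some y)) <= ennreal (4 * (c1 * \<delta> + c2 * c3)) * emeasure m E"
proof (cases "dist z0 y < 7/10 * r")
	case True
	thus ?thesis by (simp add: \<psi>_inside)
next
	case False
	have "hh (Some y) * ennreal (\<psi> (Some y)) <= ennreal (2 * c1 + 2 * c2 * c3 / \<delta>) * emeasure m E * ennreal (\<phi> y + \<epsilon>) * ennreal (\<psi> (Some y))"
		using False y r_pos by (intro mult_right_mono hh_near_boundary) auto
	also have "... = ennreal (2 * c1 + 2 * c2 * c3 / \<delta>) * emeasure m E * ennreal (\<psi> (Some y) * (\<phi> y + \<epsilon>))"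
		using \<psi>_nonneg \<phi>_range[of y] pos by (simp add: ennreal_mult ac_simps)
	also have "... <= ennreal (2 * c1 + 2 * c2 * c3 / \<delta>) * emeasure m E * ennreal (2 * \<delta>)"
		unfolding \<psi>_identity by (intro mult_left_mono ennreal_leI \<psi>_numerator) simp
	also have "... = ennreal ((2 * c1 + 2 * c2 * c3 / \<delta>) * (2 * \<delta>)) * emeasure m E"
		by (subst ennreal_mult) (use pos in "auto simp: ac_simps")
	also have "(2 * c1 + 2 * c2 * c3 / \<delta>) * (2 * \<delta>) = 4 * (c1 * \<delta> + c2 * c3)" using pos by (simp add: field_simps)
	finally show ?thesis .
qed

end

section \<open>The supremum bound for harmonic functions\<close>

context hunt
begin

lemma R_upto_measurable:
	assumes "rate k" "T \<in> hmeas" "v \<in> smeas"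
	shows "R_upto k T v \<in> smeas"
	unfolding R_upto_def[abs_def]
	by (rule measurable_nn_integral_P, rule occ_measurable[OF assms(1,3,2)]) simp

lemma stopped_start_measurable:
	assumes "rate k" "T \<in> hmeas" "f \<in> smeas"
	shows "stopped k T f \<in> smeas"
	unfolding stopped_def[abs_def]
	by (rule measurable_nn_integral_P) (use stopped_measurable[OF assms] in "simp add: measurable_P_iff")

lemma R_upto_cong_rate:
	assumes k: "rate k" "rate k'" and D: "open D" and eq: "!!y. y \<in> D ==> k (Some y) = k' (Some y)"
	shows "R_upto k (leave D) v x = R_upto k' (leave D) v x"
	unfolding R_upto_def
proof (rule nn_integral_cong)
	fix w assume "w \<in> space (P x)"
	hence w: "w \<in> paths X" by simp
	have "M k t w = M k' t w" if t: "ennreal t < leave D w" for t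
	proof -
		have "pos X s w \<in> Some ` D" if "0 <= s" "s <= t" for s
			by (rule before_leave[OF D that(1)]) (use t that(2) in "auto intro: le_less_trans ennreal_leI")
		hence "k (pos X s w) = k' (pos X s w)" if "0 <= s" "s <= t" for s using that eq by fastforce
		thus ?thesis using M_antimono_rate[OF k w, of t] M_antimono_rate[OF k(2,1) w, of t] by force
	qed
	thus "occ k v (leave D w) w = occ k' v (leave D w) w"
		unfolding occ_def by (intro nn_integral_cong) (simp add: indicator_def)
qed

lemma harmonic_killed:
	assumes W: "open W" and k: "rate k" and f: "f \<in> smeas" "f None = 0" and harm: "!!z. exit_value W f z = f z"
	shows "f x = stopped k (leave W) f x + R_upto k (leave W) (%z. ennreal (k z) * f z) x"
	using exit_value_killed[OF W k f, of x] by (simp add: harm)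

text \<open>For each rate the stopped part and the killed part add up to the same finite integral,
  and the stopped parts increase to all of it as the rate decreases to 0.\<close>

lemma R_upto_vanishing_rate:
	assumes W: "open W" and f: "f \<in> smeas" "f None = 0" and harm: "!!z. exit_value W f z = f z"
		and \<mu>: "sets \<mu> = sets borel" and fin: "(nn_integral \<mu> (%x. f (Some x))) < \<infinity>"
	shows "(INF n. \<integral>\<^sup>+x. R_upto (%_. inv1 n) (leave W) (%z. ennreal (inv1 n) * f z) (Some x) \<partial>\<mu>) = 0"
		(is "(INF n. ?t n) = 0")
proof -
	let ?a = "%n. inv1 n"
	let ?s = "%n. \<integral>\<^sup>+x. stopped (%_. ?a n) (leave W) f (Some x) \<partial>\<mu>"
	note T = leave_measurable[OF W]
	have k: "rate (%_. ?a n)" for n by (rule rate_const) simp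
	have sm: "(%x. stopped (%_. ?a n) (leave W) f (Some x)) \<in> borel_measurable \<mu>" for n
		using measurable_compose[OF measurable_Some stopped_start_measurable[OF k T f(1)]] measurable_cong_sets[OF \<mu> refl] by blast
	have rm: "(%x. R_upto (%_. ?a n) (leave W) (%z. ennreal (?a n) * f z) (Some x)) \<in> borel_measurable \<mu>" for n
	proof -
		have "(%z. ennreal (?a n) * f z) \<in> smeas" using f(1) by measurable
		from measurable_compose[OF measurable_Some R_upto_measurable[OF k T this]] show ?thesis
			using measurable_cong_sets[OF \<mu> refl] by blast
	qed
	let ?I = "\<integral>\<^sup>+x. f (Some x) \<partial>\<mu>"
	have sum: "?s n + ?t n = ?I" for n
	proof -
		have "?s n + ?t n = (nn_integral \<mu> (%x. stopped (%_. ?a n) (leave W) f (Some x) + R_upto (%_. ?a n) (leave W) (%z. ennreal (?a n) * f z) (Some x)))"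
			by (rule nn_integral_add[OF sm rm, symmetric])
		also have "... = ?I"
			by (intro nn_integral_cong harmonic_killed[OF W k f harm, symmetric])
		finally show ?thesis .
	qed
	have "(SUP n. ?s n) = (nn_integral \<mu> (%x. (SUP n. stopped (%_. ?a n) (leave W) f (Some x))))"
	proof (rule nn_integral_monotone_convergence_SUP[symmetric])
		show "incseq (%n x. stopped (%_. ?a n) (leave W) f (Some x))"
			by (intro monotoneI le_funI stopped_antimono_rate[OF k k]) (simp add: field_simps)
	qed (rule sm)
	also have "... = ?I"
		unfolding stopped_const_SUP[OF T f(1)] stopped_zero[where f = f, OF f(2)] harm ..
	finally have S: "(SUP n. ?s n) = ?I" .
	have "?s n + (INF n. ?t n) <= ?I" for n
		unfolding sum[of n, symmetric] by (intro add_left_mono INF_lower) simp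
	hence "(SUP n. ?s n + (INF n. ?t n)) <= ?I" by (intro SUP_least)
	hence "(SUP n. ?s n) + (INF n. ?t n) <= ?I" by (subst ennreal_SUP_add_left[symmetric]) auto
	hence "?I + (INF n. ?t n) <= ?I + 0" unfolding S by simp
	thus ?thesis using fin by (subst (asm) ennreal_add_left_cancel_le) auto
qed

end

context killing
begin

text \<open>
	Duality turns the contribution of the penalty to \<open>\<integral>\<^sub>E u dm\<close> into an integral of \<open>u\<close> against the dual potential;
	\<open>\<eta>\<close> vanishes on \<open>U\<close>, so the rates \<open>kn n\<close> may be used there for all \<open>n\<close>. The truncation provides the finite integral
	needed for \<open>n \<rightarrow> \<infinity>\<close>.
\<close>

lemma penalty_contribution:
	assumes U: "open U" "U \<subseteq> ball z0 (9/10 * r)" and u: "u \<in> bmeas"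
	shows "(\<integral>\<^sup>+x\<in>E. X.R_upto (%z. \<alpha> + \<psi> z) (X.leave U) (ext0 (%y. ennreal (\<psi> (Some y)) * ennreal (u y))) (Some x) \<partial>m) <=
		ennreal (4 * (c1 * \<delta> + c2 * c3)) * emeasure m E * (\<integral>\<^sup>+y\<in>{y. 7/10 * r <= dist z0 y & dist z0 y < 9/10 * r}. ennreal (u y) \<partial>m)"
proof -
	let ?k = "%z. \<alpha> + \<psi> z"
	let ?c = "ennreal (4 * (c1 * \<delta> + c2 * c3)) * emeasure m E" and ?A = "{y. 7/10 * r <= dist z0 y & dist z0 y < 9/10 * r}"
	define w where "w L y = ennreal (\<psi> (Some y)) * min (ennreal (u y)) (of_nat L) * indicator U y" for L y
	note T = X.leave_measurable[OF U(1)]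
	have Us [measurable]: "U \<in> sets borel" using U(1) by simp
	have [measurable]: "(%y. \<psi> (Some y)) \<in> bmeas"
		by (rule measurable_compose[OF measurable_Some rate_measurable[OF rate_\<psi>]])
	note [measurable] = u
	have w[measurable]: "w L \<in> bmeas" for L unfolding w_def by measurable
	have wm: "ext0 (w L) \<in> smeas" for L by (rule measurable_ext0[OF w])
	obtain b where b: "!!z. \<psi> z <= b" using rate_\<psi> by (auto simp: rate_def)
	have b0: "0 <= b" using b[of None] \<psi>_nonneg[of None] by simp
	have w_le: "w L y <= ennreal (b * real L)" for L y
	proof -
		have "w L y <= ennreal b * ennreal (real L) * 1"
			unfolding w_def by (intro mult_mono ennreal_leI b) (auto simp: indicator_def ennreal_of_nat_eq_real_of_nat)
		thus ?thesis using b0 by (simp add: ennreal_mult)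
	qed
	have fin: "(nn_integral m (%y. h 0 (Some y) * w L y)) < \<infinity>" for L
	proof -
		have "(nn_integral m (%y. h 0 (Some y) * w L y)) <= (nn_integral m (%y. (ennreal (1 / \<alpha>) * ennreal (b * real L)) * indicator (ball z0 (9/10 * r)) y))"
		proof (rule nn_integral_mono)
			fix y show "h 0 (Some y) * w L y <= (ennreal (1 / \<alpha>) * ennreal (b * real L)) * indicator (ball z0 (9/10 * r)) y"
			proof (cases "y \<in> U")
				case True
				hence i: "indicator (ball z0 (9/10 * r)) y = (1 :: ennreal)" using U(2) by (auto simp: indicator_def)
				show ?thesis unfolding i mult_1_right by (rule mult_mono[OF h_bound w_le]) auto
			qed (simp add: w_def)
		qed
		also have "... = (ennreal (1 / \<alpha>) * ennreal (b * real L)) * emeasure m (ball z0 (9/10 * r))"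
			by (rule nn_integral_cmult_indicator) (simp add: sets_m)
		also have "... < \<infinity>" using V_finite[of "9/10 * r"] by (auto simp: ennreal_mult_less_top)
		finally show ?thesis .
	qed
	have step: "(\<integral>\<^sup>+x\<in>E. X.R_upto ?k (X.leave U) (ext0 (w L)) (Some x) \<partial>m) <= ?c * (\<integral>\<^sup>+y\<in>?A. ennreal (u y) \<partial>m)" for L
	proof -
		have "(\<integral>\<^sup>+x\<in>E. X.R_upto ?k (X.leave U) (ext0 (w L)) (Some x) \<partial>m) <= (INF n. \<integral>\<^sup>+y. h n (Some y) * w L y \<partial>m)"
		proof (rule INF_greatest)
			fix n
			have "X.R_upto ?k (X.leave U) (ext0 (w L)) z = X.R_upto (kn n) (X.leave U) (ext0 (w L)) z" for z
			proof (rule X.R_upto_cong_rate[OF rate_k rate_kn U(1)])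
				fix y assume "y \<in> U"
				hence "\<eta> (Some y) = 0" using U(2) by (intro \<eta>_inside) auto
				thus "\<alpha> + \<psi> (Some y) = kn n (Some y)" by (simp add: kn_def)
			qed
			hence "(\<integral>\<^sup>+x\<in>E. X.R_upto ?k (X.leave U) (ext0 (w L)) (Some x) \<partial>m) <= (nn_integral m (%x. indicator E x * X.R (kn n) (ext0 (w L)) (Some x)))"
				by (intro nn_integral_mono) (simp add: indicator_def X.R_upto_le_R)
			also have "... = (nn_integral m (%y. Xh.R (kn n) (ext0 (indicator E)) (Some y) * w L y))"
				by (rule killed_duality[OF X.hunt_axioms Xh.hunt_axioms dual sets_m rate_kn kn_ge(2) pos(1) _ _ w w_le])
					(use E(1) E_fin b0 in "auto simp: sets_m")
			finally show "(\<integral>\<^sup>+x\<in>E. X.R_upto ?k (X.leave U) (ext0 (w L)) (Some x) \<partial>m) <= (nn_integral m (%y. h n (Some y) * w L y))"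
				by (simp add: h_def)
		qed
		also have "... = (nn_integral m (%y. (INF n. h n (Some y) * w L y)))"
		proof (rule nn_integral_monotone_convergence_INF_decseq[where i = 0, symmetric])
			show "decseq (%n y. h n (Some y) * w L y)"
				using monotoneD[OF h_decseq] by (intro monotoneI le_funI mult_right_mono) (auto simp: le_fun_def)
			show "(%y. h n (Some y) * w L y) \<in> borel_measurable m" for n
				using measurable_compose[OF measurable_Some h_measurable[of n]] by measurable
		qed (rule fin)
		also have "... <= (nn_integral m (%y. ?c * (ennreal (u y) * indicator ?A y)))"
		proof (rule nn_integral_mono)
			fix y
			show "(INF n. h n (Some y) * w L y) <= ?c * (ennreal (u y) * indicator ?A y)"
			\<comment> \<open>Within \<open>7 r / 10\<close> the penalty is 0, and \<open>U\<close> has no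
			  points from \<open>9 r / 10\<close> on, so only the annulus contributes.\<close>
			proof (cases "y \<in> ?A & y \<in> U")
				case False
				hence "w L y = 0" using \<psi>_inside[of y] U(2) by (cases "y \<in> U") (auto simp: w_def not_le[symmetric])
				thus ?thesis by (simp add: INF_lower2[of 0])
			next
				case True
				have wfin: "w L y < \<infinity>" unfolding w_def by (auto simp: ennreal_mult_less_top indicator_def of_nat_less_top intro: le_less_trans[OF min.cobounded2])
				have "(INF n. h n (Some y) * w L y) = w L y * hh (Some y)"
					unfolding hh_def using monotoneD[OF h_decseq] wfin
					by (subst INF_cmult_decseq[symmetric]) (auto intro!: monotoneI simp: le_fun_def mult.commute)
				also have "... <= (ennreal (\<psi> (Some y)) * ennreal (u y)) * hh (Some y)"
					using True by (intro mult_right_mono) (auto simp: w_def intro!: mult_left_mono)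
				also have "... = (hh (Some y) * ennreal (\<psi> (Some y))) * ennreal (u y)" by (simp add: ac_simps)
				also have "... <= ?c * ennreal (u y)" using True r_pos by (intro mult_right_mono hh_\<psi>) auto
				finally show ?thesis using True by simp
			qed
		qed
		also have "... = ?c * (\<integral>\<^sup>+y\<in>?A. ennreal (u y) \<partial>m)" by (rule nn_integral_cmult) measurable
		finally show ?thesis .
	qed
	have wmono: "w i y <= w l y" if "i <= l" for i l y
		unfolding w_def using that by (intro mult_right_mono mult_left_mono min.mono) (auto simp: of_nat_mono)
	have wSUP: "(SUP L. w L y) = ennreal (\<psi> (Some y)) * ennreal (u y)" if "y \<in> U" for y
	proof (rule antisym)
		show "(SUP L. w L y) <= ennreal (\<psi> (Some y)) * ennreal (u y)"
			using that by (intro SUP_least) (auto simp: w_def intro!: mult_left_mono)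
		obtain L where "u y <= real L" using real_arch_simple by blast
		hence "ennreal (u y) <= of_nat L" by (simp add: ennreal_of_nat_eq_real_of_nat ennreal_leI)
		thus "ennreal (\<psi> (Some y)) * ennreal (u y) <= (SUP L. w L y)"
			using that by (intro SUP_upper2[of L]) (auto simp: w_def min_def)
	qed
	have "X.R_upto ?k (X.leave U) (ext0 (%y. ennreal (\<psi> (Some y)) * ennreal (u y))) z = (SUP L. X.R_upto ?k (X.leave U) (ext0 (w L)) z)" for z
	proof -
		have "X.R_upto ?k (X.leave U) (ext0 (%y. ennreal (\<psi> (Some y)) * ennreal (u y))) z = X.R_upto ?k (X.leave U) (%z. SUP L. ext0 (w L) z) z"
			by (rule X.R_upto_cong[OF U(1)]) (simp add: ext0_simps wSUP)
		also have "... = (SUP L. X.R_upto ?k (X.leave U) (ext0 (w L)) z)"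
			by (rule X.R_upto_SUP[OF rate_k T wm]) (auto intro!: monotoneI le_funI wmono simp: ext0_def split: option.split)
		finally show ?thesis .
	qed
	hence "(\<integral>\<^sup>+x\<in>E. X.R_upto ?k (X.leave U) (ext0 (%y. ennreal (\<psi> (Some y)) * ennreal (u y))) (Some x) \<partial>m) =
			(nn_integral m (%x. (SUP L. X.R_upto ?k (X.leave U) (ext0 (w L)) (Some x) * indicator E x)))"
		by (intro nn_integral_cong) (auto simp: indicator_def)
	also have "... = (SUP L. \<integral>\<^sup>+x\<in>E. X.R_upto ?k (X.leave U) (ext0 (w L)) (Some x) \<partial>m)"
	proof (rule nn_integral_monotone_convergence_SUP)
		show "incseq (%L x. X.R_upto ?k (X.leave U) (ext0 (w L)) (Some x) * indicator E x)"
			by (intro monotoneI le_funI mult_right_mono X.R_upto_mono) (auto intro!: wmono simp: ext0_def split: option.split)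
		show "(%x. X.R_upto ?k (X.leave U) (ext0 (w L)) (Some x) * indicator E x) \<in> borel_measurable m" for L
			using measurable_compose[OF measurable_Some X.R_upto_measurable[OF rate_k T wm[of L]]] E(1) by measurable
	qed
	also have "... <= ?c * (\<integral>\<^sup>+y\<in>?A. ennreal (u y) \<partial>m)" by (intro SUP_least step)
	finally show ?thesis .
qed

end

context point_setting
begin

lemma penalty_antimono:
	assumes "!!x. 0 <= \<phi> x" "!!x. \<phi> x <= 1" "0 < \<epsilon>" "\<epsilon> <= \<epsilon>'" "0 <= \<delta>"
	shows "penalty Xh \<phi> \<delta> \<epsilon>' z <= penalty Xh \<phi> \<delta> \<epsilon> z"
	using assms by (cases z) (auto simp: penalty_def ext0_simps add_nonneg_pos add_nonneg_nonneg intro!: divide_left_mono mult_pos_pos)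

text \<open>
	Integrated over \<open>E\<close>, the value \<open>u\<close> splits into the payoff upon leaving \<open>D \<inter> B(z0, 9r/10)\<close> under the penalty, the
	contribution of the penalty, and that of the rate \<open>\<alpha>\<close>. The last one vanishes as \<open>\<alpha> \<rightarrow> 0\<close>; as \<open>\<epsilon> \<rightarrow> 0\<close>, the penalty
	confines the process to \<open>B(z0, 85r/100)\<close>, out of which it can only leave \<open>B(z0, 9r/10)\<close> by a jump.
\<close>

lemma harmonic_integral_bound:
	fixes u :: "'a => real" and \<phi> :: "'a => real"
	assumes r: "small r" and c: "0 < \<delta>" "0 <= c1" "0 <= c2" "0 <= c3" "0 <= c5" "0 <= c6"
		and \<phi>: "\<phi> \<in> bump m \<D> (closure (ball z0 (7/10 * r))) (ball z0 (8/10 * r))"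
		and gen_le: "!!x. gen Xh \<phi> x <= \<delta>"
		and green_bound: "!!x y. 6/10 * r < dist z0 x ==> dist z0 x < r ==> dist z0 y < r / 2 ==> Gh (ball z0 r) x y <= ennreal c1"
		and mean_bound: "!!W y. open W ==> W \<subseteq> ball z0 r ==> X.exit_mean W y <= ennreal c2"
		and jump_bound: "!!x z. 7/10 * r <= dist z0 x ==> dist z0 z < 65/100 * r ==> jh x z <= c3"
		and far_bound: "!!x z. dist z0 x < 85/100 * r ==> 9/10 * r <= dist z0 z ==> j x z <= c5 * j z0 z"
		and near_bound: "!!z. 7/10 * r <= dist z0 z ==> dist z0 z < 9/10 * r ==> 1 <= c6 * j z0 z"
		and D: "open D" "D \<subseteq> ball z0 r" and u: "u \<in> bmeas"
		and harm: "!!x. x \<in> D ==> ennreal (u x) = X.exit_value D (enn0 u) (Some x)"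
		and van: "!!x. x \<in> ball z0 r ==> x \<notin> D ==> u x = 0"
		and E: "E \<in> sets borel" "E \<subseteq> D \<inter> ball z0 (r / 2)" and N: "!!x. x \<in> E ==> u x <= N"
	shows "(\<integral>\<^sup>+x\<in>E. ennreal (u x) \<partial>m) <=
		ennreal (c5 * c2 + 4 * (c1 * \<delta> + c2 * c3) * c6) * (\<integral>\<^sup>+z\<in>{z. r / 2 <= dist z0 z}. ennreal (j z0 z) * ennreal (u z) \<partial>m) * emeasure m E"
proof -
	have r0': "0 < r" using r by (simp add: small_def)
	define f where "f = enn0 u"
	\<comment> \<open>The process is confined to \<open>B(z0, 85 r / 100)\<close>, while the relevant
	  landing points are beyond \<open>9 r / 10\<close>; the Levy system requires this gap.\<close>
	define U where "U = D \<inter> ball z0 (9/10 * r)"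
	define U' where "U' = D \<inter> ball z0 (85/100 * r)"
	have U: "open U" "U \<subseteq> D" "U \<subseteq> ball z0 (9/10 * r)" and U': "open U'" "U' \<subseteq> U" "U' \<subseteq> ball z0 r"
		using D r0' by (auto simp: U_def U'_def)
	define e where "e n = inv1 n" for n
	have e: "0 < e n" for n by (simp add: e_def)
	define \<psi> where "\<psi> n = penalty Xh \<phi> \<delta> (e n)" for n
	define \<mu> where "\<mu> = density m (indicator E)"
	define K where "K = (\<integral>\<^sup>+z\<in>{z. r / 2 <= dist z0 z}. ennreal (j z0 z) * ennreal (u z) \<partial>m)"
	note T = X.leave_measurable[OF U(1)]
	note [measurable] = u E(1)
	have sets_\<mu>: "sets \<mu> = sets borel" by (simp add: \<mu>_def sets_m)
	have int_\<mu>: "(nn_integral \<mu> (%x. g x)) = (\<integral>\<^sup>+x\<in>E. g x \<partial>m)" if "g \<in> bmeas" for g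
		unfolding \<mu>_def using that by (subst nn_integral_density) (auto simp: mult.commute)
	have int_const: "(\<integral>\<^sup>+x\<in>E. a \<partial>m) = a * emeasure m E" for a
		by (simp add: nn_integral_cmult_indicator sets_m)
	have Efin: "emeasure m E < \<infinity>"
		by (rule le_less_trans[OF emeasure_mono V_finite[of "r / 2"]]) (use E in "auto simp: sets_m")
	have f: "f \<in> smeas" "f None = 0"
		unfolding f_def by (intro measurable_ext0, measurable)
	have fm: "(%x. f (Some x)) \<in> bmeas" by (rule measurable_compose[OF measurable_Some f(1)])
	have harmU: "X.exit_value U f z = f z" for z
		by (rule X.harmonic_subset[OF _ D(1) U(1,2) f]) (use harm in "simp add: f_def ext0_simps")
	have killing: "killing m X Xh \<D> G Gh j jh \<Phi> R0 r0 n0 z0 r \<alpha> (e n) \<delta> c1 c2 c3 \<phi> E" if "0 < \<alpha>" for n \<alpha>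
		by unfold_locales (use that e r c \<phi> gen_le green_bound mean_bound[of "ball z0 r"] jump_bound E in auto)
	have rate_\<psi>: "rate (\<psi> n)" for n unfolding \<psi>_def by (rule killing.rate_\<psi>[OF killing[of 1 n]]) simp
	let ?I = "\<integral>\<^sup>+x\<in>E. ennreal (u x) \<partial>m"
	let ?a = "%n. \<integral>\<^sup>+x. X.stopped (\<psi> n) (X.leave U) f (Some x) \<partial>\<mu>"
	let ?t = "%i. \<integral>\<^sup>+x. X.R_upto (%_. e i) (X.leave U) (%z. ennreal (e i) * f z) (Some x) \<partial>\<mu>"
	let ?A = "{y. 7/10 * r <= dist z0 y & dist z0 y < 9/10 * r}"
	let ?b = "ennreal (4 * (c1 * \<delta> + c2 * c3)) * emeasure m E * (\<integral>\<^sup>+y\<in>?A. ennreal (u y) \<partial>m)"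
	have If: "(nn_integral \<mu> (%x. f (Some x))) = ?I" using int_\<mu>[OF fm] by (simp add: f_def ext0_simps)
	have Ifin: "?I < \<infinity>"
	proof -
		have "?I <= (\<integral>\<^sup>+x\<in>E. ennreal N \<partial>m)"
			using N by (intro nn_integral_mono) (auto simp: indicator_def intro: ennreal_leI)
		also have "... < \<infinity>" using Efin by (simp add: int_const ennreal_mult_less_top)
		finally show ?thesis .
	qed
	\<comment> \<open>\<open>\<epsilon> = e n\<close> and \<open>\<alpha> = e i\<close> vary
	  independently: \<open>i\<close> tends to infinity first, which removes \<open>?t i\<close>, and
	  only then \<open>n\<close>.\<close>
	have split: "?I <= ?a n + (?b + ?t i)" for n i
	proof -
		interpret K: killing m X Xh \<D> G Gh j jh \<Phi> R0 r0 n0 z0 r "e i" "e n" \<delta> c1 c2 c3 \<phi> E by (rule killing[OF e])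
		let ?k = "%z. e i + \<psi> n z"
		have k: "rate ?k" using K.rate_k by (simp add: \<psi>_def)
		have ei: "rate (%_::'a option. e i)" using e[of i] by (intro rate_const) simp
		have \<psi>m [measurable]: "\<psi> n \<in> smeas" by (rule rate_measurable[OF rate_\<psi>])
		have [measurable]: "(%y. \<psi> n (Some y)) \<in> bmeas" by (rule measurable_compose[OF measurable_Some \<psi>m])
		note [measurable] = f(1)
		let ?p = "ext0 (%y. ennreal (\<psi> n (Some y)) * ennreal (u y))"
		have p[measurable]: "?p \<in> smeas" by (intro measurable_ext0) measurable
		let ?s1 = "%x. X.stopped (\<psi> n) (X.leave U) f (Some x)"
		let ?s2 = "%x. X.R_upto ?k (X.leave U) ?p (Some x)"
		let ?s3 = "%x. X.R_upto (%_. e i) (X.leave U) (%z. ennreal (e i) * f z) (Some x)"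
		have m1: "?s1 \<in> bmeas" by (rule measurable_compose[OF measurable_Some X.stopped_start_measurable[OF rate_\<psi> T f(1)]])
		have m2: "?s2 \<in> bmeas" by (rule measurable_compose[OF measurable_Some X.R_upto_measurable[OF k T p]])
		have m3: "?s3 \<in> bmeas"
			by (rule measurable_compose[OF measurable_Some X.R_upto_measurable[OF ei T]]) measurable
		have pw: "f (Some x) <= ?s1 x + (?s2 x + ?s3 x)" for x
		proof -
			have "f (Some x) = X.stopped ?k (X.leave U) f (Some x) + X.R_upto ?k (X.leave U) (%z. ennreal (?k z) * f z) (Some x)"
				by (rule X.harmonic_killed[OF U(1) k f harmU])
			also have "X.R_upto ?k (X.leave U) (%z. ennreal (?k z) * f z) (Some x) = X.R_upto ?k (X.leave U) (%z. ?p z + ennreal (e i) * f z) (Some x)"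
			proof (rule X.R_upto_cong[OF U(1)])
				fix y show "ennreal (?k (Some y)) * f (Some y) = ?p (Some y) + ennreal (e i) * f (Some y)"
					using e[of i] rate_nonneg[OF rate_\<psi>, of n "Some y"] by (simp add: f_def ext0_simps ennreal_plus distrib_right add.commute)
			qed
			also have "... = ?s2 x + X.R_upto ?k (X.leave U) (%z. ennreal (e i) * f z) (Some x)"
				by (rule X.R_upto_add[OF k T p]) measurable
			also have "X.R_upto ?k (X.leave U) (%z. ennreal (e i) * f z) (Some x) <= ?s3 x"
				by (rule X.R_upto_antimono_rate[OF ei k]) (use rate_nonneg[OF rate_\<psi>] in simp)
			also have "X.stopped ?k (X.leave U) f (Some x) <= ?s1 x"
				by (rule X.stopped_antimono_rate[OF rate_\<psi> k]) (use e[of i] in simp)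
			finally show ?thesis by (simp add: add_mono)
		qed
		have "?I <= (nn_integral \<mu> (%x. ?s1 x + (?s2 x + ?s3 x)))" unfolding If[symmetric] by (intro nn_integral_mono pw)
		also have "... = ?a n + (nn_integral \<mu> (%x. ?s2 x + ?s3 x))"
			by (rule nn_integral_add; subst measurable_cong_sets[OF sets_\<mu> refl]) (use m1 m2 m3 in auto)
		also have "(nn_integral \<mu> (%x. ?s2 x + ?s3 x)) = (nn_integral \<mu> (%x. ?s2 x)) + ?t i"
			by (rule nn_integral_add; subst measurable_cong_sets[OF sets_\<mu> refl]) (use m2 m3 in auto)
		also have "(nn_integral \<mu> (%x. ?s2 x)) <= ?b"
			unfolding int_\<mu>[OF m2] using K.penalty_contribution[OF U(1,3) u] by (simp add: \<psi>_def)
		finally show ?thesis by (simp add: add_left_mono add_right_mono)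
	qed
	have t0: "(INF i. ?t i) = 0"
		unfolding e_def using Ifin by (intro X.R_upto_vanishing_rate[OF U(1) f harmU sets_\<mu>]) (simp add: If)
	have "?I <= ?a n + ?b" for n
	proof -
		have "?I - (?a n + ?b) <= ?t i" for i
			using split[of n i] Ifin by (auto simp: ennreal_minus_le_iff add.assoc)
		hence "?I - (?a n + ?b) <= 0" unfolding t0[symmetric] by (rule INF_greatest)
		hence "?I <= (?a n + ?b) + 0" using Ifin by (subst (asm) ennreal_minus_le_iff) auto
		thus ?thesis by simp
	qed
	hence "?I - ?b <= ?a n" for n using Ifin by (auto simp: ennreal_minus_le_iff add.commute)
	hence "?I - ?b <= (INF n. ?a n)" by (rule INF_greatest)
	hence main: "?I <= (INF n. ?a n) + ?b" using Ifin by (auto simp: ennreal_minus_le_iff add.commute)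
	have a: "(INF n. ?a n) <= ennreal (c5 * c2) * K * emeasure m E"
	proof -
		let ?A9 = "{z. 9/10 * r <= dist z0 z}"
		\<comment> \<open>At exits from \<open>U\<close> this payoff equals \<open>f\<close>: an exit
		  point closer than \<open>9 r / 10\<close> is outside \<open>D\<close>, where \<open>u\<close>
		  vanishes.\<close>
		define g where "g = ext0 (%z. ennreal (u z) * indicator ?A9 z)"
		have gm: "g \<in> smeas" "g None = 0" "!!z. g z < \<infinity>"
			unfolding g_def by (intro measurable_ext0, measurable) (auto simp: ext0_def ennreal_mult_less_top indicator_def split: option.split)
		have gf: "g z <= f z" for z
			by (auto simp: g_def f_def ext0_def indicator_def split: option.split)
		have fg: "f z = g z" if z: "z \<notin> Some ` U" for z
		proof (cases z)
			case (Some y)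
			show ?thesis
			proof (cases "y \<in> ?A9")
				case False
				hence "y \<notin> D" "y \<in> ball z0 r" using z Some r0' by (auto simp: U_def)
				thus ?thesis using van Some False by (simp add: f_def g_def ext0_simps)
			qed (simp add: Some f_def g_def ext0_simps)
		qed (simp add: f_def g_def ext0_simps)
		have \<psi>_mono: "\<psi> n z <= \<psi> (Suc n) z" for n z
			unfolding \<psi>_def using bumpD(5,6)[OF \<phi>] c(1) by (intro penalty_antimono e) (auto simp: e_def field_simps)
		\<comment> \<open>Beyond \<open>8 r / 10\<close> the bump is 0, and the penalty with
		  \<open>\<epsilon> = 1 / (n + 1)\<close> is at least \<open>(n + 1) \<delta>\<close>; it
		  dominates \<open>n\<close> times this fixed rate.\<close>
		let ?\<chi> = "ext0 (%x. \<delta> * indicator {x. 8/10 * r < dist z0 x} x)"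
		have \<chi>: "rate ?\<chi>"
			unfolding rate_def
		proof (intro conjI allI exI[of _ \<delta>])
			show "?\<chi> \<in> smeas" by (intro measurable_ext0) measurable
			show "0 <= ?\<chi> z" "?\<chi> z <= \<delta>" for z using c(1) by (auto simp: ext0_def indicator_def split: option.split)
		qed
		have \<chi>_le: "real n * ?\<chi> z <= \<psi> n z" for n z
		proof (cases z)
			case (Some x)
			show ?thesis
			proof (cases "8/10 * r < dist z0 x")
				case True
				hence \<phi>0: "\<phi> x = 0" by (intro bumpD(4)[OF \<phi>]) simp
				have "real n * \<delta> <= \<delta> * real (Suc n)" using c(1) by (simp add: algebra_simps)
				also have "... <= (max 0 (gen Xh \<phi> x) + \<delta>) * real (Suc n)" by (intro mult_right_mono) auto
				also have "... = \<psi> n z" unfolding \<psi>_def penalty_def e_def Some ext0_simps \<phi>0 by (simp only: divide_inverse inverse_inverse_eq diff_0_right mult_1_right add_0)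
				finally show ?thesis using True by (simp add: Some ext0_simps)
			next
				case False
				thus ?thesis using rate_nonneg[OF rate_\<psi>, of n z] by (simp add: Some ext0_simps)
			qed
		qed (simp add: \<psi>_def penalty_def ext0_simps)
		have pw: "(INF n. X.stopped (\<psi> n) (X.leave U) f (Some x)) <= ennreal (c5 * c2) * K" if x: "x \<in> E" for x
		proof -
			have xU: "x \<in> U'" using x E(2) r0' by (auto simp: U'_def)
			have "X.stopped (\<psi> n) (X.leave U) f (Some x) = X.stopped (\<psi> n) (X.leave U) g (Some x)" for n
				by (rule X.stopped_cong_outside[OF U(1) fg])
			hence "(INF n. X.stopped (\<psi> n) (X.leave U) f (Some x)) = (INF n. X.stopped (\<psi> n) (X.leave U) g (Some x))" by simp
			also have "... <= X.exit_value U' g (Some x)"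
			proof (rule X.stopped_strong_killing[OF rate_\<psi> \<psi>_mono \<chi>_le \<chi>])
				show "open {x. 8/10 * r < dist z0 x}" by (intro open_Collect_less continuous_intros)
				show "0 < ?\<chi> (Some y)" if "y \<in> {x. 8/10 * r < dist z0 x}" for y using that c(1) by (simp add: ext0_simps)
				show "U - U' \<subseteq> {x. 8/10 * r < dist z0 x}" using r0' by (auto simp: U_def U'_def)
				have "X.exit_value U g (Some x) <= X.exit_value U f (Some x)" by (rule X.exit_value_mono[OF gf])
				also have "... < \<infinity>" unfolding harmU by (simp add: f_def ext0_simps)
				finally show "X.exit_value U g (Some x) < \<infinity>" .
			qed (use U U' gm in auto)
			also have "... <= (\<integral>\<^sup>+z\<in>?A9. ennreal (c5 * j z0 z) * ennreal (u z) \<partial>m) * X.exit_mean U' (Some x)"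
				unfolding g_def
			proof (rule levy_exit_upper[OF U'(1) xU])
				have "closure U' \<subseteq> cball z0 (85/100 * r)" using closure_ball_subset closure_mono[of U' "ball z0 (85/100 * r)"] by (auto simp: U'_def)
				thus "?A9 \<inter> closure U' = {}" using r0' by force
				show "j y z <= c5 * j z0 z" if "y \<in> U'" "z \<in> ?A9" for y z using far_bound[of y z] that by (auto simp: U'_def)
			qed measurable
			also have "... <= (ennreal c5 * K) * ennreal c2"
			proof (intro mult_mono mean_bound U')
				have "(\<integral>\<^sup>+z\<in>?A9. ennreal (c5 * j z0 z) * ennreal (u z) \<partial>m) <= (nn_integral m (%z. ennreal c5 * (ennreal (j z0 z) * ennreal (u z) * indicator {z. r / 2 <= dist z0 z} z)))"
					using c(5) r0' by (intro nn_integral_mono) (auto simp: indicator_def ennreal_mult' mult.assoc)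
				also have "... = ennreal c5 * K" unfolding K_def by (rule nn_integral_cmult) measurable
				finally show "(\<integral>\<^sup>+z\<in>?A9. ennreal (c5 * j z0 z) * ennreal (u z) \<partial>m) <= ennreal c5 * K" .
			qed auto
			also have "... = ennreal (c5 * c2) * K" using c by (simp add: ennreal_mult ac_simps)
			finally show ?thesis .
		qed
		have sm: "(%x. X.stopped (\<psi> n) (X.leave U) f (Some x)) \<in> bmeas" for n
			by (rule measurable_compose[OF measurable_Some X.stopped_start_measurable[OF rate_\<psi> T f(1)]])
		have "(INF n. ?a n) = (nn_integral \<mu> (%x. (INF n. X.stopped (\<psi> n) (X.leave U) f (Some x))))"
		proof (rule nn_integral_monotone_convergence_INF_decseq[where i = 0, symmetric])
			have "\<psi> i z <= \<psi> l z" if "i <= l" for i l z using lift_Suc_mono_le[of "%n. \<psi> n z"] \<psi>_mono that by blast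
			thus "decseq (%n x. X.stopped (\<psi> n) (X.leave U) f (Some x))"
				by (intro monotoneI le_funI X.stopped_antimono_rate[OF rate_\<psi> rate_\<psi>])
			show "(%x. X.stopped (\<psi> n) (X.leave U) f (Some x)) \<in> borel_measurable \<mu>" for n
				using sm measurable_cong_sets[OF sets_\<mu> refl] by blast
			have "?a 0 <= (nn_integral \<mu> (%x. f (Some x)))"
			proof (rule nn_integral_mono)
				fix x show "X.stopped (\<psi> 0) (X.leave U) f (Some x) <= f (Some x)"
					by (subst X.harmonic_killed[OF U(1) rate_\<psi>[of 0] f harmU, of "Some x"]) (rule add_increasing2[OF zero_le order_refl])
			qed
			thus "?a 0 < \<infinity>" using Ifin by (simp add: If)
		qed
		also have "... = (\<integral>\<^sup>+x\<in>E. (INF n. X.stopped (\<psi> n) (X.leave U) f (Some x)) \<partial>m)"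
			by (rule int_\<mu>) (use sm in measurable)
		also have "... <= (\<integral>\<^sup>+x\<in>E. ennreal (c5 * c2) * K \<partial>m)"
			using pw by (intro nn_integral_mono) (simp add: indicator_def)
		finally show ?thesis by (simp add: int_const)
	qed
	have "(\<integral>\<^sup>+y\<in>?A. ennreal (u y) \<partial>m) <= (nn_integral m (%z. ennreal c6 * (ennreal (j z0 z) * ennreal (u z) * indicator {z. r / 2 <= dist z0 z} z)))"
	proof (rule nn_integral_mono)
		fix z
		show "ennreal (u z) * indicator ?A z <= ennreal c6 * (ennreal (j z0 z) * ennreal (u z) * indicator {z. r / 2 <= dist z0 z} z)"
		proof (cases "z \<in> ?A")
			case True
			hence "ennreal 1 <= ennreal (c6 * j z0 z)" using near_bound[of z] by (intro ennreal_leI) auto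
			hence "1 * ennreal (u z) <= (ennreal c6 * ennreal (j z0 z)) * ennreal (u z)"
				using c(6) by (intro mult_right_mono) (auto simp: ennreal_mult')
			thus ?thesis using True r0' by (simp add: mult.assoc)
		qed simp
	qed
	also have "... = ennreal c6 * K" unfolding K_def by (rule nn_integral_cmult) measurable
	finally have "?b <= ennreal (4 * (c1 * \<delta> + c2 * c3)) * emeasure m E * (ennreal c6 * K)" by (rule mult_left_mono) simp
	with main a have "?I <= ennreal (c5 * c2) * K * emeasure m E + ennreal (4 * (c1 * \<delta> + c2 * c3)) * emeasure m E * (ennreal c6 * K)"
		by (meson add_mono order_trans)
	also have "... = ennreal (c5 * c2 + 4 * (c1 * \<delta> + c2 * c3) * c6) * K * emeasure m E"
	proof -
		have "ennreal (c5 * c2 + 4 * (c1 * \<delta> + c2 * c3) * c6) = ennreal (c5 * c2) + ennreal (4 * (c1 * \<delta> + c2 * c3)) * ennreal c6"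
			using c by (simp add: ennreal_plus ennreal_mult)
		thus ?thesis by (simp only: distrib_right) (simp only: ac_simps)
	qed
	finally show ?thesis unfolding K_def .
qed

text \<open>
	An almost everywhere bound holds everywhere: killed at a large rate \<open>n\<close>, the process stops inside \<open>Q\<close>, and it does so
	with an absolutely continuous distribution.
\<close>

lemma harmonic_bound_everywhere:
	fixes u :: "'a => real"
	assumes Q: "open Q" and u: "u \<in> bmeas" and b: "0 <= b"
		and harm: "!!z. X.exit_value Q (enn0 u) z = enn0 u z"
		and ae: "AE x in m. x \<in> Q --> u x <= b" and y: "y \<in> Q"
	shows "ennreal (u y) <= ennreal b"
proof -
	let ?f = "enn0 u"
	note [measurable] = u
	have f: "?f \<in> smeas" "?f None = 0"
		by (intro measurable_ext0) (auto simp: ext0_simps)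
	from ae obtain N where N': "N \<in> null_sets m" "{x \<in> space m. \<not> (x \<in> Q --> u x <= b)} \<subseteq> N"
		unfolding eventually_ae_filter by blast
	hence N: "N \<in> null_sets m" "!!x. x \<notin> N ==> x \<in> Q ==> u x <= b" by auto
	have Nm [measurable]: "N \<in> sets borel" using N(1) by (auto simp: sets_m)
	have iN: "ext0 (indicator N :: 'a => ennreal) \<in> smeas" by (intro measurable_ext0 borel_measurable_indicator Nm)
	let ?k = "%n _. real (Suc n)"
	have k: "rate (?k n)" for n by (rule rate_const) simp
	have near: "X.R_upto (?k n) (X.leave Q) (%z. ennreal (real (Suc n)) * ?f z) (Some y) <= ennreal b" for n
	proof -
		\<comment> \<open>An infinite value on the null set \<open>N\<close> costs nothing, since the
		  resolvent measures do not charge \<open>N\<close>.\<close>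
		let ?v = "%z. ennreal (real (Suc n) * b) + \<infinity> * ext0 (indicator N) z"
		have "X.R_upto (?k n) (X.leave Q) (%z. ennreal (real (Suc n)) * ?f z) (Some y) <= X.R_upto (?k n) (X.leave Q) ?v (Some y)"
		proof (rule X.R_upto_mono_on[OF Q])
			fix x assume x: "x \<in> Q"
			show "ennreal (real (Suc n)) * ?f (Some x) <= ?v (Some x)"
			proof (cases "x \<in> N")
				case False
				have "ennreal (real (Suc n)) * ennreal (u x) <= ennreal (real (Suc n)) * ennreal b"
					by (intro mult_left_mono ennreal_leI N(2)[OF False x]) simp
				thus ?thesis using b by (simp add: ext0_simps ennreal_mult False del: of_nat_Suc)
			qed (simp add: ext0_simps)
		qed
		also have "... <= X.R (?k n) ?v (Some y)" by (rule X.R_upto_le_R)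
		also have "... = X.R (?k n) (%_. ennreal (real (Suc n) * b)) (Some y) + X.R (?k n) (%z. \<infinity> * ext0 (indicator N) z) (Some y)"
			by (rule X.R_add[OF k]) (use iN in measurable)
		also have "X.R (?k n) (%z. \<infinity> * ext0 (indicator N) z) (Some y) = \<infinity> * X.R (?k n) (ext0 (indicator N)) (Some y)"
			by (rule X.R_cmult[OF k iN])
		also have "X.R (?k n) (ext0 (indicator N)) (Some y) = resolvent X (real (Suc n)) (indicator N) y"
			by (rule X.resolvent_eq_R[symmetric]) simp
		also have "... = 0" using dual N(1) unfolding strong_dual_def by (metis of_nat_0_less_iff zero_less_Suc)
		also have "X.R (?k n) (%_. ennreal (real (Suc n) * b)) (Some y) <= ennreal (real (Suc n) * b / real (Suc n))"
			by (rule X.R_bound[OF k]) (use b in auto)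
		finally show ?thesis by (simp del: of_nat_Suc)
	qed
	\<comment> \<open>The stopped payoff is taken outside \<open>Q\<close> in any case; cutting it off
	  inside makes \<open>g\<close> vanish at the starting point.\<close>
	define g where "g = (%z. ?f z * indicator (- Some ` Q) z)"
	have Qs: "Some ` Q \<in> sets state_alg" using Q by (intro Some_image_sets_state_alg) auto
	have gm: "g \<in> smeas"
		unfolding g_def using f(1) sets.compl_sets[OF Qs]
		by (intro borel_measurable_times_ennreal borel_measurable_indicator) (auto simp: space_state_alg Compl_eq_Diff_UNIV)
	\<comment> \<open>The killing acts on the whole space, so the limit is bounded by the payoff at
	  leaving the empty set, which is \<open>g\<close> at the start.\<close>
	have "(INF n. X.stopped (?k n) (X.leave Q) g (Some y)) <= X.exit_value {} g (Some y)"
	proof (rule X.stopped_strong_killing[where \<eta> = "%_. 1" and V = UNIV])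
		have "X.exit_value Q g (Some y) <= X.exit_value Q ?f (Some y)"
			by (rule X.exit_value_mono) (auto simp: g_def indicator_def)
		also have "... < \<infinity>" unfolding harm by (simp add: ext0_simps)
		finally show "X.exit_value Q g (Some y) < \<infinity>" .
		show "g z < \<infinity>" for z by (auto simp: g_def ext0_def indicator_def split: option.split)
		show "g None = 0" by (simp add: g_def f(2))
	qed (use k gm Q in "auto intro: rate_const")
	also have "X.exit_value {} g (Some y) = g (Some y)" by (rule X.exit_value_outside) auto
	also have "... = 0" using y by (simp add: g_def)
	finally have z: "(INF n. X.stopped (?k n) (X.leave Q) g (Some y)) = 0" by simp
	have "ennreal (u y) - ennreal b <= X.stopped (?k n) (X.leave Q) g (Some y)" for n
	proof -
		have "ennreal (u y) = X.stopped (?k n) (X.leave Q) ?f (Some y) + X.R_upto (?k n) (X.leave Q) (%z. ennreal (real (Suc n)) * ?f z) (Some y)"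
			using X.harmonic_killed[OF Q k f harm, of "Some y" n] by (simp add: ext0_simps)
		also have "X.stopped (?k n) (X.leave Q) ?f (Some y) = X.stopped (?k n) (X.leave Q) g (Some y)"
			by (rule X.stopped_cong_outside[OF Q]) (simp add: g_def)
		finally have "ennreal (u y) <= X.stopped (?k n) (X.leave Q) g (Some y) + ennreal b" using near[of n] by (simp add: add_left_mono)
		thus ?thesis by (simp add: ennreal_minus_le_iff add.commute)
	qed
	hence "ennreal (u y) - ennreal b <= 0" unfolding z[symmetric] by (rule INF_greatest)
	hence "ennreal (u y) <= ennreal b + 0" by (subst (asm) ennreal_minus_le_iff) auto
	thus ?thesis by simp
qed

text \<open>On \<open>E = {b < u \<le> N}\<close> the hypothesis leaves no mass for
  \<open>u - b\<close>. The truncation at \<open>N\<close> supplies the boundedness on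
  \<open>E\<close> that \<open>harmonic_integral_bound\<close> asks for.\<close>

lemma AE_bound_of_integral:
	assumes u: "u \<in> bmeas" and Q: "Q \<in> sets borel" "Q \<subseteq> ball z0 r" and b: "0 <= b"
		and le: "!!E N. E \<in> sets borel ==> E \<subseteq> Q ==> (!!x. x \<in> E ==> u x <= real N) ==> (\<integral>\<^sup>+x\<in>E. ennreal (u x) \<partial>m) <= ennreal b * emeasure m E"
	shows "AE x in m. x \<in> Q --> u x <= b"
proof -
	note [measurable] = u Q(1)
	have "AE x in m. x \<in> Q & u x <= real N --> u x <= b" for N
	proof -
		define E where "E = {x \<in> Q. b < u x & u x <= real N}"
		have E [measurable]: "E \<in> sets borel" unfolding E_def by measurable
		have Efin: "emeasure m E < \<infinity>"
			by (rule le_less_trans[OF emeasure_mono V_finite[of r]]) (use Q in "auto simp: sets_m E_def")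
		have "(\<integral>\<^sup>+x\<in>E. ennreal (u x) \<partial>m) = (nn_integral m (%x. ennreal b * indicator E x + ennreal (u x - b) * indicator E x))"
			using b by (intro nn_integral_cong) (auto simp: indicator_def E_def ennreal_plus[symmetric])
		also have "... = (nn_integral m (%x. ennreal b * indicator E x)) + (nn_integral m (%x. ennreal (u x - b) * indicator E x))"
			by (rule nn_integral_add) measurable
		also have "(nn_integral m (%x. ennreal b * indicator E x)) = ennreal b * emeasure m E"
			by (simp add: nn_integral_cmult_indicator sets_m)
		finally have eq: "(\<integral>\<^sup>+x\<in>E. ennreal (u x) \<partial>m) = ennreal b * emeasure m E + (nn_integral m (%x. ennreal (u x - b) * indicator E x))" .
		have "(\<integral>\<^sup>+x\<in>E. ennreal (u x) \<partial>m) <= ennreal b * emeasure m E" by (rule le[OF E]) (auto simp: E_def)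
		hence "ennreal b * emeasure m E + (nn_integral m (%x. ennreal (u x - b) * indicator E x)) <= ennreal b * emeasure m E + 0"
			unfolding eq by simp
		hence "(nn_integral m (%x. ennreal (u x - b) * indicator E x)) = 0"
			using Efin by (subst (asm) ennreal_add_left_cancel_le) (auto simp: ennreal_mult_eq_top_iff)
		hence "AE x in m. ennreal (u x - b) * indicator E x = 0"
			by (subst (asm) nn_integral_0_iff_AE) measurable
		thus ?thesis
			by eventually_elim (auto simp: E_def indicator_def ennreal_eq_0_iff not_less split: if_splits)
	qed
	hence "AE x in m. \<forall>N::nat. x \<in> Q & u x <= real N --> u x <= b" by (intro AE_all_countable[THEN iffD2] allI)
	thus ?thesis by eventually_elim (use real_arch_simple in blast)
qed

lemma D1_bound:
	assumes a: "1 / 2 < a" "a < 1"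
	obtains c where "0 < c" "!!r. 0 < r ==> ereal r < r0 ==>
			(SUP x\<in>closure (annulus z0 (a * r) r). SUP y\<in>ball z0 (r / 2). max (G (ball z0 r) x y) (Gh (ball z0 r) x y))
				<= ennreal c * ennreal (\<Phi> r) / vol m z0 r"
	using D1 a unfolding assumption_D1_def by meson

text \<open>The constants of \<open>harmonic_integral_bound\<close> are products of powers of
  \<open>v r\<close> and \<open>\<Phi> r\<close> with fixed factors and combine to a multiple of
  \<open>\<Phi> r\<close>. An infinite integral makes the claim trivial; otherwise the bounds on
  subsets of \<open>D \<inter> B(z0, r / 2)\<close> pass to almost every and then to every
  point.\<close>

lemma harmonic_sup_bound:
	obtains c where "0 < c"
		"!!r D u y. small r ==> open D ==> D \<subseteq> ball z0 r ==> u \<in> bmeas ==>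
			(\<forall>x\<in>D. ennreal (u x) = X.exit_value D (enn0 u) (Some x)) ==>
			(\<forall>x\<in>ball z0 r - D. u x = 0) ==> y \<in> D ==> dist z0 y < r / 2 ==>
			ennreal (u y) <= ennreal (c * \<Phi> r) * (\<integral>\<^sup>+z\<in>{z. r / 2 <= dist z0 z}. ennreal (j z0 z) * ennreal (u z) \<partial>m)"
proof -
	obtain k1 where k1: "0 < k1" "!!r. 0 < r ==> ereal r < r0 ==>
			(SUP x\<in>closure (annulus z0 (6/10 * r) r). SUP y\<in>ball z0 (r / 2). max (G (ball z0 r) x y) (Gh (ball z0 r) x y))
				<= ennreal k1 * ennreal (\<Phi> r) / vol m z0 r"
		by (rule D1_bound[of "6/10"]) auto
	obtain k2 where k2: "0 < k2" "!!r W y. small r ==> open W ==> W \<subseteq> ball z0 r ==> X.exit_mean W y <= ennreal (k2 * \<Phi> r)"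
		using exit_mean_ball by blast
	obtain kd where kd: "0 < kd" "!!r. 0 < r ==> ereal r < r0 ==> \<exists>f\<in>bump m \<D> (closure (ball z0 (7/8 * r))) (ball z0 r).
			 \<forall>x. gen X f x <= kd / \<Phi> r & gen Xh f x <= kd / \<Phi> r"
		by (rule ball_bump[of "7/8"]) auto
	obtain ku where ku: "0 < ku" "!!r x. 0 < r ==> ereal r < r0 ==> r <= dist z0 x ==> j z0 x * v r * \<Phi> r <= ku"
		by (rule j_upper) (rule that)
	\<comment> \<open>\<open>17/18\<close> is the ratio of \<open>85/100\<close> to \<open>9/10\<close>
	  and exceeds that of \<open>65/100\<close> to \<open>7/10\<close>, so one constant serves the exit
	  jumps and the dual jumps.\<close>
	obtain kc where kc: "1 <= kc" "!!r x y. 0 < r ==> ereal r < r0 ==> dist z0 x < 17/18 * r ==> r <= dist z0 y ==>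
			j x y <= kc * j z0 y & j z0 y <= kc * j x y & j y x <= kc * j y z0 & j y z0 <= kc * j y x"
		by (rule C1_comparable[of "17/18"]) auto
	obtain kl where kl: "0 < kl" "!!y. y ~= z0 ==> ereal (dist z0 y) < ereal (3/4) * r0 ==>
			kl <= j z0 y * (v (dist z0 y) * \<Phi> (dist z0 y)) & kl <= j y z0 * (v (dist z0 y) * \<Phi> (dist z0 y))"
		by (rule j_lower) (rule that)
	obtain Kv where Kv: "1 <= Kv" "!!r. 0 < r ==> v (2 * r) <= Kv * v r" by (rule v_scale[of 2]) auto
	obtain KP where KP: "1 <= KP" "!!r. 0 < r ==> \<Phi> (2 * r) <= KP * \<Phi> r" by (rule Phi_scale[of 2]) auto
	define k3 where "k3 = kc * ku * (Kv * KP)"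
	have k3: "0 < k3" using kc ku Kv KP by (simp add: k3_def)
	define c where "c = kc * k2 + 4 * (k1 * (kd * KP) + k2 * k3) / kl"
	have c: "0 < c" using kc k2 k1 kd KP k3 kl by (auto simp: c_def intro!: add_pos_pos divide_pos_pos mult_pos_pos)
	show ?thesis
	proof (rule that[OF c])
		fix r D and u :: "'a => real" and y
		assume r: "small r" and D: "open D" "D \<subseteq> ball z0 r" and u: "u \<in> bmeas"
			and harm': "\<forall>x\<in>D. ennreal (u x) = X.exit_value D (enn0 u) (Some x)"
			and van': "\<forall>x\<in>ball z0 r - D. u x = 0" and y: "y \<in> D" "dist z0 y < r / 2"
		have harm: "ennreal (u x) = X.exit_value D (enn0 u) (Some x)" if "x \<in> D" for x using harm' that by blast
		have van: "u x = 0" if "x \<in> ball z0 r" "x \<notin> D" for x using van' that by blast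
		define K where "K = (\<integral>\<^sup>+z\<in>{z. r / 2 <= dist z0 z}. ennreal (j z0 z) * ennreal (u z) \<partial>m)"
		have p: "0 < r" "0 < \<Phi> r" "0 < v r" using r Phi_pos v_pos by (auto simp: small_def)
		have sc: "0 < t * r" "ereal (t * r) < r0" if "0 < t" "t <= 4" for t
			using small_scale[OF r that(2)] p(1) that by auto
		define \<delta> where "\<delta> = kd * KP / \<Phi> r"
		define c1 where "c1 = k1 * \<Phi> r / v r"
		define c2 where "c2 = k2 * \<Phi> r"
		define c3 where "c3 = k3 / (v r * \<Phi> r)"
		define c6 where "c6 = v r * \<Phi> r / kl"
		have nn: "0 < \<delta>" "0 <= c1" "0 <= c2" "0 <= c3" "0 <= kc" "0 <= c6"
			using p kd KP k1 k2 k3 kc kl by (auto simp: \<delta>_def c1_def c2_def c3_def c6_def)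
		have half: "v r <= Kv * v (t * r)" "\<Phi> r <= KP * \<Phi> (t * r)" if "1 / 2 <= t" for t
		proof -
			have "1 / 2 * r <= t * r" using that p(1) by (intro mult_right_mono) auto
			hence "v (r / 2) <= v (t * r)" "\<Phi> (r / 2) <= \<Phi> (t * r)" using p(1) by (auto intro: v_mono Phi_mono)
			moreover have "v r <= Kv * v (r / 2)" "\<Phi> r <= KP * \<Phi> (r / 2)" using Kv(2)[of "r / 2"] KP(2)[of "r / 2"] p(1) by auto
			ultimately show "v r <= Kv * v (t * r)" "\<Phi> r <= KP * \<Phi> (t * r)"
				using Kv(1) KP(1) by (auto intro: order_trans mult_left_mono)
		qed
		\<comment> \<open>At radius \<open>8 r / 10\<close> the plateau ratio \<open>7/8\<close> gives a
		  plateau of radius \<open>7 r / 10\<close>.\<close>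
		obtain \<phi> where \<phi>': "\<phi> \<in> bump m \<D> (closure (ball z0 (7/8 * (8/10 * r)))) (ball z0 (8/10 * r))"
				"!!x. gen Xh \<phi> x <= kd / \<Phi> (8/10 * r)"
			using kd(2)[OF sc[of "8/10"]] by auto
		have \<phi>: "\<phi> \<in> bump m \<D> (closure (ball z0 (7/10 * r))) (ball z0 (8/10 * r))" using \<phi>'(1) by simp
		have gen_le: "gen Xh \<phi> x <= \<delta>" for x
		proof -
			have "kd / \<Phi> (8/10 * r) <= \<delta>"
				using half(2)[of "8/10"] p Phi_pos[of "8/10 * r"] kd(1) unfolding \<delta>_def by (simp add: field_simps)
			thus ?thesis using \<phi>'(2)[of x] by simp
		qed
		have green_bound: "Gh (ball z0 r) x y <= ennreal c1" if "6/10 * r < dist z0 x" "dist z0 x < r" "dist z0 y < r / 2" for x y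
		proof -
			have x: "x \<in> closure (annulus z0 (6/10 * r) r)" by (rule subsetD[OF closure_annulus]) (use that in "simp add: annulus_def")
			have "Gh (ball z0 r) x y <= (SUP x\<in>closure (annulus z0 (6/10 * r) r). SUP y\<in>ball z0 (r / 2). max (G (ball z0 r) x y) (Gh (ball z0 r) x y))"
				by (rule SUP_upper2[OF x], rule SUP_upper2[of y]) (use that in auto)
			also have "... <= ennreal k1 * ennreal (\<Phi> r) / vol m z0 r" by (rule k1(2)[OF p(1) small_less[OF r]])
			also have "... = ennreal c1" unfolding vol_eq c1_def using k1(1) p by (simp add: ennreal_mult[symmetric] divide_ennreal)
			finally show ?thesis .
		qed
		have mean_bound: "X.exit_mean W y <= ennreal c2" if "open W" "W \<subseteq> ball z0 r" for W y
			unfolding c2_def by (rule k2(2)[OF r that])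
		have jump_bound: "jh x z <= c3" if x: "7/10 * r <= dist z0 x" and z: "dist z0 z < 65/100 * r" for x z
		proof -
			have xz: "x ~= z" "x ~= z0" using x z p(1) by auto
			have "jh x z = j z x" using xz by (intro j_eq) auto
			also have "... <= kc * j z0 x" using kc(2)[OF sc[of "7/10"], of z x] x z p(1) by auto
			also have "... <= c3"
			proof -
				have "j z0 x * v r * \<Phi> r <= j z0 x * (Kv * v (7/10 * r)) * (KP * \<Phi> (7/10 * r))"
					using half[of "7/10"] j_pos[of z0 x] xz p by (intro mult_mono) (auto intro: mult_nonneg_nonneg)
				also have "... = (j z0 x * v (7/10 * r) * \<Phi> (7/10 * r)) * (Kv * KP)" by simp
				also have "... <= ku * (Kv * KP)" using ku(2)[OF sc[of "7/10"] x] Kv KP by (intro mult_right_mono) auto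
				finally have "kc * (j z0 x * v r * \<Phi> r) <= kc * (ku * (Kv * KP))" using kc(1) by (intro mult_left_mono) auto
				thus ?thesis unfolding c3_def k3_def using p by (simp add: pos_le_divide_eq ac_simps)
			qed
			finally show ?thesis .
		qed
		have far_bound: "j x z <= kc * j z0 z" if "dist z0 x < 85/100 * r" "9/10 * r <= dist z0 z" for x z
			using kc(2)[OF sc[of "9/10"], of x z] that by auto
		have near_bound: "1 <= c6 * j z0 z" if z: "7/10 * r <= dist z0 z" "dist z0 z < 9/10 * r" for z
		proof -
			have zz: "z ~= z0" using z p(1) by auto
			have "ereal (2 * r) < r0" using sc[of 2] by simp
			hence "ereal (dist z0 z) < ereal (3/4) * r0" using z p(1) by (cases r0) auto
			hence "kl <= j z0 z * (v (dist z0 z) * \<Phi> (dist z0 z))" using kl(2)[OF zz] by blast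
			also have "... <= j z0 z * (v r * \<Phi> r)"
				using j_pos[of z0 z] zz z p(1) v_pos[of "dist z0 z"] Phi_pos[of "dist z0 z"] p
				by (intro mult_left_mono mult_mono v_mono Phi_mono) (auto intro: less_imp_le)
			finally show ?thesis unfolding c6_def using kl(1) by (simp add: field_simps)
		qed
		\<comment> \<open>\<open>c1 \<delta>\<close> and \<open>c2 c3\<close> both scale as
		  \<open>1 / v r\<close>, and \<open>c6\<close> as \<open>v r \<Phi> r\<close>; their product
		  scales as \<open>\<Phi> r\<close>.\<close>
		have const: "kc * c2 + 4 * (c1 * \<delta> + c2 * c3) * c6 = c * \<Phi> r"
			unfolding c_def c1_def c2_def c3_def c6_def \<delta>_def using p kl(1) by (simp add: field_simps)
		have main: "(\<integral>\<^sup>+x\<in>E. ennreal (u x) \<partial>m) <= ennreal (c * \<Phi> r) * K * emeasure m E"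
			if "E \<in> sets borel" "E \<subseteq> D \<inter> ball z0 (r / 2)" "!!x. x \<in> E ==> u x <= real N" for E N
			using harmonic_integral_bound[OF r nn \<phi> gen_le green_bound mean_bound jump_bound far_bound near_bound D u harm van that]
			unfolding const K_def by simp
		show "ennreal (u y) <= ennreal (c * \<Phi> r) * (\<integral>\<^sup>+z\<in>{z. r / 2 <= dist z0 z}. ennreal (j z0 z) * ennreal (u z) \<partial>m)"
			unfolding K_def[symmetric]
		proof (cases "K = \<infinity>")
			case True
			thus "ennreal (u y) <= ennreal (c * \<Phi> r) * K" using c p by (simp add: ennreal_mult_top)
		next
			case False
			then obtain \<kappa> where \<kappa>: "K = ennreal \<kappa>" "0 <= \<kappa>" by (cases K) auto
			define b where "b = c * \<Phi> r * \<kappa>"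
			have b: "0 <= b" "ennreal (c * \<Phi> r) * K = ennreal b" using c p \<kappa> by (auto simp: b_def ennreal_mult)
			let ?Q = "D \<inter> ball z0 (r / 2)"
			have Q: "open ?Q" "?Q \<subseteq> D" using D by auto
			have f: "enn0 u \<in> smeas" "enn0 u None = 0"
				using u by (intro measurable_ext0, measurable)
			have harmQ: "X.exit_value ?Q (enn0 u) z = enn0 u z" for z
				by (rule X.harmonic_subset[OF _ D(1) Q f]) (use harm in "simp add: ext0_simps")
			have "AE x in m. x \<in> ?Q --> u x <= b"
				by (rule AE_bound_of_integral[OF u _ _ b(1)]) (use Q main b(2) in auto)
			hence "ennreal (u y) <= ennreal b" by (rule harmonic_bound_everywhere[OF Q(1) u b(1) harmQ]) (use y in auto)
			thus "ennreal (u y) <= ennreal (c * \<Phi> r) * K" using b(2) by simp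
		qed
	qed
qed

text \<open>At the exit from \<open>U\<close>, positions in \<open>A\<close> are governed by the
  Levy system; the remaining ones with \<open>u > 0\<close> lie in \<open>D\<close> within
  \<open>r / 2\<close>, where the supremum bound meets the probability bound of
  \<open>exit_near\<close> and \<open>\<Phi> r\<close> cancels. The inner edge of \<open>A\<close>
  is left free between \<open>r / 4\<close> and \<open>r / 2\<close>, which accommodates every
  radius \<open>a r / 2\<close>.\<close>

lemma harmonic_upper:
	obtains c where "0 < c"
		"!!r D u x A. small r ==> open D ==> D \<subseteq> ball z0 r ==> u \<in> bmeas ==>
			(\<forall>x\<in>D. ennreal (u x) = X.exit_value D (enn0 u) (Some x)) ==>
			(\<forall>x\<in>ball z0 r - D. u x = 0) ==> x \<in> D ==> dist z0 x < r / 8 ==>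
			A \<in> sets borel ==> {z. r / 2 <= dist z0 z} \<subseteq> A ==> A \<subseteq> {z. r / 4 <= dist z0 z} ==>
			ennreal (u x) <= ennreal c * X.exit_mean D (Some x) * (\<integral>\<^sup>+z\<in>A. ennreal (j z0 z) * ennreal (u z) \<partial>m)"
proof -
	obtain c1 where c1: "1 <= c1" "!!r x y. 0 < r ==> ereal r < r0 ==> dist z0 x < 4/5 * r ==> r <= dist z0 y ==>
			j x y <= c1 * j z0 y & j z0 y <= c1 * j x y & j y x <= c1 * j y z0 & j y z0 <= c1 * j y x"
		by (rule C1_comparable[of "4/5"]) auto
	obtain c2 where c2: "0 < c2" "!!r U y. small r ==> open U ==> dist z0 y < r / 8 ==>
			X.exit_value U (ext0 (indicator {z. r / 5 <= dist z0 z & dist z0 z < r})) (Some y) <= ennreal (c2 / \<Phi> r) * X.exit_mean U (Some y)"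
		using exit_near by blast
	obtain c3 where c3: "0 < c3" "!!r D u y. small r ==> open D ==> D \<subseteq> ball z0 r ==> u \<in> bmeas ==>
			(\<forall>x\<in>D. ennreal (u x) = X.exit_value D (enn0 u) (Some x)) ==>
			(\<forall>x\<in>ball z0 r - D. u x = 0) ==> y \<in> D ==> dist z0 y < r / 2 ==>
			ennreal (u y) <= ennreal (c3 * \<Phi> r) * (\<integral>\<^sup>+z\<in>{z. r / 2 <= dist z0 z}. ennreal (j z0 z) * ennreal (u z) \<partial>m)"
		by (rule harmonic_sup_bound) (rule that)
	show ?thesis
	proof (rule that[of "c1 + c2 * c3"])
		show "0 < c1 + c2 * c3" using c1(1) c2(1) c3(1) by (simp add: add_pos_pos)
		fix r D and u :: "'a => real" and x A
		assume r: "small r" and D: "open D" "D \<subseteq> ball z0 r" and u: "u \<in> bmeas"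
			and harm': "\<forall>x\<in>D. ennreal (u x) = X.exit_value D (enn0 u) (Some x)"
			and van': "\<forall>x\<in>ball z0 r - D. u x = 0" and x: "x \<in> D" "dist z0 x < r / 8"
			and A: "A \<in> sets borel" "{z. r / 2 <= dist z0 z} \<subseteq> A" "A \<subseteq> {z. r / 4 <= dist z0 z}"
		have harm: "ennreal (u x) = X.exit_value D (enn0 u) (Some x)" if "x \<in> D" for x using harm' that by blast
		have van: "u x = 0" if "x \<in> ball z0 r" "x \<notin> D" for x using van' that by blast
		have p: "0 < r" "0 < \<Phi> r" using r Phi_pos by (auto simp: small_def)
		note [measurable] = u A(1)
		let ?K = "\<integral>\<^sup>+z\<in>A. ennreal (j z0 z) * ennreal (u z) \<partial>m"
		let ?f = "enn0 u" and ?B = "{z. r / 5 <= dist z0 z & dist z0 z < r}"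
		define U where "U = D \<inter> ball z0 (r / 5)"
		have U: "open U" "U \<subseteq> D" "x \<in> U" using D x p by (auto simp: U_def)
		let ?e = "X.exit_mean U (Some x)"
		have f: "?f \<in> smeas" "?f None = 0" by (intro measurable_ext0) (auto simp: ext0_simps)
		let ?fA = "ext0 (%z. ennreal (u z) * indicator A z)" and ?fB = "ext0 (indicator ?B) :: 'a option => ennreal"
		have m: "?fA \<in> smeas" "?fB \<in> smeas"
			by (intro measurable_ext0 borel_measurable_times_ennreal borel_measurable_indicator; measurable)+
		have sup: "ennreal (u y) <= ennreal (c3 * \<Phi> r) * ?K" if "y \<in> D" "dist z0 y < r / 2" for y
		proof -
			have "ennreal (u y) <= ennreal (c3 * \<Phi> r) * (\<integral>\<^sup>+z\<in>{z. r / 2 <= dist z0 z}. ennreal (j z0 z) * ennreal (u z) \<partial>m)"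
				by (rule c3(2)[OF r D u harm' van' that])
			also have "... <= ennreal (c3 * \<Phi> r) * ?K"
				using A(2) by (intro mult_left_mono nn_integral_mono) (auto simp: indicator_def)
			finally show ?thesis .
		qed
		have "ennreal (u x) = X.exit_value U ?f (Some x)"
			using X.harmonic_subset[OF _ D(1) U(1,2) f, of "Some x"] harm by (simp add: ext0_simps)
		also have "... <= X.exit_value U (%z. ?fA z + (ennreal (c3 * \<Phi> r) * ?K) * ?fB z) (Some x)"
		proof (rule X.exit_value_mono_outside[OF U(1)])
			fix z assume z: "z \<notin> Some ` U"
			show "?f z <= ?fA z + (ennreal (c3 * \<Phi> r) * ?K) * ?fB z"
			proof (cases z)
				case (Some y)
				consider "y \<in> A" | "y \<notin> A" "y \<in> D" | "y \<notin> A" "y \<notin> D" by blast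
				thus ?thesis
				proof cases
					case 2
					hence "dist z0 y < r / 2" using A(2) by (auto simp: not_le[symmetric])
					moreover have "y \<in> ?B" using 2 z Some D(2) by (auto simp: U_def not_less)
					ultimately show ?thesis using sup[OF 2(2)] Some by (simp add: ext0_simps add_increasing)
				next
					case 3
					hence "dist z0 y < r / 2" using A(2) by (auto simp: not_le[symmetric])
					thus ?thesis using van[of y] 3 p Some by (simp add: ext0_simps)
				qed (simp add: Some ext0_simps)
			qed (simp add: ext0_simps)
		qed
		also have "... = X.exit_value U ?fA (Some x) + X.exit_value U (%z. (ennreal (c3 * \<Phi> r) * ?K) * ?fB z) (Some x)"
			using m by (intro X.exit_value_add[OF U(1)]) measurable
		also have "X.exit_value U (%z. (ennreal (c3 * \<Phi> r) * ?K) * ?fB z) (Some x) = (ennreal (c3 * \<Phi> r) * ?K) * X.exit_value U ?fB (Some x)"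
			by (rule X.exit_value_cmult[OF U(1) m(2)])
		also have "... <= (ennreal (c3 * \<Phi> r) * ?K) * (ennreal (c2 / \<Phi> r) * ?e)"
			by (intro mult_left_mono c2(2)[OF r U(1) x(2)]) simp
		also have "... = ennreal (c3 * \<Phi> r) * ennreal (c2 / \<Phi> r) * (?e * ?K)" by (simp only: ac_simps)
		also have "ennreal (c3 * \<Phi> r) * ennreal (c2 / \<Phi> r) = ennreal (c2 * c3)"
			using p c2(1) c3(1) by (simp add: ennreal_mult[symmetric])
		also have "X.exit_value U ?fA (Some x) <= (\<integral>\<^sup>+z\<in>A. ennreal (c1 * j z0 z) * ennreal (u z) \<partial>m) * ?e"
		proof (rule levy_exit_upper[OF U(1,3) _ A(1)])
			have "closure U \<subseteq> cball z0 (r / 5)" using closure_ball_subset closure_mono[of U "ball z0 (r / 5)"] by (auto simp: U_def)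
			thus "A \<inter> closure U = {}" using A(3) p by force
			show "j y z <= c1 * j z0 z" if "y \<in> U" "z \<in> A" for y z
				using c1(2)[of "r / 4" y z] that A(3) p small_scale[OF r, of "1/4"] by (auto simp: U_def)
		qed measurable
		also have "(\<integral>\<^sup>+z\<in>A. ennreal (c1 * j z0 z) * ennreal (u z) \<partial>m) = ennreal c1 * ?K"
			using c1(1) by (subst nn_integral_cmult[symmetric]) (auto simp: ennreal_mult' ac_simps intro!: nn_integral_cong)
		also have "ennreal c1 * ?K * ?e + ennreal (c2 * c3) * (?e * ?K) = ennreal (c1 + c2 * c3) * ?e * ?K"
		proof -
			have "ennreal (c1 + c2 * c3) = ennreal c1 + ennreal (c2 * c3)" using c1(1) c2(1) c3(1) by (simp add: ennreal_plus)
			thus ?thesis by (simp only: distrib_right) (simp only: ac_simps)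
		qed
		also have "... <= ennreal (c1 + c2 * c3) * X.exit_mean D (Some x) * ?K"
			by (intro mult_right_mono mult_left_mono X.exit_mean_subset U D) auto
		finally show "ennreal (u x) <= ennreal (c1 + c2 * c3) * X.exit_mean D (Some x) * ?K"
			by (simp add: add_left_mono add_right_mono)
	qed
qed

text \<open>Points of \<open>- D\<close> where \<open>u\<close> is not assumed to vanish are irregular, hence not hit.\<close>

lemma harmonic_cutoff:
	fixes u :: "'a => real"
	assumes D: "open D" and u: "regular_harmonic X D u" and x: "x \<in> D"
		and eq: "!!y. y \<in> D \<union> (- closure D \<union> regular_boundary X D) ==> u' y = u y"
	shows "ennreal (u' x) = X.exit_value D (enn0 u') (Some x)"
proof -
	have sf: "strongly_feller X" and sp: "!!A. semi_polar X A ==> polar X A"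
		using A unfolding assumption_A_def by blast+
	have irr: "AE w in X.P (Some x). \<forall>t>0. \<forall>y. pos X t w = Some y & y \<notin> D --> y \<in> - closure D \<union> regular_boundary X D"
		by (rule X.irregular_points_not_hit[OF sf sp D])
	have "ennreal (u' x) = X.exit_value D (enn0 u) (Some x)"
		using X.regular_harmonic_exit_value[OF u D x] eq x by simp
	also have "... = X.exit_value D (enn0 u') (Some x)"
		unfolding X.exit_value_def
	proof (rule nn_integral_cong_AE)
		show "AE w in X.P (Some x). enn0 u (pos_at X (X.leave D) w) = enn0 u' (pos_at X (X.leave D) w)"
			using irr X.AE_at_leave[OF D, of "Some x"] X.AE_start[of "Some x"] AE_space
		proof eventually_elim
			case (elim w)
			hence w: "w \<in> paths X" by simp
			show ?case
			proof (cases "pos_at X (X.leave D) w")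
				case (Some y)
				then obtain t where t: "X.leave D w = ennreal t" "0 <= t"
					by (cases "X.leave D w") (auto simp: pos_at_def)
				have "0 < X.leave D w" by (rule X.leave_pos[OF D w]) (use elim x in simp)
				hence "0 < t" using t by simp
				moreover have "pos X t w = Some y" using Some t by (simp add: pos_at_def)
				moreover have "y \<notin> D" using elim Some t by auto
				ultimately have "y \<in> - closure D \<union> regular_boundary X D" using elim by blast
				thus ?thesis using eq[of y] Some by (simp add: ext0_simps)
			qed (simp add: ext0_simps)
		qed
	qed
	finally show ?thesis .
qed

end

section \<open>The two bounds joined, with \<open>u\<close> modified off \<open>D\<close> for the
  upper one\<close>

theorem theorem4p1:
  fixes m :: "'a::heine_borel measure"
    and X :: "('w, 'a) process" and Xh :: "('v, 'a) process"
    and \<D> :: "('a \<Rightarrow> real) set"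
    and G Gh :: "'a set \<Rightarrow> 'a \<Rightarrow> 'a \<Rightarrow> ennreal"
    and j jh :: "'a \<Rightarrow> 'a \<Rightarrow> real"
    and \<Phi> :: "real \<Rightarrow> real"
    and R0 r0 :: ereal and n0 :: nat and z0 :: 'a
  assumes space: "state_space m R0"
    and A: "assumption_A m X Xh"
    and green: "dual_green_functions m X Xh G Gh"
    and B: "assumption_B m X Xh \<D>"
    and C: "assumption_C m X Xh j jh"
    and r0: "0 < r0" "r0 \<le> R0"
    and V1: "assumption_V1 m z0"
    and V2: "assumption_V2 m z0 r0 n0"
    and Phi: "assumption_Phi \<Phi>"
    and B1a: "assumption_B1a m X Xh \<D> \<Phi> z0 r0"
    and B1b: "assumption_B1b m X Xh \<D> j z0 r0"
    and B1c: "assumption_B1c m X Xh \<D> \<Phi> z0 r0"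
    and C1: "assumption_C1 m j jh \<Phi> z0 r0"
    and D1: "assumption_D1 m G Gh \<Phi> z0 r0"
  shows "\<forall>a. 1/2 < a \<and> a < 1 \<longrightarrow>
    (\<exists>C\<^sub>1>1. \<forall>r>0. ereal r < r0 / ereal (2 * real n0) \<longrightarrow>
      (\<forall>D u. open D \<and> D \<subseteq> ball z0 r \<and>
         u \<in> borel_measurable borel \<and> (\<forall>x. 0 \<le> u x) \<and> regular_harmonic X D u \<and>
         (\<forall>x\<in>ball z0 r \<inter> (- closure D \<union> regular_boundary X D). u x = 0) \<longrightarrow>
         (\<forall>x\<in>D \<inter> ball z0 (r / 8).
            ennreal (inverse C\<^sub>1) * expect X x (exit_time X D) *
                (\<integral>\<^sup>+z\<in>- closure (ball z0 (a * r / 2)). ennreal (j z0 z * u z) \<partial>m)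
              \<le> ennreal (u x) \<and>
            ennreal (u x) \<le>
              ennreal C\<^sub>1 * expect X x (exit_time X D) *
                (\<integral>\<^sup>+z\<in>- closure (ball z0 (a * r / 2)). ennreal (j z0 z * u z) \<partial>m))))"
proof -
  interpret point_setting m X Xh \<D> G Gh j jh \<Phi> R0 r0 n0 z0
    by unfold_locales fact+
  obtain c1 where c1: "1 \<le> c1"
    "\<And>r D u x A. small r \<Longrightarrow> open D \<Longrightarrow> D \<subseteq> ball z0 r \<Longrightarrow> u \<in> borel_measurable borel \<Longrightarrow> regular_harmonic X D u \<Longrightarrow>
      x \<in> D \<Longrightarrow> dist z0 x < r / 8 \<Longrightarrow> A \<in> sets borel \<Longrightarrow> A \<subseteq> {z. r / 4 \<le> dist z0 z} \<Longrightarrow>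
      X.exit_mean D (Some x) * (\<integral>\<^sup>+z\<in>A. ennreal (j z0 z) * ennreal (u z) \<partial>m) \<le> ennreal c1 * ennreal (u x)"
    by (rule harmonic_lower) (rule that)
  obtain c2 where c2: "0 < c2"
    "\<And>r D u x A. small r \<Longrightarrow> open D \<Longrightarrow> D \<subseteq> ball z0 r \<Longrightarrow> u \<in> borel_measurable borel \<Longrightarrow>
      (\<forall>x\<in>D. ennreal (u x) = X.exit_value D (ext0 (\<lambda>y. ennreal (u y))) (Some x)) \<Longrightarrow>
      (\<forall>x\<in>ball z0 r - D. u x = 0) \<Longrightarrow> x \<in> D \<Longrightarrow> dist z0 x < r / 8 \<Longrightarrow>
      A \<in> sets borel \<Longrightarrow> {z. r / 2 \<le> dist z0 z} \<subseteq> A \<Longrightarrow> A \<subseteq> {z. r / 4 \<le> dist z0 z} \<Longrightarrow>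
      ennreal (u x) \<le> ennreal c2 * X.exit_mean D (Some x) * (\<integral>\<^sup>+z\<in>A. ennreal (j z0 z) * ennreal (u z) \<partial>m)"
    by (rule harmonic_upper) (rule that)
  \<comment> \<open>It dominates both constants and exceeds 1, as \<open>c1 \<ge> 1\<close> and
    \<open>c2 > 0\<close>.\<close>
  define c where "c = c1 + c2"
  have c: "1 < c" "c1 \<le> c" "c2 \<le> c" using c1(1) c2(1) by (auto simp: c_def)
  have "ennreal (inverse c) * expect X x (exit_time X D) *
          (\<integral>\<^sup>+z\<in>- closure (ball z0 (a * r / 2)). ennreal (j z0 z * u z) \<partial>m) \<le> ennreal (u x) \<and>
        ennreal (u x) \<le> ennreal c * expect X x (exit_time X D) *
          (\<integral>\<^sup>+z\<in>- closure (ball z0 (a * r / 2)). ennreal (j z0 z * u z) \<partial>m)"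
    if a: "1 / 2 < a" "a < 1" and r: "0 < r" "ereal r < r0 / ereal (2 * real n0)"
      and D: "open D" "D \<subseteq> ball z0 r" and u: "u \<in> borel_measurable borel" "\<And>x. 0 \<le> u x" "regular_harmonic X D u"
      and van: "\<And>x. x \<in> ball z0 r \<Longrightarrow> x \<in> - closure D \<union> regular_boundary X D \<Longrightarrow> u x = 0"
      and x: "x \<in> D" "dist z0 x < r / 8" for a r D u x
  proof -
    have small: "small r"
    proof -
      have "0 < 2 * real n0" using n0 by simp
      then show ?thesis using r unfolding small_def by (cases r0) (auto simp: field_simps)
    qed
    define F where "F = - closure (ball z0 (a * r / 2))"
    have F: "F \<in> sets borel" unfolding F_def by simp
    \<comment> \<open>\<open>a > 1/2\<close> puts the inner edge of the domain of integration beyond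
      \<open>r / 4\<close>; below, \<open>a < 1\<close> keeps it inside
      \<open>r / 2\<close>.\<close>
    have F4: "F \<subseteq> {z. r / 4 \<le> dist z0 z}"
    proof
      fix z assume "z \<in> F"
      then have "z \<notin> ball z0 (a * r / 2)" unfolding F_def using closure_subset by blast
      moreover have "1 / 2 * r \<le> a * r" using a r by (intro mult_right_mono) auto
      ultimately show "z \<in> {z. r / 4 \<le> dist z0 z}" by simp
    qed
    have F2: "{z. r / 2 \<le> dist z0 z} \<subseteq> F"
    proof -
      have "a * r < 1 * r" using a r by (intro mult_strict_right_mono) auto
      moreover have "closure (ball z0 (a * r / 2)) \<subseteq> cball z0 (a * r / 2)" by (rule closure_ball_subset)
      ultimately show ?thesis unfolding F_def by force
    qed
    let ?e = "X.exit_mean D (Some x)"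
    define K where "K w = (\<integral>\<^sup>+z\<in>F. ennreal (j z0 z) * ennreal (w z) \<partial>m)" for w
    have Keq: "(\<integral>\<^sup>+z\<in>- closure (ball z0 (a * r / 2)). ennreal (j z0 z * u z) \<partial>m) = K u"
      using u(2) by (simp add: K_def F_def ennreal_mult'')
    have ee: "expect X x (exit_time X D) = ?e" by (rule X.exit_mean_eq_expect[OF D(1) x(1)])
    have "ennreal (inverse c) * (?e * K u) \<le> ennreal (inverse c) * (ennreal c * ennreal (u x))"
    proof (rule mult_left_mono)
      have "?e * K u \<le> ennreal c1 * ennreal (u x)" unfolding K_def by (rule c1(2)[OF small D u(1,3) x F F4])
      also have "\<dots> \<le> ennreal c * ennreal (u x)" by (intro mult_right_mono ennreal_leI c) simp
      finally show "?e * K u \<le> ennreal c * ennreal (u x)" .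
    qed simp
    also have "\<dots> = ennreal (inverse c * c) * ennreal (u x)"
      by (subst ennreal_mult) (use c(1) in \<open>auto simp: mult.assoc\<close>)
    also have "\<dots> = ennreal (u x)" using c(1) by simp
    finally have lower: "ennreal (inverse c) * ?e * K u \<le> ennreal (u x)" by (simp add: mult.assoc)
    \<comment> \<open>\<open>u\<close> may be nonzero at irregular boundary points inside the ball.
      Setting it to 0 there leaves the exit expectations unchanged, gives the vanishing demanded by
      \<open>harmonic_upper\<close>, and can only decrease the integral \<open>K\<close>.\<close>
    define u' where "u' y = (if y \<in> ball z0 r \<and> y \<notin> D then 0 else u y)" for y
    have u': "u' \<in> borel_measurable borel" 
    proof -
      have [measurable]: "ball z0 r \<in> sets borel" "D \<in> sets borel" using D(1) by auto
      note [measurable] = u(1)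
      show ?thesis unfolding u'_def[abs_def] by measurable
    qed
    have "ennreal (u' x) \<le> ennreal c2 * ?e * K u'"
      unfolding K_def
    proof (rule c2(2)[OF small D u' _ _ x F F2 F4])
      show "\<forall>y\<in>D. ennreal (u' y) = X.exit_value D (ext0 (\<lambda>y. ennreal (u' y))) (Some y)"
      proof
        fix y assume "y \<in> D"
        then show "ennreal (u' y) = X.exit_value D (ext0 (\<lambda>y. ennreal (u' y))) (Some y)"
          by (rule harmonic_cutoff[OF D(1) u(3)]) (use van in \<open>auto simp: u'_def\<close>)
      qed
    qed (simp add: u'_def)
    also have "\<dots> \<le> ennreal c * ?e * K u"
    proof (intro mult_mono ennreal_leI c)
      show "K u' \<le> K u" unfolding K_def
        by (intro nn_integral_mono mult_right_mono mult_left_mono) (auto simp: u'_def)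
    qed auto
    finally have upper: "ennreal (u x) \<le> ennreal c * ?e * K u" using x(1) by (simp add: u'_def)
    show ?thesis unfolding Keq ee using lower upper by blast
  qed
  then show ?thesis using c(1) by (intro allI impI exI[of _ c]) auto
qed

end
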